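(* Let $H$ be a finite-dimensional quasitriangular Hopf algebra over $\Bbbk$ with $R$-matrix $R=\sum_is_i\otimes t_i$. Then the pair $(R_H(\Bbbk),K_{\mathrm{ref}}(\Bbbk))$, consisting of the reflective algebra of the trivial left $H$-comodule algebra $\Bbbk$ and its quantum $K$-matrix (defined in the context), is an initial object of the category ${}^H\mathsf{QT}$ of quasitriangular left $H$-comodule algebras.
   Context: $\Bbbk$ is an algebraically closed field, $\otimes=\otimes_\Bbbk$, sumless Sweedler notation $\Delta(h)=h_{(1)}\otimes h_{(2)}$. $R=\sum_is_i\otimes t_i\in H\otimes H$ is invertible with $(\Delta\otimes \mathrm{Id})R=R_{13}R_{23}$, $(\mathrm{Id}\otimes\Delta)R=R_{13}R_{12}$, $R\Delta(h)=\Delta^{\mathrm{op}}(h)R$. A left $H$-comodule algebra $Q$ with coaction $\delta:Q\to H\otimes Q$ is quasitriangular if it is equipped with an invertible element $K\in H\otimes Q$ (a quantum $K$-matrix) such that $(\Delta\otimes \mathrm{Id}_Q)K=K_{23}R_{21}K_{13}R_{21}^{-1}$, $(\mathrm{Id}_H\otimes\delta)K=R_{21}K_{13}R_{12}$ in $H\otimes H\otimes Q$, and $K\delta(q)=\delta(q)K$ for all $q\in Q$. The category ${}^H\mathsf{QT}$: objects are pairs $(Q,K)$ with $Q$ a left $H$-comodule algebra and $K\in H\otimes Q$ a quantum $K$-matrix for $Q$; a morphism $(Q_1,K_1)\to(Q_2,K_2)$ is a linear map $\phi:Q_1\to Q_2$ that is both a left $H$-comodule morphism and an algebra morphism, with $K_2=(\mathrm{Id}_H\otimes\phi)(K_1)$.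 $\widehat{H}$ is $H$ as a vector space with comultiplication $\widehat{\Delta}(h)=\sum_{i,j}t_jh_{(1)}t_i\otimes h_{(2)}s_iS^{-1}(s_j)$, counit $\varepsilon$, and left $H$-action $\ell\rightharpoonup h=\ell_{(2)}hS^{-1}(\ell_{(1)})$; $\widehat{H}^*$ is its dual algebra, $\langle\xi\zeta,h\rangle=\langle\xi\otimes\zeta,\widehat{\Delta}(h)\rangle$, with right $H$-action $\langle\xi\leftharpoonup\ell,h\rangle=\langle\xi,\ell\rightharpoonup h\rangle$. For a left $H$-comodule algebra $A$, the reflective algebra $R_H(A)=A\rtimes_H(\widehat{H}^* )^{\mathrm{op}}$ is the quotient of the free product of the algebras $A$ and $(\widehat{H}^* )^{\mathrm{op}}$ by the relations $\xi a=a_{[0]}(\xi\leftharpoonup a_{[-1]})$. For $A=\Bbbk$ with coaction $1\mapsto1_H\otimes1$ this gives $R_H(\Bbbk)\cong(\widehat{H}^* )^{\mathrm{op}}$. With $\{h_d,\xi_d\}_d$ a dual basis of $H$ ($h_d\in H$, $\xi_d\in H^*$), its left $H$-coaction is $\delta_{\mathrm{ref}}(\xi)=\sum_{i,j,d}\langle\xi,t_jh_ds_i\rangle\,s_jt_i\otimes\xi_d$ and its quantum $K$-matrix is $K_{\mathrm{ref}}(\Bbbk)=\sum_dh_d\otimes\xi_d\in H\otimes(\widehat{H}^* )^{\mathrm{op}}$. *)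

theory Defs
  imports
    "HOL-Algebra.QuotRing"
    "HOL-Algebra.Free_Abelian_Groups"
    "HOL-Algebra.Algebraic_Closure"
    "Jordan_Normal_Form.Missing_VectorSpace"
begin

section \<open>Algebras over a field\<close>

text \<open>
  The library's \<^locale>\<open>algebra\<close> is commutative, so associative unital algebras are introduced here
  on the same record type; the zero algebra is allowed.
\<close>

definition assoc_algebra :: "('k, 'l) ring_scheme \<Rightarrow> ('k, 'a, 'm) module_scheme \<Rightarrow> bool" where
  "assoc_algebra K A \<longleftrightarrow> vectorspace K A \<and> ring A \<and>
     (\<forall>c\<in>carrier K. \<forall>x\<in>carrier A. \<forall>y\<in>carrier A.
        (c \<odot>\<^bsub>A\<^esub> x) \<otimes>\<^bsub>A\<^esub> y = c \<odot>\<^bsub>A\<^esub> (x \<otimes>\<^bsub>A\<^esub> y) \<and>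
        x \<otimes>\<^bsub>A\<^esub> (c \<odot>\<^bsub>A\<^esub> y) = c \<odot>\<^bsub>A\<^esub> (x \<otimes>\<^bsub>A\<^esub> y))"

definition algebra_hom ::
  "('k, 'l) ring_scheme \<Rightarrow> ('k, 'a, 'm) module_scheme \<Rightarrow> ('k, 'b, 'n) module_scheme \<Rightarrow> ('a \<Rightarrow> 'b) set" where
  "algebra_hom K A B = module_hom K A B \<inter> ring_hom A B"

definition op_algebra :: "('k, 'a) module \<Rightarrow> ('k, 'a) module" where
  "op_algebra A = A\<lparr>monoid.mult := \<lambda>x y. y \<otimes>\<^bsub>A\<^esub> x\<rparr>"

definition ground_algebra :: "('k, 'l) ring_scheme \<Rightarrow> ('k, 'k) module" where
  "ground_algebra K = \<lparr>carrier = carrier K, monoid.mult = monoid.mult K, one = \<one>\<^bsub>K\<^esub>,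
     ring.zero = \<zero>\<^bsub>K\<^esub>, ring.add = ring.add K, smult = monoid.mult K\<rparr>"

text \<open>Linear functionals, normalised to be \<^term>\<open>undefined\<close> off the carrier.\<close>

definition dual_space :: "('k, 'l) ring_scheme \<Rightarrow> ('k, 'a, 'm) module_scheme \<Rightarrow> ('a \<Rightarrow> 'k) set" where
  "dual_space K V = extensional (carrier V) \<inter> module_hom K V (ground_algebra K)"

definition dual_basis ::
  "('k, 'l) ring_scheme \<Rightarrow> ('k, 'a, 'm) module_scheme \<Rightarrow> 'd set \<Rightarrow> ('d \<Rightarrow> 'a) \<Rightarrow> ('d \<Rightarrow> 'a \<Rightarrow> 'k) \<Rightarrow> bool" where
  "dual_basis K V D v \<xi> \<longleftrightarrow>
     inj_on v D \<and> vectorspace.basis K V (v ` D) \<and> \<xi> \<in> D \<rightarrow> dual_space K V \<and>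
     (\<forall>d\<in>D. \<forall>e\<in>D. \<xi> d (v e) = (if d = e then \<one>\<^bsub>K\<^esub> else \<zero>\<^bsub>K\<^esub>))"


section \<open>Tensor products\<close>

text \<open>
  The tensor product over \<open>K\<close> is the free abelian group on pairs modulo the subgroup generated by
  additivity in each argument and balancedness; its elements are cosets.
\<close>

type_synonym ('a, 'b) tensor = "('a \<times> 'b \<Rightarrow>\<^sub>0 int) set"

definition tensor_relators ::
  "('k, 'l) ring_scheme \<Rightarrow> ('k, 'a, 'm) module_scheme \<Rightarrow> ('k, 'b, 'n) module_scheme \<Rightarrow> ('a, 'b) tensor" where
  "tensor_relators K V W =
     {frag_of (v \<oplus>\<^bsub>V\<^esub> v', w) - frag_of (v, w) - frag_of (v', w) | v v' w.
        v \<in> carrier V \<and> v' \<in> carrier V \<and> w \<in> carrier W} \<union>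
     {frag_of (v, w \<oplus>\<^bsub>W\<^esub> w') - frag_of (v, w) - frag_of (v, w') | v w w'.
        v \<in> carrier V \<and> w \<in> carrier W \<and> w' \<in> carrier W} \<union>
     {frag_of (c \<odot>\<^bsub>V\<^esub> v, w) - frag_of (v, c \<odot>\<^bsub>W\<^esub> w) | c v w.
        c \<in> carrier K \<and> v \<in> carrier V \<and> w \<in> carrier W}"

definition tensor_null ::
  "('k, 'l) ring_scheme \<Rightarrow> ('k, 'a, 'm) module_scheme \<Rightarrow> ('k, 'b, 'n) module_scheme \<Rightarrow> ('a, 'b) tensor" where
  "tensor_null K V W =
     generate (free_Abelian_group (carrier V \<times> carrier W)) (tensor_relators K V W)"

definition pure ::
  "('k, 'l) ring_scheme \<Rightarrow> ('k, 'a, 'm) module_scheme \<Rightarrow> ('k, 'b, 'n) module_scheme \<Rightarrow>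
   'a \<Rightarrow> 'b \<Rightarrow> ('a, 'b) tensor" where
  "pure K V W v w =
     tensor_null K V W #>\<^bsub>free_Abelian_group (carrier V \<times> carrier W)\<^esub> frag_of (v, w)"

text \<open>
  The additive map out of a tensor product induced by \<open>f\<close>. It is independent of the chosen
  representative only if \<open>f\<close> is biadditive and balanced, which is the case in every use below.
\<close>

definition tensor_lift :: "('c, 'm) ring_scheme \<Rightarrow> ('a \<Rightarrow> 'b \<Rightarrow> 'c) \<Rightarrow> ('a, 'b) tensor \<Rightarrow> 'c" where
  "tensor_lift M f t =
     (let x = (SOME x. x \<in> t) in
      \<Oplus>\<^bsub>M\<^esub>p\<in>Poly_Mapping.keys x. [Poly_Mapping.lookup x p] \<cdot>\<^bsub>M\<^esub> f (fst p) (snd p))"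

text \<open>
  The additive group of the tensor product; the multiplicative fields are set to dummies here and
  given their values in \<open>tensor\<close>.
\<close>

definition tensor_additive ::
  "('k, 'l) ring_scheme \<Rightarrow> ('k, 'a, 'm) module_scheme \<Rightarrow> ('k, 'b, 'n) module_scheme \<Rightarrow>
   ('a, 'b) tensor ring" where
  "tensor_additive K V W =
     (let G = free_Abelian_group (carrier V \<times> carrier W) Mod tensor_null K V W in
      \<lparr>carrier = carrier G, monoid.mult = undefined, one = undefined,
       ring.zero = \<one>\<^bsub>G\<^esub>, ring.add = monoid.mult G\<rparr>)"

definition tensor ::
  "('k, 'l) ring_scheme \<Rightarrow> ('k, 'a, 'm) module_scheme \<Rightarrow> ('k, 'b, 'n) module_scheme \<Rightarrow>
   ('k, ('a, 'b) tensor) module" where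
  "tensor K A B =
     (let T = tensor_additive K A B in
      \<lparr>carrier = carrier T,
       monoid.mult = (\<lambda>s t. tensor_lift T (\<lambda>a b. tensor_lift T (\<lambda>a' b'.
                pure K A B (a \<otimes>\<^bsub>A\<^esub> a') (b \<otimes>\<^bsub>B\<^esub> b')) t) s),
       one = pure K A B \<one>\<^bsub>A\<^esub> \<one>\<^bsub>B\<^esub>,
       ring.zero = \<zero>\<^bsub>T\<^esub>,
       ring.add = ring.add T,
       smult = (\<lambda>c. tensor_lift T (\<lambda>a. pure K A B (c \<odot>\<^bsub>A\<^esub> a)))\<rparr>)"

definition tensor_map ::
  "('k, 'l) ring_scheme \<Rightarrow> ('k, 'a, 'm) module_scheme \<Rightarrow> ('k, 'b, 'n) module_scheme \<Rightarrow>
   ('c \<Rightarrow> 'a) \<Rightarrow> ('d \<Rightarrow> 'b) \<Rightarrow> ('c, 'd) tensor \<Rightarrow> ('a, 'b) tensor" where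
  "tensor_map K A B f g = tensor_lift (tensor K A B) (\<lambda>x y. pure K A B (f x) (g y))"

definition tensor_swap ::
  "('k, 'l) ring_scheme \<Rightarrow> ('k, 'a, 'm) module_scheme \<Rightarrow> ('k, 'b, 'n) module_scheme \<Rightarrow>
   ('b, 'a) tensor \<Rightarrow> ('a, 'b) tensor" where
  "tensor_swap K A B = tensor_lift (tensor K A B) (\<lambda>y x. pure K A B x y)"

text \<open>Threefold tensor products are bracketed to the right.\<close>

abbreviation tensor3 ::
  "('k, 'l) ring_scheme \<Rightarrow> ('k, 'a, 'm) module_scheme \<Rightarrow> ('k, 'b, 'n) module_scheme \<Rightarrow>
   ('k, 'c, 'o) module_scheme \<Rightarrow> ('k, ('a, ('b, 'c) tensor) tensor) module" where
  "tensor3 K A B C \<equiv> tensor K A (tensor K B C)"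

abbreviation pure3 ::
  "('k, 'l) ring_scheme \<Rightarrow> ('k, 'a, 'm) module_scheme \<Rightarrow> ('k, 'b, 'n) module_scheme \<Rightarrow>
   ('k, 'c, 'o) module_scheme \<Rightarrow> 'a \<Rightarrow> 'b \<Rightarrow> 'c \<Rightarrow> ('a, ('b, 'c) tensor) tensor" where
  "pure3 K A B C a b c \<equiv> pure K A (tensor K B C) a (pure K B C b c)"

text \<open>Leg notation in \<open>H \<otimes> H \<otimes> Q\<close>: \<open>leg12 K H Q x\<close> is $x_{12}$, and so on.\<close>

definition leg12 ::
  "('k, 'l) ring_scheme \<Rightarrow> ('k, 'h, 'm) module_scheme \<Rightarrow> ('k, 'q, 'n) module_scheme \<Rightarrow>
   ('h, 'h) tensor \<Rightarrow> ('h, ('h, 'q) tensor) tensor" where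
  "leg12 K H Q = tensor_lift (tensor3 K H H Q) (\<lambda>a b. pure3 K H H Q a b \<one>\<^bsub>Q\<^esub>)"

definition leg21 ::
  "('k, 'l) ring_scheme \<Rightarrow> ('k, 'h, 'm) module_scheme \<Rightarrow> ('k, 'q, 'n) module_scheme \<Rightarrow>
   ('h, 'h) tensor \<Rightarrow> ('h, ('h, 'q) tensor) tensor" where
  "leg21 K H Q = tensor_lift (tensor3 K H H Q) (\<lambda>a b. pure3 K H H Q b a \<one>\<^bsub>Q\<^esub>)"

definition leg13 ::
  "('k, 'l) ring_scheme \<Rightarrow> ('k, 'h, 'm) module_scheme \<Rightarrow> ('k, 'q, 'n) module_scheme \<Rightarrow>
   ('h, 'q) tensor \<Rightarrow> ('h, ('h, 'q) tensor) tensor" where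
  "leg13 K H Q = tensor_lift (tensor3 K H H Q) (\<lambda>a q. pure3 K H H Q a \<one>\<^bsub>H\<^esub> q)"

definition leg23 ::
  "('k, 'l) ring_scheme \<Rightarrow> ('k, 'h, 'm) module_scheme \<Rightarrow> ('k, 'q, 'n) module_scheme \<Rightarrow>
   ('h, 'q) tensor \<Rightarrow> ('h, ('h, 'q) tensor) tensor" where
  "leg23 K H Q = tensor_lift (tensor3 K H H Q) (\<lambda>a q. pure3 K H H Q \<one>\<^bsub>H\<^esub> a q)"


section \<open>Quasitriangular Hopf algebras\<close>

record ('k, 'h) hopf = "('k, 'h) module" +
  comul :: "'h \<Rightarrow> ('h, 'h) tensor"
  counit :: "'h \<Rightarrow> 'k"
  antipode :: "'h \<Rightarrow> 'h"

text \<open>$\Delta \otimes \mathrm{Id} : H \otimes Q \to H \otimes H \otimes Q$\<close>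

definition comul_left ::
  "('k, 'l) ring_scheme \<Rightarrow> ('k, 'h, 'm) hopf_scheme \<Rightarrow> ('k, 'q, 'n) module_scheme \<Rightarrow>
   ('h, 'q) tensor \<Rightarrow> ('h, ('h, 'q) tensor) tensor" where
  "comul_left K H Q =
     tensor_lift (tensor3 K H H Q) (\<lambda>a q.
       tensor_lift (tensor3 K H H Q) (\<lambda>a1 a2. pure3 K H H Q a1 a2 q) (comul H a))"

definition hopf_algebra :: "('k, 'l) ring_scheme \<Rightarrow> ('k, 'h, 'm) hopf_scheme \<Rightarrow> bool" where
  "hopf_algebra K H \<longleftrightarrow>
     assoc_algebra K H \<and>
     comul H \<in> algebra_hom K H (tensor K H H) \<and>
     counit H \<in> algebra_hom K H (ground_algebra K) \<and>
     antipode H \<in> module_hom K H H \<and>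
     (\<forall>h\<in>carrier H.
        comul_left K H H (comul H h) = tensor_map K H (tensor K H H) id (comul H) (comul H h) \<and>
        tensor_lift H (\<lambda>a b. counit H a \<odot>\<^bsub>H\<^esub> b) (comul H h) = h \<and>
        tensor_lift H (\<lambda>a b. counit H b \<odot>\<^bsub>H\<^esub> a) (comul H h) = h \<and>
        tensor_lift H (\<lambda>a b. antipode H a \<otimes>\<^bsub>H\<^esub> b) (comul H h) = counit H h \<odot>\<^bsub>H\<^esub> \<one>\<^bsub>H\<^esub> \<and>
        tensor_lift H (\<lambda>a b. a \<otimes>\<^bsub>H\<^esub> antipode H b) (comul H h) = counit H h \<odot>\<^bsub>H\<^esub> \<one>\<^bsub>H\<^esub>)"

definition R_matrix ::
  "('k, 'l) ring_scheme \<Rightarrow> ('k, 'h, 'm) hopf_scheme \<Rightarrow> ('h, 'h) tensor \<Rightarrow> bool" where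
  "R_matrix K H R \<longleftrightarrow>
     R \<in> Units (tensor K H H) \<and>
     comul_left K H H R = leg13 K H H R \<otimes>\<^bsub>tensor3 K H H H\<^esub> leg23 K H H R \<and>
     tensor_map K H (tensor K H H) id (comul H) R =
       leg13 K H H R \<otimes>\<^bsub>tensor3 K H H H\<^esub> leg12 K H H R \<and>
     (\<forall>h\<in>carrier H.
        R \<otimes>\<^bsub>tensor K H H\<^esub> comul H h = tensor_swap K H H (comul H h) \<otimes>\<^bsub>tensor K H H\<^esub> R)"

definition quasitriangular_hopf_algebra ::
  "('k, 'l) ring_scheme \<Rightarrow> ('k, 'h, 'm) hopf_scheme \<Rightarrow> ('h, 'h) tensor \<Rightarrow> bool" where
  "quasitriangular_hopf_algebra K H R \<longleftrightarrow> hopf_algebra K H \<and> R_matrix K H R"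

abbreviation antipode_inv :: "('k, 'h, 'm) hopf_scheme \<Rightarrow> 'h \<Rightarrow> 'h" where
  "antipode_inv H \<equiv> inv_into (carrier H) (antipode H)"


section \<open>The category of quasitriangular left comodule algebras\<close>

record ('k, 'h, 'q) comod_algebra = "('k, 'q) module" +
  coact :: "'q \<Rightarrow> ('h, 'q) tensor"

definition comodule_algebra ::
  "('k, 'l) ring_scheme \<Rightarrow> ('k, 'h, 'm) hopf_scheme \<Rightarrow> ('k, 'h, 'q) comod_algebra \<Rightarrow> bool" where
  "comodule_algebra K H Q \<longleftrightarrow>
     assoc_algebra K Q \<and>
     coact Q \<in> algebra_hom K Q (tensor K H Q) \<and>
     (\<forall>q\<in>carrier Q.
        comul_left K H Q (coact Q q) = tensor_map K H (tensor K H Q) id (coact Q) (coact Q q) \<and>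
        tensor_lift Q (\<lambda>a x. counit H a \<odot>\<^bsub>Q\<^esub> x) (coact Q q) = q)"

definition K_matrix ::
  "('k, 'l) ring_scheme \<Rightarrow> ('k, 'h, 'm) hopf_scheme \<Rightarrow> ('h, 'h) tensor \<Rightarrow>
   ('k, 'h, 'q) comod_algebra \<Rightarrow> ('h, 'q) tensor \<Rightarrow> bool" where
  "K_matrix K H R Q \<kappa> \<longleftrightarrow>
     (let T = tensor3 K H H Q; R12 = leg12 K H Q R; R21 = leg21 K H Q R;
          K13 = leg13 K H Q \<kappa>; K23 = leg23 K H Q \<kappa>
      in
        \<kappa> \<in> Units (tensor K H Q) \<and>
        comul_left K H Q \<kappa> = K23 \<otimes>\<^bsub>T\<^esub> R21 \<otimes>\<^bsub>T\<^esub> K13 \<otimes>\<^bsub>T\<^esub> inv\<^bsub>T\<^esub> R21 \<and>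
        tensor_map K H (tensor K H Q) id (coact Q) \<kappa> = R21 \<otimes>\<^bsub>T\<^esub> K13 \<otimes>\<^bsub>T\<^esub> R12 \<and>
        (\<forall>q\<in>carrier Q.
           \<kappa> \<otimes>\<^bsub>tensor K H Q\<^esub> coact Q q = coact Q q \<otimes>\<^bsub>tensor K H Q\<^esub> \<kappa>))"

definition QT_objects ::
  "('k, 'l) ring_scheme \<Rightarrow> ('k, 'h, 'm) hopf_scheme \<Rightarrow> ('h, 'h) tensor \<Rightarrow>
   (('k, 'h, 'q) comod_algebra \<times> ('h, 'q) tensor) set" where
  "QT_objects K H R = {(Q, \<kappa>). comodule_algebra K H Q \<and> K_matrix K H R Q \<kappa>}"

text \<open>Morphisms are extensional, so that equality of morphisms is equality of functions.\<close>

definition QT_hom ::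
  "('k, 'l) ring_scheme \<Rightarrow> ('k, 'h, 'm) hopf_scheme \<Rightarrow>
   ('k, 'h, 'p) comod_algebra \<times> ('h, 'p) tensor \<Rightarrow>
   ('k, 'h, 'q) comod_algebra \<times> ('h, 'q) tensor \<Rightarrow> ('p \<Rightarrow> 'q) set" where
  "QT_hom K H = (\<lambda>(Q1, \<kappa>1) (Q2, \<kappa>2).
     {\<phi> \<in> extensional (carrier Q1) \<inter> algebra_hom K Q1 Q2.
        (\<forall>q\<in>carrier Q1. tensor_map K H Q2 id \<phi> (coact Q1 q) = coact Q2 (\<phi> q)) \<and>
        tensor_map K H Q2 id \<phi> \<kappa>1 = \<kappa>2})"


section \<open>Free products of algebras\<close>

definition free_ring :: "'x set \<Rightarrow> ('x list \<Rightarrow>\<^sub>0 int) ring" where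
  "free_ring S =
     \<lparr>carrier = {x. Poly_Mapping.keys x \<subseteq> lists S},
      monoid.mult = (\<lambda>x y. frag_extend (\<lambda>u. frag_extend (\<lambda>v. frag_of (u @ v)) y) x),
      one = frag_of [], ring.zero = 0, ring.add = (+)\<rparr>"

text \<open>
  The free product (coproduct of unital \<open>K\<close>-algebras) is the free ring on the disjoint union of the
  two carriers, modulo the relations making both inclusions unital ring homomorphisms and
  identifying the images of the scalars. Scalars are then automatically central, and
  \<open>K\<close> acts by multiplication with the common image of \<open>K\<close>.
\<close>

definition free_product_relators ::
  "('k, 'l) ring_scheme \<Rightarrow> ('k, 'a, 'm) module_scheme \<Rightarrow> ('k, 'b, 'n) module_scheme \<Rightarrow>
   (('a + 'b) list \<Rightarrow>\<^sub>0 int) set" where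
  "free_product_relators K A B =
     {frag_of [Inl (x \<oplus>\<^bsub>A\<^esub> y)] - frag_of [Inl x] - frag_of [Inl y] | x y.
        x \<in> carrier A \<and> y \<in> carrier A} \<union>
     {frag_of [Inl (x \<otimes>\<^bsub>A\<^esub> y)] - frag_of [Inl x, Inl y] | x y.
        x \<in> carrier A \<and> y \<in> carrier A} \<union>
     {frag_of [Inl \<one>\<^bsub>A\<^esub>] - frag_of []} \<union>
     {frag_of [Inr (x \<oplus>\<^bsub>B\<^esub> y)] - frag_of [Inr x] - frag_of [Inr y] | x y.
        x \<in> carrier B \<and> y \<in> carrier B} \<union>
     {frag_of [Inr (x \<otimes>\<^bsub>B\<^esub> y)] - frag_of [Inr x, Inr y] | x y.
        x \<in> carrier B \<and> y \<in> carrier B} \<union>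
     {frag_of [Inr \<one>\<^bsub>B\<^esub>] - frag_of []} \<union>
     {frag_of [Inl (c \<odot>\<^bsub>A\<^esub> \<one>\<^bsub>A\<^esub>)] - frag_of [Inr (c \<odot>\<^bsub>B\<^esub> \<one>\<^bsub>B\<^esub>)] | c. c \<in> carrier K}"

type_synonym ('a, 'b) free_prod = "(('a + 'b) list \<Rightarrow>\<^sub>0 int) set"

definition free_product_class ::
  "('k, 'l) ring_scheme \<Rightarrow> ('k, 'a, 'm) module_scheme \<Rightarrow> ('k, 'b, 'n) module_scheme \<Rightarrow>
   (('a + 'b) list \<Rightarrow>\<^sub>0 int) \<Rightarrow> ('a, 'b) free_prod" where
  "free_product_class K A B x =
     (let F = free_ring (carrier A <+> carrier B) in
      (Idl\<^bsub>F\<^esub> (free_product_relators K A B)) +>\<^bsub>F\<^esub> x)"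

definition free_product ::
  "('k, 'l) ring_scheme \<Rightarrow> ('k, 'a, 'm) module_scheme \<Rightarrow> ('k, 'b, 'n) module_scheme \<Rightarrow>
   ('k, ('a, 'b) free_prod) module" where
  "free_product K A B =
     (let F = free_ring (carrier A <+> carrier B);
          P = F Quot (Idl\<^bsub>F\<^esub> (free_product_relators K A B))
      in ring.extend P (module.fields
           (\<lambda>c t. free_product_class K A B (frag_of [Inl (c \<odot>\<^bsub>A\<^esub> \<one>\<^bsub>A\<^esub>)]) \<otimes>\<^bsub>P\<^esub> t)))"


section \<open>The reflective algebra\<close>

text \<open>
  $\widehat\Delta(h) = \sum_{i,j} t_j h_{(1)} t_i \otimes h_{(2)} s_i S^{-1}(s_j)$ where
  $R = \sum_i s_i \otimes t_i$
\<close>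

definition hat_comul ::
  "('k, 'l) ring_scheme \<Rightarrow> ('k, 'h, 'm) hopf_scheme \<Rightarrow> ('h, 'h) tensor \<Rightarrow> 'h \<Rightarrow> ('h, 'h) tensor" where
  "hat_comul K H R h =
     (let T = tensor K H H in
      tensor_lift T (\<lambda>sj tj. tensor_lift T (\<lambda>si ti. tensor_lift T (\<lambda>h1 h2.
        pure K H H (tj \<otimes>\<^bsub>H\<^esub> h1 \<otimes>\<^bsub>H\<^esub> ti) (h2 \<otimes>\<^bsub>H\<^esub> si \<otimes>\<^bsub>H\<^esub> antipode_inv H sj))
        (comul H h)) R) R)"

text \<open>$\ell \rightharpoonup h = \ell_{(2)} h S^{-1}(\ell_{(1)})$\<close>

definition hat_act :: "('k, 'h, 'm) hopf_scheme \<Rightarrow> 'h \<Rightarrow> 'h \<Rightarrow> 'h" where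
  "hat_act H l h =
     tensor_lift H (\<lambda>l1 l2. l2 \<otimes>\<^bsub>H\<^esub> h \<otimes>\<^bsub>H\<^esub> antipode_inv H l1) (comul H l)"

definition hat_dual ::
  "('k, 'l) ring_scheme \<Rightarrow> ('k, 'h, 'm) hopf_scheme \<Rightarrow> ('h, 'h) tensor \<Rightarrow> ('k, 'h \<Rightarrow> 'k) module" where
  "hat_dual K H R =
     \<lparr>carrier = dual_space K H,
      monoid.mult = (\<lambda>\<xi> \<zeta>. \<lambda>h\<in>carrier H. tensor_lift K (\<lambda>a b. \<xi> a \<otimes>\<^bsub>K\<^esub> \<zeta> b) (hat_comul K H R h)),
      one = (\<lambda>h\<in>carrier H. counit H h),
      ring.zero = (\<lambda>h\<in>carrier H. \<zero>\<^bsub>K\<^esub>),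
      ring.add = (\<lambda>\<xi> \<zeta>. \<lambda>h\<in>carrier H. \<xi> h \<oplus>\<^bsub>K\<^esub> \<zeta> h),
      smult = (\<lambda>c \<xi>. \<lambda>h\<in>carrier H. c \<otimes>\<^bsub>K\<^esub> \<xi> h)\<rparr>"

definition hat_dual_act :: "('k, 'h, 'm) hopf_scheme \<Rightarrow> ('h \<Rightarrow> 'k) \<Rightarrow> 'h \<Rightarrow> 'h \<Rightarrow> 'k" where
  "hat_dual_act H \<xi> l = (\<lambda>h\<in>carrier H. \<xi> (hat_act H l h))"

abbreviation hat_dual_op ::
  "('k, 'l) ring_scheme \<Rightarrow> ('k, 'h, 'm) hopf_scheme \<Rightarrow> ('h, 'h) tensor \<Rightarrow> ('k, 'h \<Rightarrow> 'k) module" where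
  "hat_dual_op K H R \<equiv> op_algebra (hat_dual K H R)"

text \<open>The relators $\xi a - a_{[0]}(\xi \leftharpoonup a_{[-1]})$ in the free product\<close>

definition reflective_relators ::
  "('k, 'l) ring_scheme \<Rightarrow> ('k, 'h, 'm) hopf_scheme \<Rightarrow> ('h, 'h) tensor \<Rightarrow>
   ('k, 'h, 'a) comod_algebra \<Rightarrow> ('a, 'h \<Rightarrow> 'k) free_prod set" where
  "reflective_relators K H R A =
     (let B = hat_dual_op K H R; F = free_product K A B;
          inA = (\<lambda>a. free_product_class K A B (frag_of [Inl a]));
          inB = (\<lambda>\<xi>. free_product_class K A B (frag_of [Inr \<xi>]))
      in {(inB \<xi> \<otimes>\<^bsub>F\<^esub> inA a) \<ominus>\<^bsub>F\<^esub>
            tensor_lift F (\<lambda>l a0. inA a0 \<otimes>\<^bsub>F\<^esub> inB (hat_dual_act H \<xi> l)) (coact A a) | \<xi> a.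
          \<xi> \<in> carrier B \<and> a \<in> carrier A})"

definition reflective_class ::
  "('k, 'l) ring_scheme \<Rightarrow> ('k, 'h, 'm) hopf_scheme \<Rightarrow> ('h, 'h) tensor \<Rightarrow>
   ('k, 'h, 'a) comod_algebra \<Rightarrow> ('a, 'h \<Rightarrow> 'k) free_prod \<Rightarrow> ('a, 'h \<Rightarrow> 'k) free_prod set" where
  "reflective_class K H R A x =
     (let F = free_product K A (hat_dual_op K H R) in
      (Idl\<^bsub>F\<^esub> (reflective_relators K H R A)) +>\<^bsub>F\<^esub> x)"

definition reflective_algebra ::
  "('k, 'l) ring_scheme \<Rightarrow> ('k, 'h, 'm) hopf_scheme \<Rightarrow> ('h, 'h) tensor \<Rightarrow>
   ('k, 'h, 'a) comod_algebra \<Rightarrow> ('k, ('a, 'h \<Rightarrow> 'k) free_prod set) module" where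
  "reflective_algebra K H R A =
     (let F = free_product K A (hat_dual_op K H R);
          P = F Quot (Idl\<^bsub>F\<^esub> (reflective_relators K H R A))
      in ring.extend P (module.fields
           (\<lambda>c t. reflective_class K H R A (c \<odot>\<^bsub>F\<^esub> \<one>\<^bsub>F\<^esub>) \<otimes>\<^bsub>P\<^esub> t)))"

text \<open>The canonical map $(\widehat H^*)^{\mathrm{op}} \to R_H(A)$\<close>

definition reflective_incl ::
  "('k, 'l) ring_scheme \<Rightarrow> ('k, 'h, 'm) hopf_scheme \<Rightarrow> ('h, 'h) tensor \<Rightarrow>
   ('k, 'h, 'a) comod_algebra \<Rightarrow> ('h \<Rightarrow> 'k) \<Rightarrow> ('a, 'h \<Rightarrow> 'k) free_prod set" where
  "reflective_incl K H R A \<xi> =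
     reflective_class K H R A (free_product_class K A (hat_dual_op K H R) (frag_of [Inr \<xi>]))"

text \<open>The ground field with coaction $1 \mapsto 1_H \otimes 1$\<close>

definition trivial_comodule_algebra ::
  "('k, 'l) ring_scheme \<Rightarrow> ('k, 'h, 'm) hopf_scheme \<Rightarrow> ('k, 'h, 'k) comod_algebra" where
  "trivial_comodule_algebra K H =
     module.extend (ground_algebra K)
       (comod_algebra.fields (pure K H (ground_algebra K) \<one>\<^bsub>H\<^esub>))"

text \<open>
  $\delta_{\mathrm{ref}}(\xi) = \sum_{i,j,d} \langle \xi, t_j h_d s_i\rangle\, s_j t_i \otimes \xi_d$
  with values in $H \otimes (\widehat H^*)^{\mathrm{op}}$
\<close>

definition delta_ref ::
  "('k, 'l) ring_scheme \<Rightarrow> ('k, 'h, 'm) hopf_scheme \<Rightarrow> ('h, 'h) tensor \<Rightarrow>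
   'd set \<Rightarrow> ('d \<Rightarrow> 'h) \<Rightarrow> ('d \<Rightarrow> 'h \<Rightarrow> 'k) \<Rightarrow> ('h \<Rightarrow> 'k) \<Rightarrow> ('h, 'h \<Rightarrow> 'k) tensor" where
  "delta_ref K H R D hb \<xi>b \<xi> =
     (let B = hat_dual_op K H R; T = tensor K H B in
      tensor_lift T (\<lambda>sj tj. tensor_lift T (\<lambda>si ti.
        \<Oplus>\<^bsub>T\<^esub>d\<in>D. \<xi> (tj \<otimes>\<^bsub>H\<^esub> hb d \<otimes>\<^bsub>H\<^esub> si) \<odot>\<^bsub>T\<^esub> pure K H B (sj \<otimes>\<^bsub>H\<^esub> ti) (\<xi>b d)) R) R)"

text \<open>
  For the trivial comodule algebra the canonical map $(\widehat H^*)^{\mathrm{op}} \to R_H(\Bbbk)$ is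
  bijective; the coaction and the K-matrix of $R_H(\Bbbk)$ are transported along it.
\<close>

definition reflective_comodule_algebra ::
  "('k, 'l) ring_scheme \<Rightarrow> ('k, 'h, 'm) hopf_scheme \<Rightarrow> ('h, 'h) tensor \<Rightarrow>
   'd set \<Rightarrow> ('d \<Rightarrow> 'h) \<Rightarrow> ('d \<Rightarrow> 'h \<Rightarrow> 'k) \<Rightarrow>
   ('k, 'h, ('k, 'h \<Rightarrow> 'k) free_prod set) comod_algebra" where
  "reflective_comodule_algebra K H R D hb \<xi>b =
     (let A = trivial_comodule_algebra K H; P = reflective_algebra K H R A;
          \<iota> = reflective_incl K H R A
      in module.extend P (comod_algebra.fields
           (\<lambda>t. tensor_map K H P id \<iota>
                  (delta_ref K H R D hb \<xi>b (inv_into (carrier (hat_dual_op K H R)) \<iota> t)))))"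

definition K_ref ::
  "('k, 'l) ring_scheme \<Rightarrow> ('k, 'h, 'm) hopf_scheme \<Rightarrow> ('h, 'h) tensor \<Rightarrow>
   'd set \<Rightarrow> ('d \<Rightarrow> 'h) \<Rightarrow> ('d \<Rightarrow> 'h \<Rightarrow> 'k) \<Rightarrow>
   ('h, ('k, 'h \<Rightarrow> 'k) free_prod set) tensor" where
  "K_ref K H R D hb \<xi>b =
     (let A = trivial_comodule_algebra K H; P = reflective_algebra K H R A in
      \<Oplus>\<^bsub>tensor K H P\<^esub>d\<in>D. pure K H P (hb d) (reflective_incl K H R A (\<xi>b d)))"

end

theory Submission
  imports Defs
begin

text \<open>
  Pairing the last leg of an element of $H \otimes R_H(\Bbbk) = H \otimes (\widehat H^*)^{\mathrm{op}}$
  with the elements of $H$ determines that element, and turns $K_{\mathrm{ref}}$ into the identity map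
  of $H$. The comodule algebra and K-matrix axioms for $R_H(\Bbbk)$ thus become identities in $H$, which
  follow from the Yang-Baxter equation, $R\Delta = \Delta^{\mathrm{op}}R$ and the antipode axioms.

  A morphism $\phi$ to $(Q, \kappa)$ with $\kappa = \sum_i a_i \otimes x_i$ has to map $K_{\mathrm{ref}}$ to
  $\kappa$, which forces $\phi(\xi) = \sum_i \xi(a_i)x_i$. The formula for $(\Delta \otimes \mathrm{Id})\kappa$
  is equivalent to $(\widehat\Delta \otimes \mathrm{Id})\kappa = \kappa_{23}\kappa_{13}$, so this $\phi$ is
  multiplicative; applying $\varepsilon$ shows that $(\varepsilon \otimes \mathrm{Id})\kappa$ is an invertible
  idempotent, so $\phi$ is unital; and the formula for $(\mathrm{Id} \otimes \delta)\kappa$ says that it is a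
  comodule map.
\<close>

section \<open>Tensor products\<close>

text \<open>Elements of a tensor product are cosets of formal sums, and \<open>tensor_lift\<close>
  picks a representative by choice, so no element comes with a canonical expansion. Sweedler sums
  and sums over R are therefore nested lifts, and each axiom is restated against an arbitrary
  multilinear continuation \<open>F\<close> into an arbitrary module \<open>W\<close>; only in this
  form can it be applied in the middle of a longer expression. A calculation then consists of
  congruence steps that descend through lifts, interchanges of independent sums, and one axiom at a
  time. Three obstacles shape the rest. \<open>antipode_inv\<close> is a true inverse only once the
  antipode is bijective: injectivity comes from the Drinfeld element of R, surjectivity from finite
  dimension. The inverse of \<open>K_ref\<close> is found as a left and a right inverse with quite
  different formulas, which associativity forces to coincide. And the reflective algebra is a
  quotient of a free product that is itself a quotient of a free ring, so it first has to be
  recognised as the opposite dual algebra.\<close>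

hide_const (open) Modules.module_hom Vector_Spaces.linear

text \<open>Terms outside the support have coefficient 0. Summing over a larger finite set makes the
  sums for \<open>x\<close>, \<open>y\<close> and \<open>x + y\<close> run over the same indices,
  which is how additivity is proved next.\<close>

lemma (in abelian_group) finsum_frag_superset:
  fixes x :: "'z \<Rightarrow>\<^sub>0 int"
  assumes "f \<in> S \<rightarrow> carrier G" "finite A" "Poly_Mapping.keys x \<subseteq> A" "A \<subseteq> S"
  shows "(\<Oplus>p\<in>Poly_Mapping.keys x. [Poly_Mapping.lookup x p] \<cdot> f p) = (\<Oplus>p\<in>A. [Poly_Mapping.lookup x p] \<cdot> f p)"
proof (rule add.finprod_mono_neutral_cong_left)
  fix i assume "i \<in> A - Poly_Mapping.keys x"
  then show "[Poly_Mapping.lookup x i] \<cdot> f i = \<zero>" by (simp add: in_keys_iff add_pow_def)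
qed (use assms in \<open>auto intro!: add.int_pow_closed\<close>)

text \<open>The universal property of the free abelian group, with the extension of \<open>f\<close>
  written exactly as in the bodies of \<open>tensor_lift\<close> and \<open>free_eval\<close>, so
  that both inherit additivity from here.\<close>

lemma (in abelian_group) finsum_frag_hom:
  assumes f: "f \<in> S \<rightarrow> carrier G"
  shows "(\<lambda>x. \<Oplus>p\<in>Poly_Mapping.keys x. [Poly_Mapping.lookup x p] \<cdot> f p)
    \<in> hom (free_Abelian_group S) (add_monoid G)"
proof (rule homI)
  fix x assume "x \<in> carrier (free_Abelian_group S)"
  then show "(\<Oplus>p\<in>Poly_Mapping.keys x. [Poly_Mapping.lookup x p] \<cdot> f p) \<in> carrier (add_monoid G)"
    using f by (auto intro!: finsum_closed add.int_pow_closed)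
next
  fix x y assume xy: "x \<in> carrier (free_Abelian_group S)" "y \<in> carrier (free_Abelian_group S)"
  define A where "A = Poly_Mapping.keys x \<union> Poly_Mapping.keys y"
  have A: "finite A" "A \<subseteq> S" and fA: "f \<in> A \<rightarrow> carrier G" using xy f unfolding A_def by auto
  have k: "Poly_Mapping.keys (x + y) \<subseteq> A" unfolding A_def by (rule keys_add)
  have "(\<Oplus>p\<in>Poly_Mapping.keys (x + y). [Poly_Mapping.lookup (x + y) p] \<cdot> f p)
      = (\<Oplus>p\<in>A. [Poly_Mapping.lookup x p] \<cdot> f p \<oplus> [Poly_Mapping.lookup y p] \<cdot> f p)"
    unfolding finsum_frag_superset[OF f A(1) k A(2)]
    using fA by (intro add.finprod_cong')
      (auto simp: Poly_Mapping.lookup_add add.int_pow_mult Pi_iff intro!: add.int_pow_closed)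
  also have "\<dots> = (\<Oplus>p\<in>A. [Poly_Mapping.lookup x p] \<cdot> f p) \<oplus> (\<Oplus>p\<in>A. [Poly_Mapping.lookup y p] \<cdot> f p)"
    using fA by (intro finsum_addf) (auto intro!: add.int_pow_closed)
  also have "\<dots> = (\<Oplus>p\<in>Poly_Mapping.keys x. [Poly_Mapping.lookup x p] \<cdot> f p)
      \<oplus> (\<Oplus>p\<in>Poly_Mapping.keys y. [Poly_Mapping.lookup y p] \<cdot> f p)"
    using finsum_frag_superset[OF f A(1) _ A(2), of x] finsum_frag_superset[OF f A(1) _ A(2), of y]
    unfolding A_def by auto
  finally show "(\<Oplus>p\<in>Poly_Mapping.keys (x \<otimes>\<^bsub>free_Abelian_group S\<^esub> y).
        [Poly_Mapping.lookup (x \<otimes>\<^bsub>free_Abelian_group S\<^esub> y) p] \<cdot> f p)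
     = (\<Oplus>p\<in>Poly_Mapping.keys x. [Poly_Mapping.lookup x p] \<cdot> f p) \<otimes>\<^bsub>add_monoid G\<^esub>
       (\<Oplus>p\<in>Poly_Mapping.keys y. [Poly_Mapping.lookup y p] \<cdot> f p)" by simp
qed

lemma (in abelian_group) finsum_frag_of:
  assumes "f p \<in> carrier G"
  shows "(\<Oplus>q\<in>Poly_Mapping.keys (frag_of p). [Poly_Mapping.lookup (frag_of p) q] \<cdot> f q) = f p"
  using assms by (simp add: add.int_pow_1)

lemma module_homI [intro?]:
  assumes "\<And>x. x \<in> carrier V \<Longrightarrow> f x \<in> carrier W"
    and "\<And>x y. x \<in> carrier V \<Longrightarrow> y \<in> carrier V \<Longrightarrow> f (x \<oplus>\<^bsub>V\<^esub> y) = f x \<oplus>\<^bsub>W\<^esub> f y"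
    and "\<And>c x. c \<in> carrier K \<Longrightarrow> x \<in> carrier V \<Longrightarrow> f (c \<odot>\<^bsub>V\<^esub> x) = c \<odot>\<^bsub>W\<^esub> f x"
  shows "f \<in> module_hom K V W"
  using assms by (auto simp: module_hom_def)

lemma module_homD:
  assumes "f \<in> module_hom K V W"
  shows "x \<in> carrier V \<Longrightarrow> f x \<in> carrier W"
    and "x \<in> carrier V \<Longrightarrow> y \<in> carrier V \<Longrightarrow> f (x \<oplus>\<^bsub>V\<^esub> y) = f x \<oplus>\<^bsub>W\<^esub> f y"
    and "c \<in> carrier K \<Longrightarrow> x \<in> carrier V \<Longrightarrow> f (c \<odot>\<^bsub>V\<^esub> x) = c \<odot>\<^bsub>W\<^esub> f x"
  using assms by (auto simp: module_hom_def)

lemma module_hom_zero: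
  assumes "f \<in> module_hom K V W" "module K V" "module K W"
  shows "f \<zero>\<^bsub>V\<^esub> = \<zero>\<^bsub>W\<^esub>"
proof -
  interpret V: module K V by fact
  interpret W: module K W by fact
  have "f \<zero>\<^bsub>V\<^esub> \<oplus>\<^bsub>W\<^esub> f \<zero>\<^bsub>V\<^esub> = f \<zero>\<^bsub>V\<^esub>" using module_homD(2)[OF assms(1), of "\<zero>\<^bsub>V\<^esub>" "\<zero>\<^bsub>V\<^esub>"] by simp
  then show ?thesis using module_homD(1)[OF assms(1)] by (metis W.add.l_cancel_one V.zero_closed)
qed

text \<open>Formulated as membership of each partial map in \<open>module_hom\<close> rather than as
  equations: bilinearity of a long expression is then decided by composing linear maps, without
  computing with elements.\<close>

definition bilin ::
  "('k, 'l) ring_scheme \<Rightarrow> ('k, 'a, 'm) module_scheme \<Rightarrow> ('k, 'b, 'n) module_scheme \<Rightarrow>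
   ('k, 'c, 'o) module_scheme \<Rightarrow> ('a \<Rightarrow> 'b \<Rightarrow> 'c) \<Rightarrow> bool" where
  "bilin K U V W f \<longleftrightarrow>
     (\<forall>u\<in>carrier U. (\<lambda>v. f u v) \<in> module_hom K V W) \<and>
     (\<forall>v\<in>carrier V. (\<lambda>u. f u v) \<in> module_hom K U W)"

lemma bilinD:
  assumes "bilin K U V W f"
  shows "u \<in> carrier U \<Longrightarrow> v \<in> carrier V \<Longrightarrow> f u v \<in> carrier W"
    and "u \<in> carrier U \<Longrightarrow> u' \<in> carrier U \<Longrightarrow> v \<in> carrier V \<Longrightarrow> f (u \<oplus>\<^bsub>U\<^esub> u') v = f u v \<oplus>\<^bsub>W\<^esub> f u' v"
    and "u \<in> carrier U \<Longrightarrow> v \<in> carrier V \<Longrightarrow> v' \<in> carrier V \<Longrightarrow> f u (v \<oplus>\<^bsub>V\<^esub> v') = f u v \<oplus>\<^bsub>W\<^esub> f u v'"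
    and "c \<in> carrier K \<Longrightarrow> u \<in> carrier U \<Longrightarrow> v \<in> carrier V \<Longrightarrow> f (c \<odot>\<^bsub>U\<^esub> u) v = c \<odot>\<^bsub>W\<^esub> f u v"
    and "c \<in> carrier K \<Longrightarrow> u \<in> carrier U \<Longrightarrow> v \<in> carrier V \<Longrightarrow> f u (c \<odot>\<^bsub>V\<^esub> v) = c \<odot>\<^bsub>W\<^esub> f u v"
  using assms unfolding bilin_def module_hom_def by auto

text \<open>
  Values in a bare abelian group, since \<^const>\<open>tensor\<close> only becomes a module once its scalar
  multiplication, itself a \<^const>\<open>tensor_lift\<close>, is understood.
\<close>

definition balanced ::
  "('k, 'l) ring_scheme \<Rightarrow> ('k, 'a, 'm) module_scheme \<Rightarrow> ('k, 'b, 'n) module_scheme \<Rightarrow>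
   ('c, 'o) ring_scheme \<Rightarrow> ('a \<Rightarrow> 'b \<Rightarrow> 'c) \<Rightarrow> bool" where
  "balanced K U V M f \<longleftrightarrow>
     (\<forall>u\<in>carrier U. \<forall>v\<in>carrier V. f u v \<in> carrier M) \<and>
     (\<forall>u\<in>carrier U. \<forall>u'\<in>carrier U. \<forall>v\<in>carrier V. f (u \<oplus>\<^bsub>U\<^esub> u') v = f u v \<oplus>\<^bsub>M\<^esub> f u' v) \<and>
     (\<forall>u\<in>carrier U. \<forall>v\<in>carrier V. \<forall>v'\<in>carrier V. f u (v \<oplus>\<^bsub>V\<^esub> v') = f u v \<oplus>\<^bsub>M\<^esub> f u v') \<and>
     (\<forall>c\<in>carrier K. \<forall>u\<in>carrier U. \<forall>v\<in>carrier V. f (c \<odot>\<^bsub>U\<^esub> u) v = f u (c \<odot>\<^bsub>V\<^esub> v))"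

lemma bilin_imp_balanced: "bilin K U V W f \<Longrightarrow> balanced K U V W f"
  unfolding balanced_def by (simp add: bilinD)

section \<open>The tensor product as an abelian group; independence of lifts from the
  representative\<close>

locale tensor_product =
  U: module K U + V: module K V
  for K :: "('k, 'l) ring_scheme" and U :: "('k, 'a, 'm) module_scheme" and V :: "('k, 'b, 'n) module_scheme"
begin

abbreviation "FF \<equiv> free_Abelian_group (carrier U \<times> carrier V)"
abbreviation "NN \<equiv> tensor_null K U V"

lemma relators_in: "tensor_relators K U V \<subseteq> carrier FF"
proof -
  have d: "a - b \<in> carrier FF" if "a \<in> carrier FF" "b \<in> carrier FF" for a b
    using keys_diff[of a b] that by (simp del: keys_diff) blast
  show ?thesis unfolding tensor_relators_def
    by (intro subsetI; elim UnE CollectE exE conjE; hypsubst; intro d) simp_all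
qed

lemma NN_normal: "NN \<lhd> FF"
  unfolding tensor_null_def
  by (intro comm_group.normal_iff_subgroup[OF abelian_free_Abelian_group, THEN iffD2]
      group.generate_is_subgroup[OF group_free_Abelian_group] relators_in)

lemma NN_subgroup: "subgroup NN FF"
  using NN_normal normal_imp_subgroup by blast

definition coset :: "('a \<times> 'b \<Rightarrow>\<^sub>0 int) \<Rightarrow> ('a, 'b) tensor" where
  "coset x = NN #>\<^bsub>FF\<^esub> x"

lemma pure_eq: "pure K U V u v = coset (frag_of (u, v))"
  by (simp add: pure_def coset_def)

lemma carrier_tensor: "carrier (tensor K U V) = coset ` carrier FF"
  by (simp add: tensor_def tensor_additive_def Let_def carrier_FactGroup coset_def)

lemma zero_tensor: "\<zero>\<^bsub>tensor K U V\<^esub> = coset 0"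
proof -
  have "NN #>\<^bsub>FF\<^esub> \<one>\<^bsub>FF\<^esub> = NN"
    using subgroup.subset[OF NN_subgroup] group.coset_mult_one[OF group_free_Abelian_group] by blast
  then show ?thesis by (simp add: tensor_def tensor_additive_def Let_def coset_def)
qed

lemma coset_add:
  assumes "x \<in> carrier FF" "y \<in> carrier FF"
  shows "coset x \<oplus>\<^bsub>tensor K U V\<^esub> coset y = coset (x + y)"
  using normal.rcos_sum[OF NN_normal assms]
  by (simp add: tensor_def tensor_additive_def Let_def coset_def)

lemma some_in_coset:
  assumes "x \<in> carrier FF"
  obtains n where "n \<in> NN" "(SOME y. y \<in> coset x) = n + x"
proof -
  have "x \<in> coset x" unfolding coset_def
    by (rule group.rcos_self[OF group_free_Abelian_group assms NN_subgroup])
  then have "(SOME y. y \<in> coset x) \<in> coset x" by (rule someI)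
  then show thesis using that unfolding coset_def r_coset_def by auto
qed

text \<open>The chosen representative of the coset of \<open>x\<close> is \<open>n + x\<close> with
  \<open>n\<close> in \<open>NN\<close>. The homomorphism \<open>L\<close> extending
  \<open>f\<close> sends each relator to zero because \<open>f\<close> is balanced, hence vanishes
  on the generated subgroup \<open>NN\<close>, and the choice does not matter.\<close>

lemma tensor_lift_coset:
  assumes M: "abelian_group M" and f: "balanced K U V M f" and x: "x \<in> carrier FF"
  shows "tensor_lift M f (coset x) =
    (\<Oplus>\<^bsub>M\<^esub>p\<in>Poly_Mapping.keys x. [Poly_Mapping.lookup x p] \<cdot>\<^bsub>M\<^esub> f (fst p) (snd p))"
proof -
  interpret M: abelian_group M by fact
  have f': "(\<lambda>p. f (fst p) (snd p)) \<in> carrier U \<times> carrier V \<rightarrow> carrier M"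
    using f unfolding balanced_def by auto
  have fc: "u \<in> carrier U \<Longrightarrow> v \<in> carrier V \<Longrightarrow> f u v \<in> carrier M" for u v
    using f unfolding balanced_def by auto
  define L where "L x = (\<Oplus>\<^bsub>M\<^esub>p\<in>Poly_Mapping.keys x. [Poly_Mapping.lookup x p] \<cdot>\<^bsub>M\<^esub> f (fst p) (snd p))"
    for x :: "'a \<times> 'b \<Rightarrow>\<^sub>0 int"
  have L_hom: "L \<in> hom FF (add_monoid M)"
    using M.finsum_frag_hom[OF f'] unfolding L_def .
  interpret L: group_hom FF "add_monoid M" L
    by (intro group_hom.intro group_hom_axioms.intro L_hom group_free_Abelian_group M.a_group)
  have ab: "r = 0 + r" for r :: "'a \<times> 'b \<Rightarrow>\<^sub>0 int" by simp
  have Lof: "L (frag_of (u, v)) = f u v" if "u \<in> carrier U" "v \<in> carrier V" for u v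
    unfolding L_def using M.finsum_frag_of[of "\<lambda>p. f (fst p) (snd p)" "(u,v)"] fc[OF that] by simp
  have Ldiff: "L (a - b) = L a \<ominus>\<^bsub>M\<^esub> L b" if "a \<in> carrier FF" "b \<in> carrier FF" for a b
  proof -
    have "L (a \<otimes>\<^bsub>FF\<^esub> inv\<^bsub>FF\<^esub> b) = L a \<ominus>\<^bsub>M\<^esub> L b"
      unfolding a_minus_def a_inv_def
      using L.hom_mult[OF that(1) L.G.inv_closed[OF that(2)]] L.hom_inv[OF that(2)] by simp
    then show ?thesis using that by simp
  qed
  have d: "a - b \<in> carrier FF" if "a \<in> carrier FF" "b \<in> carrier FF" for a b
    using keys_diff[of a b] that by (simp del: keys_diff) blast
  have dsum: "a \<oplus>\<^bsub>M\<^esub> b \<ominus>\<^bsub>M\<^esub> a \<ominus>\<^bsub>M\<^esub> b = \<zero>\<^bsub>M\<^esub>" if "a \<in> carrier M" "b \<in> carrier M" for a b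
  proof -
    have "a \<oplus>\<^bsub>M\<^esub> b \<ominus>\<^bsub>M\<^esub> a \<ominus>\<^bsub>M\<^esub> b = (b \<oplus>\<^bsub>M\<^esub> a) \<oplus>\<^bsub>M\<^esub> (\<ominus>\<^bsub>M\<^esub> a \<oplus>\<^bsub>M\<^esub> \<ominus>\<^bsub>M\<^esub> b)"
      using that M.a_comm[of a b] by (simp add: M.minus_eq M.a_assoc)
    also have "\<dots> = b \<oplus>\<^bsub>M\<^esub> ((a \<oplus>\<^bsub>M\<^esub> \<ominus>\<^bsub>M\<^esub> a) \<oplus>\<^bsub>M\<^esub> \<ominus>\<^bsub>M\<^esub> b)"
      using that by (simp only: M.a_assoc M.a_inv_closed M.a_closed M.add.m_closed)
    finally show ?thesis using that by (simp add: M.r_neg)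
  qed
  have dself: "a \<ominus>\<^bsub>M\<^esub> a = \<zero>\<^bsub>M\<^esub>" if "a \<in> carrier M" for a
    using that by (simp add: M.minus_eq M.r_neg)
  have rel: "\<forall>r \<in> tensor_relators K U V. L r = \<zero>\<^bsub>M\<^esub>"
    unfolding tensor_relators_def
  proof (intro ballI; elim UnE CollectE exE conjE; hypsubst)
    fix u u' v assume "u \<in> carrier U" "u' \<in> carrier U" "v \<in> carrier V"
    moreover from this have "f (u \<oplus>\<^bsub>U\<^esub> u') v = f u v \<oplus>\<^bsub>M\<^esub> f u' v" using f unfolding balanced_def by auto
    ultimately show "L (frag_of (u \<oplus>\<^bsub>U\<^esub> u', v) - frag_of (u, v) - frag_of (u', v)) = \<zero>\<^bsub>M\<^esub>"
      by (simp add: Ldiff d Lof fc dsum del: carrier_free_Abelian_group_iff)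
  next
    fix u v v' assume "u \<in> carrier U" "v \<in> carrier V" "v' \<in> carrier V"
    moreover from this have "f u (v \<oplus>\<^bsub>V\<^esub> v') = f u v \<oplus>\<^bsub>M\<^esub> f u v'" using f unfolding balanced_def by auto
    ultimately show "L (frag_of (u, v \<oplus>\<^bsub>V\<^esub> v') - frag_of (u, v) - frag_of (u, v')) = \<zero>\<^bsub>M\<^esub>"
      by (simp add: Ldiff d Lof fc dsum del: carrier_free_Abelian_group_iff)
  next
    fix c u v assume "c \<in> carrier K" "u \<in> carrier U" "v \<in> carrier V"
    moreover from this have "f (c \<odot>\<^bsub>U\<^esub> u) v = f u (c \<odot>\<^bsub>V\<^esub> v)" using f unfolding balanced_def by auto
    ultimately show "L (frag_of (c \<odot>\<^bsub>U\<^esub> u, v) - frag_of (u, c \<odot>\<^bsub>V\<^esub> v)) = \<zero>\<^bsub>M\<^esub>"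
      by (simp add: Ldiff d Lof fc dself del: carrier_free_Abelian_group_iff)
  qed
  have null: "L n = \<zero>\<^bsub>M\<^esub>" if "n \<in> NN" for n
  proof -
    have "generate FF (tensor_relators K U V) \<subseteq> kernel FF (add_monoid M) L"
      by (rule L.G.generate_subgroup_incl[OF _ L.subgroup_kernel])
         (use relators_in rel in \<open>unfold kernel_def, force simp del: carrier_free_Abelian_group_iff\<close>)
    then show ?thesis using that unfolding tensor_null_def kernel_def by auto
  qed
  obtain n where n: "n \<in> NN" "(SOME y. y \<in> coset x) = n + x" using some_in_coset[OF x] .
  have nc: "n \<in> carrier FF" using n subgroup.subset[OF NN_subgroup] by blast
  have "L (n \<otimes>\<^bsub>FF\<^esub> x) = L n \<oplus>\<^bsub>M\<^esub> L x" using L.hom_mult[OF nc x] by simp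
  then have "L (n + x) = L x" using null[OF n(1)] L.hom_closed[OF x] by simp
  then show ?thesis unfolding tensor_lift_def n(2) Let_def L_def .
qed

lemma pure_in: "u \<in> carrier U \<Longrightarrow> v \<in> carrier V \<Longrightarrow> pure K U V u v \<in> carrier (tensor K U V)"
  unfolding pure_eq carrier_tensor by auto

lemma tensor_lift_pure:
  assumes "abelian_group M" "balanced K U V M f" "u \<in> carrier U" "v \<in> carrier V"
  shows "tensor_lift M f (pure K U V u v) = f u v"
proof -
  have "f u v \<in> carrier M" using assms unfolding balanced_def by auto
  then show ?thesis unfolding pure_eq
    using tensor_lift_coset[OF assms(1,2)] abelian_group.finsum_frag_of[OF assms(1), of "\<lambda>p. f (fst p) (snd p)" "(u,v)"] assms
    by simp
qed

lemma tensor_lift_closed_add: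
  assumes M: "abelian_group M" and f: "balanced K U V M f"
  shows "s \<in> carrier (tensor K U V) \<Longrightarrow> tensor_lift M f s \<in> carrier M"
    and "s \<in> carrier (tensor K U V) \<Longrightarrow> t \<in> carrier (tensor K U V) \<Longrightarrow>
      tensor_lift M f (s \<oplus>\<^bsub>tensor K U V\<^esub> t) = tensor_lift M f s \<oplus>\<^bsub>M\<^esub> tensor_lift M f t"
proof -
  interpret M: abelian_group M by fact
  have f': "(\<lambda>p. f (fst p) (snd p)) \<in> carrier U \<times> carrier V \<rightarrow> carrier M"
    using f unfolding balanced_def by auto
  note h = M.finsum_frag_hom[OF f']
  show "s \<in> carrier (tensor K U V) \<Longrightarrow> tensor_lift M f s \<in> carrier M"
    using hom_in_carrier[OF h] by (auto simp: carrier_tensor tensor_lift_coset[OF M f])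
  assume "s \<in> carrier (tensor K U V)" "t \<in> carrier (tensor K U V)"
  then obtain x y where [simp]: "s = coset x" "t = coset y" and xy: "x \<in> carrier FF" "y \<in> carrier FF"
    by (auto simp: carrier_tensor)
  have "x + y \<in> carrier FF" using monoid.m_closed[OF group.is_monoid[OF group_free_Abelian_group] xy] by simp
  then show "tensor_lift M f (s \<oplus>\<^bsub>tensor K U V\<^esub> t) = tensor_lift M f s \<oplus>\<^bsub>M\<^esub> tensor_lift M f t"
    using hom_mult[OF h xy] xy by (simp only: \<open>s = coset x\<close> \<open>t = coset y\<close> coset_add tensor_lift_coset[OF M f]) simp
qed

lemma abelian_group_tensor: "abelian_group (tensor K U V)"
proof -
  have d: "x + y \<in> carrier FF" if "x \<in> carrier FF" "y \<in> carrier FF" for x y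
    using monoid.m_closed[OF group.is_monoid[OF group_free_Abelian_group] that] by simp
  have i: "- x \<in> carrier FF" if "x \<in> carrier FF" for x
    using that by simp
  have z: "0 \<in> carrier FF" by simp
  show ?thesis
  proof (rule abelian_groupI)
    fix s assume "s \<in> carrier (tensor K U V)"
    then obtain x where x: "s = coset x" "x \<in> carrier FF" unfolding carrier_tensor by blast
    have "coset (- x) \<oplus>\<^bsub>tensor K U V\<^esub> s = \<zero>\<^bsub>tensor K U V\<^esub>"
      unfolding x(1) coset_add[OF i[OF x(2)] x(2)] zero_tensor by simp
    then show "\<exists>y\<in>carrier (tensor K U V). y \<oplus>\<^bsub>tensor K U V\<^esub> s = \<zero>\<^bsub>tensor K U V\<^esub>"
      unfolding carrier_tensor using i[OF x(2)] by blast
  next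
    fix s t r assume "s \<in> carrier (tensor K U V)" "t \<in> carrier (tensor K U V)" "r \<in> carrier (tensor K U V)"
    then obtain x y z where "s = coset x" "x \<in> carrier FF" "t = coset y" "y \<in> carrier FF" "r = coset z" "z \<in> carrier FF"
      unfolding carrier_tensor by blast
    then show "s \<oplus>\<^bsub>tensor K U V\<^esub> t \<oplus>\<^bsub>tensor K U V\<^esub> r = s \<oplus>\<^bsub>tensor K U V\<^esub> (t \<oplus>\<^bsub>tensor K U V\<^esub> r)"
      by (simp only: coset_add d add.assoc)
  next
    fix s t assume "s \<in> carrier (tensor K U V)" "t \<in> carrier (tensor K U V)"
    then obtain x y where xy: "s = coset x" "x \<in> carrier FF" "t = coset y" "y \<in> carrier FF"
      unfolding carrier_tensor by blast
    show "s \<oplus>\<^bsub>tensor K U V\<^esub> t \<in> carrier (tensor K U V)"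
      unfolding xy(1,3) coset_add[OF xy(2,4)] carrier_tensor using d[OF xy(2,4)] by blast
    show "s \<oplus>\<^bsub>tensor K U V\<^esub> t = t \<oplus>\<^bsub>tensor K U V\<^esub> s"
      unfolding xy(1,3) coset_add[OF xy(2,4)] coset_add[OF xy(4,2)] by (simp add: add.commute)
  next
    fix s assume "s \<in> carrier (tensor K U V)"
    then obtain x where x: "s = coset x" "x \<in> carrier FF" unfolding carrier_tensor by blast
    show "\<zero>\<^bsub>tensor K U V\<^esub> \<oplus>\<^bsub>tensor K U V\<^esub> s = s"
      unfolding x(1) zero_tensor coset_add[OF z x(2)] by simp
  next
    show "\<zero>\<^bsub>tensor K U V\<^esub> \<in> carrier (tensor K U V)"
      unfolding zero_tensor carrier_tensor using z by blast
  qed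
qed

lemma pure_add:
  "u \<in> carrier U \<Longrightarrow> u' \<in> carrier U \<Longrightarrow> v \<in> carrier V \<Longrightarrow>
    pure K U V (u \<oplus>\<^bsub>U\<^esub> u') v = pure K U V u v \<oplus>\<^bsub>tensor K U V\<^esub> pure K U V u' v"
  "u \<in> carrier U \<Longrightarrow> v \<in> carrier V \<Longrightarrow> v' \<in> carrier V \<Longrightarrow>
    pure K U V u (v \<oplus>\<^bsub>V\<^esub> v') = pure K U V u v \<oplus>\<^bsub>tensor K U V\<^esub> pure K U V u v'"
  "c \<in> carrier K \<Longrightarrow> u \<in> carrier U \<Longrightarrow> v \<in> carrier V \<Longrightarrow>
    pure K U V (c \<odot>\<^bsub>U\<^esub> u) v = pure K U V u (c \<odot>\<^bsub>V\<^esub> v)"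
proof -
  interpret F: comm_group FF by (rule abelian_free_Abelian_group)
  have d: "a + b \<in> carrier FF" if "a \<in> carrier FF" "b \<in> carrier FF" for a b
    using F.m_closed[OF that] by simp
  have eqI: "coset x = coset y" if "x - y \<in> NN" "x \<in> carrier FF" "y \<in> carrier FF" for x y
  proof -
    have "x \<in> coset y" unfolding coset_def r_coset_def using that(1) by (auto intro!: bexI[of _ "x - y"])
    then show ?thesis using F.repr_independence[OF _ that(3) NN_subgroup] unfolding coset_def by blast
  qed
  have rel: "r \<in> NN" if "r \<in> tensor_relators K U V" for r
    using that unfolding tensor_null_def by (rule generate.incl)
  show "pure K U V (u \<oplus>\<^bsub>U\<^esub> u') v = pure K U V u v \<oplus>\<^bsub>tensor K U V\<^esub> pure K U V u' v"
    if "u \<in> carrier U" "u' \<in> carrier U" "v \<in> carrier V"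
  proof -
    have "frag_of (u \<oplus>\<^bsub>U\<^esub> u', v) - (frag_of (u, v) + frag_of (u', v)) \<in> NN"
      by (rule rel) (use that in \<open>auto simp: tensor_relators_def diff_diff_eq\<close>)
    moreover have "frag_of (u', v) \<in> carrier FF" "frag_of (u, v) \<in> carrier FF"
      "frag_of (u \<oplus>\<^bsub>U\<^esub> u', v) \<in> carrier FF" using that by auto
    ultimately show ?thesis unfolding pure_eq by (simp only: coset_add eqI d)
  qed
  show "pure K U V u (v \<oplus>\<^bsub>V\<^esub> v') = pure K U V u v \<oplus>\<^bsub>tensor K U V\<^esub> pure K U V u v'"
    if "u \<in> carrier U" "v \<in> carrier V" "v' \<in> carrier V"
  proof -
    have "frag_of (u, v \<oplus>\<^bsub>V\<^esub> v') - (frag_of (u, v) + frag_of (u, v')) \<in> NN"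
      by (rule rel) (use that in \<open>auto simp: tensor_relators_def diff_diff_eq\<close>)
    moreover have "frag_of (u, v') \<in> carrier FF" "frag_of (u, v) \<in> carrier FF"
      "frag_of (u, v \<oplus>\<^bsub>V\<^esub> v') \<in> carrier FF" using that by auto
    ultimately show ?thesis unfolding pure_eq by (simp only: coset_add eqI d)
  qed
  show "pure K U V (c \<odot>\<^bsub>U\<^esub> u) v = pure K U V u (c \<odot>\<^bsub>V\<^esub> v)"
    if "c \<in> carrier K" "u \<in> carrier U" "v \<in> carrier V"
  proof -
    have "frag_of (c \<odot>\<^bsub>U\<^esub> u, v) - frag_of (u, c \<odot>\<^bsub>V\<^esub> v) \<in> NN"
      by (rule rel) (use that in \<open>auto simp: tensor_relators_def\<close>)
    moreover have "frag_of (c \<odot>\<^bsub>U\<^esub> u, v) \<in> carrier FF" "frag_of (u, c \<odot>\<^bsub>V\<^esub> v) \<in> carrier FF"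
      using that by auto
    ultimately show ?thesis unfolding pure_eq by (simp only: eqI)
  qed
qed

text \<open>No closure of \<open>P\<close> under negation is asked for: the negative of a pure
  tensor is again pure, with the sign moved into the first factor. The induction over formal sums
  therefore carries \<open>P\<close> for \<open>x\<close> and for \<open>- x\<close>
  together.\<close>

lemma tensor_induct [consumes 1, case_names zero add pure]:
  assumes t: "t \<in> carrier (tensor K U V)"
    and "P \<zero>\<^bsub>tensor K U V\<^esub>"
    and add: "\<And>s t. s \<in> carrier (tensor K U V) \<Longrightarrow> t \<in> carrier (tensor K U V) \<Longrightarrow> P s \<Longrightarrow> P t \<Longrightarrow>
      P (s \<oplus>\<^bsub>tensor K U V\<^esub> t)"
    and pure: "\<And>u v. u \<in> carrier U \<Longrightarrow> v \<in> carrier V \<Longrightarrow> P (pure K U V u v)"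
  shows "P t"
proof -
  interpret T: abelian_group "tensor K U V" by (rule abelian_group_tensor)
  have "P (coset x) \<and> P (coset (-x))" if x: "Poly_Mapping.keys x \<subseteq> carrier U \<times> carrier V" for x
  proof (rule free_Abelian_group_induct[OF x], goal_cases)
    case 1 then show ?case using assms(2) by (simp add: zero_tensor)
  next
    case (2 x y)
    have c: "coset x \<in> carrier (tensor K U V)" "coset y \<in> carrier (tensor K U V)"
      "coset (-x) \<in> carrier (tensor K U V)" "coset (-y) \<in> carrier (tensor K U V)"
      using 2 by (auto simp: carrier_tensor)
    have "coset (x - y) = coset x \<oplus>\<^bsub>tensor K U V\<^esub> coset (-y)" "coset (-(x - y)) = coset (-x) \<oplus>\<^bsub>tensor K U V\<^esub> coset y"
      using 2 by (auto simp: coset_add)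
    then show ?case using 2 c by (auto intro!: add)
  next
    case (3 p)
    obtain u v where p: "p = (u, v)" "u \<in> carrier U" "v \<in> carrier V" using 3 by auto
    have "coset (- frag_of p) = pure K U V (\<ominus>\<^bsub>U\<^esub> u) v"
    proof -
      have "pure K U V (u \<oplus>\<^bsub>U\<^esub> \<ominus>\<^bsub>U\<^esub> u) v = pure K U V u v \<oplus>\<^bsub>tensor K U V\<^esub> pure K U V (\<ominus>\<^bsub>U\<^esub> u) v"
        by (rule pure_add) (use p in auto)
      moreover have "pure K U V \<zero>\<^bsub>U\<^esub> v = \<zero>\<^bsub>tensor K U V\<^esub>"
      proof -
        have "pure K U V (\<zero>\<^bsub>U\<^esub> \<oplus>\<^bsub>U\<^esub> \<zero>\<^bsub>U\<^esub>) v = pure K U V \<zero>\<^bsub>U\<^esub> v \<oplus>\<^bsub>tensor K U V\<^esub> pure K U V \<zero>\<^bsub>U\<^esub> v"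
          by (rule pure_add) (use p in auto)
        then show ?thesis using pure_in[of "\<zero>\<^bsub>U\<^esub>" v] p by simp
      qed
      moreover have "pure K U V u v \<oplus>\<^bsub>tensor K U V\<^esub> coset (- frag_of p) = \<zero>\<^bsub>tensor K U V\<^esub>"
        unfolding pure_eq zero_tensor using p by (subst coset_add) auto
      moreover have "coset (- frag_of p) \<in> carrier (tensor K U V)" using p by (auto simp: carrier_tensor)
      ultimately show ?thesis using p pure_in[of u v] pure_in[of "\<ominus>\<^bsub>U\<^esub> u" v] U.M.r_neg[of u]
          T.add.l_cancel[of "pure K U V u v" "coset (- frag_of p)" "pure K U V (\<ominus>\<^bsub>U\<^esub> u) v"] by simp
    qed
    then show ?case using pure[of "\<ominus>\<^bsub>U\<^esub> u" v] pure[of u v] p by (simp add: pure_eq)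
  qed
  then show ?thesis using t by (auto simp: carrier_tensor)
qed

lemma balanced_pure: 
  assumes "f \<in> module_hom K U U" 
  shows "balanced K U V (tensor K U V) (\<lambda>u. pure K U V (f u))"
proof -
  have f: "\<And>u. u \<in> carrier U \<Longrightarrow> f u \<in> carrier U" using assms by (simp add: module_homD)
  show ?thesis unfolding balanced_def using f by (simp add: pure_in pure_add module_homD[OF assms])
qed

text \<open>Multiplication and scalars of \<open>tensor\<close> are given by lifts into
  \<open>tensor_additive\<close>. Sums and integer multiples depend only on carrier, addition and
  zero, where the two records agree, so these lifts can be read as lifts into \<open>tensor\<close>
  itself.\<close>

lemma finsum_tensor_additive: "finsum (tensor_additive K U V) = finsum (tensor K U V)"
    "add_pow (tensor_additive K U V) (n::int) = add_pow (tensor K U V) n"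
proof -
  have c: "carrier (tensor_additive K U V) = carrier (tensor K U V)"
    "ring.add (tensor_additive K U V) = ring.add (tensor K U V)"
    "\<zero>\<^bsub>tensor_additive K U V\<^esub> = \<zero>\<^bsub>tensor K U V\<^esub>"
    by (simp_all add: tensor_def Let_def)
  show "finsum (tensor_additive K U V) = finsum (tensor K U V)"
    unfolding finsum_def by (rule ext)+ (simp add: finprod_def c)
  show "add_pow (tensor_additive K U V) (n::int) = add_pow (tensor K U V) n"
    unfolding add_pow_def by (rule ext) (simp add: int_pow_def2 nat_pow_def m_inv_def c)
qed

lemma tensor_lift_tensor_additive: "tensor_lift (tensor_additive K U V) f t = tensor_lift (tensor K U V) f t"
  by (simp add: tensor_lift_def finsum_tensor_additive)

end

section \<open>Linear maps out of a tensor product\<close>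

lemma module_hom_comp:
  assumes "f \<in> module_hom K V W" "g \<in> module_hom K Z V"
  shows "(\<lambda>x. f (g x)) \<in> module_hom K Z W"
  by (rule module_homI) (simp_all add: module_homD[OF assms(1)] module_homD[OF assms(2)])

lemma module_hom_id: "(\<lambda>x. x) \<in> module_hom K V V"
  by (auto simp: module_hom_def)

lemma bilin_comp:
  assumes "bilin K U V W f"
  shows "g \<in> module_hom K Z U \<Longrightarrow> v \<in> carrier V \<Longrightarrow> (\<lambda>x. f (g x) v) \<in> module_hom K Z W"
    and "u \<in> carrier U \<Longrightarrow> g' \<in> module_hom K Z V \<Longrightarrow> (\<lambda>x. f u (g' x)) \<in> module_hom K Z W"
proof -
  assume "g \<in> module_hom K Z U" "v \<in> carrier V"
  then show "(\<lambda>x. f (g x) v) \<in> module_hom K Z W"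
    using module_hom_comp[of "\<lambda>u. f u v" K U W g Z] assms by (simp add: bilin_def)
next
  assume "u \<in> carrier U" "g' \<in> module_hom K Z V"
  then show "(\<lambda>x. f u (g' x)) \<in> module_hom K Z W"
    using module_hom_comp[of "f u" K V W g' Z] assms by (simp add: bilin_def)
qed

lemma bilin_post:
  assumes "g \<in> module_hom K W Z" "bilin K U V W f"
  shows "bilin K U V Z (\<lambda>u v. g (f u v))"
  using assms(2) unfolding bilin_def by (auto intro: module_hom_comp[OF assms(1)])

lemma bilin_cong:
  assumes "bilin K U V W f" "module K U" "module K V"
    and "\<And>u v. u \<in> carrier U \<Longrightarrow> v \<in> carrier V \<Longrightarrow> f u v = g u v"
  shows "bilin K U V W g"
proof -
  interpret U: module K U by fact
  interpret V: module K V by fact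
  show ?thesis unfolding bilin_def using assms(1,4)
    by (auto intro!: module_homI simp: bilinD[OF assms(1)] simp flip: assms(4))
qed

context tensor_product begin

abbreviation "T \<equiv> tensor K U V"

lemma smult_tensor: "c \<odot>\<^bsub>T\<^esub> t = tensor_lift T (\<lambda>u. pure K U V (c \<odot>\<^bsub>U\<^esub> u)) t"
proof -
  have "c \<odot>\<^bsub>T\<^esub> t = tensor_lift (tensor_additive K U V) (\<lambda>u. pure K U V (c \<odot>\<^bsub>U\<^esub> u)) t"
    by (simp only: tensor_def Let_def module.simps)
  then show ?thesis by (simp only: tensor_lift_tensor_additive)
qed

lemma smult_hom: "c \<in> carrier K \<Longrightarrow> (\<lambda>u. c \<odot>\<^bsub>U\<^esub> u) \<in> module_hom K U U"
  by (auto intro!: module_homI simp: U.smult_r_distr U.smult_assoc1[symmetric] U.R.m_comm)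

lemma smult_pure:
  assumes "c \<in> carrier K" "u \<in> carrier U" "v \<in> carrier V"
  shows "c \<odot>\<^bsub>T\<^esub> pure K U V u v = pure K U V (c \<odot>\<^bsub>U\<^esub> u) v"
  unfolding smult_tensor
  using tensor_lift_pure[OF abelian_group_tensor balanced_pure[OF smult_hom]] assms by blast

lemma module_tensor: "module K T"
proof -
  interpret T: abelian_group T by (rule abelian_group_tensor)
  note cl = tensor_lift_closed_add(1)[OF abelian_group_tensor balanced_pure[OF smult_hom], folded smult_tensor]
  note ad = tensor_lift_closed_add(2)[OF abelian_group_tensor balanced_pure[OF smult_hom], folded smult_tensor]
  have z: "c \<odot>\<^bsub>T\<^esub> \<zero>\<^bsub>T\<^esub> = \<zero>\<^bsub>T\<^esub>" if "c \<in> carrier K" for c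
    using ad[OF that T.zero_closed T.zero_closed] cl[OF that T.zero_closed] by simp
  have ac: "(a \<oplus>\<^bsub>T\<^esub> b) \<oplus>\<^bsub>T\<^esub> (c \<oplus>\<^bsub>T\<^esub> d) = (a \<oplus>\<^bsub>T\<^esub> c) \<oplus>\<^bsub>T\<^esub> (b \<oplus>\<^bsub>T\<^esub> d)"
    if "a \<in> carrier T" "b \<in> carrier T" "c \<in> carrier T" "d \<in> carrier T" for a b c d
    using that by (simp add: T.a_ac)
  show ?thesis
  proof (rule moduleI)
    fix c d t assume c: "c \<in> carrier K" and d: "d \<in> carrier K" and t: "t \<in> carrier T"
    have cd: "c \<oplus>\<^bsub>K\<^esub> d \<in> carrier K" "c \<otimes>\<^bsub>K\<^esub> d \<in> carrier K" using c d by auto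
    show "(c \<oplus>\<^bsub>K\<^esub> d) \<odot>\<^bsub>T\<^esub> t = c \<odot>\<^bsub>T\<^esub> t \<oplus>\<^bsub>T\<^esub> d \<odot>\<^bsub>T\<^esub> t"
      using t by (induction t rule: tensor_induct)
        (use c d cd in \<open>simp_all add: z ad ac cl smult_pure pure_add U.smult_l_distr\<close>)
    show "(c \<otimes>\<^bsub>K\<^esub> d) \<odot>\<^bsub>T\<^esub> t = c \<odot>\<^bsub>T\<^esub> (d \<odot>\<^bsub>T\<^esub> t)"
      using t by (induction t rule: tensor_induct)
        (use c d cd in \<open>simp_all add: z ad cl smult_pure U.smult_assoc1\<close>)
  next
    fix t assume t: "t \<in> carrier T"
    then show "\<one>\<^bsub>K\<^esub> \<odot>\<^bsub>T\<^esub> t = t"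
      by (induction t rule: tensor_induct) (simp_all add: z ad smult_pure)
  qed (simp_all add: cl ad U.R.is_cring T.abelian_group_axioms)
qed

lemma bilin_pure: "bilin K U V T (pure K U V)"
  unfolding bilin_def by (auto intro!: module_homI simp: pure_in pure_add smult_pure)

lemma lift_hom:
  assumes "bilin K U V W f" "module K W"
  shows "tensor_lift W f \<in> module_hom K T W"
proof -
  interpret W: module K W by fact
  interpret T: module K T by (rule module_tensor)
  note b = W.abelian_group_axioms bilin_imp_balanced[OF assms(1)]
  note cl = tensor_lift_closed_add(1)[OF b] and ad = tensor_lift_closed_add(2)[OF b]
  have z: "tensor_lift W f \<zero>\<^bsub>T\<^esub> = \<zero>\<^bsub>W\<^esub>"
    using ad[OF T.zero_closed T.zero_closed] cl[OF T.zero_closed] by simp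
  have "tensor_lift W f (c \<odot>\<^bsub>T\<^esub> t) = c \<odot>\<^bsub>W\<^esub> tensor_lift W f t" if c: "c \<in> carrier K" and t: "t \<in> carrier T" for c t
    using t
  proof (induction t rule: tensor_induct)
    case (pure u v)
    then show ?case using c by (simp add: smult_pure tensor_lift_pure[OF b] bilinD[OF assms(1)])
  qed (use c in \<open>simp_all add: z ad cl T.smult_r_distr W.smult_r_distr\<close>)
  then show ?thesis using cl ad by (intro module_homI)
qed

lemma lift_pure:
  assumes "bilin K U V W f" "module K W" "u \<in> carrier U" "v \<in> carrier V"
  shows "tensor_lift W f (pure K U V u v) = f u v"
  using tensor_lift_pure[OF _ bilin_imp_balanced[OF assms(1)] assms(3,4)] module.axioms(2)[OF assms(2)] by blast

lemma hom_eqI: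
  assumes "f \<in> module_hom K T W" "g \<in> module_hom K T W" "module K W"
    and "\<And>u v. u \<in> carrier U \<Longrightarrow> v \<in> carrier V \<Longrightarrow> f (pure K U V u v) = g (pure K U V u v)"
    and "t \<in> carrier T"
  shows "f t = g t"
  using assms(5)
  by (induction t rule: tensor_induct)
     (simp_all add: module_hom_zero[OF _ module_tensor assms(3)] assms(1,2,4) module_homD[OF assms(1)] module_homD[OF assms(2)])

text \<open>A lift stands for a finite sum over the tensor \<open>t\<close>, and a linear map passes
  inside a sum. Applied with \<open>g\<close> the rest of an expression, this pulls a sum out of any
  slot.\<close>

lemma hom_lift:
  assumes g: "g \<in> module_hom K W Z" and f: "bilin K U V W f" and W: "module K W" and Z: "module K Z"
    and t: "t \<in> carrier T"
  shows "g (tensor_lift W f t) = tensor_lift Z (\<lambda>u v. g (f u v)) t"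
proof (rule hom_eqI[OF _ _ Z _ t])
  have gf: "bilin K U V Z (\<lambda>u v. g (f u v))"
    by (rule bilin_post[OF g f])
  show "tensor_lift Z (\<lambda>u v. g (f u v)) \<in> module_hom K T Z" by (rule lift_hom[OF gf Z])
  show "(\<lambda>a. g (tensor_lift W f a)) \<in> module_hom K T Z" by (rule module_hom_comp[OF g lift_hom[OF f W]])
  show "g (tensor_lift W f (pure K U V u v)) = tensor_lift Z (\<lambda>u v. g (f u v)) (pure K U V u v)"
    if "u \<in> carrier U" "v \<in> carrier V" for u v
    using that by (simp add: lift_pure[OF f W] lift_pure[OF gf Z])
qed

lemma lift_cong:
  assumes f: "bilin K U V W f" and W: "module K W"
    and e: "\<And>u v. u \<in> carrier U \<Longrightarrow> v \<in> carrier V \<Longrightarrow> f u v = g u v"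
    and t: "t \<in> carrier T"
  shows "tensor_lift W f t = tensor_lift W g t"
proof -
  have g: "bilin K U V W g" by (rule bilin_cong[OF f U.module_axioms V.module_axioms e])
  show ?thesis by (rule hom_eqI[OF lift_hom[OF f W] lift_hom[OF g W] W _ t]) (simp add: lift_pure f g W e)
qed

lemma lift_add:
  assumes f: "bilin K U V W f" and g: "bilin K U V W g" and W: "module K W" and t: "t \<in> carrier T"
  shows "tensor_lift W (\<lambda>u v. f u v \<oplus>\<^bsub>W\<^esub> g u v) t = tensor_lift W f t \<oplus>\<^bsub>W\<^esub> tensor_lift W g t"
proof -
  interpret W: module K W by fact
  interpret T: module K T by (rule module_tensor)
  have h: "bilin K U V W (\<lambda>u v. f u v \<oplus>\<^bsub>W\<^esub> g u v)"
    unfolding bilin_def by (auto intro!: module_homI simp: bilinD[OF f] bilinD[OF g] W.a_ac W.smult_r_distr)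
  show ?thesis
  proof (rule hom_eqI[OF lift_hom[OF h W] _ W _ t])
    show "(\<lambda>t. tensor_lift W f t \<oplus>\<^bsub>W\<^esub> tensor_lift W g t) \<in> module_hom K T W"
      by (rule module_homI) (simp_all add: module_homD[OF lift_hom[OF f W]] module_homD[OF lift_hom[OF g W]]
        W.a_ac W.smult_r_distr)
  qed (simp add: lift_pure f g h W)
qed

lemma lift_smult:
  assumes f: "bilin K U V W f" and W: "module K W" and t: "t \<in> carrier T" and c: "c \<in> carrier K"
  shows "tensor_lift W (\<lambda>u v. c \<odot>\<^bsub>W\<^esub> f u v) t = c \<odot>\<^bsub>W\<^esub> tensor_lift W f t"
proof -
  interpret W: module K W by fact
  have "(\<lambda>w. c \<odot>\<^bsub>W\<^esub> w) \<in> module_hom K W W"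
    using c by (auto intro!: module_homI simp: W.smult_r_distr W.smult_assoc1[symmetric] U.R.m_comm)
  from hom_lift[OF this f W W t] show ?thesis by simp
qed

text \<open>For lifts to be nested, the inner one must again be multilinear in the outer variables.
  Linearity in a parameter \<open>x\<close> holds because the lift is additive and homogeneous in
  the form itself, by \<open>lift_add\<close> and \<open>lift_smult\<close>.\<close>

lemma lift_param:
  assumes f1: "\<And>u v. u \<in> carrier U \<Longrightarrow> v \<in> carrier V \<Longrightarrow> (\<lambda>x. f x u v) \<in> module_hom K Z W"
    and f2: "\<And>x. x \<in> carrier Z \<Longrightarrow> bilin K U V W (f x)"
    and W: "module K W" and Z: "module K Z" and t: "t \<in> carrier T"
  shows "(\<lambda>x. tensor_lift W (f x) t) \<in> module_hom K Z W"
proof (rule module_homI)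
  interpret Z: module K Z by fact
  fix x y assume x: "x \<in> carrier Z" and y: "y \<in> carrier Z"
  show "tensor_lift W (f x) t \<in> carrier W" using module_homD(1)[OF lift_hom[OF f2[OF x] W] t] .
  have "tensor_lift W (f (x \<oplus>\<^bsub>Z\<^esub> y)) t = tensor_lift W (\<lambda>u v. f x u v \<oplus>\<^bsub>W\<^esub> f y u v) t"
    by (rule lift_cong[OF f2 W _ t]) (use x y in \<open>simp_all add: module_homD[OF f1]\<close>)
  also have "\<dots> = tensor_lift W (f x) t \<oplus>\<^bsub>W\<^esub> tensor_lift W (f y) t"
    by (rule lift_add[OF f2[OF x] f2[OF y] W t])
  finally show "tensor_lift W (f (x \<oplus>\<^bsub>Z\<^esub> y)) t = tensor_lift W (f x) t \<oplus>\<^bsub>W\<^esub> tensor_lift W (f y) t" .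
next
  interpret Z: module K Z by fact
  fix c x assume c: "c \<in> carrier K" and x: "x \<in> carrier Z"
  have "tensor_lift W (f (c \<odot>\<^bsub>Z\<^esub> x)) t = tensor_lift W (\<lambda>u v. c \<odot>\<^bsub>W\<^esub> f x u v) t"
    by (rule lift_cong[OF f2 W _ t]) (use x c in \<open>simp_all add: module_homD[OF f1]\<close>)
  also have "\<dots> = c \<odot>\<^bsub>W\<^esub> tensor_lift W (f x) t" by (rule lift_smult[OF f2[OF x] W t c])
  finally show "tensor_lift W (f (c \<odot>\<^bsub>Z\<^esub> x)) t = c \<odot>\<^bsub>W\<^esub> tensor_lift W (f x) t" .
qed

lemma lift_id:
  assumes "t \<in> carrier T"
  shows "tensor_lift T (pure K U V) t = t"
  by (rule hom_eqI[OF lift_hom[OF bilin_pure module_tensor] module_hom_id module_tensor _ assms])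
     (simp add: lift_pure[OF bilin_pure module_tensor])

end

text \<open>Interchange of two independent sums. With \<open>s\<close> fixed both sides are linear
  in \<open>t\<close>, so it suffices to compare them on pure tensors, where the lift over
  \<open>t\<close> is just a value of \<open>f\<close>.\<close>

lemma lift_swap:
  assumes UV: "tensor_product K U V" and XY: "tensor_product K Z Y"
    and W: "module K W" and s: "s \<in> carrier (tensor K U V)" and t: "t \<in> carrier (tensor K Z Y)"
    and f1: "\<And>u v. u \<in> carrier U \<Longrightarrow> v \<in> carrier V \<Longrightarrow> bilin K Z Y W (f u v)"
    and f2: "\<And>x y. x \<in> carrier Z \<Longrightarrow> y \<in> carrier Y \<Longrightarrow> bilin K U V W (\<lambda>u v. f u v x y)"
  shows "tensor_lift W (\<lambda>u v. tensor_lift W (f u v) t) s =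
         tensor_lift W (\<lambda>x y. tensor_lift W (\<lambda>u v. f u v x y) s) t"
proof -
  interpret A: tensor_product K U V by fact
  interpret B: tensor_product K Z Y by fact
  have mT: "module K (tensor K Z Y)" by (rule B.module_tensor)
  have bl: "bilin K U V W (\<lambda>u v. tensor_lift W (f u v) t)" if t: "t \<in> carrier (tensor K Z Y)" for t
    unfolding bilin_def
  proof (intro conjI ballI)
    fix u assume u: "u \<in> carrier U"
    show "(\<lambda>v. tensor_lift W (f u v) t) \<in> module_hom K V W"
      by (rule B.lift_param[OF _ f1[OF u] W A.V.module_axioms t]) (use u f2 in \<open>auto simp: bilin_def\<close>)
  next
    fix v assume v: "v \<in> carrier V"
    show "(\<lambda>u. tensor_lift W (f u v) t) \<in> module_hom K U W"
      by (rule B.lift_param[OF _ f1[OF _ v] W A.U.module_axioms t]) (use v f2 in \<open>auto simp: bilin_def\<close>)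
  qed
  have bl': "bilin K Z Y W (\<lambda>x y. tensor_lift W (\<lambda>u v. f u v x y) s)"
    unfolding bilin_def
  proof (intro conjI ballI)
    fix u assume u: "u \<in> carrier Z"
    show "(\<lambda>y. tensor_lift W (\<lambda>ua v. f ua v u y) s) \<in> module_hom K Y W"
      by (rule A.lift_param[OF _ f2[OF u] W B.V.module_axioms s]) (use u f1 in \<open>auto simp: bilin_def\<close>)
  next
    fix v assume v: "v \<in> carrier Y"
    show "(\<lambda>u. tensor_lift W (\<lambda>ua va. f ua va u v) s) \<in> module_hom K Z W"
      by (rule A.lift_param[OF _ f2[OF _ v] W B.U.module_axioms s]) (use v f1 in \<open>auto simp: bilin_def\<close>)
  qed
  show ?thesis
  proof (rule B.hom_eqI[OF _ _ W _ t])
    show "(\<lambda>t. tensor_lift W (\<lambda>u v. tensor_lift W (f u v) t) s) \<in> module_hom K (tensor K Z Y) W"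
    proof (rule A.lift_param[OF _ bl W mT s])
      show "(\<lambda>x. tensor_lift W (f u v) x) \<in> module_hom K (tensor K Z Y) W" if "u \<in> carrier U" "v \<in> carrier V" for u v
        using B.lift_hom[OF f1[OF that] W] by simp
    qed
    show "tensor_lift W (\<lambda>x y. tensor_lift W (\<lambda>u v. f u v x y) s) \<in> module_hom K (tensor K Z Y) W"
      by (rule B.lift_hom[OF bl' W])
    fix x y assume xy: "x \<in> carrier Z" "y \<in> carrier Y"
    have "tensor_lift W (\<lambda>u v. tensor_lift W (f u v) (pure K Z Y x y)) s = tensor_lift W (\<lambda>u v. f u v x y) s"
      by (rule A.lift_cong[OF bl W _ s]) (use xy in \<open>simp_all add: B.pure_in B.lift_pure f1 W\<close>)
    then show "tensor_lift W (\<lambda>u v. tensor_lift W (f u v) (pure K Z Y x y)) s =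
        tensor_lift W (\<lambda>x y. tensor_lift W (\<lambda>u v. f u v x y) s) (pure K Z Y x y)"
      using xy by (simp add: B.lift_pure[OF bl' W])
  qed
qed

section \<open>The algebra structure on a tensor product\<close>

lemma assoc_algebraD:
  assumes "assoc_algebra K A"
  shows "vectorspace K A" "ring A" "module K A" "field K"
  using assms by (auto simp: assoc_algebra_def vectorspace_def)

lemma mult_hom:
  assumes "assoc_algebra K A" "a \<in> carrier A"
  shows "f \<in> module_hom K Z A \<Longrightarrow> (\<lambda>x. f x \<otimes>\<^bsub>A\<^esub> a) \<in> module_hom K Z A"
    and "f \<in> module_hom K Z A \<Longrightarrow> (\<lambda>x. a \<otimes>\<^bsub>A\<^esub> f x) \<in> module_hom K Z A"
proof -
  interpret A: ring A using assoc_algebraD[OF assms(1)] by auto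
  show "f \<in> module_hom K Z A \<Longrightarrow> (\<lambda>x. f x \<otimes>\<^bsub>A\<^esub> a) \<in> module_hom K Z A"
    "f \<in> module_hom K Z A \<Longrightarrow> (\<lambda>x. a \<otimes>\<^bsub>A\<^esub> f x) \<in> module_hom K Z A"
    using assms by (auto intro!: module_homI simp: module_homD A.l_distr A.r_distr assoc_algebra_def)
qed

locale tensor_algebra =
  fixes K :: "('k, 'l) ring_scheme" and A :: "('k, 'a, 'm) module_scheme" and B :: "('k, 'b, 'n) module_scheme"
  assumes A: "assoc_algebra K A" and B: "assoc_algebra K B"
begin

sublocale tensor_product K A B
  using assoc_algebraD[OF A] assoc_algebraD[OF B] by (intro tensor_product.intro)

sublocale A: ring A using assoc_algebraD[OF A] by auto
sublocale B: ring B using assoc_algebraD[OF B] by auto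

lemma tensor_mult:
  "s \<otimes>\<^bsub>T\<^esub> t = tensor_lift T (\<lambda>a b. tensor_lift T (\<lambda>a' b'. pure K A B (a \<otimes>\<^bsub>A\<^esub> a') (b \<otimes>\<^bsub>B\<^esub> b')) t) s"
proof -
  have "s \<otimes>\<^bsub>T\<^esub> t = tensor_lift (tensor_additive K A B) (\<lambda>a b. tensor_lift (tensor_additive K A B)
     (\<lambda>a' b'. pure K A B (a \<otimes>\<^bsub>A\<^esub> a') (b \<otimes>\<^bsub>B\<^esub> b')) t) s"
    by (simp only: tensor_def Let_def partial_object.simps monoid.simps ring.simps)
  then show ?thesis by (simp only: tensor_lift_tensor_additive)
qed

lemma one_tensor: "\<one>\<^bsub>T\<^esub> = pure K A B \<one>\<^bsub>A\<^esub> \<one>\<^bsub>B\<^esub>"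
  by (simp add: tensor_def Let_def)

lemma b1: "a \<in> carrier A \<Longrightarrow> b \<in> carrier B \<Longrightarrow>
    bilin K A B T (\<lambda>a' b'. pure K A B (a \<otimes>\<^bsub>A\<^esub> a') (b \<otimes>\<^bsub>B\<^esub> b'))"
  unfolding bilin_def
  by (auto intro!: bilin_comp[OF bilin_pure] mult_hom A B module_hom_id)

lemma b2: "t \<in> carrier T \<Longrightarrow> bilin K A B T (\<lambda>a b. tensor_lift T (\<lambda>a' b'. pure K A B (a \<otimes>\<^bsub>A\<^esub> a') (b \<otimes>\<^bsub>B\<^esub> b')) t)"
  unfolding bilin_def
  by (auto intro!: lift_param bilin_comp[OF bilin_pure] mult_hom A B module_hom_id b1 module_tensor U.module_axioms V.module_axioms)

lemma mult_left_hom: "t \<in> carrier T \<Longrightarrow> (\<lambda>s. s \<otimes>\<^bsub>T\<^esub> t) \<in> module_hom K T T"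
  unfolding tensor_mult using lift_hom[OF b2 module_tensor] by simp

lemma mult_right_hom: "s \<in> carrier T \<Longrightarrow> (\<lambda>t. s \<otimes>\<^bsub>T\<^esub> t) \<in> module_hom K T T"
  unfolding tensor_mult
  by (rule lift_param[OF _ b2 module_tensor module_tensor]) (simp_all add: lift_hom[OF b1 module_tensor])

lemma mult_pure:
  assumes "a \<in> carrier A" "a' \<in> carrier A" "b \<in> carrier B" "b' \<in> carrier B"
  shows "pure K A B a b \<otimes>\<^bsub>T\<^esub> pure K A B a' b' = pure K A B (a \<otimes>\<^bsub>A\<^esub> a') (b \<otimes>\<^bsub>B\<^esub> b')"
  unfolding tensor_mult using assms
  by (simp add: lift_pure[OF b2 module_tensor] lift_pure[OF b1 module_tensor] pure_in)

lemma mult_closed: "s \<in> carrier T \<Longrightarrow> t \<in> carrier T \<Longrightarrow> s \<otimes>\<^bsub>T\<^esub> t \<in> carrier T"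
  using mult_left_hom by (rule module_homD)

text \<open>Three pure tensors associate because the factors do. Facts \<open>1\<close>,
  \<open>2\<close> and \<open>3\<close> then release the right, the middle and the left argument in
  turn, each time comparing two linear maps on pure tensors.\<close>

lemma assoc_algebra_tensor: "assoc_algebra K T"
proof -
  interpret T: module K T by (rule module_tensor)
  have fK: "field K" using assoc_algebraD[OF A] by auto
  note L = mult_left_hom and R = mult_right_hom and P = pure_in
  have 1: "(pure K A B a b \<otimes>\<^bsub>T\<^esub> pure K A B a' b') \<otimes>\<^bsub>T\<^esub> r = pure K A B a b \<otimes>\<^bsub>T\<^esub> (pure K A B a' b' \<otimes>\<^bsub>T\<^esub> r)"
    if ab: "a \<in> carrier A" "a' \<in> carrier A" "b \<in> carrier B" "b' \<in> carrier B" and r: "r \<in> carrier T" for a b a' b' r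
    by (rule hom_eqI[OF R module_hom_comp[OF R R] module_tensor _ r])
       (use ab in \<open>simp_all add: P mult_pure A.m_assoc B.m_assoc\<close>)
  have 2: "(pure K A B a b \<otimes>\<^bsub>T\<^esub> t) \<otimes>\<^bsub>T\<^esub> r = pure K A B a b \<otimes>\<^bsub>T\<^esub> (t \<otimes>\<^bsub>T\<^esub> r)"
    if ab: "a \<in> carrier A" "b \<in> carrier B" and r: "r \<in> carrier T" and t: "t \<in> carrier T" for a b t r
    by (rule hom_eqI[OF module_hom_comp[OF L R] module_hom_comp[OF R L] module_tensor _ t])
       (use ab r in \<open>simp_all add: P 1\<close>)
  have 3: "(s \<otimes>\<^bsub>T\<^esub> t) \<otimes>\<^bsub>T\<^esub> r = s \<otimes>\<^bsub>T\<^esub> (t \<otimes>\<^bsub>T\<^esub> r)"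
    if r: "r \<in> carrier T" and t: "t \<in> carrier T" and s: "s \<in> carrier T" for s t r
    by (rule hom_eqI[OF module_hom_comp[OF L L] L module_tensor _ s])
       (use t r in \<open>simp_all add: P 2 mult_closed\<close>)
  have one: "\<one>\<^bsub>T\<^esub> \<in> carrier T" by (simp add: one_tensor pure_in)
  have l1: "\<one>\<^bsub>T\<^esub> \<otimes>\<^bsub>T\<^esub> t = t" if "t \<in> carrier T" for t
    by (rule hom_eqI[OF R module_hom_id module_tensor _ that]) (simp_all add: one_tensor P mult_pure)
  have r1: "t \<otimes>\<^bsub>T\<^esub> \<one>\<^bsub>T\<^esub> = t" if "t \<in> carrier T" for t
    by (rule hom_eqI[OF L module_hom_id module_tensor _ that]) (simp_all add: one_tensor P mult_pure)
  have ring: "ring T"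
    by (rule ringI[OF T.abelian_group_axioms monoidI])
       (simp_all add: mult_closed one 3 l1 r1 module_homD[OF L] module_homD[OF R])
  show ?thesis unfolding assoc_algebra_def vectorspace_def
    using ring fK module_tensor by (simp add: module_homD[OF L] module_homD[OF R])
qed

text \<open>A form evaluated at a product of tensors becomes a double sum over the factors. Applied
  to equations between products in H \<otimes> H it gives their versions with a continuation, such
  as \<open>sw_mult\<close> and \<open>R_inverse\<close>.\<close>

lemma lift_mult:
  assumes F: "bilin K A B W F" and W: "module K W" and s: "s \<in> carrier T" and t: "t \<in> carrier T"
  shows "tensor_lift W F (s \<otimes>\<^bsub>T\<^esub> t) =
    tensor_lift W (\<lambda>a b. tensor_lift W (\<lambda>a' b'. F (a \<otimes>\<^bsub>A\<^esub> a') (b \<otimes>\<^bsub>B\<^esub> b')) t) s"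
proof -
  have "tensor_lift W F (s \<otimes>\<^bsub>T\<^esub> t) =
    tensor_lift W (\<lambda>a b. tensor_lift W F (tensor_lift T (\<lambda>a' b'. pure K A B (a \<otimes>\<^bsub>A\<^esub> a') (b \<otimes>\<^bsub>B\<^esub> b')) t)) s"
    unfolding tensor_mult by (rule hom_lift[OF lift_hom[OF F W] b2[OF t] module_tensor W s])
  also have "\<dots> = tensor_lift W (\<lambda>a b. tensor_lift W (\<lambda>a' b'. F (a \<otimes>\<^bsub>A\<^esub> a') (b \<otimes>\<^bsub>B\<^esub> b')) t) s"
  proof (rule lift_cong[OF _ W _ s])
    show "bilin K A B W (\<lambda>a b. tensor_lift W F (tensor_lift T (\<lambda>a' b'. pure K A B (a \<otimes>\<^bsub>A\<^esub> a') (b \<otimes>\<^bsub>B\<^esub> b')) t))"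
      by (rule bilin_post[OF lift_hom[OF F W] b2[OF t]])
    fix a b assume ab: "a \<in> carrier A" "b \<in> carrier B"
    have "tensor_lift W F (tensor_lift T (\<lambda>a' b'. pure K A B (a \<otimes>\<^bsub>A\<^esub> a') (b \<otimes>\<^bsub>B\<^esub> b')) t) =
      tensor_lift W (\<lambda>a' b'. tensor_lift W F (pure K A B (a \<otimes>\<^bsub>A\<^esub> a') (b \<otimes>\<^bsub>B\<^esub> b'))) t"
      by (rule hom_lift[OF lift_hom[OF F W] b1[OF ab] module_tensor W t])
    also have "\<dots> = tensor_lift W (\<lambda>a' b'. F (a \<otimes>\<^bsub>A\<^esub> a') (b \<otimes>\<^bsub>B\<^esub> b')) t"
    proof (rule lift_cong[OF _ W _ t])
      show "bilin K A B W (\<lambda>a' b'. tensor_lift W F (pure K A B (a \<otimes>\<^bsub>A\<^esub> a') (b \<otimes>\<^bsub>B\<^esub> b')))"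
        by (rule bilin_post[OF lift_hom[OF F W] b1[OF ab]])
    qed (use ab in \<open>simp add: lift_pure[OF F W]\<close>)
    finally show "tensor_lift W F (tensor_lift T (\<lambda>a' b'. pure K A B (a \<otimes>\<^bsub>A\<^esub> a') (b \<otimes>\<^bsub>B\<^esub> b')) t) =
      tensor_lift W (\<lambda>a' b'. F (a \<otimes>\<^bsub>A\<^esub> a') (b \<otimes>\<^bsub>B\<^esub> b')) t" .
  qed
  finally show ?thesis .
qed

end

lemma module_ground: "field K \<Longrightarrow> module K (ground_algebra K)"
proof -
  assume "field K"
  then interpret K: field K .
  show ?thesis
    by (rule moduleI[OF K.is_cring abelian_groupI])
       (auto simp: ground_algebra_def K.a_ac K.l_distr K.r_distr K.m_assoc intro!: bexI[of _ "\<ominus>\<^bsub>K\<^esub> _"] simp: K.l_neg)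
qed

lemma assoc_algebra_ground: "field K \<Longrightarrow> assoc_algebra K (ground_algebra K)"
proof -
  assume fK: "field K"
  then interpret K: field K .
  interpret M: module K "ground_algebra K" by (rule module_ground[OF fK])
  have "ring (ground_algebra K)"
    by (rule ringI[OF M.abelian_group_axioms monoidI])
       (auto simp: ground_algebra_def K.m_assoc K.l_distr K.r_distr)
  then show ?thesis unfolding assoc_algebra_def vectorspace_def using fK M.module_axioms
    by (auto simp: ground_algebra_def K.m_assoc K.m_lcomm)
qed

lemma finsum_ground: "finsum (ground_algebra K) = finsum K"
  unfolding finsum_def by (rule ext)+ (simp add: finprod_def ground_algebra_def)

text \<open>\<open>hat_dual\<close> sums in the field record \<open>K\<close>, whereas linear maps
  and lifts are treated here for module targets. \<open>K\<close> and
  \<open>ground_algebra K\<close> share carrier, addition and zero, so the lifts coincide.\<close>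

lemma tensor_lift_ground: "tensor_lift (ground_algebra K) = tensor_lift K"
proof -
  have "add_pow (ground_algebra K) (n::int) = add_pow K n" for n
    unfolding add_pow_def by (rule ext) (simp add: int_pow_def2 nat_pow_def m_inv_def ground_algebra_def)
  then show ?thesis by (simp add: tensor_lift_def fun_eq_iff Let_def finsum_ground)
qed

section \<open>Hopf algebras\<close>

definition trilin ::
  "('k, 'l) ring_scheme \<Rightarrow> ('k, 'a, 'm) module_scheme \<Rightarrow> ('k, 'b, 'n) module_scheme \<Rightarrow>
   ('k, 'c, 'o) module_scheme \<Rightarrow> ('k, 'd, 'p) module_scheme \<Rightarrow> ('a \<Rightarrow> 'b \<Rightarrow> 'c \<Rightarrow> 'd) \<Rightarrow> bool" where
  "trilin K U V Z W f \<longleftrightarrow>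
     (\<forall>u\<in>carrier U. bilin K V Z W (f u)) \<and>
     (\<forall>v\<in>carrier V. \<forall>z\<in>carrier Z. (\<lambda>u. f u v z) \<in> module_hom K U W)"

lemma trilin_comp:
  assumes "trilin K U V Z W f"
  shows "g \<in> module_hom K Y U \<Longrightarrow> v \<in> carrier V \<Longrightarrow> z \<in> carrier Z \<Longrightarrow> (\<lambda>x. f (g x) v z) \<in> module_hom K Y W"
    and "u \<in> carrier U \<Longrightarrow> g' \<in> module_hom K Y V \<Longrightarrow> z \<in> carrier Z \<Longrightarrow> (\<lambda>x. f u (g' x) z) \<in> module_hom K Y W"
    and "u \<in> carrier U \<Longrightarrow> v \<in> carrier V \<Longrightarrow> g'' \<in> module_hom K Y Z \<Longrightarrow> (\<lambda>x. f u v (g'' x)) \<in> module_hom K Y W"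
    and "u \<in> carrier U \<Longrightarrow> v \<in> carrier V \<Longrightarrow> z \<in> carrier Z \<Longrightarrow> f u v z \<in> carrier W"
proof -
  have 1: "\<And>u. u \<in> carrier U \<Longrightarrow> bilin K V Z W (f u)"
    and 2: "\<And>v z. v \<in> carrier V \<Longrightarrow> z \<in> carrier Z \<Longrightarrow> (\<lambda>u. f u v z) \<in> module_hom K U W"
    using assms by (simp_all add: trilin_def)
  show "g \<in> module_hom K Y U \<Longrightarrow> v \<in> carrier V \<Longrightarrow> z \<in> carrier Z \<Longrightarrow> (\<lambda>x. f (g x) v z) \<in> module_hom K Y W"
    using module_hom_comp[OF 2] .
  show "u \<in> carrier U \<Longrightarrow> g' \<in> module_hom K Y V \<Longrightarrow> z \<in> carrier Z \<Longrightarrow> (\<lambda>x. f u (g' x) z) \<in> module_hom K Y W"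
    using bilin_comp(1)[OF 1] .
  show "u \<in> carrier U \<Longrightarrow> v \<in> carrier V \<Longrightarrow> g'' \<in> module_hom K Y Z \<Longrightarrow> (\<lambda>x. f u v (g'' x)) \<in> module_hom K Y W"
    using bilin_comp(2)[OF 1] .
  show "u \<in> carrier U \<Longrightarrow> v \<in> carrier V \<Longrightarrow> z \<in> carrier Z \<Longrightarrow> f u v z \<in> carrier W"
    using bilinD(1)[OF 1] .
qed

locale tensor_triple =
  fixes K :: "('k, 'l) ring_scheme" and A :: "('k, 'a, 'm) module_scheme"
    and B :: "('k, 'b, 'n) module_scheme" and C :: "('k, 'c, 'o) module_scheme"
  assumes mA: "module K A" and mB: "module K B" and mC: "module K C"
begin

sublocale BC: tensor_product K B C using mB mC by (rule tensor_product.intro)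
sublocale ABC: tensor_product K A "tensor K B C" using mA BC.module_tensor by (rule tensor_product.intro)

definition lift3 :: "('k, 'd, 'p) module_scheme \<Rightarrow> ('a \<Rightarrow> 'b \<Rightarrow> 'c \<Rightarrow> 'd) \<Rightarrow> ('a, ('b, 'c) tensor) tensor \<Rightarrow> 'd" where
  "lift3 W F = tensor_lift W (\<lambda>a. tensor_lift W (F a))"

lemma bilin_lift3:
  assumes F: "trilin K A B C W F" and W: "module K W"
  shows "bilin K A (tensor K B C) W (\<lambda>a. tensor_lift W (F a))"
  unfolding bilin_def
proof (intro conjI ballI)
  fix a assume "a \<in> carrier A"
  then show "(\<lambda>u. tensor_lift W (F a) u) \<in> module_hom K (tensor K B C) W"
    using F BC.lift_hom[OF _ W] by (simp add: trilin_def)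
next
  fix u assume u: "u \<in> carrier (tensor K B C)"
  show "(\<lambda>a. tensor_lift W (F a) u) \<in> module_hom K A W"
    by (rule BC.lift_param[OF _ _ W mA u]) (use F in \<open>auto simp: trilin_def\<close>)
qed

lemma lift3_hom:
  assumes F: "trilin K A B C W F" and W: "module K W"
  shows "lift3 W F \<in> module_hom K (tensor3 K A B C) W"
  unfolding lift3_def by (rule ABC.lift_hom[OF bilin_lift3[OF F W] W])

lemma lift3_pure:
  assumes F: "trilin K A B C W F" and W: "module K W" and "a \<in> carrier A" "b \<in> carrier B" "c \<in> carrier C"
  shows "lift3 W F (pure3 K A B C a b c) = F a b c"
  unfolding lift3_def using assms
  by (simp add: ABC.lift_pure[OF bilin_lift3[OF F W] W] BC.pure_in BC.lift_pure trilin_def)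

lemma module_tensor3: "module K (tensor3 K A B C)"
  by (rule ABC.module_tensor)

lemma hom_eqI3:
  assumes f: "f \<in> module_hom K (tensor3 K A B C) W" and g: "g \<in> module_hom K (tensor3 K A B C) W" and W: "module K W"
    and e: "\<And>a b c. a \<in> carrier A \<Longrightarrow> b \<in> carrier B \<Longrightarrow> c \<in> carrier C \<Longrightarrow>
      f (pure3 K A B C a b c) = g (pure3 K A B C a b c)"
    and t: "t \<in> carrier (tensor3 K A B C)"
  shows "f t = g t"
proof (rule ABC.hom_eqI[OF f g W _ t])
  fix a u assume a: "a \<in> carrier A" and u: "u \<in> carrier (tensor K B C)"
  note p = bilin_comp(2)[OF ABC.bilin_pure a module_hom_id]
  show "f (pure K A (tensor K B C) a u) = g (pure K A (tensor K B C) a u)"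
    by (rule BC.hom_eqI[OF module_hom_comp[OF f p] module_hom_comp[OF g p] W _ u]) (rule e[OF a])
qed

end

locale hopf =
  fixes K :: "('k, 'l) ring_scheme" and H :: "('k, 'h, 'm) hopf_scheme" (structure)
  assumes hopf: "hopf_algebra K H"
begin

abbreviation "S \<equiv> antipode H"
abbreviation "\<epsilon> \<equiv> counit H"
abbreviation "\<Delta> \<equiv> comul H"
abbreviation "HH \<equiv> tensor K H H"

lemma algebra_H: "assoc_algebra K H"
  using hopf by (simp add: hopf_algebra_def)

lemma field_K: "field K" using assoc_algebraD[OF algebra_H] by simp
lemma module_H [simp]: "module K H" using assoc_algebraD[OF algebra_H] by simp
lemma module_K [simp]: "module K (ground_algebra K)" using module_ground[OF field_K] .

sublocale K: field K by (rule field_K)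
sublocale H: ring H using assoc_algebraD[OF algebra_H] by simp
sublocale mH: module K H by simp
sublocale HH: tensor_algebra K H H by (intro tensor_algebra.intro algebra_H)
sublocale H3: tensor_triple K H H H by (intro tensor_triple.intro) simp_all

lemma module_HH [simp]: "module K HH" by (rule HH.module_tensor)
lemma algebra_HH: "assoc_algebra K HH" by (rule HH.assoc_algebra_tensor)

lemma ground_simps [simp]: "carrier (ground_algebra K) = carrier K" "\<zero>\<^bsub>ground_algebra K\<^esub> = \<zero>\<^bsub>K\<^esub>"
  "\<one>\<^bsub>ground_algebra K\<^esub> = \<one>\<^bsub>K\<^esub>" "x \<otimes>\<^bsub>ground_algebra K\<^esub> y = x \<otimes>\<^bsub>K\<^esub> y"
  "x \<oplus>\<^bsub>ground_algebra K\<^esub> y = x \<oplus>\<^bsub>K\<^esub> y" "x \<odot>\<^bsub>ground_algebra K\<^esub> y = x \<otimes>\<^bsub>K\<^esub> y"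
  by (simp_all add: ground_algebra_def)

lemma comul_hom: "\<Delta> \<in> module_hom K H HH" "\<Delta> \<in> ring_hom H HH"
  using hopf by (auto simp: hopf_algebra_def algebra_hom_def)
lemma counit_hom: "\<epsilon> \<in> module_hom K H (ground_algebra K)" "\<epsilon> \<in> ring_hom H (ground_algebra K)"
  using hopf by (auto simp: hopf_algebra_def algebra_hom_def)
lemma antipode_hom: "S \<in> module_hom K H H"
  using hopf by (auto simp: hopf_algebra_def)

lemma comul_closed [simp]: "h \<in> carrier H \<Longrightarrow> \<Delta> h \<in> carrier HH" using module_homD(1)[OF comul_hom(1)] .
lemma counit_closed [simp]: "h \<in> carrier H \<Longrightarrow> \<epsilon> h \<in> carrier K" using module_homD(1)[OF counit_hom(1)] by simp
lemma antipode_closed [simp]: "h \<in> carrier H \<Longrightarrow> S h \<in> carrier H" using module_homD(1)[OF antipode_hom(1)] .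

lemma counit_mult [simp]: "x \<in> carrier H \<Longrightarrow> y \<in> carrier H \<Longrightarrow> \<epsilon> (x \<otimes> y) = \<epsilon> x \<otimes>\<^bsub>K\<^esub> \<epsilon> y"
  using ring_hom_mult[OF counit_hom(2)] by simp
lemma counit_one [simp]: "\<epsilon> \<one> = \<one>\<^bsub>K\<^esub>"
  using ring_hom_one[OF counit_hom(2)] by simp

text \<open>Every lift carries a multilinearity side condition; with the rules below the simplifier discharges it.\<close>

declare module_hom_id [simp]

lemma bilin_iff [simp]:
  "bilin K U V W f \<longleftrightarrow> (\<forall>u\<in>carrier U. (\<lambda>v. f u v) \<in> module_hom K V W) \<and> (\<forall>v\<in>carrier V. (\<lambda>u. f u v) \<in> module_hom K U W)"
  by (simp add: bilin_def)

lemma lin_mult [simp]: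
  "a \<in> carrier H \<Longrightarrow> f \<in> module_hom K Y H \<Longrightarrow> (\<lambda>x. f x \<otimes> a) \<in> module_hom K Y H"
  "a \<in> carrier H \<Longrightarrow> f \<in> module_hom K Y H \<Longrightarrow> (\<lambda>x. a \<otimes> f x) \<in> module_hom K Y H"
  using mult_hom[OF algebra_H] by auto

lemma lin_antipode [simp]: "f \<in> module_hom K Y H \<Longrightarrow> (\<lambda>x. S (f x)) \<in> module_hom K Y H"
  by (rule module_hom_comp[OF antipode_hom])

lemma lin_counit [simp]: "f \<in> module_hom K Y H \<Longrightarrow> (\<lambda>x. \<epsilon> (f x)) \<in> module_hom K Y (ground_algebra K)"
  by (rule module_hom_comp[OF counit_hom(1)])

lemma lin_comul [simp]: "f \<in> module_hom K Y H \<Longrightarrow> (\<lambda>x. \<Delta> (f x)) \<in> module_hom K Y HH"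
  by (rule module_hom_comp[OF comul_hom(1)])

lemma lin_smult1 [simp]:
  assumes f: "f \<in> module_hom K Y (ground_algebra K)" and "module K W" and w: "w \<in> carrier W"
  shows "(\<lambda>x. f x \<odot>\<^bsub>W\<^esub> w) \<in> module_hom K Y W"
proof -
  interpret W: module K W by fact
  have "(\<lambda>c. c \<odot>\<^bsub>W\<^esub> w) \<in> module_hom K (ground_algebra K) W"
    using w by (intro module_homI) (simp_all add: W.smult_l_distr W.smult_assoc1)
  from module_hom_comp[OF this f] show ?thesis .
qed

lemma lin_smult2 [simp]:
  assumes c: "c \<in> carrier K" and f: "f \<in> module_hom K Y W" and "module K W"
  shows "(\<lambda>x. c \<odot>\<^bsub>W\<^esub> f x) \<in> module_hom K Y W"
proof -
  interpret W: module K W by fact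
  have "(\<lambda>w. c \<odot>\<^bsub>W\<^esub> w) \<in> module_hom K W W"
    using c by (intro module_homI) (simp_all add: W.smult_r_distr W.smult_assoc1[symmetric] K.m_comm)
  from module_hom_comp[OF this f] show ?thesis .
qed

lemma lin_pure [simp]:
  "module K U \<Longrightarrow> module K V \<Longrightarrow> v \<in> carrier V \<Longrightarrow> f \<in> module_hom K Y U \<Longrightarrow>
    (\<lambda>x. pure K U V (f x) v) \<in> module_hom K Y (tensor K U V)"
  "module K U \<Longrightarrow> module K V \<Longrightarrow> u \<in> carrier U \<Longrightarrow> g \<in> module_hom K Y V \<Longrightarrow>
    (\<lambda>x. pure K U V u (g x)) \<in> module_hom K Y (tensor K U V)"
  by (rule bilin_comp[OF tensor_product.bilin_pure[OF tensor_product.intro]]; assumption)+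

lemma pure_closed [simp]:
  "module K U \<Longrightarrow> module K V \<Longrightarrow> u \<in> carrier U \<Longrightarrow> v \<in> carrier V \<Longrightarrow> pure K U V u v \<in> carrier (tensor K U V)"
  by (rule tensor_product.pure_in[OF tensor_product.intro])

lemma module_tensor [simp]: "module K U \<Longrightarrow> module K V \<Longrightarrow> module K (tensor K U V)"
  by (rule tensor_product.module_tensor[OF tensor_product.intro])

lemma smult_closed [simp]: "module K W \<Longrightarrow> c \<in> carrier K \<Longrightarrow> w \<in> carrier W \<Longrightarrow> c \<odot>\<^bsub>W\<^esub> w \<in> carrier W"
  by (rule module.smult_closed)

section \<open>Sweedler sums: the coalgebra axioms with a continuation\<close>

abbreviation sw where "sw W h F \<equiv> tensor_lift W F (\<Delta> h)"

lemma sw_closed [simp]: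
  "module K W \<Longrightarrow> bilin K H H W F \<Longrightarrow> h \<in> carrier H \<Longrightarrow> sw W h F \<in> carrier W"
  by (rule module_homD(1)[OF HH.lift_hom comul_closed])

lemma lin_sw1 [simp]:
  assumes "module K W" "module K Y" "h \<in> carrier H"
    "\<forall>x\<in>carrier Y. bilin K H H W (F x)" "\<forall>u\<in>carrier H. \<forall>v\<in>carrier H. (\<lambda>x. F x u v) \<in> module_hom K Y W"
  shows "(\<lambda>x. sw W h (F x)) \<in> module_hom K Y W"
  by (rule HH.lift_param) (use assms in auto)

lemma lin_sw2 [simp]:
  assumes "module K W" "bilin K H H W F" "g \<in> module_hom K Y H"
  shows "(\<lambda>x. sw W (g x) F) \<in> module_hom K Y W"
  by (rule module_hom_comp[OF HH.lift_hom[OF assms(2,1)] lin_comul[OF assms(3)]])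

lemma sw_cong:
  "module K W \<Longrightarrow> h \<in> carrier H \<Longrightarrow> bilin K H H W F \<Longrightarrow>
   (\<And>a b. a \<in> carrier H \<Longrightarrow> b \<in> carrier H \<Longrightarrow> F a b = G a b) \<Longrightarrow> sw W h F = sw W h G"
  by (rule HH.lift_cong) auto

lemma hom_sw:
  "g \<in> module_hom K W Z \<Longrightarrow> module K W \<Longrightarrow> module K Z \<Longrightarrow> h \<in> carrier H \<Longrightarrow> bilin K H H W F \<Longrightarrow>
   g (sw W h F) = sw Z h (\<lambda>a b. g (F a b))"
  by (rule HH.hom_lift) auto

lemma smult_hom:
  "g \<in> module_hom K V W \<Longrightarrow> c \<in> carrier K \<Longrightarrow> x \<in> carrier V \<Longrightarrow> g (c \<odot>\<^bsub>V\<^esub> x) = c \<odot>\<^bsub>W\<^esub> g x"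
  by (rule module_homD(3))

text \<open>Both sides are \<open>lift3 W F\<close> applied to the two sides of the coassociativity
  axiom in H \<otimes> (H \<otimes> H). With an arbitrary trilinear \<open>F\<close> the axiom
  becomes a rewriting rule that can be used under other sums.\<close>

lemma coassoc:
  assumes W: "module K W" and F: "trilin K H H H W F" and h: "h \<in> carrier H"
  shows "sw W h (\<lambda>a b. sw W a (\<lambda>a1 a2. F a1 a2 b)) = sw W h (\<lambda>a b. sw W b (\<lambda>b1 b2. F a b1 b2))"
proof -
  note [simp] = W h trilin_comp[OF F] H3.module_tensor3
  have T [simp]: "module K (tensor K H (tensor K H H))" by simp
  note L = H3.lift3_hom[OF F W]
  have "comul_left K H H (\<Delta> h) = tensor_map K H (tensor K H H) id \<Delta> (\<Delta> h)"
    using hopf h unfolding hopf_algebra_def by blast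
  then have "H3.lift3 W F (comul_left K H H (\<Delta> h)) = H3.lift3 W F (tensor_map K H (tensor K H H) id \<Delta> (\<Delta> h))" by simp
  moreover have "H3.lift3 W F (comul_left K H H (\<Delta> h)) = sw W h (\<lambda>a b. sw W a (\<lambda>a1 a2. F a1 a2 b))"
  proof -
    have "H3.lift3 W F (comul_left K H H (\<Delta> h)) = sw W h (\<lambda>a b. H3.lift3 W F (sw H3.ABC.T a (\<lambda>a1 a2. pure3 K H H H a1 a2 b)))"
      unfolding comul_left_def by (rule hom_sw[OF L]) simp_all
    also have "\<dots> = sw W h (\<lambda>a b. sw W a (\<lambda>a1 a2. H3.lift3 W F (pure3 K H H H a1 a2 b)))"
      by (rule sw_cong, simp_all add: module_hom_comp[OF L]) (rule hom_sw[OF L], simp_all)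
    also have "\<dots> = sw W h (\<lambda>a b. sw W a (\<lambda>a1 a2. F a1 a2 b))"
      by (rule sw_cong, simp_all add: module_hom_comp[OF L]) (rule sw_cong, simp_all add: module_hom_comp[OF L] H3.lift3_pure[OF F W])
    finally show ?thesis .
  qed
  moreover have "H3.lift3 W F (tensor_map K H (tensor K H H) id \<Delta> (\<Delta> h)) = sw W h (\<lambda>a b. sw W b (\<lambda>b1 b2. F a b1 b2))"
  proof -
    have "H3.lift3 W F (tensor_map K H (tensor K H H) id \<Delta> (\<Delta> h)) = sw W h (\<lambda>a b. H3.lift3 W F (pure K H HH a (\<Delta> b)))"
      unfolding tensor_map_def id_def by (rule hom_sw[OF L]) simp_all
    also have "\<dots> = sw W h (\<lambda>a b. sw W b (\<lambda>b1 b2. F a b1 b2))"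
      unfolding H3.lift3_def
      by (rule sw_cong, simp_all add: module_hom_comp[OF L[unfolded H3.lift3_def]]) 
        (simp add: H3.ABC.lift_pure[OF H3.bilin_lift3[OF F W] W])
    finally show ?thesis .
  qed
  ultimately show ?thesis by simp
qed

lemma sw_swap:
  assumes "module K W" "h \<in> carrier H" "k \<in> carrier H"
    "\<And>u v. u \<in> carrier H \<Longrightarrow> v \<in> carrier H \<Longrightarrow> bilin K H H W (F u v)"
    "\<And>x y. x \<in> carrier H \<Longrightarrow> y \<in> carrier H \<Longrightarrow> bilin K H H W (\<lambda>u v. F u v x y)"
  shows "sw W h (\<lambda>a b. sw W k (F a b)) = sw W k (\<lambda>c d. sw W h (\<lambda>a b. F a b c d))"
  by (rule lift_swap[OF HH.tensor_product_axioms HH.tensor_product_axioms assms(1)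
        comul_closed[OF assms(2)] comul_closed[OF assms(3)] assms(4,5)])

text \<open>Here and in the next three lemmas the linear map \<open>g\<close> is the context in
  which the axiom is used. It passes through the sum by \<open>hom_sw\<close>; with \<open>g\<close>
  the identity of H one has the axiom itself.\<close>

lemma sw_counit_left:
  assumes g: "g \<in> module_hom K H W" and W: "module K W" and h: "h \<in> carrier H"
  shows "sw W h (\<lambda>a b. \<epsilon> a \<odot>\<^bsub>W\<^esub> g b) = g h"
proof -
  have "g (sw H h (\<lambda>a b. \<epsilon> a \<odot>\<^bsub>H\<^esub> b)) = sw W h (\<lambda>a b. g (\<epsilon> a \<odot>\<^bsub>H\<^esub> b))"
    by (rule hom_sw[OF g]) (simp_all add: W h)
  also have "\<dots> = sw W h (\<lambda>a b. \<epsilon> a \<odot>\<^bsub>W\<^esub> g b)"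
    by (rule sw_cong) (simp_all add: W h module_hom_comp[OF g] smult_hom[OF g])
  finally show ?thesis using hopf h unfolding hopf_algebra_def by simp
qed

lemma sw_counit_right:
  assumes g: "g \<in> module_hom K H W" and W: "module K W" and h: "h \<in> carrier H"
  shows "sw W h (\<lambda>a b. \<epsilon> b \<odot>\<^bsub>W\<^esub> g a) = g h"
proof -
  have "g (sw H h (\<lambda>a b. \<epsilon> b \<odot>\<^bsub>H\<^esub> a)) = sw W h (\<lambda>a b. g (\<epsilon> b \<odot>\<^bsub>H\<^esub> a))"
    by (rule hom_sw[OF g]) (simp_all add: W h)
  also have "\<dots> = sw W h (\<lambda>a b. \<epsilon> b \<odot>\<^bsub>W\<^esub> g a)"
    by (rule sw_cong) (simp_all add: W h module_hom_comp[OF g] smult_hom[OF g])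
  finally show ?thesis using hopf h unfolding hopf_algebra_def by simp
qed

lemma sw_antipode_left:
  assumes g: "g \<in> module_hom K H W" and W: "module K W" and h: "h \<in> carrier H"
  shows "sw W h (\<lambda>a b. g (S a \<otimes> b)) = \<epsilon> h \<odot>\<^bsub>W\<^esub> g \<one>"
proof -
  have "g (sw H h (\<lambda>a b. S a \<otimes> b)) = sw W h (\<lambda>a b. g (S a \<otimes> b))"
    by (rule hom_sw[OF g]) (simp_all add: W h)
  moreover have "sw H h (\<lambda>a b. S a \<otimes> b) = \<epsilon> h \<odot>\<^bsub>H\<^esub> \<one>"
    using hopf h unfolding hopf_algebra_def by simp
  ultimately show ?thesis using smult_hom[OF g, of "\<epsilon> h" \<one>] h by simp
qed

lemma sw_antipode_right:
  assumes g: "g \<in> module_hom K H W" and W: "module K W" and h: "h \<in> carrier H"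
  shows "sw W h (\<lambda>a b. g (a \<otimes> S b)) = \<epsilon> h \<odot>\<^bsub>W\<^esub> g \<one>"
proof -
  have "g (sw H h (\<lambda>a b. a \<otimes> S b)) = sw W h (\<lambda>a b. g (a \<otimes> S b))"
    by (rule hom_sw[OF g]) (simp_all add: W h)
  moreover have "sw H h (\<lambda>a b. a \<otimes> S b) = \<epsilon> h \<odot>\<^bsub>H\<^esub> \<one>"
    using hopf h unfolding hopf_algebra_def by simp
  ultimately show ?thesis using smult_hom[OF g, of "\<epsilon> h" \<one>] h by simp
qed

lemma sw_mult:
  assumes F: "bilin K H H W F" and W: "module K W" and x: "x \<in> carrier H" and y: "y \<in> carrier H"
  shows "sw W (x \<otimes> y) F = sw W x (\<lambda>a b. sw W y (\<lambda>a' b'. F (a \<otimes> a') (b \<otimes> b')))"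
  using HH.lift_mult[OF F W comul_closed[OF x] comul_closed[OF y]] ring_hom_mult[OF comul_hom(2) x y] by simp

lemma sw_one:
  assumes F: "bilin K H H W F" and W: "module K W"
  shows "sw W \<one> F = F \<one> \<one>"
  using HH.lift_pure[OF F W H.one_closed H.one_closed] ring_hom_one[OF comul_hom(2)]
  by (simp add: HH.one_tensor)

lemma sw_pure: "h \<in> carrier H \<Longrightarrow> sw HH h (pure K H H) = \<Delta> h"
  by (rule HH.lift_id) simp

text \<open>In the convolution algebra Hom(H, A), whose unit is h \<mapsto> \<epsilon>(h) 1, a left
  inverse \<open>f\<close> and a right inverse \<open>k\<close> of \<open>g\<close> agree: f = f *
  (g * k) = (f * g) * k = k.\<close>

lemma convolution_inverse_unique:
  assumes A: "assoc_algebra K A"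
    and f: "f \<in> module_hom K H A" and g: "g \<in> module_hom K H A" and k: "k \<in> module_hom K H A"
    and fg: "\<And>h. h \<in> carrier H \<Longrightarrow> sw A h (\<lambda>a b. f a \<otimes>\<^bsub>A\<^esub> g b) = \<epsilon> h \<odot>\<^bsub>A\<^esub> \<one>\<^bsub>A\<^esub>"
    and gk: "\<And>h. h \<in> carrier H \<Longrightarrow> sw A h (\<lambda>a b. g a \<otimes>\<^bsub>A\<^esub> k b) = \<epsilon> h \<odot>\<^bsub>A\<^esub> \<one>\<^bsub>A\<^esub>"
    and h: "h \<in> carrier H"
  shows "f h = k h"
proof -
  interpret A: ring A using assoc_algebraD[OF A] by simp
  have [simp]: "module K A" using assoc_algebraD[OF A] by simp
  have sm: "(c \<odot>\<^bsub>A\<^esub> x) \<otimes>\<^bsub>A\<^esub> y = c \<odot>\<^bsub>A\<^esub> (x \<otimes>\<^bsub>A\<^esub> y)" "x \<otimes>\<^bsub>A\<^esub> (c \<odot>\<^bsub>A\<^esub> y) = c \<odot>\<^bsub>A\<^esub> (x \<otimes>\<^bsub>A\<^esub> y)"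
    if "c \<in> carrier K" "x \<in> carrier A" "y \<in> carrier A" for c x y
    using A that by (auto simp: assoc_algebra_def)
  note [simp] = mult_hom[OF A] module_homD(1)[OF f] module_homD(1)[OF g] module_homD(1)[OF k]
    f g k module_hom_comp[OF f] module_hom_comp[OF g] module_hom_comp[OF k] h
  have "f h = sw A h (\<lambda>a b. \<epsilon> b \<odot>\<^bsub>A\<^esub> f a)"
    by (rule sw_counit_right[symmetric]) simp_all
  also have "\<dots> = sw A h (\<lambda>a b. f a \<otimes>\<^bsub>A\<^esub> sw A b (\<lambda>b1 b2. g b1 \<otimes>\<^bsub>A\<^esub> k b2))"
    by (rule sw_cong) (simp_all add: gk sm)
  also have "\<dots> = sw A h (\<lambda>a b. sw A b (\<lambda>b1 b2. f a \<otimes>\<^bsub>A\<^esub> (g b1 \<otimes>\<^bsub>A\<^esub> k b2)))"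
    by (rule sw_cong, simp, simp, simp, rule hom_sw) simp_all
  also have "\<dots> = sw A h (\<lambda>a b. sw A a (\<lambda>a1 a2. f a1 \<otimes>\<^bsub>A\<^esub> (g a2 \<otimes>\<^bsub>A\<^esub> k b)))"
    by (rule coassoc[symmetric]) (simp_all add: trilin_def)
  also have "\<dots> = sw A h (\<lambda>a b. sw A a (\<lambda>a1 a2. (f a1 \<otimes>\<^bsub>A\<^esub> g a2) \<otimes>\<^bsub>A\<^esub> k b))"
    by (rule sw_cong, simp, simp, simp, rule sw_cong) (simp_all add: A.m_assoc)
  also have "\<dots> = sw A h (\<lambda>a b. sw A a (\<lambda>a1 a2. f a1 \<otimes>\<^bsub>A\<^esub> g a2) \<otimes>\<^bsub>A\<^esub> k b)"
    by (rule sw_cong, simp, simp, simp, rule hom_sw[symmetric]) simp_all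
  also have "\<dots> = sw A h (\<lambda>a b. \<epsilon> a \<odot>\<^bsub>A\<^esub> k b)"
    by (rule sw_cong) (simp_all add: fg sm)
  also have "\<dots> = k h"
    by (rule sw_counit_left) simp_all
  finally show ?thesis .
qed

section \<open>The antipode reverses products and coproducts\<close>

lemma antipode_one [simp]: "S \<one> = \<one>"
  using sw_antipode_left[of "\<lambda>x. x" H \<one>] sw_one[of H "\<lambda>a b. S a \<otimes> b"] mH.smult_one[of \<one>] by simp

lemma antipode_mult:
  assumes x: "x \<in> carrier H" and y: "y \<in> carrier H"
  shows "S (x \<otimes> y) = S y \<otimes> S x"
proof -
  note [simp] = x y
  \<comment> \<open>In Sweedler notation \<open>G a b c\<close> is S(a y1) b y2 S(y3) S(c).
    \<open>G1\<close> cancels y2 against S(y3); \<open>G2\<close>, with the first two arguments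
    running over the coproduct of \<open>u\<close>, cancels S(u1 y1) against u2 y2 instead.
    Coassociativity in \<open>x\<close> links the two evaluations. This unrolls the convolution
    argument for the coalgebra H \<otimes> H.\<close>
  define G where "G a b c = sw H y (\<lambda>p q. sw H p (\<lambda>p1 p2. S (a \<otimes> p1) \<otimes> (b \<otimes> p2) \<otimes> (S q \<otimes> S c)))" for a b c
  have G1: "G a b c = S (a \<otimes> y) \<otimes> (b \<otimes> S c)"
    if [simp]: "a \<in> carrier H" "b \<in> carrier H" "c \<in> carrier H" for a b c
  proof -
    have "G a b c = sw H y (\<lambda>p q. sw H q (\<lambda>q1 q2. S (a \<otimes> p) \<otimes> (b \<otimes> q1) \<otimes> (S q2 \<otimes> S c)))"
      unfolding G_def by (rule coassoc) (simp_all add: trilin_def)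
    also have "\<dots> = sw H y (\<lambda>p q. sw H q (\<lambda>q1 q2. S (a \<otimes> p) \<otimes> b \<otimes> (q1 \<otimes> S q2) \<otimes> S c))"
      by (rule sw_cong, simp, simp, simp, rule sw_cong) (simp_all add: H.m_assoc)
    also have "\<dots> = sw H y (\<lambda>p q. \<epsilon> q \<odot>\<^bsub>H\<^esub> (S (a \<otimes> p) \<otimes> b \<otimes> \<one> \<otimes> S c))"
      by (rule sw_cong, simp, simp, simp, rule sw_antipode_right) simp_all
    also have "\<dots> = S (a \<otimes> y) \<otimes> b \<otimes> \<one> \<otimes> S c"
      by (rule sw_counit_right) simp_all
    finally show ?thesis by (simp add: H.m_assoc)
  qed
  have G2: "sw H u (\<lambda>u1 u2. G u1 u2 v) = \<epsilon> u \<odot>\<^bsub>H\<^esub> (S y \<otimes> S v)"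
    if [simp]: "u \<in> carrier H" "v \<in> carrier H" for u v
  proof -
    have "sw H u (\<lambda>u1 u2. G u1 u2 v)
      = sw H y (\<lambda>p q. sw H u (\<lambda>u1 u2. sw H p (\<lambda>p1 p2. S (u1 \<otimes> p1) \<otimes> (u2 \<otimes> p2) \<otimes> (S q \<otimes> S v))))"
      unfolding G_def by (rule sw_swap) simp_all
    also have "\<dots> = sw H y (\<lambda>p q. sw H (u \<otimes> p) (\<lambda>a b. S a \<otimes> b \<otimes> (S q \<otimes> S v)))"
      by (rule sw_cong, simp, simp, simp, rule sw_mult[symmetric]) simp_all
    also have "\<dots> = sw H y (\<lambda>p q. \<epsilon> (u \<otimes> p) \<odot>\<^bsub>H\<^esub> (\<one> \<otimes> (S q \<otimes> S v)))"
      by (rule sw_cong, simp, simp, simp, rule sw_antipode_left) simp_all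
    also have "\<dots> = sw H y (\<lambda>p q. \<epsilon> p \<odot>\<^bsub>H\<^esub> (\<epsilon> u \<odot>\<^bsub>H\<^esub> (S q \<otimes> S v)))"
      by (rule sw_cong) (simp_all add: mH.smult_assoc1[symmetric] K.m_comm)
    also have "\<dots> = \<epsilon> u \<odot>\<^bsub>H\<^esub> (S y \<otimes> S v)"
      by (rule sw_counit_left) simp_all
    finally show ?thesis .
  qed
  have "S (x \<otimes> y) = sw H x (\<lambda>u v. \<epsilon> v \<odot>\<^bsub>H\<^esub> S (u \<otimes> y))"
    by (rule sw_counit_right[symmetric]) simp_all
  also have "\<dots> = sw H x (\<lambda>u v. sw H v (\<lambda>v1 v2. S (u \<otimes> y) \<otimes> (v1 \<otimes> S v2)))"
  proof (rule sw_cong, simp, simp, simp)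
    fix u v assume [simp]: "u \<in> carrier H" "v \<in> carrier H"
    show "\<epsilon> v \<odot>\<^bsub>H\<^esub> S (u \<otimes> y) = sw H v (\<lambda>v1 v2. S (u \<otimes> y) \<otimes> (v1 \<otimes> S v2))"
      using sw_antipode_right[of "\<lambda>z. S (u \<otimes> y) \<otimes> z" H v] by simp
  qed
  also have "\<dots> = sw H x (\<lambda>u v. sw H v (\<lambda>v1 v2. G u v1 v2))"
    by (rule sw_cong, simp, simp, simp, rule sw_cong) (simp_all add: G1)
  also have "\<dots> = sw H x (\<lambda>u v. sw H u (\<lambda>u1 u2. G u1 u2 v))"
    unfolding G_def by (rule coassoc[symmetric]) (simp_all add: trilin_def)
  also have "\<dots> = sw H x (\<lambda>u v. \<epsilon> u \<odot>\<^bsub>H\<^esub> (S y \<otimes> S v))"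
    unfolding G_def by (rule sw_cong, simp, simp, simp, rule G2[unfolded G_def]) simp_all
  also have "\<dots> = S y \<otimes> S x"
    by (rule sw_counit_left) simp_all
  finally show ?thesis .
qed

lemma lin_mult_K [simp]:
  assumes "c \<in> carrier K" "f \<in> module_hom K Y (ground_algebra K)"
  shows "(\<lambda>x. c \<otimes>\<^bsub>K\<^esub> f x) \<in> module_hom K Y (ground_algebra K)"
    and "(\<lambda>x. f x \<otimes>\<^bsub>K\<^esub> c) \<in> module_hom K Y (ground_algebra K)"
  using mult_hom[OF assoc_algebra_ground[OF field_K], of c] assms by simp_all

lemma counit_antipode [simp]:
  assumes [simp]: "x \<in> carrier H" shows "\<epsilon> (S x) = \<epsilon> x"
proof -
  let ?k = "ground_algebra K"
  have "\<epsilon> (S x) = sw ?k x (\<lambda>a b. \<epsilon> b \<odot>\<^bsub>?k\<^esub> \<epsilon> (S a))"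
    by (rule sw_counit_right[symmetric]) simp_all
  also have "\<dots> = sw ?k x (\<lambda>a b. \<epsilon> (S a \<otimes> b))"
    by (rule sw_cong) (simp_all add: K.m_comm)
  also have "\<dots> = \<epsilon> x \<odot>\<^bsub>?k\<^esub> \<epsilon> \<one>" by (rule sw_antipode_left) simp_all
  finally show ?thesis by simp
qed

lemma lin_mult_HH [simp]:
  "a \<in> carrier HH \<Longrightarrow> f \<in> module_hom K Y HH \<Longrightarrow> (\<lambda>x. f x \<otimes>\<^bsub>HH\<^esub> a) \<in> module_hom K Y HH"
  "a \<in> carrier HH \<Longrightarrow> f \<in> module_hom K Y HH \<Longrightarrow> (\<lambda>x. a \<otimes>\<^bsub>HH\<^esub> f x) \<in> module_hom K Y HH"
  using mult_hom[OF algebra_HH] by auto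

text \<open>Both sides invert \<Delta> under convolution in Hom(H, H \<otimes> H), one from the left
  and one from the right. For \<Delta> composed with S this is multiplicativity of \<Delta>; for the
  flipped form, h1 S(h4) \<otimes> h2 S(h3) collapses from the inside out.\<close>

lemma comul_antipode:
  assumes h: "h \<in> carrier H"
  shows "\<Delta> (S h) = sw HH h (\<lambda>a b. pure K H H (S b) (S a))"
proof (rule convolution_inverse_unique[OF algebra_HH _ comul_hom(1) _ _ _ h])
  show "(\<lambda>h. \<Delta> (S h)) \<in> module_hom K H HH" "(\<lambda>h. sw HH h (\<lambda>a b. pure K H H (S b) (S a))) \<in> module_hom K H HH"
    by simp_all
  fix h assume [simp]: "h \<in> carrier H"
  have "sw HH h (\<lambda>a b. \<Delta> (S a) \<otimes>\<^bsub>HH\<^esub> \<Delta> b) = sw HH h (\<lambda>a b. \<Delta> (S a \<otimes> b))"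
    by (rule sw_cong) (simp_all add: ring_hom_mult[OF comul_hom(2)])
  also have "\<dots> = \<epsilon> h \<odot>\<^bsub>HH\<^esub> \<Delta> \<one>" by (rule sw_antipode_left) simp_all
  finally show "sw HH h (\<lambda>a b. \<Delta> (S a) \<otimes>\<^bsub>HH\<^esub> \<Delta> b) = \<epsilon> h \<odot>\<^bsub>HH\<^esub> \<one>\<^bsub>HH\<^esub>"
    by (simp add: ring_hom_one[OF comul_hom(2)])
  have e: "\<Delta> a \<otimes>\<^bsub>HH\<^esub> pure K H H p q = sw HH a (\<lambda>a1 a2. pure K H H (a1 \<otimes> p) (a2 \<otimes> q))"
    if [simp]: "a \<in> carrier H" "p \<in> carrier H" "q \<in> carrier H" for a p q
  proof -
    have "\<Delta> a \<otimes>\<^bsub>HH\<^esub> pure K H H p q = sw HH a (pure K H H) \<otimes>\<^bsub>HH\<^esub> pure K H H p q"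
      by (simp add: sw_pure)
    also have "\<dots> = sw HH a (\<lambda>a1 a2. pure K H H a1 a2 \<otimes>\<^bsub>HH\<^esub> pure K H H p q)"
      by (rule hom_sw) simp_all
    also have "\<dots> = sw HH a (\<lambda>a1 a2. pure K H H (a1 \<otimes> p) (a2 \<otimes> q))"
      by (rule sw_cong) (simp_all add: HH.mult_pure)
    finally show ?thesis .
  qed
  have "sw HH h (\<lambda>a b. \<Delta> a \<otimes>\<^bsub>HH\<^esub> sw HH b (\<lambda>b1 b2. pure K H H (S b2) (S b1)))
     = sw HH h (\<lambda>a b. sw HH b (\<lambda>b1 b2. \<Delta> a \<otimes>\<^bsub>HH\<^esub> pure K H H (S b2) (S b1)))"
    by (rule sw_cong, simp, simp, simp, rule hom_sw) simp_all
  also have "\<dots> = sw HH h (\<lambda>a b. sw HH b (\<lambda>b1 b2. sw HH a (\<lambda>a1 a2. pure K H H (a1 \<otimes> S b2) (a2 \<otimes> S b1))))"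
    by (rule sw_cong, simp, simp, simp, rule sw_cong) (simp_all add: e)
  also have "\<dots> = sw HH h (\<lambda>a b. sw HH a (\<lambda>c d. sw HH c (\<lambda>a1 a2. pure K H H (a1 \<otimes> S b) (a2 \<otimes> S d))))"
    by (rule coassoc[symmetric]) (simp_all add: trilin_def)
  also have "\<dots> = sw HH h (\<lambda>a b. sw HH a (\<lambda>c d. sw HH d (\<lambda>d1 d2. pure K H H (c \<otimes> S b) (d1 \<otimes> S d2))))"
    by (rule sw_cong, simp, simp, simp, rule coassoc) (simp_all add: trilin_def)
  also have "\<dots> = sw HH h (\<lambda>a b. sw HH a (\<lambda>c d. \<epsilon> d \<odot>\<^bsub>HH\<^esub> pure K H H (c \<otimes> S b) \<one>))"
    by (rule sw_cong, simp, simp, simp, rule sw_cong, simp, simp, simp, rule sw_antipode_right) simp_all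
  also have "\<dots> = sw HH h (\<lambda>a b. pure K H H (a \<otimes> S b) \<one>)"
    by (rule sw_cong, simp, simp, simp, rule sw_counit_right) simp_all
  also have "\<dots> = \<epsilon> h \<odot>\<^bsub>HH\<^esub> pure K H H \<one> \<one>"
    by (rule sw_antipode_right) simp_all
  finally show "sw HH h (\<lambda>a b. \<Delta> a \<otimes>\<^bsub>HH\<^esub> sw HH b (\<lambda>b1 b2. pure K H H (S b2) (S b1))) = \<epsilon> h \<odot>\<^bsub>HH\<^esub> \<one>\<^bsub>HH\<^esub>"
    by (simp add: HH.one_tensor)
qed

lemma sw_antipode:
  assumes F: "bilin K H H W F" and W: "module K W" and h: "h \<in> carrier H"
  shows "sw W (S h) F = sw W h (\<lambda>a b. F (S b) (S a))"
proof -
  note [simp] = W h bilin_comp[OF F]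
  have "sw W (S h) F = sw W h (\<lambda>a b. tensor_lift W F (pure K H H (S b) (S a)))"
    unfolding comul_antipode[OF h] by (rule hom_sw[OF HH.lift_hom[OF F W]]) simp_all
  also have "\<dots> = sw W h (\<lambda>a b. F (S b) (S a))"
    by (rule sw_cong) (simp_all add: HH.lift_pure[OF F W] module_hom_comp[OF HH.lift_hom[OF F W]])
  finally show ?thesis .
qed

end

text \<open>An injective endomorphism carries a basis to linearly independent vectors of the same
  number. By dimension these form a basis again, so the image is everything. It will be applied to
  the antipode.\<close>

lemma (in vectorspace) inj_endomorphism_surj:
  assumes T: "T \<in> module_hom K V V" and inj: "inj_on T (carrier V)" and fd: fin_dim
  shows "T ` carrier V = carrier V"
proof -
  interpret T: linear_map K V V T
    using T by (intro linear_map.intro mod_hom.intro mod_hom_axioms.intro vectorspace_axioms module_axioms)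
  obtain B where B: "finite B" "basis B" using finite_basis_exists[OF fd] by blast
  then have BV: "B \<subseteq> carrier V" and li: "lin_indpt B" unfolding basis_def by auto
  have inj_B: "inj_on T B" using inj BV inj_on_subset by blast
  have img: "lincomb a (T ` B) = T (lincomb (a \<circ> T) B)" if "a \<in> T ` B \<rightarrow> carrier K" for a
    using T.lincomb_linear_image[OF inj BV that B(1)] .
  have TBV: "T ` B \<subseteq> carrier V" using BV module_homD(1)[OF T] by auto
  have "lin_indpt (T ` B)"
  proof (rule finite_lin_indpt2)
    fix a assume a: "a \<in> T ` B \<rightarrow> carrier K" and z: "lincomb a (T ` B) = \<zero>\<^bsub>V\<^esub>"
    have aT: "a \<circ> T \<in> B \<rightarrow> carrier K" using a by auto
    have "T (lincomb (a \<circ> T) B) = T \<zero>\<^bsub>V\<^esub>" using z img[OF a] module_hom_zero[OF T module_axioms module_axioms] by simp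
    then have "lincomb (a \<circ> T) B = \<zero>\<^bsub>V\<^esub>"
      using inj_onD[OF inj] lincomb_closed[OF BV aT] by simp
    then have "a \<circ> T \<in> B \<rightarrow> {\<zero>\<^bsub>K\<^esub>}" by (rule not_lindepD[OF li B(1) subset_refl aT])
    then show "\<forall>v\<in>T ` B. a v = \<zero>\<^bsub>K\<^esub>" by auto
  qed (use B TBV in auto)
  moreover have "dim \<le> card (T ` B)" using dim_basis[OF B] card_image[OF inj_B] by simp
  ultimately have "basis (T ` B)" using dim_li_is_basis[OF fd _ TBV] B(1) by simp
  then have sp: "span (T ` B) = carrier V" unfolding basis_def by simp
  show ?thesis
  proof
    show "T ` carrier V \<subseteq> carrier V" using module_homD(1)[OF T] by auto
    show "carrier V \<subseteq> T ` carrier V"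
    proof
      fix y assume "y \<in> carrier V"
      then have "y \<in> span (T ` B)" using sp by simp
      then obtain a where "a \<in> T ` B \<rightarrow> carrier K" "y = lincomb a (T ` B)"
        using finite_span[OF finite_imageI[OF B(1)] TBV] by auto
      moreover from this have "a \<circ> T \<in> B \<rightarrow> carrier K" by auto
      ultimately show "y \<in> T ` carrier V" using img lincomb_closed[OF BV, of "a \<circ> T"] by simp
    qed
  qed
qed

text \<open>Products of legs such as R13 R23 are products of two lifts. A linear map
  \<open>L\<close> applied to such a product becomes a double sum, one sum for each factor, in the
  order of multiplication.\<close>

lemma lift_lift_mult:
  assumes s: "tensor_product K U V" "s \<in> carrier (tensor K U V)" "bilin K U V A f"
    and t: "tensor_product K U' V'" "t \<in> carrier (tensor K U' V')" "bilin K U' V' A g"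
    and A: "assoc_algebra K A" and L: "L \<in> module_hom K A W" and W: "module K W"
  shows "L (tensor_lift A f s \<otimes>\<^bsub>A\<^esub> tensor_lift A g t)
    = tensor_lift W (\<lambda>a b. tensor_lift W (\<lambda>c d. L (f a b \<otimes>\<^bsub>A\<^esub> g c d)) t) s"
proof -
  interpret s: tensor_product K U V by fact
  interpret t: tensor_product K U' V' by fact
  have mA: "module K A" using assoc_algebraD[OF A] by simp
  have gt: "tensor_lift A g t \<in> carrier A" by (rule module_homD(1)[OF t.lift_hom[OF t(3) mA] t(2)])
  have 1: "(\<lambda>x. L (x \<otimes>\<^bsub>A\<^esub> tensor_lift A g t)) \<in> module_hom K A W"
    by (rule module_hom_comp[OF L mult_hom(1)[OF A gt module_hom_id]])
  have "L (tensor_lift A f s \<otimes>\<^bsub>A\<^esub> tensor_lift A g t) = tensor_lift W (\<lambda>a b. L (f a b \<otimes>\<^bsub>A\<^esub> tensor_lift A g t)) s"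
    by (rule s.hom_lift[OF 1 s(3) mA W s(2)])
  also have "\<dots> = tensor_lift W (\<lambda>a b. tensor_lift W (\<lambda>c d. L (f a b \<otimes>\<^bsub>A\<^esub> g c d)) t) s"
  proof (rule s.lift_cong[OF bilin_post[OF 1 s(3)] W _ s(2)])
    fix u v assume "u \<in> carrier U" "v \<in> carrier V"
    then have "f u v \<in> carrier A" by (rule bilinD(1)[OF s(3)])
    from module_hom_comp[OF L mult_hom(2)[OF A this module_hom_id]]
    show "L (f u v \<otimes>\<^bsub>A\<^esub> tensor_lift A g t) = tensor_lift W (\<lambda>c d. L (f u v \<otimes>\<^bsub>A\<^esub> g c d)) t"
      by (rule t.hom_lift[OF _ t(3) mA W t(2)])
  qed
  finally show ?thesis .
qed

locale tensor_triple_algebra =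
  fixes K :: "('k, 'l) ring_scheme" and A :: "('k, 'a, 'm) module_scheme"
    and B :: "('k, 'b, 'n) module_scheme" and C :: "('k, 'c, 'o) module_scheme"
  assumes A: "assoc_algebra K A" and B: "assoc_algebra K B" and C: "assoc_algebra K C"
begin

sublocale tensor_triple K A B C
  by (intro tensor_triple.intro assoc_algebraD(3)[OF A] assoc_algebraD(3)[OF B] assoc_algebraD(3)[OF C])
sublocale aBC: tensor_algebra K B C using B C by (rule tensor_algebra.intro)
sublocale aABC: tensor_algebra K A "tensor K B C" using A aBC.assoc_algebra_tensor by (rule tensor_algebra.intro)

lemma algebra3: "assoc_algebra K (tensor3 K A B C)" by (rule aABC.assoc_algebra_tensor)

lemma mult_pure3:
  assumes "a \<in> carrier A" "a' \<in> carrier A" "b \<in> carrier B" "b' \<in> carrier B" "c \<in> carrier C" "c' \<in> carrier C"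
  shows "pure3 K A B C a b c \<otimes>\<^bsub>tensor3 K A B C\<^esub> pure3 K A B C a' b' c'
    = pure3 K A B C (a \<otimes>\<^bsub>A\<^esub> a') (b \<otimes>\<^bsub>B\<^esub> b') (c \<otimes>\<^bsub>C\<^esub> c')"
  using assms by (simp add: aABC.mult_pure aBC.mult_pure BC.pure_in)

lemma one3: "\<one>\<^bsub>tensor3 K A B C\<^esub> = pure3 K A B C \<one>\<^bsub>A\<^esub> \<one>\<^bsub>B\<^esub> \<one>\<^bsub>C\<^esub>"
  by (simp add: aABC.one_tensor aBC.one_tensor)

end

section \<open>Quasitriangular Hopf algebras\<close>

locale qt_hopf = hopf K H
  for K :: "('k, 'l) ring_scheme" and H :: "('k, 'h, 'm) hopf_scheme" (structure) +
  fixes R :: "('h, 'h) tensor"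
  assumes R: "R_matrix K H R"
begin

sublocale A3: tensor_triple_algebra K H H H by (intro tensor_triple_algebra.intro algebra_H)

lemma R_unit: "R \<in> Units HH" using R by (simp add: R_matrix_def)
lemma R_closed [simp]: "R \<in> carrier HH" using R_unit by (simp add: Units_def)

definition Ri where "Ri = inv\<^bsub>HH\<^esub> R"

lemma monoid_HH: "Group.monoid HH" using assoc_algebraD(2)[OF algebra_HH] by (rule ring.is_monoid)

lemma Ri_closed [simp]: "Ri \<in> carrier HH" unfolding Ri_def by (rule monoid.Units_inv_closed[OF monoid_HH R_unit])
lemma R_Ri: "R \<otimes>\<^bsub>HH\<^esub> Ri = \<one>\<^bsub>HH\<^esub>" "Ri \<otimes>\<^bsub>HH\<^esub> R = \<one>\<^bsub>HH\<^esub>"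
  unfolding Ri_def by (rule monoid.Units_r_inv[OF monoid_HH R_unit] monoid.Units_l_inv[OF monoid_HH R_unit])+

abbreviation rr where "rr W F \<equiv> tensor_lift W F R"
abbreviation ri where "ri W F \<equiv> tensor_lift W F Ri"

lemma rr_closed [simp]:
  "module K W \<Longrightarrow> bilin K H H W F \<Longrightarrow> rr W F \<in> carrier W"
  "module K W \<Longrightarrow> bilin K H H W F \<Longrightarrow> ri W F \<in> carrier W"
  by (rule module_homD(1)[OF HH.lift_hom R_closed] module_homD(1)[OF HH.lift_hom Ri_closed]; assumption)+

lemma lin_rr [simp]:
  assumes "module K W" "module K Y"
    "\<forall>x\<in>carrier Y. bilin K H H W (F x)" "\<forall>u\<in>carrier H. \<forall>v\<in>carrier H. (\<lambda>x. F x u v) \<in> module_hom K Y W"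
  shows "(\<lambda>x. rr W (F x)) \<in> module_hom K Y W" "(\<lambda>x. ri W (F x)) \<in> module_hom K Y W"
  by (rule HH.lift_param; use assms in simp)+

lemma rr_cong:
  "module K W \<Longrightarrow> bilin K H H W F \<Longrightarrow>
   (\<And>a b. a \<in> carrier H \<Longrightarrow> b \<in> carrier H \<Longrightarrow> F a b = G a b) \<Longrightarrow> rr W F = rr W G"
  "module K W \<Longrightarrow> bilin K H H W F \<Longrightarrow>
   (\<And>a b. a \<in> carrier H \<Longrightarrow> b \<in> carrier H \<Longrightarrow> F a b = G a b) \<Longrightarrow> ri W F = ri W G"
  by (rule HH.lift_cong; simp)+

lemma hom_rr:
  "g \<in> module_hom K W Z \<Longrightarrow> module K W \<Longrightarrow> module K Z \<Longrightarrow> bilin K H H W F \<Longrightarrow>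
   g (rr W F) = rr Z (\<lambda>a b. g (F a b))"
  "g \<in> module_hom K W Z \<Longrightarrow> module K W \<Longrightarrow> module K Z \<Longrightarrow> bilin K H H W F \<Longrightarrow>
   g (ri W F) = ri Z (\<lambda>a b. g (F a b))"
  by (rule HH.hom_lift; simp)+

lemma tt_swap:
  assumes "module K W" "s \<in> carrier HH" "t \<in> carrier HH"
    "\<And>u v. u \<in> carrier H \<Longrightarrow> v \<in> carrier H \<Longrightarrow> bilin K H H W (F u v)"
    "\<And>x y. x \<in> carrier H \<Longrightarrow> y \<in> carrier H \<Longrightarrow> bilin K H H W (\<lambda>u v. F u v x y)"
  shows "tensor_lift W (\<lambda>a b. tensor_lift W (F a b) t) s = tensor_lift W (\<lambda>c d. tensor_lift W (\<lambda>a b. F a b c d) s) t"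
  by (rule lift_swap[OF HH.tensor_product_axioms HH.tensor_product_axioms assms])

lemma R_inverse:
  assumes F: "bilin K H H W F" and W: "module K W"
  shows "rr W (\<lambda>s t. ri W (\<lambda>s' t'. F (s \<otimes> s') (t \<otimes> t'))) = F \<one> \<one>"
    and "ri W (\<lambda>s t. rr W (\<lambda>s' t'. F (s \<otimes> s') (t \<otimes> t'))) = F \<one> \<one>"
  using HH.lift_mult[OF F W R_closed Ri_closed] HH.lift_mult[OF F W Ri_closed R_closed]
    HH.lift_pure[OF F W H.one_closed H.one_closed] by (simp_all only: R_Ri HH.one_tensor)

text \<open>The pair \<open>s\<close>, \<open>t\<close> belongs to R13 and the pair
  \<open>s'\<close>, \<open>t'\<close> to R23. They meet only in the third leg, where the order of
  the product R13 R23 gives \<open>t \<otimes> t'\<close>.\<close>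

lemma R_comul_left:
  assumes W: "module K W" and F: "trilin K H H H W F"
  shows "rr W (\<lambda>s t. sw W s (\<lambda>s1 s2. F s1 s2 t)) = rr W (\<lambda>s t. rr W (\<lambda>s' t'. F s s' (t \<otimes> t')))"
proof -
  let ?T = "tensor3 K H H H"
  note L = H3.lift3_hom[OF F W]
  note [simp] = W trilin_comp[OF F] module_hom_comp[OF L] H3.lift3_pure[OF F W]
  have "comul_left K H H R = leg13 K H H R \<otimes>\<^bsub>?T\<^esub> leg23 K H H R" using R unfolding R_matrix_def by blast
  then have "H3.lift3 W F (comul_left K H H R) = H3.lift3 W F (leg13 K H H R \<otimes>\<^bsub>?T\<^esub> leg23 K H H R)" by simp
  moreover have "H3.lift3 W F (comul_left K H H R) = rr W (\<lambda>s t. sw W s (\<lambda>s1 s2. F s1 s2 t))"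
  proof -
    have "H3.lift3 W F (comul_left K H H R) = rr W (\<lambda>a b. H3.lift3 W F (sw ?T a (\<lambda>a1 a2. pure3 K H H H a1 a2 b)))"
      unfolding comul_left_def by (rule hom_rr[OF L]) simp_all
    also have "\<dots> = rr W (\<lambda>a b. sw W a (\<lambda>a1 a2. H3.lift3 W F (pure3 K H H H a1 a2 b)))"
      by (rule rr_cong, simp, simp, rule hom_sw[OF L]) simp_all
    also have "\<dots> = rr W (\<lambda>a b. sw W a (\<lambda>a1 a2. F a1 a2 b))"
      by (rule rr_cong, simp, simp, rule sw_cong) simp_all
    finally show ?thesis .
  qed
  moreover have "H3.lift3 W F (leg13 K H H R \<otimes>\<^bsub>?T\<^esub> leg23 K H H R) = rr W (\<lambda>s t. rr W (\<lambda>s' t'. F s s' (t \<otimes> t')))"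
  proof -
    have "H3.lift3 W F (leg13 K H H R \<otimes>\<^bsub>?T\<^esub> leg23 K H H R)
      = rr W (\<lambda>s t. rr W (\<lambda>s' t'. H3.lift3 W F (pure3 K H H H s \<one> t \<otimes>\<^bsub>?T\<^esub> pure3 K H H H \<one> s' t')))"
      unfolding leg13_def leg23_def
      by (rule lift_lift_mult[OF HH.tensor_product_axioms _ _ HH.tensor_product_axioms _ _ A3.algebra3 L W]) simp_all
    also have "\<dots> = rr W (\<lambda>s t. rr W (\<lambda>s' t'. F s s' (t \<otimes> t')))"
      by (rule rr_cong, simp, simp add: mult_hom[OF A3.algebra3], rule rr_cong, simp_all add: mult_hom[OF A3.algebra3] A3.mult_pure3)
    finally show ?thesis .
  qed
  ultimately show ?thesis by simp
qed

text \<open>In R13 R12 the two copies meet in the first leg, giving \<open>s \<otimes> s'\<close>.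
  The factor \<open>t\<close> of R13 lands in the third slot, so the inner \<open>t'\<close>
  precedes it in the list of arguments.\<close>

lemma R_comul_right:
  assumes W: "module K W" and F: "trilin K H H H W F"
  shows "rr W (\<lambda>s t. sw W t (\<lambda>t1 t2. F s t1 t2)) = rr W (\<lambda>s t. rr W (\<lambda>s' t'. F (s \<otimes> s') t' t))"
proof -
  let ?T = "tensor3 K H H H"
  note L = H3.lift3_hom[OF F W]
  note [simp] = W trilin_comp[OF F] module_hom_comp[OF L] H3.lift3_pure[OF F W]
  have "tensor_map K H (tensor K H H) id (comul H) R = leg13 K H H R \<otimes>\<^bsub>?T\<^esub> leg12 K H H R" using R unfolding R_matrix_def by blast
  then have "H3.lift3 W F (tensor_map K H (tensor K H H) id (comul H) R) = H3.lift3 W F (leg13 K H H R \<otimes>\<^bsub>?T\<^esub> leg12 K H H R)" by simp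
  moreover have "H3.lift3 W F (tensor_map K H (tensor K H H) id (comul H) R) = rr W (\<lambda>s t. sw W t (\<lambda>t1 t2. F s t1 t2))"
  proof -
    have "H3.lift3 W F (tensor_map K H (tensor K H H) id (comul H) R) = rr W (\<lambda>a b. H3.lift3 W F (pure K H HH a (\<Delta> b)))"
      unfolding tensor_map_def id_def by (rule hom_rr[OF L]) simp_all
    also have "\<dots> = rr W (\<lambda>a b. sw W b (\<lambda>b1 b2. F a b1 b2))"
      by (rule rr_cong, simp, simp) (simp add: H3.lift3_def H3.ABC.lift_pure[OF H3.bilin_lift3[OF F W] W])
    finally show ?thesis .
  qed
  moreover have "H3.lift3 W F (leg13 K H H R \<otimes>\<^bsub>?T\<^esub> leg12 K H H R) = rr W (\<lambda>s t. rr W (\<lambda>s' t'. F (s \<otimes> s') t' t))"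
  proof -
    have "H3.lift3 W F (leg13 K H H R \<otimes>\<^bsub>?T\<^esub> leg12 K H H R)
      = rr W (\<lambda>s t. rr W (\<lambda>s' t'. H3.lift3 W F (pure3 K H H H s \<one> t \<otimes>\<^bsub>?T\<^esub> pure3 K H H H s' t' \<one>)))"
      unfolding leg13_def leg12_def
      by (rule lift_lift_mult[OF HH.tensor_product_axioms _ _ HH.tensor_product_axioms _ _ A3.algebra3 L W]) simp_all
    also have "\<dots> = rr W (\<lambda>s t. rr W (\<lambda>s' t'. F (s \<otimes> s') t' t))"
      by (rule rr_cong, simp, simp add: mult_hom[OF A3.algebra3], rule rr_cong, simp_all add: mult_hom[OF A3.algebra3] A3.mult_pure3)
    finally show ?thesis .
  qed
  ultimately show ?thesis by simp
qed

lemma R_comul_op: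
  assumes W: "module K W" and F: "bilin K H H W F" and [simp]: "h \<in> carrier H"
  shows "rr W (\<lambda>s t. sw W h (\<lambda>a b. F (s \<otimes> a) (t \<otimes> b))) = rr W (\<lambda>s t. sw W h (\<lambda>a b. F (b \<otimes> s) (a \<otimes> t)))"
proof -
  note [simp] = W bilin_comp[OF F] module_hom_comp[OF HH.lift_hom[OF F W]]
  have e: "R \<otimes>\<^bsub>HH\<^esub> \<Delta> h = tensor_swap K H H (\<Delta> h) \<otimes>\<^bsub>HH\<^esub> R" using R unfolding R_matrix_def by simp
  have "rr W (\<lambda>s t. sw W h (\<lambda>a b. F (s \<otimes> a) (t \<otimes> b))) = tensor_lift W F (R \<otimes>\<^bsub>HH\<^esub> \<Delta> h)"
    by (rule HH.lift_mult[OF F W, symmetric]) simp_all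
  also have "\<dots> = tensor_lift W F (sw HH h (\<lambda>a b. pure K H H b a) \<otimes>\<^bsub>HH\<^esub> rr HH (pure K H H))"
    unfolding e tensor_swap_def HH.lift_id[OF R_closed] ..
  also have "\<dots> = sw W h (\<lambda>a b. rr W (\<lambda>s t. tensor_lift W F (pure K H H b a \<otimes>\<^bsub>HH\<^esub> pure K H H s t)))"
    by (rule lift_lift_mult[OF HH.tensor_product_axioms _ _ HH.tensor_product_axioms _ _ algebra_HH HH.lift_hom[OF F W] W]) simp_all
  also have "\<dots> = sw W h (\<lambda>a b. rr W (\<lambda>s t. F (b \<otimes> s) (a \<otimes> t)))"
    by (rule sw_cong, simp, simp, simp, rule rr_cong) (simp_all add: HH.mult_pure HH.lift_pure[OF F W])
  also have "\<dots> = rr W (\<lambda>s t. sw W h (\<lambda>a b. F (b \<otimes> s) (a \<otimes> t)))"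
    by (rule tt_swap) simp_all
  finally show ?thesis .
qed

end

context hopf begin

lemma pure_smult [simp]:
  assumes "module K U" "module K V" "c \<in> carrier K" "u \<in> carrier U" "v \<in> carrier V"
  shows "pure K U V (c \<odot>\<^bsub>U\<^esub> u) v = c \<odot>\<^bsub>tensor K U V\<^esub> pure K U V u v"
    "pure K U V u (c \<odot>\<^bsub>V\<^esub> v) = c \<odot>\<^bsub>tensor K U V\<^esub> pure K U V u v"
  using smult_hom[OF lin_pure(1)[OF assms(1,2) assms(5) module_hom_id] assms(3,4)]
    smult_hom[OF lin_pure(2)[OF assms(1,2) assms(4) module_hom_id] assms(3,5)] by simp_all

end

section \<open>Counit, Yang-Baxter and antipode identities for R\<close>

context qt_hopf begin

lemma R_eq: "rr HH (pure K H H) = R"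
  by (rule HH.lift_id[OF R_closed])

text \<open>Let e = (\<epsilon> \<otimes> Id)R. Applying \<epsilon> to the first leg of (\<Delta>
  \<otimes> Id)R = R13 R23 gives R = (1 \<otimes> e)R, hence 1 \<otimes> 1 = 1 \<otimes> e as R is
  invertible. Applying \<epsilon> \<otimes> Id once more extracts e = 1 from the tensor.\<close>

lemma R_counit_left:
  assumes g: "g \<in> module_hom K H W" and W: "module K W"
  shows "rr W (\<lambda>s t. \<epsilon> s \<odot>\<^bsub>W\<^esub> g t) = g \<one>"
proof -
  define e where "e = rr H (\<lambda>s t. \<epsilon> s \<odot>\<^bsub>H\<^esub> t)"
  have e [simp]: "e \<in> carrier H" by (simp add: e_def)
  note smHH = module_homD(3)[OF HH.mult_left_hom]
  have p: "pure K H H \<one> t \<otimes>\<^bsub>HH\<^esub> R = rr HH (\<lambda>s' t'. pure K H H s' (t \<otimes> t'))" if [simp]: "t \<in> carrier H" for t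
  proof -
    have "pure K H H \<one> t \<otimes>\<^bsub>HH\<^esub> rr HH (pure K H H) = rr HH (\<lambda>s' t'. pure K H H \<one> t \<otimes>\<^bsub>HH\<^esub> pure K H H s' t')"
      by (rule hom_rr(1)[where g = "\<lambda>x. pure K H H \<one> t \<otimes>\<^bsub>HH\<^esub> x"]) simp_all
    also have "\<dots> = rr HH (\<lambda>s' t'. pure K H H s' (t \<otimes> t'))"
      by (rule rr_cong) (simp_all add: HH.mult_pure)
    finally show ?thesis unfolding R_eq .
  qed
  have "rr HH (pure K H H) = rr HH (\<lambda>s t. sw HH s (\<lambda>s1 s2. \<epsilon> s1 \<odot>\<^bsub>HH\<^esub> pure K H H s2 t))"
    by (rule rr_cong, simp, simp, rule sw_counit_left[symmetric]) simp_all
  also have "\<dots> = rr HH (\<lambda>s t. rr HH (\<lambda>s' t'. \<epsilon> s \<odot>\<^bsub>HH\<^esub> pure K H H s' (t \<otimes> t')))"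
    by (rule R_comul_left) (simp_all add: trilin_def)
  also have "\<dots> = rr HH (\<lambda>s t. \<epsilon> s \<odot>\<^bsub>HH\<^esub> rr HH (\<lambda>s' t'. pure K H H s' (t \<otimes> t')))"
    by (rule rr_cong, simp, simp, rule hom_rr(1)[symmetric]) simp_all
  also have "\<dots> = rr HH (\<lambda>s t. pure K H H \<one> (\<epsilon> s \<odot>\<^bsub>H\<^esub> t) \<otimes>\<^bsub>HH\<^esub> R)"
    by (rule rr_cong, simp, simp) (simp add: p smHH)
  also have "\<dots> = pure K H H \<one> e \<otimes>\<^bsub>HH\<^esub> R"
    unfolding e_def by (rule hom_rr(1)[symmetric, where g = "\<lambda>x. pure K H H \<one> x \<otimes>\<^bsub>HH\<^esub> R"]) simp_all
  finally have "R = pure K H H \<one> e \<otimes>\<^bsub>HH\<^esub> R" unfolding R_eq .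
  then have "R \<otimes>\<^bsub>HH\<^esub> Ri = pure K H H \<one> e \<otimes>\<^bsub>HH\<^esub> (R \<otimes>\<^bsub>HH\<^esub> Ri)"
    using monoid.m_assoc[OF monoid_HH, of "pure K H H \<one> e" R Ri] by simp
  then have "\<one>\<^bsub>HH\<^esub> = pure K H H \<one> e"
    using monoid.r_one[OF monoid_HH, of "pure K H H \<one> e"] by (simp add: R_Ri)
  then have 1: "pure K H H \<one> \<one> = pure K H H \<one> e" by (simp only: HH.one_tensor)
  have L: "tensor_lift H (\<lambda>a b. \<epsilon> a \<odot>\<^bsub>H\<^esub> b) (pure K H H \<one> x) = x" if "x \<in> carrier H" for x
  proof -
    have "tensor_lift H (\<lambda>a b. \<epsilon> a \<odot>\<^bsub>H\<^esub> b) (pure K H H \<one> x) = \<epsilon> \<one> \<odot>\<^bsub>H\<^esub> x"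
      by (rule HH.lift_pure) (use that in simp_all)
    then show ?thesis using that mH.smult_one[of x] by simp
  qed
  have "e = \<one>" using L[OF e] L[OF H.one_closed] unfolding 1 by (rule trans[OF sym])
  moreover have "g e = rr W (\<lambda>s t. g (\<epsilon> s \<odot>\<^bsub>H\<^esub> t))" unfolding e_def by (rule hom_rr(1)[OF g]) (simp_all add: W)
  moreover have "\<dots> = rr W (\<lambda>s t. \<epsilon> s \<odot>\<^bsub>W\<^esub> g t)"
    by (rule rr_cong) (simp_all add: W module_hom_comp[OF g] smult_hom[OF g])
  ultimately show ?thesis by simp
qed

text \<open>The mirror image of \<open>R_counit_left\<close>: \<epsilon> on the third leg of (Id
  \<otimes> \<Delta>)R = R13 R12 gives R = (e \<otimes> 1)R for e = (Id \<otimes>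
  \<epsilon>)R.\<close>

lemma R_counit_right:
  assumes g: "g \<in> module_hom K H W" and W: "module K W"
  shows "rr W (\<lambda>s t. \<epsilon> t \<odot>\<^bsub>W\<^esub> g s) = g \<one>"
proof -
  define e where "e = rr H (\<lambda>s t. \<epsilon> t \<odot>\<^bsub>H\<^esub> s)"
  have e [simp]: "e \<in> carrier H" by (simp add: e_def)
  note smHH = module_homD(3)[OF HH.mult_left_hom]
  have p: "pure K H H s \<one> \<otimes>\<^bsub>HH\<^esub> R = rr HH (\<lambda>s' t'. pure K H H (s \<otimes> s') t')" if [simp]: "s \<in> carrier H" for s
  proof -
    have "pure K H H s \<one> \<otimes>\<^bsub>HH\<^esub> rr HH (pure K H H) = rr HH (\<lambda>s' t'. pure K H H s \<one> \<otimes>\<^bsub>HH\<^esub> pure K H H s' t')"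
      by (rule hom_rr(1)[where g = "\<lambda>x. pure K H H s \<one> \<otimes>\<^bsub>HH\<^esub> x"]) simp_all
    also have "\<dots> = rr HH (\<lambda>s' t'. pure K H H (s \<otimes> s') t')"
      by (rule rr_cong) (simp_all add: HH.mult_pure)
    finally show ?thesis unfolding R_eq .
  qed
  have "rr HH (pure K H H) = rr HH (\<lambda>s t. sw HH t (\<lambda>t1 t2. \<epsilon> t2 \<odot>\<^bsub>HH\<^esub> pure K H H s t1))"
    by (rule rr_cong, simp, simp, rule sw_counit_right[symmetric]) simp_all
  also have "\<dots> = rr HH (\<lambda>s t. rr HH (\<lambda>s' t'. \<epsilon> t \<odot>\<^bsub>HH\<^esub> pure K H H (s \<otimes> s') t'))"
    by (rule R_comul_right) (simp_all add: trilin_def)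
  also have "\<dots> = rr HH (\<lambda>s t. \<epsilon> t \<odot>\<^bsub>HH\<^esub> rr HH (\<lambda>s' t'. pure K H H (s \<otimes> s') t'))"
    by (rule rr_cong, simp, simp, rule hom_rr(1)[symmetric]) simp_all
  also have "\<dots> = rr HH (\<lambda>s t. pure K H H (\<epsilon> t \<odot>\<^bsub>H\<^esub> s) \<one> \<otimes>\<^bsub>HH\<^esub> R)"
    by (rule rr_cong, simp, simp) (simp add: p smHH)
  also have "\<dots> = pure K H H e \<one> \<otimes>\<^bsub>HH\<^esub> R"
    unfolding e_def by (rule hom_rr(1)[symmetric, where g = "\<lambda>x. pure K H H x \<one> \<otimes>\<^bsub>HH\<^esub> R"]) simp_all
  finally have "R = pure K H H e \<one> \<otimes>\<^bsub>HH\<^esub> R" unfolding R_eq .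
  then have "R \<otimes>\<^bsub>HH\<^esub> Ri = pure K H H e \<one> \<otimes>\<^bsub>HH\<^esub> (R \<otimes>\<^bsub>HH\<^esub> Ri)"
    using monoid.m_assoc[OF monoid_HH, of "pure K H H e \<one>" R Ri] by simp
  then have "\<one>\<^bsub>HH\<^esub> = pure K H H e \<one>"
    using monoid.r_one[OF monoid_HH, of "pure K H H e \<one>"] by (simp add: R_Ri)
  then have 1: "pure K H H \<one> \<one> = pure K H H e \<one>" by (simp only: HH.one_tensor)
  have L: "tensor_lift H (\<lambda>a b. \<epsilon> b \<odot>\<^bsub>H\<^esub> a) (pure K H H x \<one>) = x" if "x \<in> carrier H" for x
  proof -
    have "tensor_lift H (\<lambda>a b. \<epsilon> b \<odot>\<^bsub>H\<^esub> a) (pure K H H x \<one>) = \<epsilon> \<one> \<odot>\<^bsub>H\<^esub> x"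
      by (rule HH.lift_pure) (use that in simp_all)
    then show ?thesis using that mH.smult_one[of x] by simp
  qed
  have "e = \<one>" using L[OF e] L[OF H.one_closed] unfolding 1 by (rule trans[OF sym])
  moreover have "g e = rr W (\<lambda>s t. g (\<epsilon> t \<odot>\<^bsub>H\<^esub> s))" unfolding e_def by (rule hom_rr(1)[OF g]) (simp_all add: W)
  moreover have "\<dots> = rr W (\<lambda>s t. \<epsilon> t \<odot>\<^bsub>W\<^esub> g s)"
    by (rule rr_cong) (simp_all add: W module_hom_comp[OF g] smult_hom[OF g])
  ultimately show ?thesis by simp
qed

text \<open>Fold R13 R23 in R12 R13 R23 into (\<Delta> \<otimes> Id)R, move R12 across it by
  R\<Delta> = \<Delta>^op R, and unfold. The opposite coproduct has exchanged the first two legs,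
  which leaves R23 R13 R12.\<close>

lemma yang_baxter:
  assumes W: "module K W" and F: "trilin K H H H W F"
  shows "rr W (\<lambda>s1 t1. rr W (\<lambda>s2 t2. rr W (\<lambda>s3 t3. F (s1 \<otimes> s2) (t1 \<otimes> s3) (t2 \<otimes> t3))))
       = rr W (\<lambda>s3 t3. rr W (\<lambda>s2 t2. rr W (\<lambda>s1 t1. F (s2 \<otimes> s1) (s3 \<otimes> t1) (t3 \<otimes> t2))))"
proof -
  note [simp] = W trilin_comp[OF F]
  have "rr W (\<lambda>s1 t1. rr W (\<lambda>s2 t2. rr W (\<lambda>s3 t3. F (s1 \<otimes> s2) (t1 \<otimes> s3) (t2 \<otimes> t3))))
    = rr W (\<lambda>s1 t1. rr W (\<lambda>s t. sw W s (\<lambda>a b. F (s1 \<otimes> a) (t1 \<otimes> b) t)))"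
    by (rule rr_cong, simp, simp, rule R_comul_left[symmetric]) (simp_all add: trilin_def)
  also have "\<dots> = rr W (\<lambda>s t. rr W (\<lambda>s1 t1. sw W s (\<lambda>a b. F (s1 \<otimes> a) (t1 \<otimes> b) t)))"
    by (rule tt_swap) simp_all
  also have "\<dots> = rr W (\<lambda>s t. rr W (\<lambda>s1 t1. sw W s (\<lambda>a b. F (b \<otimes> s1) (a \<otimes> t1) t)))"
    by (rule rr_cong, simp, simp, rule R_comul_op) simp_all
  also have "\<dots> = rr W (\<lambda>s t. sw W s (\<lambda>a b. rr W (\<lambda>s1 t1. F (b \<otimes> s1) (a \<otimes> t1) t)))"
    by (rule rr_cong, simp, simp, rule tt_swap) simp_all
  also have "\<dots> = rr W (\<lambda>s3 t3. rr W (\<lambda>s2 t2. rr W (\<lambda>s1 t1. F (s2 \<otimes> s1) (s3 \<otimes> t1) (t3 \<otimes> t2))))"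
    by (rule R_comul_left) (simp_all add: trilin_def)
  finally show ?thesis .
qed

text \<open>The two copies of R fold into (Id \<otimes> \<Delta>)R, which turns
  \<open>t' \<otimes> S t\<close> into t1 S(t2); the antipode axiom and then the counit of R
  finish.\<close>

lemma R_antipode:
  assumes F: "bilin K H H W F" and W: "module K W"
  shows "rr W (\<lambda>s t. rr W (\<lambda>s' t'. F (s \<otimes> s') (t' \<otimes> S t))) = F \<one> \<one>"
proof -
  note [simp] = W bilin_comp[OF F] bilinD(1)[OF F]
  have "rr W (\<lambda>s t. rr W (\<lambda>s' t'. F (s \<otimes> s') (t' \<otimes> S t))) = rr W (\<lambda>s t. sw W t (\<lambda>t1 t2. F s (t1 \<otimes> S t2)))"
    by (rule R_comul_right[symmetric]) (simp_all add: trilin_def)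
  also have "\<dots> = rr W (\<lambda>s t. \<epsilon> t \<odot>\<^bsub>W\<^esub> F s \<one>)"
    by (rule rr_cong, simp, simp, rule sw_antipode_right) simp_all
  also have "\<dots> = F \<one> \<one>" by (rule R_counit_right) simp_all
  finally show ?thesis .
qed

text \<open>\<open>u\<close> is the Drinfeld element. Insert S(h1) h2 between S(t) and s, so that
  S(h1 t) h2 s appears. R\<Delta> = \<Delta>^op R replaces it by S(t h2) s h1, and S(S(h3)) S(t h2)
  = S(t h2 S(h3)) collapses by the antipode axiom.\<close>

lemma antipode_squared:
  defines "u \<equiv> rr H (\<lambda>s t. S t \<otimes> s)"
  assumes [simp]: "h \<in> carrier H"
  shows "S (S h) \<otimes> u = u \<otimes> h"
proof -
  have "S (S h) \<otimes> u = rr H (\<lambda>s t. S (S h) \<otimes> (S t \<otimes> s))"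
    unfolding u_def by (rule hom_rr(1)) simp_all
  also have "\<dots> = rr H (\<lambda>s t. sw H h (\<lambda>a b. \<epsilon> a \<odot>\<^bsub>H\<^esub> (S (S b) \<otimes> (S t \<otimes> s))))"
    by (rule rr_cong, simp, simp, rule sw_counit_left[symmetric]) simp_all
  also have "\<dots> = rr H (\<lambda>s t. sw H h (\<lambda>a b. sw H a (\<lambda>a1 a2. S (S b) \<otimes> (S t \<otimes> (S a1 \<otimes> a2) \<otimes> s))))"
  proof (rule rr_cong, simp, simp, rule sw_cong, simp, simp, simp)
    fix s t a b assume [simp]: "s \<in> carrier H" "t \<in> carrier H" "a \<in> carrier H" "b \<in> carrier H"
    show "\<epsilon> a \<odot>\<^bsub>H\<^esub> (S (S b) \<otimes> (S t \<otimes> s)) = sw H a (\<lambda>a1 a2. S (S b) \<otimes> (S t \<otimes> (S a1 \<otimes> a2) \<otimes> s))"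
      using sw_antipode_left[of "\<lambda>z. S (S b) \<otimes> (S t \<otimes> z \<otimes> s)" H a] by simp
  qed
  also have "\<dots> = sw H h (\<lambda>a b. rr H (\<lambda>s t. sw H a (\<lambda>a1 a2. S (S b) \<otimes> (S t \<otimes> (S a1 \<otimes> a2) \<otimes> s))))"
    by (rule tt_swap) simp_all
  also have "\<dots> = sw H h (\<lambda>a b. rr H (\<lambda>s t. sw H a (\<lambda>a1 a2. S (S b) \<otimes> (S (a1 \<otimes> t) \<otimes> (a2 \<otimes> s)))))"
    by (rule sw_cong, simp, simp, simp, rule rr_cong, simp, simp, rule sw_cong) (simp_all add: antipode_mult H.m_assoc)
  also have "\<dots> = sw H h (\<lambda>a b. rr H (\<lambda>s t. sw H a (\<lambda>a1 a2. S (S b) \<otimes> (S (t \<otimes> a2) \<otimes> (s \<otimes> a1)))))"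
    by (rule sw_cong, simp, simp, simp, rule R_comul_op[symmetric]) simp_all
  also have "\<dots> = rr H (\<lambda>s t. sw H h (\<lambda>a b. sw H a (\<lambda>a1 a2. S (S b) \<otimes> (S (t \<otimes> a2) \<otimes> (s \<otimes> a1)))))"
    by (rule tt_swap) simp_all
  also have "\<dots> = rr H (\<lambda>s t. sw H h (\<lambda>a b. sw H b (\<lambda>b1 b2. S (S b2) \<otimes> (S (t \<otimes> b1) \<otimes> (s \<otimes> a)))))"
    by (rule rr_cong, simp, simp, rule coassoc) (simp_all add: trilin_def)
  also have "\<dots> = rr H (\<lambda>s t. sw H h (\<lambda>a b. sw H b (\<lambda>b1 b2. S (b1 \<otimes> S b2) \<otimes> (S t \<otimes> s \<otimes> a))))"
    by (rule rr_cong, simp, simp, rule sw_cong, simp, simp, simp, rule sw_cong) (simp_all add: antipode_mult H.m_assoc)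
  also have "\<dots> = rr H (\<lambda>s t. sw H h (\<lambda>a b. \<epsilon> b \<odot>\<^bsub>H\<^esub> (S \<one> \<otimes> (S t \<otimes> s \<otimes> a))))"
    by (rule rr_cong, simp, simp, rule sw_cong, simp, simp, simp, rule sw_antipode_right) simp_all
  also have "\<dots> = rr H (\<lambda>s t. S \<one> \<otimes> (S t \<otimes> s \<otimes> h))"
    by (rule rr_cong, simp, simp, rule sw_counit_right) simp_all
  also have "\<dots> = rr H (\<lambda>s t. (S t \<otimes> s) \<otimes> h)"
    by (rule rr_cong) simp_all
  also have "\<dots> = u \<otimes> h"
    unfolding u_def by (rule hom_rr(1)[symmetric]) simp_all
  finally show ?thesis .
qed

text \<open>\<open>v\<close> is a left inverse of the Drinfeld element: in v u the relation S(S(s))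
  u = u s moves \<open>u\<close> between t and s, and the sum becomes the one in
  \<open>R_antipode\<close>. Since S(S(x)) u = u x, equality of S(x) and S(y) gives u x = u y, and
  \<open>v\<close> cancels \<open>u\<close>.\<close>

lemma antipode_inj: "inj_on S (carrier H)"
proof -
  define u where "u = rr H (\<lambda>s t. S t \<otimes> s)"
  define v where "v = rr H (\<lambda>s t. t \<otimes> S (S s))"
  have [simp]: "u \<in> carrier H" "v \<in> carrier H" by (simp_all add: u_def v_def)
  have "v \<otimes> u = rr H (\<lambda>s t. t \<otimes> S (S s) \<otimes> u)"
    unfolding v_def by (rule hom_rr(1)) simp_all
  also have "\<dots> = rr H (\<lambda>s t. t \<otimes> u \<otimes> s)"
    by (rule rr_cong) (simp_all add: H.m_assoc antipode_squared[folded u_def])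
  also have "\<dots> = rr H (\<lambda>s t. rr H (\<lambda>s' t'. t \<otimes> (S t' \<otimes> s') \<otimes> s))"
    unfolding u_def by (rule rr_cong, simp, simp, rule hom_rr(1)) simp_all
  also have "\<dots> = rr H (\<lambda>s' t'. rr H (\<lambda>s t. t \<otimes> (S t' \<otimes> s') \<otimes> s))"
    by (rule tt_swap) simp_all
  also have "\<dots> = rr H (\<lambda>s' t'. rr H (\<lambda>s t. (t \<otimes> S t') \<otimes> (s' \<otimes> s)))"
    by (rule rr_cong, simp, simp, rule rr_cong) (simp_all add: H.m_assoc)
  also have "\<dots> = \<one> \<otimes> \<one>" by (rule R_antipode) simp_all
  finally have vu: "v \<otimes> u = \<one>" by simp
  show ?thesis
  proof (rule inj_onI)
    fix x y assume [simp]: "x \<in> carrier H" "y \<in> carrier H" and "S x = S y"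
    then have "u \<otimes> x = u \<otimes> y" using antipode_squared[folded u_def, of x] antipode_squared[folded u_def, of y] by simp
    then have "(v \<otimes> u) \<otimes> x = (v \<otimes> u) \<otimes> y" by (simp add: H.m_assoc)
    then show "x = y" by (simp add: vu)
  qed
qed

end

section \<open>The inverse of the antipode in finite dimension\<close>

locale fd_qt_hopf = qt_hopf K H R
  for K :: "('k, 'l) ring_scheme" and H :: "('k, 'h, 'm) hopf_scheme" (structure) and R :: "('h, 'h) tensor" +
  assumes fin_dim: "vectorspace.fin_dim K H"
begin

abbreviation "Si \<equiv> antipode_inv H"

lemma antipode_surj: "S ` carrier H = carrier H"
  by (rule vectorspace.inj_endomorphism_surj[OF assoc_algebraD(1)[OF algebra_H] antipode_hom antipode_inj fin_dim])

lemma Si_closed [simp]: "x \<in> carrier H \<Longrightarrow> Si x \<in> carrier H"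
  using inv_into_into[of x S "carrier H"] antipode_surj by simp
lemma S_Si [simp]: "x \<in> carrier H \<Longrightarrow> S (Si x) = x"
  using f_inv_into_f[of x S "carrier H"] antipode_surj by simp
lemma Si_S [simp]: "x \<in> carrier H \<Longrightarrow> Si (S x) = x"
  using inv_into_f_f[OF antipode_inj] .

lemma Si_eqI: "x \<in> carrier H \<Longrightarrow> y \<in> carrier H \<Longrightarrow> S y = x \<Longrightarrow> Si x = y"
  using Si_S by blast

lemma Si_hom: "Si \<in> module_hom K H H"
proof (rule module_homI)
  show "Si (x \<oplus> y) = Si x \<oplus> Si y" if "x \<in> carrier H" "y \<in> carrier H" for x y
    by (rule Si_eqI) (use that in \<open>simp_all add: module_homD[OF antipode_hom]\<close>)
  show "Si (c \<odot>\<^bsub>H\<^esub> x) = c \<odot>\<^bsub>H\<^esub> Si x" if "c \<in> carrier K" "x \<in> carrier H" for c x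
    by (rule Si_eqI) (use that in \<open>simp_all add: module_homD[OF antipode_hom]\<close>)
qed simp

lemma lin_Si [simp]: "f \<in> module_hom K Y H \<Longrightarrow> (\<lambda>x. Si (f x)) \<in> module_hom K Y H"
  by (rule module_hom_comp[OF Si_hom])

lemma Si_mult: "x \<in> carrier H \<Longrightarrow> y \<in> carrier H \<Longrightarrow> Si (x \<otimes> y) = Si y \<otimes> Si x"
  by (rule Si_eqI) (simp_all add: antipode_mult)

lemma Si_one [simp]: "Si \<one> = \<one>"
  by (rule Si_eqI) simp_all

lemma counit_Si [simp]: "x \<in> carrier H \<Longrightarrow> \<epsilon> (Si x) = \<epsilon> x"
  using counit_antipode[of "Si x"] by simp

text \<open>This is \<open>sw_antipode\<close> at S^{-1}(h), for the form that swaps its arguments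
  and applies S^{-1} to both before \<open>F\<close>.\<close>

lemma sw_Si:
  assumes F: "bilin K H H W F" and W: "module K W" and h: "h \<in> carrier H"
  shows "sw W (Si h) F = sw W h (\<lambda>a b. F (Si b) (Si a))"
proof -
  note [simp] = W h bilin_comp[OF F]
  have "sw W (S (Si h)) (\<lambda>a b. F (Si b) (Si a)) = sw W (Si h) (\<lambda>a b. F (Si (S a)) (Si (S b)))"
    by (rule sw_antipode) simp_all
  also have "\<dots> = sw W (Si h) F" by (rule sw_cong) simp_all
  finally show ?thesis by simp
qed

text \<open>These are the antipode axioms under S^{-1}, which reverses products: S^{-1}(a S(b)) = b
  S^{-1}(a) and S^{-1}(S(a) b) = S^{-1}(b) a. Hence the factors of the coproduct appear in the
  opposite order.\<close>

lemma sw_Si_left: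
  assumes g: "g \<in> module_hom K H W" and W: "module K W" and h: "h \<in> carrier H"
  shows "sw W h (\<lambda>a b. g (b \<otimes> Si a)) = \<epsilon> h \<odot>\<^bsub>W\<^esub> g \<one>"
    "sw W h (\<lambda>a b. g (Si b \<otimes> a)) = \<epsilon> h \<odot>\<^bsub>W\<^esub> g \<one>"
proof -
  note [simp] = W h module_hom_comp[OF g]
  have "sw W h (\<lambda>a b. g (b \<otimes> Si a)) = sw W h (\<lambda>a b. g (Si (a \<otimes> S b)))"
    by (rule sw_cong) (simp_all add: Si_mult)
  also have "\<dots> = \<epsilon> h \<odot>\<^bsub>W\<^esub> g (Si \<one>)" by (rule sw_antipode_right) simp_all
  finally show "sw W h (\<lambda>a b. g (b \<otimes> Si a)) = \<epsilon> h \<odot>\<^bsub>W\<^esub> g \<one>" by simp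
  have "sw W h (\<lambda>a b. g (Si b \<otimes> a)) = sw W h (\<lambda>a b. g (Si (S a \<otimes> b)))"
    by (rule sw_cong) (simp_all add: Si_mult)
  also have "\<dots> = \<epsilon> h \<odot>\<^bsub>W\<^esub> g (Si \<one>)" by (rule sw_antipode_left) simp_all
  finally show "sw W h (\<lambda>a b. g (Si b \<otimes> a)) = \<epsilon> h \<odot>\<^bsub>W\<^esub> g \<one>" by simp
qed

text \<open>By (\<Delta> \<otimes> Id)R = R13 R23 the two first legs fold into s2 S^{-1}(s1) or
  S^{-1}(s2) s1 for the coproduct of a single s, and these collapse to the counit. So S^{-1}(s)
  \<otimes> t is the two-sided inverse of R in H^op \<otimes> H; it is what cancels the factor with
  S^{-1} in \<open>hat_comul\<close>.\<close>

lemma R_Si: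
  assumes F: "bilin K H H W F" and W: "module K W"
  shows "rr W (\<lambda>s t. rr W (\<lambda>s' t'. F (s' \<otimes> Si s) (t \<otimes> t'))) = F \<one> \<one>"
    and "rr W (\<lambda>s t. rr W (\<lambda>s' t'. F (Si s' \<otimes> s) (t \<otimes> t'))) = F \<one> \<one>"
proof -
  note [simp] = W bilin_comp[OF F] bilinD(1)[OF F]
  have "rr W (\<lambda>s t. rr W (\<lambda>s' t'. F (s' \<otimes> Si s) (t \<otimes> t'))) = rr W (\<lambda>s t. sw W s (\<lambda>a b. F (b \<otimes> Si a) t))"
    by (rule R_comul_left[symmetric]) (simp_all add: trilin_def)
  also have "\<dots> = rr W (\<lambda>s t. \<epsilon> s \<odot>\<^bsub>W\<^esub> F \<one> t)"
    by (rule rr_cong, simp, simp, rule sw_Si_left) simp_all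
  also have "\<dots> = F \<one> \<one>" by (rule R_counit_left) simp_all
  finally show "rr W (\<lambda>s t. rr W (\<lambda>s' t'. F (s' \<otimes> Si s) (t \<otimes> t'))) = F \<one> \<one>" .
  have "rr W (\<lambda>s t. rr W (\<lambda>s' t'. F (Si s' \<otimes> s) (t \<otimes> t'))) = rr W (\<lambda>s t. sw W s (\<lambda>a b. F (Si b \<otimes> a) t))"
    by (rule R_comul_left[symmetric]) (simp_all add: trilin_def)
  also have "\<dots> = rr W (\<lambda>s t. \<epsilon> s \<odot>\<^bsub>W\<^esub> F \<one> t)"
    by (rule rr_cong, simp, simp, rule sw_Si_left) simp_all
  also have "\<dots> = F \<one> \<one>" by (rule R_counit_left) simp_all
  finally show "rr W (\<lambda>s t. rr W (\<lambda>s' t'. F (Si s' \<otimes> s) (t \<otimes> t'))) = F \<one> \<one>" .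
qed

section \<open>The twisted comultiplication\<close>

abbreviation hw where "hw W h F \<equiv> tensor_lift W F (hat_comul K H R h)"

text \<open>
  The maps below act on bilinear and trilinear forms by the legs of \<open>R\<close>: \<open>rij\<close> multiplies
  the arguments \<open>i\<close> and \<open>j\<close> by $R_{ji}$ on the right, and \<open>cij\<close> multiplies argument
  \<open>i\<close> by \<open>t\<close> on the left and argument \<open>j\<close> by $S^{-1}(s)$ on the right, with the larger index
  receiving \<open>s\<close>. In this language \<open>hat_comul\<close> is \<open>comul\<close> followed by
  \<open>r2\<close> and \<open>c2\<close>, and its coassociativity becomes the Yang-Baxter equation \<open>r32_r31_r21\<close>.
\<close>

definition r2 where "r2 W F x y = rr W (\<lambda>s t. F (x \<otimes> t) (y \<otimes> s))"
definition c2 where "c2 W F x y = rr W (\<lambda>s t. F (t \<otimes> x) (y \<otimes> Si s))"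
definition r21 where "r21 W F x y z = rr W (\<lambda>s t. F (x \<otimes> t) (y \<otimes> s) z)"
definition r31 where "r31 W F x y z = rr W (\<lambda>s t. F (x \<otimes> t) y (z \<otimes> s))"
definition r32 where "r32 W F x y z = rr W (\<lambda>s t. F x (y \<otimes> t) (z \<otimes> s))"
definition c21 where "c21 W F x y z = rr W (\<lambda>s t. F (t \<otimes> x) (y \<otimes> Si s) z)"
definition c31 where "c31 W F x y z = rr W (\<lambda>s t. F (t \<otimes> x) y (z \<otimes> Si s))"
definition c32 where "c32 W F x y z = rr W (\<lambda>s t. F x (t \<otimes> y) (z \<otimes> Si s))"

lemmas op_defs = r21_def r31_def r32_def c21_def c31_def c32_def

lemma bilin_r2: "bilin K H H W F \<Longrightarrow> module K W \<Longrightarrow> bilin K H H W (r2 W F)"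
  and bilin_c2: "bilin K H H W F \<Longrightarrow> module K W \<Longrightarrow> bilin K H H W (c2 W F)"
proof -
  assume F: "bilin K H H W F" and W: "module K W"
  note [simp] = W bilin_comp[OF F]
  show "bilin K H H W (r2 W F)" "bilin K H H W (c2 W F)" by (simp_all add: r2_def c2_def)
qed

lemma trilin_op:
  assumes F: "trilin K H H H W F" and W: "module K W"
  shows "trilin K H H H W (r21 W F)"
    and "trilin K H H H W (r31 W F)"
    and "trilin K H H H W (r32 W F)"
    and "trilin K H H H W (c21 W F)"
    and "trilin K H H H W (c31 W F)"
    and "trilin K H H H W (c32 W F)"
proof -
  note [simp] = W trilin_comp[OF F]
  show "trilin K H H H W (r21 W F)" "trilin K H H H W (r31 W F)" "trilin K H H H W (r32 W F)" "trilin K H H H W (c21 W F)" "trilin K H H H W (c31 W F)" "trilin K H H H W (c32 W F)"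
    by (simp_all add: trilin_def op_defs)
qed

text \<open>Agreement on the carrier only, since the operators evaluate forms at elements of H. With
  transitivity declared, chains of operator identities can be written as calculations.\<close>

definition teq :: "('h \<Rightarrow> 'h \<Rightarrow> 'h \<Rightarrow> 'w) \<Rightarrow> ('h \<Rightarrow> 'h \<Rightarrow> 'h \<Rightarrow> 'w) \<Rightarrow> bool" where
  "teq F G \<longleftrightarrow> (\<forall>x\<in>carrier H. \<forall>y\<in>carrier H. \<forall>z\<in>carrier H. F x y z = G x y z)"

lemma teq_trans [trans]: "teq F G \<Longrightarrow> teq G J \<Longrightarrow> teq F J"
  by (simp add: teq_def)

lemma teq_op:
  assumes F: "trilin K H H H W F" and W: "module K W" and e: "teq F G"
  shows "teq (r21 W F) (r21 W G)"
    and "teq (r31 W F) (r31 W G)"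
    and "teq (r32 W F) (r32 W G)"
    and "teq (c21 W F) (c21 W G)"
    and "teq (c31 W F) (c31 W G)"
    and "teq (c32 W F) (c32 W G)"
proof -
  note [simp] = W trilin_comp[OF F]
  show "teq (r21 W F) (r21 W G)" "teq (r31 W F) (r31 W G)" "teq (r32 W F) (r32 W G)" "teq (c21 W F) (c21 W G)" "teq (c31 W F) (c31 W G)" "teq (c32 W F) (c32 W G)"
    using e by (auto simp: teq_def op_defs intro!: rr_cong)
qed

text \<open>Here and in the next two lemmas the operators share exactly one argument and multiply it
  on opposite sides, so they commute by associativity and an interchange of sums.\<close>

lemma c32_r21:
  assumes F: "trilin K H H H W F" and W: "module K W"
  shows "teq (c32 W (r21 W F)) (r21 W (c32 W F))"
proof -
  note [simp] = W trilin_comp[OF F]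
  show ?thesis unfolding teq_def op_defs
    by (intro ballI, subst tt_swap, simp_all, rule rr_cong, simp, simp, rule rr_cong) (simp_all add: H.m_assoc)
qed

lemma c31_r21:
  assumes F: "trilin K H H H W F" and W: "module K W"
  shows "teq (c31 W (r21 W F)) (r21 W (c31 W F))"
proof -
  note [simp] = W trilin_comp[OF F]
  show ?thesis unfolding teq_def op_defs
    by (intro ballI, subst tt_swap, simp_all, rule rr_cong, simp, simp, rule rr_cong) (simp_all add: H.m_assoc)
qed

lemma c32_c21:
  assumes F: "trilin K H H H W F" and W: "module K W"
  shows "teq (c32 W (c21 W F)) (c21 W (c32 W F))"
proof -
  note [simp] = W trilin_comp[OF F]
  show ?thesis unfolding teq_def op_defs
    by (intro ballI, subst tt_swap, simp_all, rule rr_cong, simp, simp, rule rr_cong) (simp_all add: H.m_assoc)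
qed

text \<open>The Yang-Baxter equation with its three arguments read backwards. As these operators
  multiply on the right, the outermost one contributes the leftmost factor, so composition order is
  product order.\<close>

lemma r32_r31_r21:
  assumes F: "trilin K H H H W F" and W: "module K W"
  shows "teq (r32 W (r31 W (r21 W F))) (r21 W (r31 W (r32 W F)))"
  unfolding teq_def
proof (intro ballI)
  fix x y z assume [simp]: "x \<in> carrier H" "y \<in> carrier H" "z \<in> carrier H"
  note [simp] = W trilin_comp[OF F]
  have "r32 W (r31 W (r21 W F)) x y z = rr W (\<lambda>s1 t1. rr W (\<lambda>s2 t2. rr W (\<lambda>s3 t3. F (x \<otimes> (t2 \<otimes> t3)) (y \<otimes> (t1 \<otimes> s3)) (z \<otimes> (s1 \<otimes> s2)))))"
    unfolding op_defs by (rule rr_cong, simp, simp, rule rr_cong, simp, simp, rule rr_cong) (simp_all add: H.m_assoc)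
  also have "\<dots> = rr W (\<lambda>s3 t3. rr W (\<lambda>s2 t2. rr W (\<lambda>s1 t1. F (x \<otimes> (t3 \<otimes> t2)) (y \<otimes> (s3 \<otimes> t1)) (z \<otimes> (s2 \<otimes> s1)))))"
    by (rule yang_baxter[where F = "\<lambda>a b c. F (x \<otimes> c) (y \<otimes> b) (z \<otimes> a)"]) (simp_all add: trilin_def)
  also have "\<dots> = r21 W (r31 W (r32 W F)) x y z"
    unfolding op_defs by (rule rr_cong, simp, simp, rule rr_cong, simp, simp, rule rr_cong) (simp_all add: H.m_assoc)
  finally show "r32 W (r31 W (r21 W F)) x y z = r21 W (r31 W (r32 W F)) x y z" .
qed

text \<open>\<Delta> is multiplicative, and the coproduct of a leg of R splits R into two copies.
  Here (Id \<otimes> \<Delta>)R = R13 R12 fixes the order of \<open>r32\<close> and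
  \<open>r31\<close>. \<open>comul_left_c2\<close> and \<open>comul_right_r2\<close> follow the same
  pattern, with the axiom that matches the leg inside \<Delta>.\<close>

lemma comul_left_r2:
  assumes G: "trilin K H H H W G" and W: "module K W" and [simp]: "x \<in> carrier H" "z \<in> carrier H"
  shows "r2 W (\<lambda>x z. sw W x (\<lambda>a b. G a b z)) x z = sw W x (\<lambda>a b. r32 W (r31 W G) a b z)"
proof -
  note [simp] = W trilin_comp[OF G]
  have "r2 W (\<lambda>x z. sw W x (\<lambda>a b. G a b z)) x z = rr W (\<lambda>s t. sw W x (\<lambda>a b. sw W t (\<lambda>c d. G (a \<otimes> c) (b \<otimes> d) (z \<otimes> s))))"
    unfolding r2_def by (rule rr_cong, simp, simp, rule sw_mult) simp_all
  also have "\<dots> = sw W x (\<lambda>a b. rr W (\<lambda>s t. sw W t (\<lambda>c d. G (a \<otimes> c) (b \<otimes> d) (z \<otimes> s))))"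
    by (rule tt_swap) simp_all
  also have "\<dots> = sw W x (\<lambda>a b. rr W (\<lambda>s t. rr W (\<lambda>s' t'. G (a \<otimes> t') (b \<otimes> t) (z \<otimes> (s \<otimes> s')))))"
    by (rule sw_cong, simp, simp, simp, rule R_comul_right) (simp_all add: trilin_def)
  also have "\<dots> = sw W x (\<lambda>a b. r32 W (r31 W G) a b z)"
    unfolding op_defs by (rule sw_cong, simp, simp, simp, rule rr_cong, simp, simp, rule rr_cong) (simp_all add: H.m_assoc)
  finally show ?thesis .
qed

lemma comul_left_c2:
  assumes G: "trilin K H H H W G" and W: "module K W" and [simp]: "x \<in> carrier H" "z \<in> carrier H"
  shows "c2 W (\<lambda>x z. sw W x (\<lambda>a b. G a b z)) x z = sw W x (\<lambda>a b. c31 W (c32 W G) a b z)"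
proof -
  note [simp] = W trilin_comp[OF G]
  have "c2 W (\<lambda>x z. sw W x (\<lambda>a b. G a b z)) x z = rr W (\<lambda>s t. sw W t (\<lambda>c d. sw W x (\<lambda>a b. G (c \<otimes> a) (d \<otimes> b) (z \<otimes> Si s))))"
    unfolding c2_def by (rule rr_cong, simp, simp, rule sw_mult) simp_all
  also have "\<dots> = rr W (\<lambda>s t. sw W x (\<lambda>a b. sw W t (\<lambda>c d. G (c \<otimes> a) (d \<otimes> b) (z \<otimes> Si s))))"
    by (rule rr_cong, simp, simp, rule tt_swap) simp_all
  also have "\<dots> = sw W x (\<lambda>a b. rr W (\<lambda>s t. sw W t (\<lambda>c d. G (c \<otimes> a) (d \<otimes> b) (z \<otimes> Si s))))"
    by (rule tt_swap) simp_all
  also have "\<dots> = sw W x (\<lambda>a b. rr W (\<lambda>s t. rr W (\<lambda>s' t'. G (t' \<otimes> a) (t \<otimes> b) (z \<otimes> Si (s \<otimes> s')))))"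
    by (rule sw_cong, simp, simp, simp, rule R_comul_right) (simp_all add: trilin_def)
  \<comment> \<open>S^{-1} reverses \<open>s \<otimes> s'\<close>, so the copy of R acting on the
    first argument is now also the first to act on the third; this decides the order of
    \<open>c31\<close> and \<open>c32\<close>.\<close>
  also have "\<dots> = sw W x (\<lambda>a b. rr W (\<lambda>s t. rr W (\<lambda>s' t'. G (t' \<otimes> a) (t \<otimes> b) (z \<otimes> Si s' \<otimes> Si s))))"
    by (rule sw_cong, simp, simp, simp, rule rr_cong, simp, simp, rule rr_cong) (simp_all add: H.m_assoc Si_mult)
  also have "\<dots> = sw W x (\<lambda>a b. c31 W (c32 W G) a b z)"
    unfolding op_defs by (rule sw_cong, simp, simp, simp, rule tt_swap) simp_all
  finally show ?thesis .
qed

lemma comul_right_r2: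
  assumes G: "trilin K H H H W G" and W: "module K W" and [simp]: "x \<in> carrier H" "y \<in> carrier H"
  shows "r2 W (\<lambda>x y. sw W y (\<lambda>b c. G x b c)) x y = sw W y (\<lambda>b c. r21 W (r31 W G) x b c)"
proof -
  note [simp] = W trilin_comp[OF G]
  have "r2 W (\<lambda>x y. sw W y (\<lambda>b c. G x b c)) x y = rr W (\<lambda>s t. sw W y (\<lambda>b c. sw W s (\<lambda>d e. G (x \<otimes> t) (b \<otimes> d) (c \<otimes> e))))"
    unfolding r2_def by (rule rr_cong, simp, simp, rule sw_mult) simp_all
  also have "\<dots> = sw W y (\<lambda>b c. rr W (\<lambda>s t. sw W s (\<lambda>d e. G (x \<otimes> t) (b \<otimes> d) (c \<otimes> e))))"
    by (rule tt_swap) simp_all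
  also have "\<dots> = sw W y (\<lambda>b c. rr W (\<lambda>s t. rr W (\<lambda>s' t'. G (x \<otimes> (t \<otimes> t')) (b \<otimes> s) (c \<otimes> s'))))"
    by (rule sw_cong, simp, simp, simp, rule R_comul_left) (simp_all add: trilin_def)
  also have "\<dots> = sw W y (\<lambda>b c. r21 W (r31 W G) x b c)"
    unfolding op_defs by (rule sw_cong, simp, simp, simp, rule rr_cong, simp, simp, rule rr_cong) (simp_all add: H.m_assoc)
  finally show ?thesis .
qed

text \<open>
  Expanding $\Delta(S^{-1}(s))$ against \<open>r32\<close> is where $R\Delta = \Delta^{\mathrm{op}}R$ enters.
\<close>

lemma comul_right_c2:
  assumes G: "trilin K H H H W G" and W: "module K W" and [simp]: "x \<in> carrier H" "y \<in> carrier H"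
  shows "c2 W (\<lambda>x y. sw W y (\<lambda>b c. r32 W G x b c)) x y = sw W y (\<lambda>b c. r32 W (c31 W (c21 W G)) x b c)"
proof -
  note [simp] = W trilin_comp[OF G]
  have "c2 W (\<lambda>x y. sw W y (\<lambda>b c. r32 W G x b c)) x y
     = rr W (\<lambda>s t. sw W y (\<lambda>b c. sw W (Si s) (\<lambda>p q. rr W (\<lambda>s' t'. G (t \<otimes> x) (b \<otimes> p \<otimes> t') (c \<otimes> q \<otimes> s')))))"
    unfolding c2_def op_defs by (rule rr_cong, simp, simp, rule sw_mult) simp_all
  also have "\<dots> = sw W y (\<lambda>b c. rr W (\<lambda>s t. sw W (Si s) (\<lambda>p q. rr W (\<lambda>s' t'. G (t \<otimes> x) (b \<otimes> p \<otimes> t') (c \<otimes> q \<otimes> s')))))"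
    by (rule tt_swap) simp_all
  also have "\<dots> = sw W y (\<lambda>b c. rr W (\<lambda>s t. rr W (\<lambda>s' t'. sw W (Si s) (\<lambda>p q. G (t \<otimes> x) (b \<otimes> p \<otimes> t') (c \<otimes> q \<otimes> s')))))"
    by (rule sw_cong, simp, simp, simp, rule rr_cong, simp, simp, rule tt_swap) simp_all
  also have "\<dots> = sw W y (\<lambda>b c. rr W (\<lambda>s t. rr W (\<lambda>s' t'. sw W (Si s) (\<lambda>p q. G (t \<otimes> x) (b \<otimes> (p \<otimes> t')) (c \<otimes> (q \<otimes> s'))))))"
    by (rule sw_cong, simp, simp, simp, rule rr_cong, simp, simp, rule rr_cong, simp, simp, rule sw_cong) (simp_all add: H.m_assoc)
  also have "\<dots> = sw W y (\<lambda>b c. rr W (\<lambda>s t. rr W (\<lambda>s' t'. sw W (Si s) (\<lambda>p q. G (t \<otimes> x) (b \<otimes> (t' \<otimes> q)) (c \<otimes> (s' \<otimes> p))))))"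
    by (rule sw_cong, simp, simp, simp, rule rr_cong, simp, simp,
        rule R_comul_op[symmetric, where F = "\<lambda>u v. G (_ \<otimes> x) (_ \<otimes> v) (_ \<otimes> u)"]) simp_all
  also have "\<dots> = sw W y (\<lambda>b c. rr W (\<lambda>s t. rr W (\<lambda>s' t'. sw W s (\<lambda>d e. G (t \<otimes> x) (b \<otimes> (t' \<otimes> Si d)) (c \<otimes> (s' \<otimes> Si e))))))"
    by (rule sw_cong, simp, simp, simp, rule rr_cong, simp, simp, rule rr_cong, simp, simp, rule sw_Si) simp_all
  also have "\<dots> = sw W y (\<lambda>b c. rr W (\<lambda>s' t'. rr W (\<lambda>s t. sw W s (\<lambda>d e. G (t \<otimes> x) (b \<otimes> (t' \<otimes> Si d)) (c \<otimes> (s' \<otimes> Si e))))))"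
    by (rule sw_cong, simp, simp, simp, rule tt_swap) simp_all
  also have "\<dots> = sw W y (\<lambda>b c. rr W (\<lambda>s' t'. rr W (\<lambda>s t. rr W (\<lambda>s1 t1. G (t \<otimes> t1 \<otimes> x) (b \<otimes> (t' \<otimes> Si s)) (c \<otimes> (s' \<otimes> Si s1))))))"
    by (rule sw_cong, simp, simp, simp, rule rr_cong, simp, simp, rule R_comul_left) (simp_all add: trilin_def)
  also have "\<dots> = sw W y (\<lambda>b c. rr W (\<lambda>s' t'. rr W (\<lambda>s t. rr W (\<lambda>s1 t1. G (t \<otimes> (t1 \<otimes> x)) (b \<otimes> t' \<otimes> Si s) (c \<otimes> s' \<otimes> Si s1)))))"
    by (rule sw_cong, simp, simp, simp, rule rr_cong, simp, simp, rule rr_cong, simp, simp, rule rr_cong) (simp_all add: H.m_assoc)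
  also have "\<dots> = sw W y (\<lambda>b c. r32 W (c31 W (c21 W G)) x b c)"
    unfolding op_defs by (rule sw_cong, simp, simp, simp, rule rr_cong, simp, simp, rule tt_swap) simp_all
  finally show ?thesis .
qed

lemma hat_comul_lift:
  assumes F: "bilin K H H W F" and W: "module K W" and h: "h \<in> carrier H"
  shows "hw W h F = rr W (\<lambda>s t. rr W (\<lambda>s' t'. sw W h (\<lambda>a b. F (t \<otimes> a \<otimes> t') (b \<otimes> s' \<otimes> Si s))))"
proof -
  note L = HH.lift_hom[OF F W]
  note [simp] = W h module_hom_comp[OF L] bilin_comp[OF F] HH.lift_pure[OF F W]
  have "hw W h F = rr W (\<lambda>s t. tensor_lift W F (rr HH (\<lambda>s' t'. sw HH h (\<lambda>a b. pure K H H (t \<otimes> a \<otimes> t') (b \<otimes> s' \<otimes> Si s)))))"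
    unfolding hat_comul_def Let_def by (rule hom_rr(1)[OF L]) simp_all
  also have "\<dots> = rr W (\<lambda>s t. rr W (\<lambda>s' t'. tensor_lift W F (sw HH h (\<lambda>a b. pure K H H (t \<otimes> a \<otimes> t') (b \<otimes> s' \<otimes> Si s)))))"
    by (rule rr_cong, simp, simp, rule hom_rr(1)[OF L]) simp_all
  also have "\<dots> = rr W (\<lambda>s t. rr W (\<lambda>s' t'. sw W h (\<lambda>a b. tensor_lift W F (pure K H H (t \<otimes> a \<otimes> t') (b \<otimes> s' \<otimes> Si s)))))"
    by (rule rr_cong, simp, simp, rule rr_cong, simp, simp, rule hom_sw[OF L]) simp_all
  also have "\<dots> = rr W (\<lambda>s t. rr W (\<lambda>s' t'. sw W h (\<lambda>a b. F (t \<otimes> a \<otimes> t') (b \<otimes> s' \<otimes> Si s))))"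
    by (rule rr_cong, simp, simp, rule rr_cong, simp, simp, rule sw_cong) simp_all
  finally show ?thesis .
qed

lemma hat_comul_hom: "hat_comul K H R \<in> module_hom K H HH"
proof -
  have "hat_comul K H R = (\<lambda>h. rr HH (\<lambda>sj tj. rr HH (\<lambda>si ti. sw HH h (\<lambda>h1 h2. pure K H H (tj \<otimes> h1 \<otimes> ti) (h2 \<otimes> si \<otimes> Si sj)))))"
    by (simp add: hat_comul_def Let_def fun_eq_iff)
  then show ?thesis by simp
qed

lemma hat_comul_closed [simp]: "h \<in> carrier H \<Longrightarrow> hat_comul K H R h \<in> carrier HH"
  by (rule module_homD(1)[OF hat_comul_hom])

lemma hw_closed [simp]:
  "module K W \<Longrightarrow> bilin K H H W F \<Longrightarrow> h \<in> carrier H \<Longrightarrow> hw W h F \<in> carrier W"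
  by (rule module_homD(1)[OF HH.lift_hom hat_comul_closed])

lemma lin_hw1 [simp]:
  assumes "module K W" "module K Y" "h \<in> carrier H"
    "\<forall>x\<in>carrier Y. bilin K H H W (F x)" "\<forall>u\<in>carrier H. \<forall>v\<in>carrier H. (\<lambda>x. F x u v) \<in> module_hom K Y W"
  shows "(\<lambda>x. hw W h (F x)) \<in> module_hom K Y W"
  by (rule HH.lift_param) (use assms in auto)

lemma lin_hw2 [simp]:
  assumes "module K W" "bilin K H H W F" "g \<in> module_hom K Y H"
  shows "(\<lambda>x. hw W (g x) F) \<in> module_hom K Y W"
  by (rule module_hom_comp[OF HH.lift_hom[OF assms(2,1)] module_hom_comp[OF hat_comul_hom assms(3)]])

lemma hw_cong:
  "module K W \<Longrightarrow> h \<in> carrier H \<Longrightarrow> bilin K H H W F \<Longrightarrow>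
   (\<And>a b. a \<in> carrier H \<Longrightarrow> b \<in> carrier H \<Longrightarrow> F a b = G a b) \<Longrightarrow> hw W h F = hw W h G"
  by (rule HH.lift_cong) auto

lemma hom_hw:
  "g \<in> module_hom K W Z \<Longrightarrow> module K W \<Longrightarrow> module K Z \<Longrightarrow> h \<in> carrier H \<Longrightarrow> bilin K H H W F \<Longrightarrow>
   g (hw W h F) = hw Z h (\<lambda>a b. g (F a b))"
  by (rule HH.hom_lift) auto

text \<open>In \<open>hat_comul\<close> the copy of R carrying S^{-1} is the outermost sum.
  Interchanging sums puts \<Delta> outside and that copy innermost, which is the shape on which the
  operator identities act.\<close>

lemma hw_eq:
  assumes F: "bilin K H H W F" and W: "module K W" and [simp]: "h \<in> carrier H"
  shows "hw W h F = sw W h (\<lambda>a b. r2 W (c2 W F) a b)"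
proof -
  note [simp] = W bilin_comp[OF F]
  have "hw W h F = rr W (\<lambda>s t. rr W (\<lambda>s' t'. sw W h (\<lambda>a b. F (t \<otimes> a \<otimes> t') (b \<otimes> s' \<otimes> Si s))))"
    by (rule hat_comul_lift[OF F W]) simp
  also have "\<dots> = rr W (\<lambda>s t. sw W h (\<lambda>a b. rr W (\<lambda>s' t'. F (t \<otimes> a \<otimes> t') (b \<otimes> s' \<otimes> Si s))))"
    by (rule rr_cong, simp, simp, rule tt_swap) simp_all
  also have "\<dots> = sw W h (\<lambda>a b. rr W (\<lambda>s t. rr W (\<lambda>s' t'. F (t \<otimes> a \<otimes> t') (b \<otimes> s' \<otimes> Si s))))"
    by (rule tt_swap) simp_all
  also have "\<dots> = sw W h (\<lambda>a b. rr W (\<lambda>s' t'. rr W (\<lambda>s t. F (t \<otimes> a \<otimes> t') (b \<otimes> s' \<otimes> Si s))))"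
    by (rule sw_cong, simp, simp, simp, rule tt_swap) simp_all
  also have "\<dots> = sw W h (\<lambda>a b. r2 W (c2 W F) a b)"
    unfolding r2_def c2_def by (rule sw_cong, simp, simp, simp, rule rr_cong, simp, simp, rule rr_cong) (simp_all add: H.m_assoc)
  finally show ?thesis .
qed

lemma r2_c2_cong:
  assumes F: "bilin K H H W F" and W: "module K W" and [simp]: "x \<in> carrier H" "y \<in> carrier H"
    and e: "\<And>a b. a \<in> carrier H \<Longrightarrow> b \<in> carrier H \<Longrightarrow> F a b = G a b"
  shows "r2 W F x y = r2 W G x y" "c2 W F x y = c2 W G x y"
proof -
  note [simp] = W bilin_comp[OF F]
  show "r2 W F x y = r2 W G x y" "c2 W F x y = c2 W G x y"
    unfolding r2_def c2_def by (rule rr_cong; simp add: e)+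
qed

lemma hat_coassoc:
  assumes F: "trilin K H H H W F" and W: "module K W" and [simp]: "h \<in> carrier H"
  shows "hw W h (\<lambda>a b. hw W a (\<lambda>a1 a2. F a1 a2 b)) = hw W h (\<lambda>a b. hw W b (\<lambda>b1 b2. F a b1 b2))"
proof -
  note t = trilin_op[OF _ W]
  note [simp] = W trilin_comp[OF F] 
  note lins = trilin_comp[OF t(1)] trilin_comp[OF t(2)] trilin_comp[OF t(3)] trilin_comp[OF t(4)] trilin_comp[OF t(5)] trilin_comp[OF t(6)] t F
  have e1: "r2 W (c2 W (\<lambda>a b. F a b z)) = (\<lambda>a b. r21 W (c21 W F) a b z)"
    and e2: "r2 W (c2 W (\<lambda>a b. F x a b)) = (\<lambda>a b. r32 W (c32 W F) x a b)" for x z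
    by (simp_all add: fun_eq_iff r2_def c2_def op_defs)
  \<comment> \<open>\<open>?L\<close> and \<open>?R\<close> are the operator words that the two
    iterated twists place between the iterated ordinary coproduct and \<open>F\<close>. They differ
    by moving \<open>c32\<close> and \<open>c31\<close> past \<open>r21\<close>, one Yang-Baxter
    move, and the interchange of \<open>c32\<close> with \<open>c21\<close>; ordinary
    coassociativity does the rest.\<close>
  let ?L = "r32 W (r31 W (c31 W (c32 W (r21 W (c21 W F)))))"
  let ?R = "r21 W (r31 W (r32 W (c31 W (c21 W (c32 W F)))))"
  have "teq ?L (r32 W (r31 W (c31 W (r21 W (c32 W (c21 W F))))))"
    by (intro teq_op c32_r21 t F W)
  also have "teq \<dots> (r32 W (r31 W (r21 W (c31 W (c32 W (c21 W F))))))"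
    by (intro teq_op c31_r21 t F W)
  also have "teq \<dots> (r21 W (r31 W (r32 W (c31 W (c32 W (c21 W F))))))"
    by (intro r32_r31_r21 t F W)
  also have "teq \<dots> ?R"
    by (intro teq_op c32_c21 t F W)
  finally have LR: "teq ?L ?R" .
  have 1: "bilin K H H W (\<lambda>x z. hw W x (\<lambda>a1 a2. F a1 a2 z))"
    and 2: "bilin K H H W (\<lambda>x y. hw W y (\<lambda>b1 b2. F x b1 b2))"
    by simp_all
  have 3: "bilin K H H W (\<lambda>x z. sw W x (\<lambda>a b. c31 W (c32 W (r21 W (c21 W F))) a b z))"
    and 4: "bilin K H H W (\<lambda>x y. sw W y (\<lambda>b c. r32 W (c31 W (c21 W (c32 W F))) x b c))"
    by (simp_all add: lins)
  have "hw W h (\<lambda>a b. hw W a (\<lambda>a1 a2. F a1 a2 b)) = sw W h (\<lambda>x z. r2 W (c2 W (\<lambda>x z. hw W x (\<lambda>a1 a2. F a1 a2 z))) x z)"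
    by (rule hw_eq) simp_all
  also have "\<dots> = sw W h (\<lambda>x z. r2 W (\<lambda>x z. sw W x (\<lambda>a b. c31 W (c32 W (r21 W (c21 W F))) a b z)) x z)"
  proof (rule sw_cong[OF W _ bilin_r2[OF bilin_c2[OF 1 W] W]], simp, rule r2_c2_cong(1)[OF bilin_c2[OF 1 W] W], simp, simp)
    fix x z assume [simp]: "x \<in> carrier H" "z \<in> carrier H"
    have "c2 W (\<lambda>x z. hw W x (\<lambda>a1 a2. F a1 a2 z)) x z = c2 W (\<lambda>x z. sw W x (\<lambda>a b. r21 W (c21 W F) a b z)) x z"
      by (rule r2_c2_cong(2)[OF 1 W], simp, simp, subst hw_eq) (simp_all add: e1 e2)
    then show "c2 W (\<lambda>x z. hw W x (\<lambda>a1 a2. F a1 a2 z)) x z = sw W x (\<lambda>a b. c31 W (c32 W (r21 W (c21 W F))) a b z)"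
      using comul_left_c2[OF t(1)[OF t(4)[OF F]] W, of x z] by simp
  qed
  also have "\<dots> = sw W h (\<lambda>x z. sw W x (\<lambda>a b. ?L a b z))"
    by (rule sw_cong[OF W _ bilin_r2[OF 3 W]], simp, rule comul_left_r2) (simp_all add: t F)
  also have "\<dots> = sw W h (\<lambda>x z. sw W x (\<lambda>a b. ?R a b z))"
    by (rule sw_cong, simp, simp, simp add: lins, rule sw_cong) (use LR in \<open>simp_all add: lins teq_def\<close>)
  also have "\<dots> = sw W h (\<lambda>x y. sw W y (\<lambda>b c. ?R x b c))"
    by (rule coassoc) (simp_all add: t F)
  also have "\<dots> = sw W h (\<lambda>x y. r2 W (\<lambda>x y. sw W y (\<lambda>b c. r32 W (c31 W (c21 W (c32 W F))) x b c)) x y)"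
    by (rule sw_cong[symmetric, OF W _ bilin_r2[OF 4 W]], simp, rule comul_right_r2) (simp_all add: t F)
  also have "\<dots> = sw W h (\<lambda>x y. r2 W (c2 W (\<lambda>x y. hw W y (\<lambda>b1 b2. F x b1 b2))) x y)"
  proof (rule sw_cong[symmetric, OF W _ bilin_r2[OF bilin_c2[OF 2 W] W]], simp, rule r2_c2_cong(1)[OF bilin_c2[OF 2 W] W], simp, simp)
    fix x y assume [simp]: "x \<in> carrier H" "y \<in> carrier H"
    have "c2 W (\<lambda>x y. hw W y (\<lambda>b1 b2. F x b1 b2)) x y = c2 W (\<lambda>x y. sw W y (\<lambda>b c. r32 W (c32 W F) x b c)) x y"
      by (rule r2_c2_cong(2)[OF 2 W], simp, simp, subst hw_eq) (simp_all add: e1 e2)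
    then show "c2 W (\<lambda>x y. hw W y (\<lambda>b1 b2. F x b1 b2)) x y = sw W y (\<lambda>b c. r32 W (c31 W (c21 W (c32 W F))) x b c)"
      using comul_right_c2[OF t(6)[OF F] W, of x y] by simp
  qed
  also have "\<dots> = hw W h (\<lambda>a b. hw W b (\<lambda>b1 b2. F a b1 b2))"
    by (rule hw_eq[symmetric]) simp_all
  finally show ?thesis .
qed

text \<open>\<epsilon> is multiplicative, so it falls separately on a factor of the coproduct of
  \<open>h\<close> and on a leg of each copy of R. The counit axiom removes the first, and
  \<open>R_counit_right\<close> or \<open>R_counit_left\<close> replaces the remaining legs of R by
  1.\<close>

lemma hat_counit:
  assumes g: "g \<in> module_hom K H W" and W: "module K W" and [simp]: "h \<in> carrier H"
  shows "hw W h (\<lambda>a b. \<epsilon> a \<odot>\<^bsub>W\<^esub> g b) = g h" "hw W h (\<lambda>a b. \<epsilon> b \<odot>\<^bsub>W\<^esub> g a) = g h"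
proof -
  interpret W: module K W by fact
  note [simp] = W module_hom_comp[OF g] module_homD(1)[OF g]
  have "hw W h (\<lambda>a b. \<epsilon> a \<odot>\<^bsub>W\<^esub> g b)
     = rr W (\<lambda>s t. rr W (\<lambda>s' t'. sw W h (\<lambda>a b. \<epsilon> (t \<otimes> a \<otimes> t') \<odot>\<^bsub>W\<^esub> g (b \<otimes> s' \<otimes> Si s))))"
    by (rule hat_comul_lift) simp_all
  also have "\<dots> = rr W (\<lambda>s t. rr W (\<lambda>s' t'. sw W h (\<lambda>a b. \<epsilon> a \<odot>\<^bsub>W\<^esub> (\<epsilon> t' \<odot>\<^bsub>W\<^esub> (\<epsilon> t \<odot>\<^bsub>W\<^esub> g (b \<otimes> s' \<otimes> Si s))))))"
    by (rule rr_cong, simp, simp, rule rr_cong, simp, simp, rule sw_cong) (simp_all add: W.smult_assoc1[symmetric] K.m_ac)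
  also have "\<dots> = rr W (\<lambda>s t. rr W (\<lambda>s' t'. \<epsilon> t' \<odot>\<^bsub>W\<^esub> (\<epsilon> t \<odot>\<^bsub>W\<^esub> g (h \<otimes> s' \<otimes> Si s))))"
    by (rule rr_cong, simp, simp, rule rr_cong, simp, simp, rule sw_counit_left) simp_all
  also have "\<dots> = rr W (\<lambda>s t. \<epsilon> t \<odot>\<^bsub>W\<^esub> g (h \<otimes> \<one> \<otimes> Si s))"
    by (rule rr_cong, simp, simp, rule R_counit_right) simp_all
  also have "\<dots> = g (h \<otimes> \<one> \<otimes> Si \<one>)" by (rule R_counit_right) simp_all
  finally show "hw W h (\<lambda>a b. \<epsilon> a \<odot>\<^bsub>W\<^esub> g b) = g h" by simp
  have "hw W h (\<lambda>a b. \<epsilon> b \<odot>\<^bsub>W\<^esub> g a)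
     = rr W (\<lambda>s t. rr W (\<lambda>s' t'. sw W h (\<lambda>a b. \<epsilon> (b \<otimes> s' \<otimes> Si s) \<odot>\<^bsub>W\<^esub> g (t \<otimes> a \<otimes> t'))))"
    by (rule hat_comul_lift) simp_all
  also have "\<dots> = rr W (\<lambda>s t. rr W (\<lambda>s' t'. sw W h (\<lambda>a b. \<epsilon> b \<odot>\<^bsub>W\<^esub> (\<epsilon> s' \<odot>\<^bsub>W\<^esub> (\<epsilon> s \<odot>\<^bsub>W\<^esub> g (t \<otimes> a \<otimes> t'))))))"
    by (rule rr_cong, simp, simp, rule rr_cong, simp, simp, rule sw_cong) (simp_all add: W.smult_assoc1[symmetric] K.m_ac)
  also have "\<dots> = rr W (\<lambda>s t. rr W (\<lambda>s' t'. \<epsilon> s' \<odot>\<^bsub>W\<^esub> (\<epsilon> s \<odot>\<^bsub>W\<^esub> g (t \<otimes> h \<otimes> t'))))"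
    by (rule rr_cong, simp, simp, rule rr_cong, simp, simp, rule sw_counit_right) simp_all
  also have "\<dots> = rr W (\<lambda>s t. \<epsilon> s \<odot>\<^bsub>W\<^esub> g (t \<otimes> h \<otimes> \<one>))"
    by (rule rr_cong, simp, simp, rule R_counit_left) simp_all
  also have "\<dots> = g (\<one> \<otimes> h \<otimes> \<one>)" by (rule R_counit_left) simp_all
  finally show "hw W h (\<lambda>a b. \<epsilon> b \<odot>\<^bsub>W\<^esub> g a) = g h" by simp
qed

section \<open>Identities in H behind the K-matrix and the coaction\<close>

lemma c2_cancel:
  assumes F: "bilin K H H W F" and W: "module K W" and [simp]: "x \<in> carrier H" "y \<in> carrier H"
  shows "c2 W (\<lambda>a b. rr W (\<lambda>s t. F (t \<otimes> a) (b \<otimes> s))) x y = F x y"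
proof -
  note [simp] = W bilin_comp[OF F]
  have "c2 W (\<lambda>a b. rr W (\<lambda>s t. F (t \<otimes> a) (b \<otimes> s))) x y
      = rr W (\<lambda>s' t'. rr W (\<lambda>s t. F (t \<otimes> t' \<otimes> x) (y \<otimes> (Si s' \<otimes> s))))"
    unfolding c2_def by (rule rr_cong, simp, simp, rule rr_cong) (simp_all add: H.m_assoc)
  also have "\<dots> = rr W (\<lambda>s t. rr W (\<lambda>s' t'. F (t \<otimes> t' \<otimes> x) (y \<otimes> (Si s' \<otimes> s))))"
    by (rule tt_swap) simp_all
  also have "\<dots> = F (\<one> \<otimes> x) (y \<otimes> \<one>)"
    by (rule R_Si(2)[where F = "\<lambda>a b. F (b \<otimes> x) (y \<otimes> a)"]) simp_all
  finally show ?thesis by simp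
qed

text \<open>The extra sum in front of \<open>F\<close> inverts the \<open>c2\<close> part of the
  twist by \<open>R_Si\<close>, leaving \<Delta> followed by \<open>r2\<close>. It applies whenever
  a copy of R21 stands between the two factors of the twisted coproduct, as in K23 R21 K13.\<close>

lemma hat_cancel:
  assumes F: "bilin K H H W F" and W: "module K W" and [simp]: "h \<in> carrier H"
  shows "hw W h (\<lambda>a b. rr W (\<lambda>s t. F (t \<otimes> a) (b \<otimes> s))) = sw W h (\<lambda>a b. rr W (\<lambda>s t. F (a \<otimes> t) (b \<otimes> s)))"
proof -
  note [simp] = W bilin_comp[OF F]
  have "hw W h (\<lambda>a b. rr W (\<lambda>s t. F (t \<otimes> a) (b \<otimes> s))) = sw W h (\<lambda>a b. r2 W (c2 W (\<lambda>a b. rr W (\<lambda>s t. F (t \<otimes> a) (b \<otimes> s)))) a b)"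
    by (rule hw_eq) simp_all
  also have "\<dots> = sw W h (\<lambda>a b. r2 W F a b)"
    by (rule sw_cong[OF W _ bilin_r2[OF bilin_c2[OF _ W] W]], simp, simp, rule r2_c2_cong(1)[OF bilin_c2[OF _ W] W])
       (simp_all add: c2_cancel[OF F W])
  finally show ?thesis by (simp add: r2_def)
qed

text \<open>The candidate inverse is built to fit \<open>hat_cancel\<close>: multiplied by
  \<open>b\<close> it depends on b s and t a. After the cancellation R meets R^{-1} in h2 (s s')
  S^{-1}(t t') S^{-1}(h1), and h2 S^{-1}(h1) remains.\<close>

lemma K_ref_right_inverse:
  assumes [simp]: "h \<in> carrier H"
  shows "hw H h (\<lambda>a b. b \<otimes> rr H (\<lambda>s t. ri H (\<lambda>s' t'. s \<otimes> s' \<otimes> Si t' \<otimes> Si a \<otimes> Si t))) = \<epsilon> h \<odot>\<^bsub>H\<^esub> \<one>"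
proof -
  have "hw H h (\<lambda>a b. b \<otimes> rr H (\<lambda>s t. ri H (\<lambda>s' t'. s \<otimes> s' \<otimes> Si t' \<otimes> Si a \<otimes> Si t)))
    = hw H h (\<lambda>a b. rr H (\<lambda>s t. ri H (\<lambda>s' t'. (b \<otimes> s) \<otimes> s' \<otimes> Si t' \<otimes> Si (t \<otimes> a))))"
  proof (rule hw_cong, simp, simp, simp)
    fix a b assume [simp]: "a \<in> carrier H" "b \<in> carrier H"
    have "b \<otimes> rr H (\<lambda>s t. ri H (\<lambda>s' t'. s \<otimes> s' \<otimes> Si t' \<otimes> Si a \<otimes> Si t)) = rr H (\<lambda>s t. b \<otimes> ri H (\<lambda>s' t'. s \<otimes> s' \<otimes> Si t' \<otimes> Si a \<otimes> Si t))"
      by (rule hom_rr(1)) simp_all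
    also have "\<dots> = rr H (\<lambda>s t. ri H (\<lambda>s' t'. b \<otimes> (s \<otimes> s' \<otimes> Si t' \<otimes> Si a \<otimes> Si t)))"
      by (rule rr_cong, simp, simp, rule hom_rr(2)) simp_all
    also have "\<dots> = rr H (\<lambda>s t. ri H (\<lambda>s' t'. (b \<otimes> s) \<otimes> s' \<otimes> Si t' \<otimes> Si (t \<otimes> a)))"
      by (rule rr_cong, simp, simp, rule rr_cong(2)) (simp_all add: H.m_assoc Si_mult)
    finally show "b \<otimes> rr H (\<lambda>s t. ri H (\<lambda>s' t'. s \<otimes> s' \<otimes> Si t' \<otimes> Si a \<otimes> Si t)) = rr H (\<lambda>s t. ri H (\<lambda>s' t'. (b \<otimes> s) \<otimes> s' \<otimes> Si t' \<otimes> Si (t \<otimes> a)))" .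
  qed
  also have "\<dots> = sw H h (\<lambda>a b. rr H (\<lambda>s t. ri H (\<lambda>s' t'. (b \<otimes> s) \<otimes> s' \<otimes> Si t' \<otimes> Si (a \<otimes> t))))"
    by (rule hat_cancel[where F = "\<lambda>x y. ri H (\<lambda>s' t'. y \<otimes> s' \<otimes> Si t' \<otimes> Si x)"]) simp_all
  also have "\<dots> = sw H h (\<lambda>a b. rr H (\<lambda>s t. ri H (\<lambda>s' t'. b \<otimes> (s \<otimes> s') \<otimes> Si (t \<otimes> t') \<otimes> Si a)))"
    by (rule sw_cong, simp, simp, simp, rule rr_cong, simp, simp, rule rr_cong(2)) (simp_all add: H.m_assoc Si_mult)
  also have "\<dots> = sw H h (\<lambda>a b. b \<otimes> \<one> \<otimes> Si \<one> \<otimes> Si a)"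
    by (rule sw_cong, simp, simp, simp, rule R_inverse(1)) simp_all
  also have "\<dots> = sw H h (\<lambda>a b. b \<otimes> Si a)"
    by (rule sw_cong) simp_all
  also have "\<dots> = \<epsilon> h \<odot>\<^bsub>H\<^esub> \<one>"
    by (rule sw_Si_left(1)[where g = "\<lambda>x. x"]) simp_all
  finally show ?thesis .
qed

text \<open>Again built to fit \<open>hat_cancel\<close>, but with S in place of S^{-1}. The result
  is S(h2 s) S(s') t' h1 t, with the factors of the coproduct in the wrong order. R\<Delta> =
  \<Delta>^op R exchanges them, R^{-1} R cancels, and S(h1) h2 remains.\<close>

lemma K_ref_left_inverse:
  assumes [simp]: "h \<in> carrier H"
  shows "hw H h (\<lambda>a b. rr H (\<lambda>s t. ri H (\<lambda>s' t'. S s \<otimes> S b \<otimes> S s' \<otimes> t' \<otimes> t)) \<otimes> a) = \<epsilon> h \<odot>\<^bsub>H\<^esub> \<one>"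
proof -
  have "hw H h (\<lambda>a b. rr H (\<lambda>s t. ri H (\<lambda>s' t'. S s \<otimes> S b \<otimes> S s' \<otimes> t' \<otimes> t)) \<otimes> a)
    = hw H h (\<lambda>a b. rr H (\<lambda>s t. ri H (\<lambda>s' t'. S (b \<otimes> s) \<otimes> S s' \<otimes> t' \<otimes> (t \<otimes> a))))"
  proof (rule hw_cong, simp, simp, simp)
    fix a b assume [simp]: "a \<in> carrier H" "b \<in> carrier H"
    have "rr H (\<lambda>s t. ri H (\<lambda>s' t'. S s \<otimes> S b \<otimes> S s' \<otimes> t' \<otimes> t)) \<otimes> a = rr H (\<lambda>s t. ri H (\<lambda>s' t'. S s \<otimes> S b \<otimes> S s' \<otimes> t' \<otimes> t) \<otimes> a)"
      by (rule hom_rr(1)) simp_all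
    also have "\<dots> = rr H (\<lambda>s t. ri H (\<lambda>s' t'. S s \<otimes> S b \<otimes> S s' \<otimes> t' \<otimes> t \<otimes> a))"
      by (rule rr_cong, simp, simp, rule hom_rr(2)) simp_all
    also have "\<dots> = rr H (\<lambda>s t. ri H (\<lambda>s' t'. S (b \<otimes> s) \<otimes> S s' \<otimes> t' \<otimes> (t \<otimes> a)))"
      by (rule rr_cong, simp, simp, rule rr_cong(2)) (simp_all add: H.m_assoc antipode_mult)
    finally show "rr H (\<lambda>s t. ri H (\<lambda>s' t'. S s \<otimes> S b \<otimes> S s' \<otimes> t' \<otimes> t)) \<otimes> a = rr H (\<lambda>s t. ri H (\<lambda>s' t'. S (b \<otimes> s) \<otimes> S s' \<otimes> t' \<otimes> (t \<otimes> a)))" .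
  qed
  also have "\<dots> = sw H h (\<lambda>a b. rr H (\<lambda>s t. ri H (\<lambda>s' t'. S (b \<otimes> s) \<otimes> S s' \<otimes> t' \<otimes> (a \<otimes> t))))"
    by (rule hat_cancel[where F = "\<lambda>x y. ri H (\<lambda>s' t'. S y \<otimes> S s' \<otimes> t' \<otimes> x)"]) simp_all
  also have "\<dots> = rr H (\<lambda>s t. sw H h (\<lambda>a b. ri H (\<lambda>s' t'. S (b \<otimes> s) \<otimes> S s' \<otimes> t' \<otimes> (a \<otimes> t))))"
    by (rule tt_swap) simp_all
  also have "\<dots> = rr H (\<lambda>s t. sw H h (\<lambda>a b. ri H (\<lambda>s' t'. S (s \<otimes> a) \<otimes> S s' \<otimes> t' \<otimes> (t \<otimes> b))))"
    by (rule R_comul_op[symmetric, where F = "\<lambda>u v. ri H (\<lambda>s' t'. S u \<otimes> S s' \<otimes> t' \<otimes> v)"]) simp_all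
  also have "\<dots> = sw H h (\<lambda>a b. rr H (\<lambda>s t. ri H (\<lambda>s' t'. S (s \<otimes> a) \<otimes> S s' \<otimes> t' \<otimes> (t \<otimes> b))))"
    by (rule tt_swap) simp_all
  also have "\<dots> = sw H h (\<lambda>a b. ri H (\<lambda>s' t'. rr H (\<lambda>s t. S (s \<otimes> a) \<otimes> S s' \<otimes> t' \<otimes> (t \<otimes> b))))"
    by (rule sw_cong, simp, simp, simp, rule tt_swap) simp_all
  also have "\<dots> = sw H h (\<lambda>a b. ri H (\<lambda>s' t'. rr H (\<lambda>s t. S a \<otimes> (S (s' \<otimes> s) \<otimes> (t' \<otimes> t)) \<otimes> b)))"
    by (rule sw_cong, simp, simp, simp, rule rr_cong(2), simp, simp, rule rr_cong) (simp_all add: H.m_assoc antipode_mult)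
  also have "\<dots> = sw H h (\<lambda>a b. S a \<otimes> (S \<one> \<otimes> \<one>) \<otimes> b)"
    by (rule sw_cong, simp, simp, simp, rule R_inverse(2)[where F = "\<lambda>x y. S _ \<otimes> (S x \<otimes> y) \<otimes> _"]) simp_all
  also have "\<dots> = sw H h (\<lambda>a b. S a \<otimes> b)"
    by (rule sw_cong) simp_all
  also have "\<dots> = \<epsilon> h \<odot>\<^bsub>H\<^esub> \<one>"
    by (rule sw_antipode_left[where g = "\<lambda>x. x"]) simp_all
  finally show ?thesis .
qed

text \<open>Evaluated at \<open>h\<close>, this is the axiom K\<delta> = \<delta>K. On the left
  \<open>hat_cancel\<close> removes the S^{-1} of the twist, and R\<Delta> = \<Delta>^op R carries
  the coproduct of \<open>h\<close> past one copy of R. On the right, fact \<open>c\<close> cancels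
  that S^{-1} against the second copy of R inside \<delta>. Both sides become the sum of F (tj h2
  si) (sj h1 ti), with \<open>r2\<close> providing the pair si, ti on the right.\<close>

lemma K_ref_commute:
  assumes F: "bilin K H H W F" and W: "module K W" and [simp]: "h \<in> carrier H"
  shows "hw W h (\<lambda>a b. rr W (\<lambda>sj tj. rr W (\<lambda>si ti. F (tj \<otimes> a \<otimes> si) (b \<otimes> (sj \<otimes> ti)))))
       = hw W h (\<lambda>a b. rr W (\<lambda>sj tj. rr W (\<lambda>si ti. F (tj \<otimes> b \<otimes> si) (sj \<otimes> ti \<otimes> a))))"
proof -
  note [simp] = W bilin_comp[OF F]
  have "hw W h (\<lambda>a b. rr W (\<lambda>sj tj. rr W (\<lambda>si ti. F (tj \<otimes> a \<otimes> si) (b \<otimes> (sj \<otimes> ti)))))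
      = hw W h (\<lambda>a b. rr W (\<lambda>sj tj. rr W (\<lambda>si ti. F (tj \<otimes> a \<otimes> si) (b \<otimes> sj \<otimes> ti))))"
    by (rule hw_cong, simp, simp, simp, rule rr_cong, simp, simp, rule rr_cong) (simp_all add: H.m_assoc)
  also have "\<dots> = sw W h (\<lambda>a b. rr W (\<lambda>sj tj. rr W (\<lambda>si ti. F (a \<otimes> tj \<otimes> si) (b \<otimes> sj \<otimes> ti))))"
    by (rule hat_cancel[where F = "\<lambda>x y. rr W (\<lambda>si ti. F (x \<otimes> si) (y \<otimes> ti))"]) simp_all
  also have "\<dots> = rr W (\<lambda>sj tj. sw W h (\<lambda>a b. rr W (\<lambda>si ti. F (a \<otimes> tj \<otimes> si) (b \<otimes> sj \<otimes> ti))))"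
    by (rule tt_swap) simp_all
  also have "\<dots> = rr W (\<lambda>sj tj. sw W h (\<lambda>a b. rr W (\<lambda>si ti. F (tj \<otimes> b \<otimes> si) (sj \<otimes> a \<otimes> ti))))"
    by (rule R_comul_op[symmetric, where F = "\<lambda>u v. rr W (\<lambda>si ti. F (v \<otimes> si) (u \<otimes> ti))"]) simp_all
  also have "\<dots> = sw W h (\<lambda>a b. rr W (\<lambda>sj tj. rr W (\<lambda>si ti. F (tj \<otimes> b \<otimes> si) (sj \<otimes> a \<otimes> ti))))"
    by (rule tt_swap) simp_all
  also have "\<dots> = sw W h (\<lambda>a b. rr W (\<lambda>si ti. rr W (\<lambda>sj tj. F (tj \<otimes> b \<otimes> si) (sj \<otimes> a \<otimes> ti))))"
    by (rule sw_cong, simp, simp, simp, rule tt_swap) simp_all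
  also have "\<dots> = sw W h (\<lambda>a b. r2 W (c2 W (\<lambda>a b. rr W (\<lambda>sj tj. rr W (\<lambda>si ti. F (tj \<otimes> b \<otimes> si) (sj \<otimes> ti \<otimes> a))))) a b)"
  proof (rule sw_cong, simp, simp, simp)
    fix a b assume [simp]: "a \<in> carrier H" "b \<in> carrier H"
    have c: "rr W (\<lambda>sj tj. F (tj \<otimes> y) (sj \<otimes> x)) = c2 W (\<lambda>a b. rr W (\<lambda>sj tj. rr W (\<lambda>si ti. F (tj \<otimes> b \<otimes> si) (sj \<otimes> ti \<otimes> a)))) x y"
      if [simp]: "x \<in> carrier H" "y \<in> carrier H" for x y
    proof -
      have "c2 W (\<lambda>a b. rr W (\<lambda>sj tj. rr W (\<lambda>si ti. F (tj \<otimes> b \<otimes> si) (sj \<otimes> ti \<otimes> a)))) x y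
        = rr W (\<lambda>s t. rr W (\<lambda>sj tj. rr W (\<lambda>si ti. F (tj \<otimes> (y \<otimes> Si s) \<otimes> si) (sj \<otimes> ti \<otimes> (t \<otimes> x)))))"
        by (simp add: c2_def)
      also have "\<dots> = rr W (\<lambda>s t. rr W (\<lambda>sj tj. rr W (\<lambda>si ti. F (tj \<otimes> y \<otimes> (Si s \<otimes> si)) (sj \<otimes> (ti \<otimes> t) \<otimes> x))))"
        by (rule rr_cong, simp, simp, rule rr_cong, simp, simp, rule rr_cong) (simp_all add: H.m_assoc)
      also have "\<dots> = rr W (\<lambda>sj tj. rr W (\<lambda>s t. rr W (\<lambda>si ti. F (tj \<otimes> y \<otimes> (Si s \<otimes> si)) (sj \<otimes> (ti \<otimes> t) \<otimes> x))))"
        by (rule tt_swap) simp_all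
      also have "\<dots> = rr W (\<lambda>sj tj. rr W (\<lambda>si ti. rr W (\<lambda>s t. F (tj \<otimes> y \<otimes> (Si s \<otimes> si)) (sj \<otimes> (ti \<otimes> t) \<otimes> x))))"
        by (rule rr_cong, simp, simp, rule tt_swap) simp_all
      also have "\<dots> = rr W (\<lambda>sj tj. F (tj \<otimes> y \<otimes> \<one>) (sj \<otimes> \<one> \<otimes> x))"
        by (rule rr_cong, simp, simp, rule R_Si(2)[where F = "\<lambda>u v. F (_ \<otimes> y \<otimes> u) (_ \<otimes> v \<otimes> x)"]) simp_all
      also have "\<dots> = rr W (\<lambda>sj tj. F (tj \<otimes> y) (sj \<otimes> x))"
        by (rule rr_cong) simp_all
      finally show ?thesis ..
    qed
    show "rr W (\<lambda>si ti. rr W (\<lambda>sj tj. F (tj \<otimes> b \<otimes> si) (sj \<otimes> a \<otimes> ti)))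
      = r2 W (c2 W (\<lambda>a b. rr W (\<lambda>sj tj. rr W (\<lambda>si ti. F (tj \<otimes> b \<otimes> si) (sj \<otimes> ti \<otimes> a))))) a b"
      (is "?l = _")
    proof -
      have "?l = rr W (\<lambda>s t. rr W (\<lambda>sj tj. F (tj \<otimes> (b \<otimes> s)) (sj \<otimes> (a \<otimes> t))))"
        by (rule rr_cong, simp, simp, rule rr_cong) (simp_all add: H.m_assoc)
      also have "\<dots> = rr W (\<lambda>s t. c2 W (\<lambda>a b. rr W (\<lambda>sj tj. rr W (\<lambda>si ti. F (tj \<otimes> b \<otimes> si) (sj \<otimes> ti \<otimes> a)))) (a \<otimes> t) (b \<otimes> s))"
        by (rule rr_cong, simp, simp, rule c) simp_all
      finally show ?thesis by (simp add: r2_def)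
    qed
  qed
  also have "\<dots> = hw W h (\<lambda>a b. rr W (\<lambda>sj tj. rr W (\<lambda>si ti. F (tj \<otimes> b \<otimes> si) (sj \<otimes> ti \<otimes> a))))"
    by (rule hw_eq[symmetric]) simp_all
  finally show ?thesis .
qed

text \<open>\<Delta>(sj ti) = \<Delta>(sj) \<Delta>(ti), and each of the two axioms for the
  coproduct of a leg of R splits one copy in two. The resulting four copies are those of the
  coaction applied twice.\<close>

lemma delta_coassoc:
  assumes F: "trilin K H H H W F" and W: "module K W" and [simp]: "h \<in> carrier H"
  shows "rr W (\<lambda>sj tj. rr W (\<lambda>si ti. sw W (sj \<otimes> ti) (F (tj \<otimes> h \<otimes> si))))
    = rr W (\<lambda>sk tk. rr W (\<lambda>sl tl. rr W (\<lambda>sj tj. rr W (\<lambda>si ti. F (tj \<otimes> (tk \<otimes> h \<otimes> sl) \<otimes> si) (sj \<otimes> ti) (sk \<otimes> tl)))))"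
proof -
  note [simp] = W trilin_comp[OF F]
  have "rr W (\<lambda>sj tj. rr W (\<lambda>si ti. sw W (sj \<otimes> ti) (F (tj \<otimes> h \<otimes> si))))
    = rr W (\<lambda>sj tj. rr W (\<lambda>si ti. sw W sj (\<lambda>a a'. sw W ti (\<lambda>b b'. F (tj \<otimes> h \<otimes> si) (a \<otimes> b) (a' \<otimes> b')))))"
    by (rule rr_cong, simp, simp, rule rr_cong, simp, simp, rule sw_mult) simp_all
  also have "\<dots> = rr W (\<lambda>sj tj. sw W sj (\<lambda>a a'. rr W (\<lambda>si ti. sw W ti (\<lambda>b b'. F (tj \<otimes> h \<otimes> si) (a \<otimes> b) (a' \<otimes> b')))))"
    by (rule rr_cong, simp, simp, rule tt_swap) simp_all
  also have "\<dots> = rr W (\<lambda>sj tj. sw W sj (\<lambda>a a'. rr W (\<lambda>sl tl. rr W (\<lambda>si ti. F (tj \<otimes> h \<otimes> (sl \<otimes> si)) (a \<otimes> ti) (a' \<otimes> tl)))))"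
    by (rule rr_cong, simp, simp, rule sw_cong, simp, simp, simp, rule R_comul_right) (simp_all add: trilin_def)
  also have "\<dots> = rr W (\<lambda>sj tj. rr W (\<lambda>sk tk. rr W (\<lambda>sl tl. rr W (\<lambda>si ti. F (tj \<otimes> tk \<otimes> h \<otimes> (sl \<otimes> si)) (sj \<otimes> ti) (sk \<otimes> tl)))))"
    by (rule R_comul_left) (simp_all add: trilin_def)
  also have "\<dots> = rr W (\<lambda>sj tj. rr W (\<lambda>sk tk. rr W (\<lambda>sl tl. rr W (\<lambda>si ti. F (tj \<otimes> (tk \<otimes> h \<otimes> sl) \<otimes> si) (sj \<otimes> ti) (sk \<otimes> tl)))))"
    by (rule rr_cong, simp, simp, rule rr_cong, simp, simp, rule rr_cong, simp, simp, rule rr_cong) (simp_all add: H.m_assoc)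
  also have "\<dots> = rr W (\<lambda>sk tk. rr W (\<lambda>sj tj. rr W (\<lambda>sl tl. rr W (\<lambda>si ti. F (tj \<otimes> (tk \<otimes> h \<otimes> sl) \<otimes> si) (sj \<otimes> ti) (sk \<otimes> tl)))))"
    by (rule tt_swap) simp_all
  also have "\<dots> = rr W (\<lambda>sk tk. rr W (\<lambda>sl tl. rr W (\<lambda>sj tj. rr W (\<lambda>si ti. F (tj \<otimes> (tk \<otimes> h \<otimes> sl) \<otimes> si) (sj \<otimes> ti) (sk \<otimes> tl)))))"
    by (rule rr_cong, simp, simp, rule tt_swap) simp_all
  finally show ?thesis .
qed

text \<open>
  Insert $\sum t_x t_q \otimes s_q S^{-1}(s_x) = 1 \otimes 1$, apply the Yang-Baxter equation
  and cancel the other copy of $S^{-1}$.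
\<close>

lemma yang_baxter_Si:
  assumes G: "trilin K H H H W G" and W: "module K W"
  shows "rr W (\<lambda>sp tp. rr W (\<lambda>sb tb. rr W (\<lambda>sd td. G (tp \<otimes> tb) (sd \<otimes> Si sp) (sb \<otimes> td))))
       = rr W (\<lambda>sk tk. rr W (\<lambda>sp tp. rr W (\<lambda>si ti. G (tk \<otimes> tp) (Si sp \<otimes> si) (ti \<otimes> sk))))"
proof -
  note [simp] = W trilin_comp[OF G]
  have "rr W (\<lambda>sp tp. rr W (\<lambda>sb tb. rr W (\<lambda>sd td. G (tp \<otimes> tb) (sd \<otimes> Si sp) (sb \<otimes> td)))) = rr W (\<lambda>sx tx. rr W (\<lambda>sk tk. rr W (\<lambda>si ti. G (tx \<otimes> (tk \<otimes> \<one>)) (\<one> \<otimes> (si \<otimes> Si sx)) (sk \<otimes> ti))))"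
    by (rule rr_cong, simp, simp, rule rr_cong, simp, simp, rule rr_cong) simp_all
  also have "\<dots> = rr W (\<lambda>sx tx. rr W (\<lambda>sk tk. rr W (\<lambda>si ti. rr W (\<lambda>sq tq. rr W (\<lambda>sp tp. G (tx \<otimes> (tk \<otimes> (tq \<otimes> tp))) ((Si sp \<otimes> sq) \<otimes> (si \<otimes> Si sx)) (sk \<otimes> ti))))))"
    by (rule rr_cong, simp, simp, rule rr_cong, simp, simp, rule rr_cong, simp, simp,
        rule R_Si(2)[symmetric, where F = "\<lambda>u v. G (_ \<otimes> (_ \<otimes> v)) (u \<otimes> (_ \<otimes> Si _)) (_ \<otimes> _)"]) simp_all
  also have "\<dots> = rr W (\<lambda>sx tx. rr W (\<lambda>sk tk. rr W (\<lambda>si ti. rr W (\<lambda>sq tq. rr W (\<lambda>sp tp. G (tx \<otimes> (tk \<otimes> tq) \<otimes> tp) (Si sp \<otimes> (sq \<otimes> si) \<otimes> Si sx) (sk \<otimes> ti))))))"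
    by (rule rr_cong, simp, simp, rule rr_cong, simp, simp, rule rr_cong, simp, simp, rule rr_cong, simp, simp, rule rr_cong) (simp_all add: H.m_assoc)
  also have "\<dots> = rr W (\<lambda>sx tx. rr W (\<lambda>sk tk. rr W (\<lambda>si ti. rr W (\<lambda>sp tp. rr W (\<lambda>sq tq. G (tx \<otimes> (tk \<otimes> tq) \<otimes> tp) (Si sp \<otimes> (sq \<otimes> si) \<otimes> Si sx) (sk \<otimes> ti))))))"
    by (rule rr_cong, simp, simp, rule rr_cong, simp, simp, rule rr_cong, simp, simp, rule tt_swap) simp_all
  also have "\<dots> = rr W (\<lambda>sx tx. rr W (\<lambda>sk tk. rr W (\<lambda>sp tp. rr W (\<lambda>si ti. rr W (\<lambda>sq tq. G (tx \<otimes> (tk \<otimes> tq) \<otimes> tp) (Si sp \<otimes> (sq \<otimes> si) \<otimes> Si sx) (sk \<otimes> ti))))))"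
    by (rule rr_cong, simp, simp, rule rr_cong, simp, simp, rule tt_swap) simp_all
  also have "\<dots> = rr W (\<lambda>sx tx. rr W (\<lambda>sp tp. rr W (\<lambda>sk tk. rr W (\<lambda>si ti. rr W (\<lambda>sq tq. G (tx \<otimes> (tk \<otimes> tq) \<otimes> tp) (Si sp \<otimes> (sq \<otimes> si) \<otimes> Si sx) (sk \<otimes> ti))))))"
    by (rule rr_cong, simp, simp, rule tt_swap) simp_all
  also have "\<dots> = rr W (\<lambda>sx tx. rr W (\<lambda>sp tp. rr W (\<lambda>sk tk. rr W (\<lambda>sq tq. rr W (\<lambda>si ti. G (tx \<otimes> (tk \<otimes> tq) \<otimes> tp) (Si sp \<otimes> (sq \<otimes> si) \<otimes> Si sx) (sk \<otimes> ti))))))"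
    by (rule rr_cong, simp, simp, rule rr_cong, simp, simp, rule rr_cong, simp, simp, rule tt_swap) simp_all
  also have "\<dots> = rr W (\<lambda>sx tx. rr W (\<lambda>sp tp. rr W (\<lambda>si ti. rr W (\<lambda>sq tq. rr W (\<lambda>sk tk. G (tx \<otimes> (tq \<otimes> tk) \<otimes> tp) (Si sp \<otimes> (si \<otimes> sq) \<otimes> Si sx) (ti \<otimes> sk))))))"
    by (rule rr_cong, simp, simp, rule rr_cong, simp, simp,
        rule yang_baxter[symmetric, where F = "\<lambda>a b c. G (_ \<otimes> c \<otimes> _) (Si _ \<otimes> a \<otimes> Si _) b"]) (simp_all add: trilin_def)
  also have "\<dots> = rr W (\<lambda>sx tx. rr W (\<lambda>sp tp. rr W (\<lambda>si ti. rr W (\<lambda>sq tq. rr W (\<lambda>sk tk. G (tx \<otimes> tq \<otimes> (tk \<otimes> tp)) (Si sp \<otimes> si \<otimes> (sq \<otimes> Si sx)) (ti \<otimes> sk))))))"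
    by (rule rr_cong, simp, simp, rule rr_cong, simp, simp, rule rr_cong, simp, simp, rule rr_cong, simp, simp, rule rr_cong) (simp_all add: H.m_assoc)
  also have "\<dots> = rr W (\<lambda>sx tx. rr W (\<lambda>sp tp. rr W (\<lambda>si ti. rr W (\<lambda>sk tk. rr W (\<lambda>sq tq. G (tx \<otimes> tq \<otimes> (tk \<otimes> tp)) (Si sp \<otimes> si \<otimes> (sq \<otimes> Si sx)) (ti \<otimes> sk))))))"
    by (rule rr_cong, simp, simp, rule rr_cong, simp, simp, rule rr_cong, simp, simp, rule tt_swap) simp_all
  also have "\<dots> = rr W (\<lambda>sx tx. rr W (\<lambda>sp tp. rr W (\<lambda>sk tk. rr W (\<lambda>si ti. rr W (\<lambda>sq tq. G (tx \<otimes> tq \<otimes> (tk \<otimes> tp)) (Si sp \<otimes> si \<otimes> (sq \<otimes> Si sx)) (ti \<otimes> sk))))))"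
    by (rule rr_cong, simp, simp, rule rr_cong, simp, simp, rule tt_swap) simp_all
  also have "\<dots> = rr W (\<lambda>sx tx. rr W (\<lambda>sk tk. rr W (\<lambda>sp tp. rr W (\<lambda>si ti. rr W (\<lambda>sq tq. G (tx \<otimes> tq \<otimes> (tk \<otimes> tp)) (Si sp \<otimes> si \<otimes> (sq \<otimes> Si sx)) (ti \<otimes> sk))))))"
    by (rule rr_cong, simp, simp, rule tt_swap) simp_all
  also have "\<dots> = rr W (\<lambda>sk tk. rr W (\<lambda>sx tx. rr W (\<lambda>sp tp. rr W (\<lambda>si ti. rr W (\<lambda>sq tq. G (tx \<otimes> tq \<otimes> (tk \<otimes> tp)) (Si sp \<otimes> si \<otimes> (sq \<otimes> Si sx)) (ti \<otimes> sk))))))"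
    by (rule tt_swap) simp_all
  also have "\<dots> = rr W (\<lambda>sk tk. rr W (\<lambda>sp tp. rr W (\<lambda>sx tx. rr W (\<lambda>si ti. rr W (\<lambda>sq tq. G (tx \<otimes> tq \<otimes> (tk \<otimes> tp)) (Si sp \<otimes> si \<otimes> (sq \<otimes> Si sx)) (ti \<otimes> sk))))))"
    by (rule rr_cong, simp, simp, rule tt_swap) simp_all
  also have "\<dots> = rr W (\<lambda>sk tk. rr W (\<lambda>sp tp. rr W (\<lambda>si ti. rr W (\<lambda>sx tx. rr W (\<lambda>sq tq. G (tx \<otimes> tq \<otimes> (tk \<otimes> tp)) (Si sp \<otimes> si \<otimes> (sq \<otimes> Si sx)) (ti \<otimes> sk))))))"
    by (rule rr_cong, simp, simp, rule rr_cong, simp, simp, rule tt_swap) simp_all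
  also have "\<dots> = rr W (\<lambda>sk tk. rr W (\<lambda>sp tp. rr W (\<lambda>si ti. G (\<one> \<otimes> (tk \<otimes> tp)) (Si sp \<otimes> si \<otimes> \<one>) (ti \<otimes> sk))))"
    by (rule rr_cong, simp, simp, rule rr_cong, simp, simp, rule rr_cong, simp, simp,
        rule R_Si(1)[where F = "\<lambda>u v. G (v \<otimes> (_ \<otimes> _)) (Si _ \<otimes> _ \<otimes> u) (_ \<otimes> _)"]) simp_all
  also have "\<dots> = rr W (\<lambda>sk tk. rr W (\<lambda>sp tp. rr W (\<lambda>si ti. G (tk \<otimes> tp) (Si sp \<otimes> si) (ti \<otimes> sk))))"
    by (rule rr_cong, simp, simp, rule rr_cong, simp, simp, rule rr_cong) simp_all
  finally show ?thesis .
qed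

text \<open>\<open>f13\<close> and \<open>f23\<close> are right multiplication by R13 and R23,
  \<open>g31\<close> and \<open>g32\<close> left multiplication by R31 and R32. They describe the
  copies of R in the coaction, whose H-leg is the third argument.\<close>

definition f13 where "f13 W F x y z = rr W (\<lambda>s t. F (x \<otimes> s) y (z \<otimes> t))"
definition f23 where "f23 W F x y z = rr W (\<lambda>s t. F x (y \<otimes> s) (z \<otimes> t))"
definition g31 where "g31 W F x y z = rr W (\<lambda>s t. F (t \<otimes> x) y (s \<otimes> z))"
definition g32 where "g32 W F x y z = rr W (\<lambda>s t. F x (t \<otimes> y) (s \<otimes> z))"

lemmas op_defs' = f13_def f23_def g31_def g32_def

lemma trilin_op':
  assumes F: "trilin K H H H W F" and W: "module K W"
  shows "trilin K H H H W (f13 W F)"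
    and "trilin K H H H W (f23 W F)"
    and "trilin K H H H W (g31 W F)"
    and "trilin K H H H W (g32 W F)"
proof -
  note [simp] = W trilin_comp[OF F]
  show "trilin K H H H W (f13 W F)" "trilin K H H H W (f23 W F)" "trilin K H H H W (g31 W F)" "trilin K H H H W (g32 W F)"
    by (simp_all add: trilin_def op_defs')
qed

lemma teq_op':
  assumes F: "trilin K H H H W F" and W: "module K W" and e: "teq F G"
  shows "teq (f13 W F) (f13 W G)"
    and "teq (f23 W F) (f23 W G)"
    and "teq (g31 W F) (g31 W G)"
    and "teq (g32 W F) (g32 W G)"
proof -
  note [simp] = W trilin_comp[OF F]
  show "teq (f13 W F) (f13 W G)" "teq (f23 W F) (f23 W G)" "teq (g31 W F) (g31 W G)" "teq (g32 W F) (g32 W G)"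
    using e by (auto simp: teq_def op_defs' intro!: rr_cong)
qed

lemma g31_r21:
  assumes F: "trilin K H H H W F" and W: "module K W"
  shows "teq (g31 W (r21 W F)) (r21 W (g31 W F))"
proof -
  note [simp] = W trilin_comp[OF F]
  show ?thesis unfolding teq_def op_defs op_defs'
    by (intro ballI, subst tt_swap, simp_all, rule rr_cong, simp, simp, rule rr_cong) (simp_all add: H.m_assoc)
qed

lemma g32_r21:
  assumes F: "trilin K H H H W F" and W: "module K W"
  shows "teq (g32 W (r21 W F)) (r21 W (g32 W F))"
proof -
  note [simp] = W trilin_comp[OF F]
  show ?thesis unfolding teq_def op_defs op_defs'
    by (intro ballI, subst tt_swap, simp_all, rule rr_cong, simp, simp, rule rr_cong) (simp_all add: H.m_assoc)
qed

text \<open>The Yang-Baxter equation with the first two tensor positions exchanged: R13 R23 R21 =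
  R21 R23 R13.\<close>

lemma f13_f23_r21:
  assumes F: "trilin K H H H W F" and W: "module K W"
  shows "teq (f13 W (f23 W (r21 W F))) (r21 W (f23 W (f13 W F)))"
  unfolding teq_def
proof (intro ballI)
  fix x y z assume [simp]: "x \<in> carrier H" "y \<in> carrier H" "z \<in> carrier H"
  note [simp] = W trilin_comp[OF F]
  have "f13 W (f23 W (r21 W F)) x y z = rr W (\<lambda>s3 t3. rr W (\<lambda>s2 t2. rr W (\<lambda>s1 t1. F (x \<otimes> (s3 \<otimes> t1)) (y \<otimes> (s2 \<otimes> s1)) (z \<otimes> (t3 \<otimes> t2)))))"
    unfolding op_defs op_defs' by (rule rr_cong, simp, simp, rule rr_cong, simp, simp, rule rr_cong) (simp_all add: H.m_assoc)
  also have "\<dots> = rr W (\<lambda>s1 t1. rr W (\<lambda>s2 t2. rr W (\<lambda>s3 t3. F (x \<otimes> (t1 \<otimes> s3)) (y \<otimes> (s1 \<otimes> s2)) (z \<otimes> (t2 \<otimes> t3)))))"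
    by (rule yang_baxter[symmetric, where F = "\<lambda>a b c. F (x \<otimes> b) (y \<otimes> a) (z \<otimes> c)"]) (simp_all add: trilin_def)
  also have "\<dots> = r21 W (f23 W (f13 W F)) x y z"
    unfolding op_defs op_defs' by (rule rr_cong, simp, simp, rule rr_cong, simp, simp, rule rr_cong) (simp_all add: H.m_assoc)
  finally show "f13 W (f23 W (r21 W F)) x y z = r21 W (f23 W (f13 W F)) x y z" .
qed

text \<open>\<Delta>(x s) = \<Delta>(x) \<Delta>(s), and (\<Delta> \<otimes> Id)R = R13 R23 supplies
  the two copies of R. The left-handed companion uses the other axiom, which nests the two copies in
  the opposite order, whence its final interchange of sums.\<close>

lemma comul_mult_R_right:
  assumes G: "trilin K H H H W G" and W: "module K W" and [simp]: "x \<in> carrier H" "z \<in> carrier H"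
  shows "rr W (\<lambda>s t. sw W (x \<otimes> s) (\<lambda>a b. G a b (z \<otimes> t))) = sw W x (\<lambda>a b. f13 W (f23 W G) a b z)"
proof -
  note [simp] = W trilin_comp[OF G]
  have "rr W (\<lambda>s t. sw W (x \<otimes> s) (\<lambda>a b. G a b (z \<otimes> t))) = rr W (\<lambda>s t. sw W x (\<lambda>a b. sw W s (\<lambda>c d. G (a \<otimes> c) (b \<otimes> d) (z \<otimes> t))))"
    by (rule rr_cong, simp, simp, rule sw_mult) simp_all
  also have "\<dots> = sw W x (\<lambda>a b. rr W (\<lambda>s t. sw W s (\<lambda>c d. G (a \<otimes> c) (b \<otimes> d) (z \<otimes> t))))"
    by (rule tt_swap) simp_all
  also have "\<dots> = sw W x (\<lambda>a b. rr W (\<lambda>s t. rr W (\<lambda>s' t'. G (a \<otimes> s) (b \<otimes> s') (z \<otimes> (t \<otimes> t')))))"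
    by (rule sw_cong, simp, simp, simp, rule R_comul_left) (simp_all add: trilin_def)
  also have "\<dots> = sw W x (\<lambda>a b. f13 W (f23 W G) a b z)"
    unfolding op_defs' by (rule sw_cong, simp, simp, simp, rule rr_cong, simp, simp, rule rr_cong) (simp_all add: H.m_assoc)
  finally show ?thesis .
qed

lemma comul_mult_R_left:
  assumes G: "trilin K H H H W G" and W: "module K W" and [simp]: "x \<in> carrier H" "z \<in> carrier H"
  shows "rr W (\<lambda>s t. sw W (t \<otimes> x) (\<lambda>a b. G a b (s \<otimes> z))) = sw W x (\<lambda>a b. g31 W (g32 W G) a b z)"
proof -
  note [simp] = W trilin_comp[OF G]
  have "rr W (\<lambda>s t. sw W (t \<otimes> x) (\<lambda>a b. G a b (s \<otimes> z))) = rr W (\<lambda>s t. sw W t (\<lambda>c d. sw W x (\<lambda>a b. G (c \<otimes> a) (d \<otimes> b) (s \<otimes> z))))"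
    by (rule rr_cong, simp, simp, rule sw_mult) simp_all
  also have "\<dots> = rr W (\<lambda>s t. sw W x (\<lambda>a b. sw W t (\<lambda>c d. G (c \<otimes> a) (d \<otimes> b) (s \<otimes> z))))"
    by (rule rr_cong, simp, simp, rule tt_swap) simp_all
  also have "\<dots> = sw W x (\<lambda>a b. rr W (\<lambda>s t. sw W t (\<lambda>c d. G (c \<otimes> a) (d \<otimes> b) (s \<otimes> z))))"
    by (rule tt_swap) simp_all
  also have "\<dots> = sw W x (\<lambda>a b. rr W (\<lambda>s t. rr W (\<lambda>s' t'. G (t' \<otimes> a) (t \<otimes> b) (s \<otimes> s' \<otimes> z))))"
    by (rule sw_cong, simp, simp, simp, rule R_comul_right) (simp_all add: trilin_def)
  also have "\<dots> = sw W x (\<lambda>a b. rr W (\<lambda>s t. rr W (\<lambda>s' t'. G (t' \<otimes> a) (t \<otimes> b) (s \<otimes> (s' \<otimes> z)))))"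
    by (rule sw_cong, simp, simp, simp, rule rr_cong, simp, simp, rule rr_cong) (simp_all add: H.m_assoc)
  also have "\<dots> = sw W x (\<lambda>a b. g31 W (g32 W G) a b z)"
    unfolding op_defs' by (rule sw_cong, simp, simp, simp, rule tt_swap) simp_all
  finally show ?thesis .
qed

text \<open>Both sides are sums over five copies of R. The copies with indices \<open>a\<close> and
  \<open>c\<close> are spectators. The other three are brought to the front by interchanging sums
  and transformed by \<open>yang_baxter_Si\<close>; the remaining steps sort the sums back into the
  order of a twist followed by two coactions.\<close>

lemma delta_mult_core:
  assumes F: "trilin K H H H W F" and W: "module K W" and [simp]: "x \<in> carrier H" "y \<in> carrier H"
  shows "g31 W (g32 W (f23 W (f13 W (c21 W F)))) x y \<one>
    = c2 W (\<lambda>a b. rr W (\<lambda>sj tj. rr W (\<lambda>si ti. rr W (\<lambda>sk tk. rr W (\<lambda>sl tl.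
        F (tk \<otimes> a \<otimes> sl) (tj \<otimes> b \<otimes> si) ((sj \<otimes> ti) \<otimes> (sk \<otimes> tl))))))) x y"
proof -
  note [simp] = W trilin_comp[OF F]
  have "g31 W (g32 W (f23 W (f13 W (c21 W F)))) x y \<one> = rr W (\<lambda>sb tb. rr W (\<lambda>sa ta. rr W (\<lambda>sd td. rr W (\<lambda>sc tc. rr W (\<lambda>sp tp. F (tp \<otimes> tb \<otimes> x \<otimes> sc) (ta \<otimes> y \<otimes> (sd \<otimes> Si sp)) (sa \<otimes> (sb \<otimes> td) \<otimes> tc))))))"
    unfolding op_defs op_defs' by (rule rr_cong, simp, simp, rule rr_cong, simp, simp, rule rr_cong, simp, simp, rule rr_cong, simp, simp, rule rr_cong) (simp_all add: H.m_assoc)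
  also have "\<dots> = rr W (\<lambda>sb tb. rr W (\<lambda>sa ta. rr W (\<lambda>sd td. rr W (\<lambda>sp tp. rr W (\<lambda>sc tc. F (tp \<otimes> tb \<otimes> x \<otimes> sc) (ta \<otimes> y \<otimes> (sd \<otimes> Si sp)) (sa \<otimes> (sb \<otimes> td) \<otimes> tc))))))"
    by (rule rr_cong, simp, simp, rule rr_cong, simp, simp, rule rr_cong, simp, simp, rule tt_swap) simp_all
  also have "\<dots> = rr W (\<lambda>sb tb. rr W (\<lambda>sa ta. rr W (\<lambda>sp tp. rr W (\<lambda>sd td. rr W (\<lambda>sc tc. F (tp \<otimes> tb \<otimes> x \<otimes> sc) (ta \<otimes> y \<otimes> (sd \<otimes> Si sp)) (sa \<otimes> (sb \<otimes> td) \<otimes> tc))))))"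
    by (rule rr_cong, simp, simp, rule rr_cong, simp, simp, rule tt_swap) simp_all
  also have "\<dots> = rr W (\<lambda>sb tb. rr W (\<lambda>sp tp. rr W (\<lambda>sa ta. rr W (\<lambda>sd td. rr W (\<lambda>sc tc. F (tp \<otimes> tb \<otimes> x \<otimes> sc) (ta \<otimes> y \<otimes> (sd \<otimes> Si sp)) (sa \<otimes> (sb \<otimes> td) \<otimes> tc))))))"
    by (rule rr_cong, simp, simp, rule tt_swap) simp_all
  also have "\<dots> = rr W (\<lambda>sp tp. rr W (\<lambda>sb tb. rr W (\<lambda>sa ta. rr W (\<lambda>sd td. rr W (\<lambda>sc tc. F (tp \<otimes> tb \<otimes> x \<otimes> sc) (ta \<otimes> y \<otimes> (sd \<otimes> Si sp)) (sa \<otimes> (sb \<otimes> td) \<otimes> tc))))))"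
    by (rule tt_swap) simp_all
  also have "\<dots> = rr W (\<lambda>sp tp. rr W (\<lambda>sb tb. rr W (\<lambda>sd td. rr W (\<lambda>sa ta. rr W (\<lambda>sc tc. F (tp \<otimes> tb \<otimes> x \<otimes> sc) (ta \<otimes> y \<otimes> (sd \<otimes> Si sp)) (sa \<otimes> (sb \<otimes> td) \<otimes> tc))))))"
    by (rule rr_cong, simp, simp, rule rr_cong, simp, simp, rule tt_swap) simp_all
  also have "\<dots> = rr W (\<lambda>sk tk. rr W (\<lambda>sp tp. rr W (\<lambda>si ti. rr W (\<lambda>sa ta. rr W (\<lambda>sc tc. F (tk \<otimes> tp \<otimes> x \<otimes> sc) (ta \<otimes> y \<otimes> (Si sp \<otimes> si)) (sa \<otimes> (ti \<otimes> sk) \<otimes> tc))))))"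
    by (rule yang_baxter_Si[where G = "\<lambda>u v w. rr W (\<lambda>sa ta. rr W (\<lambda>sc tc. F (u \<otimes> x \<otimes> sc) (ta \<otimes> y \<otimes> v) (sa \<otimes> w \<otimes> tc)))"])
       (simp_all add: trilin_def)
  also have "\<dots> = rr W (\<lambda>sp tp. rr W (\<lambda>sk tk. rr W (\<lambda>si ti. rr W (\<lambda>sa ta. rr W (\<lambda>sc tc. F (tk \<otimes> tp \<otimes> x \<otimes> sc) (ta \<otimes> y \<otimes> (Si sp \<otimes> si)) (sa \<otimes> (ti \<otimes> sk) \<otimes> tc))))))"
    by (rule tt_swap) simp_all
  also have "\<dots> = rr W (\<lambda>sp tp. rr W (\<lambda>sk tk. rr W (\<lambda>sa ta. rr W (\<lambda>si ti. rr W (\<lambda>sc tc. F (tk \<otimes> tp \<otimes> x \<otimes> sc) (ta \<otimes> y \<otimes> (Si sp \<otimes> si)) (sa \<otimes> (ti \<otimes> sk) \<otimes> tc))))))"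
    by (rule rr_cong, simp, simp, rule rr_cong, simp, simp, rule tt_swap) simp_all
  also have "\<dots> = rr W (\<lambda>sp tp. rr W (\<lambda>sa ta. rr W (\<lambda>sk tk. rr W (\<lambda>si ti. rr W (\<lambda>sc tc. F (tk \<otimes> tp \<otimes> x \<otimes> sc) (ta \<otimes> y \<otimes> (Si sp \<otimes> si)) (sa \<otimes> (ti \<otimes> sk) \<otimes> tc))))))"
    by (rule rr_cong, simp, simp, rule tt_swap) simp_all
  also have "\<dots> = rr W (\<lambda>sp tp. rr W (\<lambda>sa ta. rr W (\<lambda>si ti. rr W (\<lambda>sk tk. rr W (\<lambda>sc tc. F (tk \<otimes> tp \<otimes> x \<otimes> sc) (ta \<otimes> y \<otimes> (Si sp \<otimes> si)) (sa \<otimes> (ti \<otimes> sk) \<otimes> tc))))))"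
    by (rule rr_cong, simp, simp, rule rr_cong, simp, simp, rule tt_swap) simp_all
  also have "\<dots> = c2 W (\<lambda>a b. rr W (\<lambda>sj tj. rr W (\<lambda>si ti. rr W (\<lambda>sk tk. rr W (\<lambda>sl tl.
        F (tk \<otimes> a \<otimes> sl) (tj \<otimes> b \<otimes> si) ((sj \<otimes> ti) \<otimes> (sk \<otimes> tl))))))) x y"
    unfolding c2_def by (rule rr_cong, simp, simp, rule rr_cong, simp, simp, rule rr_cong, simp, simp, rule rr_cong, simp, simp, rule rr_cong) (simp_all add: H.m_assoc)
  finally show ?thesis .
qed

text \<open>Evaluated at \<open>h\<close>, this says that the coaction is multiplicative. Expanding
  \<Delta>(tj h si) turns the left side into an operator word over \<Delta>(h) in which
  \<open>r21\<close> and \<open>c21\<close> are innermost. Yang-Baxter and the commutation rules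
  bring \<open>r21\<close> to the outside, where it is the \<open>r2\<close> of the twist on the
  right; \<open>delta_mult_core\<close> compares the rest.\<close>

lemma delta_mult:
  assumes F: "trilin K H H H W F" and W: "module K W" and [simp]: "h \<in> carrier H"
  shows "rr W (\<lambda>sj tj. rr W (\<lambda>si ti. hw W (tj \<otimes> h \<otimes> si) (\<lambda>a b. F a b (sj \<otimes> ti))))
    = hw W h (\<lambda>a b. rr W (\<lambda>sj tj. rr W (\<lambda>si ti. rr W (\<lambda>sk tk. rr W (\<lambda>sl tl.
        F (tk \<otimes> a \<otimes> sl) (tj \<otimes> b \<otimes> si) ((sj \<otimes> ti) \<otimes> (sk \<otimes> tl)))))))"
proof -
  note t = trilin_op[OF _ W] trilin_op'[OF _ W]
  note [simp] = W trilin_comp[OF F]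
  let ?G = "r21 W (c21 W F)"
  let ?B = "\<lambda>a b. rr W (\<lambda>sj tj. rr W (\<lambda>si ti. rr W (\<lambda>sk tk. rr W (\<lambda>sl tl.
        F (tk \<otimes> a \<otimes> sl) (tj \<otimes> b \<otimes> si) ((sj \<otimes> ti) \<otimes> (sk \<otimes> tl))))))"
  have G: "trilin K H H H W ?G" and c: "trilin K H H H W (c21 W F)" by (intro t F)+
  have B: "bilin K H H W ?B" by simp
  note linG = trilin_comp[OF G]
  have tf: "trilin K H H H W (f13 W (f23 W ?G))" by (intro t F)
  have e1: "r2 W (c2 W (\<lambda>a b. F a b z)) = (\<lambda>a b. ?G a b z)" for z
    by (simp add: fun_eq_iff r2_def c2_def op_defs)
  have "rr W (\<lambda>sj tj. rr W (\<lambda>si ti. hw W (tj \<otimes> h \<otimes> si) (\<lambda>a b. F a b (sj \<otimes> ti))))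
      = rr W (\<lambda>sj tj. rr W (\<lambda>si ti. sw W (tj \<otimes> h \<otimes> si) (\<lambda>a b. ?G a b (sj \<otimes> ti))))"
    by (rule rr_cong, simp, simp, rule rr_cong, simp, simp, subst hw_eq) (simp_all add: e1)
  \<comment> \<open>The unit is the third argument on which left multiplication by sj acts in the
    next step.\<close>
  also have "\<dots> = rr W (\<lambda>sj tj. sw W (tj \<otimes> h) (\<lambda>a b. f13 W (f23 W ?G) a b (sj \<otimes> \<one>)))"
    by (rule rr_cong, simp, simp add: linG, subst comul_mult_R_right[OF G W]) simp_all
  also have "\<dots> = sw W h (\<lambda>a b. g31 W (g32 W (f13 W (f23 W ?G))) a b \<one>)"
    by (rule comul_mult_R_left[OF tf W]) simp_all
  also have "\<dots> = sw W h (\<lambda>a b. r2 W (c2 W ?B) a b)"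
  proof (rule sw_cong[symmetric, OF W _ bilin_r2[OF bilin_c2[OF B W] W]], simp)
    fix a b assume [simp]: "a \<in> carrier H" "b \<in> carrier H"
    have "teq (g31 W (g32 W (f13 W (f23 W ?G)))) (g31 W (g32 W (r21 W (f23 W (f13 W (c21 W F))))))"
      by (intro teq_op' f13_f23_r21 t F W)
    also have "teq \<dots> (g31 W (r21 W (g32 W (f23 W (f13 W (c21 W F))))))"
      by (intro teq_op' g32_r21 t F W)
    also have "teq \<dots> (r21 W (g31 W (g32 W (f23 W (f13 W (c21 W F))))))"
      by (intro g31_r21 t F W)
    finally have "g31 W (g32 W (f13 W (f23 W ?G))) a b \<one> = r21 W (g31 W (g32 W (f23 W (f13 W (c21 W F))))) a b \<one>"
      by (simp add: teq_def)
    also have "\<dots> = rr W (\<lambda>s t. g31 W (g32 W (f23 W (f13 W (c21 W F)))) (a \<otimes> t) (b \<otimes> s) \<one>)"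
      by (simp add: r21_def)
    also have "\<dots> = rr W (\<lambda>s t. c2 W ?B (a \<otimes> t) (b \<otimes> s))"
    proof (rule rr_cong, simp)
      have "trilin K H H H W (g31 W (g32 W (f23 W (f13 W (c21 W F)))))" by (intro t F)
      note [simp] = trilin_comp[OF this]
      show "bilin K H H W (\<lambda>s t. g31 W (g32 W (f23 W (f13 W (c21 W F)))) (a \<otimes> t) (b \<otimes> s) \<one>)" by simp
      fix s t assume [simp]: "s \<in> carrier H" "t \<in> carrier H"
      show "g31 W (g32 W (f23 W (f13 W (c21 W F)))) (a \<otimes> t) (b \<otimes> s) \<one> = c2 W ?B (a \<otimes> t) (b \<otimes> s)"
        by (rule delta_mult_core[OF F W]) simp_all
    qed
    finally show "r2 W (c2 W ?B) a b = g31 W (g32 W (f13 W (f23 W ?G))) a b \<one>"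
      by (simp add: r2_def)
  qed
  also have "\<dots> = hw W h ?B"
    by (rule hw_eq[symmetric, OF B]) simp_all
  finally show ?thesis .
qed

lemma lin_mult_A [simp]:
  "assoc_algebra K A \<Longrightarrow> a \<in> carrier A \<Longrightarrow> f \<in> module_hom K Y A \<Longrightarrow> (\<lambda>x. f x \<otimes>\<^bsub>A\<^esub> a) \<in> module_hom K Y A"
  "assoc_algebra K A \<Longrightarrow> a \<in> carrier A \<Longrightarrow> f \<in> module_hom K Y A \<Longrightarrow> (\<lambda>x. a \<otimes>\<^bsub>A\<^esub> f x) \<in> module_hom K Y A"
  by (rule mult_hom; assumption)+

lemma mult_A_closed [simp]:
  "assoc_algebra K A \<Longrightarrow> a \<in> carrier A \<Longrightarrow> b \<in> carrier A \<Longrightarrow> a \<otimes>\<^bsub>A\<^esub> b \<in> carrier A"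
  using assoc_algebraD(2) by (metis ring.ring_simprules(5))

lemma smult_mult_A:
  "assoc_algebra K A \<Longrightarrow> c \<in> carrier K \<Longrightarrow> a \<in> carrier A \<Longrightarrow> b \<in> carrier A \<Longrightarrow> (c \<odot>\<^bsub>A\<^esub> a) \<otimes>\<^bsub>A\<^esub> b = c \<odot>\<^bsub>A\<^esub> (a \<otimes>\<^bsub>A\<^esub> b)"
  "assoc_algebra K A \<Longrightarrow> c \<in> carrier K \<Longrightarrow> a \<in> carrier A \<Longrightarrow> b \<in> carrier A \<Longrightarrow> a \<otimes>\<^bsub>A\<^esub> (c \<odot>\<^bsub>A\<^esub> b) = c \<odot>\<^bsub>A\<^esub> (a \<otimes>\<^bsub>A\<^esub> b)"
  by (simp_all add: assoc_algebra_def)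

lemma assoc_algebra_tensor [simp]: "assoc_algebra K A \<Longrightarrow> assoc_algebra K B \<Longrightarrow> assoc_algebra K (tensor K A B)"
  by (rule tensor_algebra.assoc_algebra_tensor[OF tensor_algebra.intro])

declare algebra_H [simp] assoc_algebraD(3) [simp]

text \<open>The map \<open>leg21\<close> is multiplicative and unital on R and its inverse, so the
  \<open>inv\<close> of R21 in \<open>K_matrix\<close> may be replaced by the leg of R^{-1}, which
  is a lift and can be expanded.\<close>

lemma leg21_inverse:
  assumes Q: "assoc_algebra K Q"
  shows "leg21 K H Q R \<in> Units (tensor3 K H H Q)"
    and "inv\<^bsub>tensor3 K H H Q\<^esub> (leg21 K H Q R) = leg21 K H Q Ri"
proof -
  let ?T = "tensor3 K H H Q"
  interpret T: tensor_triple_algebra K H H Q by (intro tensor_triple_algebra.intro algebra_H Q)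
  interpret Q: ring Q using assoc_algebraD(2)[OF Q] .
  have T [simp]: "assoc_algebra K ?T" by (rule T.algebra3)
  interpret mT: ring ?T using assoc_algebraD(2)[OF T] .
  note [simp] = Q
  have b: "bilin K H H ?T (\<lambda>a b. pure3 K H H Q b a \<one>\<^bsub>Q\<^esub>)" by simp
  note tp = HH.tensor_product_axioms
  have "leg21 K H Q R \<otimes>\<^bsub>?T\<^esub> leg21 K H Q Ri
     = rr ?T (\<lambda>s t. ri ?T (\<lambda>s' t'. pure3 K H H Q t s \<one>\<^bsub>Q\<^esub> \<otimes>\<^bsub>?T\<^esub> pure3 K H H Q t' s' \<one>\<^bsub>Q\<^esub>))"
    unfolding leg21_def by (rule lift_lift_mult[OF tp _ b tp _ b T module_hom_id]) simp_all
  also have "\<dots> = rr ?T (\<lambda>s t. ri ?T (\<lambda>s' t'. pure3 K H H Q (t \<otimes> t') (s \<otimes> s') \<one>\<^bsub>Q\<^esub>))"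
    by (rule rr_cong, simp, simp, rule rr_cong(2)) (simp_all add: T.mult_pure3)
  also have "\<dots> = pure3 K H H Q \<one> \<one> \<one>\<^bsub>Q\<^esub>"
    by (rule R_inverse(1)[where F = "\<lambda>a b. pure3 K H H Q b a \<one>\<^bsub>Q\<^esub>"]) simp_all
  finally have 1: "leg21 K H Q R \<otimes>\<^bsub>?T\<^esub> leg21 K H Q Ri = \<one>\<^bsub>?T\<^esub>" by (simp add: T.one3)
  have "leg21 K H Q Ri \<otimes>\<^bsub>?T\<^esub> leg21 K H Q R
     = ri ?T (\<lambda>s t. rr ?T (\<lambda>s' t'. pure3 K H H Q t s \<one>\<^bsub>Q\<^esub> \<otimes>\<^bsub>?T\<^esub> pure3 K H H Q t' s' \<one>\<^bsub>Q\<^esub>))"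
    unfolding leg21_def by (rule lift_lift_mult[OF tp _ b tp _ b T module_hom_id]) simp_all
  also have "\<dots> = ri ?T (\<lambda>s t. rr ?T (\<lambda>s' t'. pure3 K H H Q (t \<otimes> t') (s \<otimes> s') \<one>\<^bsub>Q\<^esub>))"
    by (rule rr_cong(2), simp, simp, rule rr_cong(1)) (simp_all add: T.mult_pure3)
  also have "\<dots> = pure3 K H H Q \<one> \<one> \<one>\<^bsub>Q\<^esub>"
    by (rule R_inverse(2)[where F = "\<lambda>a b. pure3 K H H Q b a \<one>\<^bsub>Q\<^esub>"]) simp_all
  finally have 2: "leg21 K H Q Ri \<otimes>\<^bsub>?T\<^esub> leg21 K H Q R = \<one>\<^bsub>?T\<^esub>" by (simp add: T.one3)
  have c: "leg21 K H Q R \<in> carrier ?T" "leg21 K H Q Ri \<in> carrier ?T"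
    unfolding leg21_def by simp_all
  show "leg21 K H Q R \<in> Units ?T" unfolding Units_def using c 1 2 by auto
  show "inv\<^bsub>?T\<^esub> (leg21 K H Q R) = leg21 K H Q Ri"
    by (rule mT.inv_unique'[OF c 1 2, symmetric])
qed

end

section \<open>Quasitriangular comodule algebras\<close>

locale qt_object = fd_qt_hopf K H R
  for K :: "('k, 'l) ring_scheme" and H :: "('k, 'h, 'm) hopf_scheme" (structure) and R :: "('h, 'h) tensor" +
  fixes Q :: "('k, 'h, 'q) comod_algebra" and kq :: "('h, 'q) tensor"
  assumes comod: "comodule_algebra K H Q" and K_mat: "K_matrix K H R Q kq"
begin

lemma algebra_Q [simp]: "assoc_algebra K Q" using comod by (simp add: comodule_algebra_def)

sublocale Q: ring Q using assoc_algebraD(2)[OF algebra_Q] .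
sublocale HQ: tensor_algebra K H Q by (intro tensor_algebra.intro algebra_H algebra_Q)
sublocale TQ: tensor_triple_algebra K H H Q by (intro tensor_triple_algebra.intro algebra_H algebra_Q)

lemma kq_unit: "kq \<in> Units (tensor K H Q)" using K_mat by (simp add: K_matrix_def Let_def)
lemma kq_closed [simp]: "kq \<in> carrier (tensor K H Q)" using kq_unit by (simp add: Units_def)

abbreviation kk where "kk W F \<equiv> tensor_lift W F kq"

lemma kk_closed [simp]: "module K W \<Longrightarrow> bilin K H Q W F \<Longrightarrow> kk W F \<in> carrier W"
  by (rule module_homD(1)[OF HQ.lift_hom kq_closed])

lemma lin_kk [simp]:
  assumes "module K W" "module K Y"
    "\<forall>x\<in>carrier Y. bilin K H Q W (F x)" "\<forall>u\<in>carrier H. \<forall>v\<in>carrier Q. (\<lambda>x. F x u v) \<in> module_hom K Y W"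
  shows "(\<lambda>x. kk W (F x)) \<in> module_hom K Y W"
  by (rule HQ.lift_param; use assms in simp)

lemma kk_cong:
  "module K W \<Longrightarrow> bilin K H Q W F \<Longrightarrow>
   (\<And>a b. a \<in> carrier H \<Longrightarrow> b \<in> carrier Q \<Longrightarrow> F a b = G a b) \<Longrightarrow> kk W F = kk W G"
  by (rule HQ.lift_cong; simp)

lemma hom_kk:
  "g \<in> module_hom K W Z \<Longrightarrow> module K W \<Longrightarrow> module K Z \<Longrightarrow> bilin K H Q W F \<Longrightarrow>
   g (kk W F) = kk Z (\<lambda>a b. g (F a b))"
  by (rule HQ.hom_lift; simp)

lemma rr_kk_swap:
  assumes "module K W" "s \<in> carrier HH"
    "\<And>u v. u \<in> carrier H \<Longrightarrow> v \<in> carrier H \<Longrightarrow> bilin K H Q W (F u v)"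
    "\<And>x y. x \<in> carrier H \<Longrightarrow> y \<in> carrier Q \<Longrightarrow> bilin K H H W (\<lambda>u v. F u v x y)"
  shows "tensor_lift W (\<lambda>a b. kk W (F a b)) s = kk W (\<lambda>c d. tensor_lift W (\<lambda>a b. F a b c d) s)"
  by (rule lift_swap[OF HH.tensor_product_axioms HQ.tensor_product_axioms assms(1,2) kq_closed assms(3,4)])

text \<open>The pairs \<open>a\<close>, \<open>x\<close>, then \<open>s\<close>, \<open>t\<close>,
  then \<open>a'\<close>, \<open>x'\<close>, then \<open>s'\<close>, \<open>t'\<close> come from the
  factors K23, R21, K13 and R21^{-1}, expanded from left to right. Only the two copies of K have a
  nontrivial leg in Q, whence the product of \<open>x\<close> and \<open>x'\<close>.\<close>

lemma kq_comul:
  assumes F: "trilin K H H Q W F" and W: "module K W"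
  shows "kk W (\<lambda>a x. sw W a (\<lambda>c d. F c d x))
    = kk W (\<lambda>a x. rr W (\<lambda>s t. kk W (\<lambda>a' x'. ri W (\<lambda>s' t'. F (t \<otimes> a' \<otimes> t') (a \<otimes> s \<otimes> s') (x \<otimes>\<^bsub>Q\<^esub> x')))))"
proof -
  let ?T = "tensor3 K H H Q" and ?p = "pure3 K H H Q"
  note L = TQ.lift3_hom[OF F W]
  note [simp] = W trilin_comp[OF F] module_hom_comp[OF L] TQ.lift3_pure[OF F W] TQ.mult_pure3 leg21_inverse(2)
  have T [simp]: "assoc_algebra K ?T" by (rule TQ.algebra3)
  let ?L = "TQ.lift3 W F"
  have "comul_left K H Q kq = leg23 K H Q kq \<otimes>\<^bsub>?T\<^esub> leg21 K H Q R \<otimes>\<^bsub>?T\<^esub> leg13 K H Q kq \<otimes>\<^bsub>?T\<^esub> leg21 K H Q Ri"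
    using K_mat unfolding K_matrix_def Let_def by simp
  moreover have "?L (comul_left K H Q kq) = kk W (\<lambda>a x. sw W a (\<lambda>c d. F c d x))"
  proof -
    have "?L (comul_left K H Q kq) = kk W (\<lambda>a x. ?L (sw ?T a (\<lambda>c d. ?p c d x)))"
      unfolding comul_left_def by (rule hom_kk[OF L]) simp_all
    also have "\<dots> = kk W (\<lambda>a x. sw W a (\<lambda>c d. ?L (?p c d x)))"
      by (rule kk_cong, simp, simp, rule hom_sw[OF L]) simp_all
    also have "\<dots> = kk W (\<lambda>a x. sw W a (\<lambda>c d. F c d x))"
      by (rule kk_cong, simp, simp, rule sw_cong) simp_all
    finally show ?thesis .
  qed
  moreover have "?L (leg23 K H Q kq \<otimes>\<^bsub>?T\<^esub> leg21 K H Q R \<otimes>\<^bsub>?T\<^esub> leg13 K H Q kq \<otimes>\<^bsub>?T\<^esub> leg21 K H Q Ri)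
    = kk W (\<lambda>a x. rr W (\<lambda>s t. kk W (\<lambda>a' x'. ri W (\<lambda>s' t'. F (t \<otimes> a' \<otimes> t') (a \<otimes> s \<otimes> s') (x \<otimes>\<^bsub>Q\<^esub> x')))))"
  proof -
    note tp = HH.tensor_product_axioms and tq = HQ.tensor_product_axioms
    have c: "leg21 K H Q Ri \<in> carrier ?T" "leg13 K H Q kq \<in> carrier ?T" "leg21 K H Q R \<in> carrier ?T"
      unfolding leg21_def leg13_def by simp_all
    note [simp] = c
    have "?L (leg23 K H Q kq \<otimes>\<^bsub>?T\<^esub> leg21 K H Q R \<otimes>\<^bsub>?T\<^esub> leg13 K H Q kq \<otimes>\<^bsub>?T\<^esub> leg21 K H Q Ri)
      = kk W (\<lambda>a x. ?L (?p \<one> a x \<otimes>\<^bsub>?T\<^esub> leg21 K H Q R \<otimes>\<^bsub>?T\<^esub> leg13 K H Q kq \<otimes>\<^bsub>?T\<^esub> leg21 K H Q Ri))"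
      unfolding leg23_def by (rule hom_kk[where g = "\<lambda>z. ?L (z \<otimes>\<^bsub>?T\<^esub> leg21 K H Q R \<otimes>\<^bsub>?T\<^esub> leg13 K H Q kq \<otimes>\<^bsub>?T\<^esub> leg21 K H Q Ri)"]) simp_all
    also have "\<dots> = kk W (\<lambda>a x. rr W (\<lambda>s t. ?L (?p t (a \<otimes> s) x \<otimes>\<^bsub>?T\<^esub> leg13 K H Q kq \<otimes>\<^bsub>?T\<^esub> leg21 K H Q Ri)))"
    proof (rule kk_cong, simp, simp)
      fix a x assume [simp]: "a \<in> carrier H" "x \<in> carrier Q"
      have "?L (?p \<one> a x \<otimes>\<^bsub>?T\<^esub> leg21 K H Q R \<otimes>\<^bsub>?T\<^esub> leg13 K H Q kq \<otimes>\<^bsub>?T\<^esub> leg21 K H Q Ri)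
        = rr W (\<lambda>s t. ?L (?p \<one> a x \<otimes>\<^bsub>?T\<^esub> ?p t s \<one>\<^bsub>Q\<^esub> \<otimes>\<^bsub>?T\<^esub> leg13 K H Q kq \<otimes>\<^bsub>?T\<^esub> leg21 K H Q Ri))"
        by (subst (1) leg21_def, rule hom_rr(1)[where g = "\<lambda>z. ?L (?p \<one> a x \<otimes>\<^bsub>?T\<^esub> z \<otimes>\<^bsub>?T\<^esub> leg13 K H Q kq \<otimes>\<^bsub>?T\<^esub> leg21 K H Q Ri)"]) simp_all
      also have "\<dots> = rr W (\<lambda>s t. ?L (?p t (a \<otimes> s) x \<otimes>\<^bsub>?T\<^esub> leg13 K H Q kq \<otimes>\<^bsub>?T\<^esub> leg21 K H Q Ri))"
        by (rule rr_cong) simp_all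
      finally show "?L (?p \<one> a x \<otimes>\<^bsub>?T\<^esub> leg21 K H Q R \<otimes>\<^bsub>?T\<^esub> leg13 K H Q kq \<otimes>\<^bsub>?T\<^esub> leg21 K H Q Ri)
        = rr W (\<lambda>s t. ?L (?p t (a \<otimes> s) x \<otimes>\<^bsub>?T\<^esub> leg13 K H Q kq \<otimes>\<^bsub>?T\<^esub> leg21 K H Q Ri))" .
    qed
    also have "\<dots> = kk W (\<lambda>a x. rr W (\<lambda>s t. kk W (\<lambda>a' x'. ?L (?p (t \<otimes> a') (a \<otimes> s) (x \<otimes>\<^bsub>Q\<^esub> x') \<otimes>\<^bsub>?T\<^esub> leg21 K H Q Ri))))"
    proof (rule kk_cong, simp, simp, rule rr_cong(1), simp, simp)
      fix a x s t assume [simp]: "a \<in> carrier H" "x \<in> carrier Q" "s \<in> carrier H" "t \<in> carrier H"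
      have "?L (?p t (a \<otimes> s) x \<otimes>\<^bsub>?T\<^esub> leg13 K H Q kq \<otimes>\<^bsub>?T\<^esub> leg21 K H Q Ri)
        = kk W (\<lambda>a' x'. ?L (?p t (a \<otimes> s) x \<otimes>\<^bsub>?T\<^esub> ?p a' \<one> x' \<otimes>\<^bsub>?T\<^esub> leg21 K H Q Ri))"
        unfolding leg13_def by (rule hom_kk[where g = "\<lambda>z. ?L (?p t (a \<otimes> s) x \<otimes>\<^bsub>?T\<^esub> z \<otimes>\<^bsub>?T\<^esub> leg21 K H Q Ri)"]) simp_all
      also have "\<dots> = kk W (\<lambda>a' x'. ?L (?p (t \<otimes> a') (a \<otimes> s) (x \<otimes>\<^bsub>Q\<^esub> x') \<otimes>\<^bsub>?T\<^esub> leg21 K H Q Ri))"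
        by (rule kk_cong) simp_all
      finally show "?L (?p t (a \<otimes> s) x \<otimes>\<^bsub>?T\<^esub> leg13 K H Q kq \<otimes>\<^bsub>?T\<^esub> leg21 K H Q Ri)
        = kk W (\<lambda>a' x'. ?L (?p (t \<otimes> a') (a \<otimes> s) (x \<otimes>\<^bsub>Q\<^esub> x') \<otimes>\<^bsub>?T\<^esub> leg21 K H Q Ri))" .
    qed
    also have "\<dots> = kk W (\<lambda>a x. rr W (\<lambda>s t. kk W (\<lambda>a' x'. ri W (\<lambda>s' t'. F (t \<otimes> a' \<otimes> t') (a \<otimes> s \<otimes> s') (x \<otimes>\<^bsub>Q\<^esub> x')))))"
    proof (rule kk_cong, simp, simp, rule rr_cong(1), simp, simp, rule kk_cong, simp, simp)
      fix a x s t a' x' assume [simp]: "a \<in> carrier H" "x \<in> carrier Q" "s \<in> carrier H" "t \<in> carrier H" "a' \<in> carrier H" "x' \<in> carrier Q"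
      have "?L (?p (t \<otimes> a') (a \<otimes> s) (x \<otimes>\<^bsub>Q\<^esub> x') \<otimes>\<^bsub>?T\<^esub> leg21 K H Q Ri)
        = ri W (\<lambda>s' t'. ?L (?p (t \<otimes> a') (a \<otimes> s) (x \<otimes>\<^bsub>Q\<^esub> x') \<otimes>\<^bsub>?T\<^esub> ?p t' s' \<one>\<^bsub>Q\<^esub>))"
        unfolding leg21_def by (rule hom_rr(2)[where g = "\<lambda>z. ?L (?p (t \<otimes> a') (a \<otimes> s) (x \<otimes>\<^bsub>Q\<^esub> x') \<otimes>\<^bsub>?T\<^esub> z)"]) simp_all
      also have "\<dots> = ri W (\<lambda>s' t'. F (t \<otimes> a' \<otimes> t') (a \<otimes> s \<otimes> s') (x \<otimes>\<^bsub>Q\<^esub> x'))"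
        by (rule rr_cong(2)) simp_all
      finally show "?L (?p (t \<otimes> a') (a \<otimes> s) (x \<otimes>\<^bsub>Q\<^esub> x') \<otimes>\<^bsub>?T\<^esub> leg21 K H Q Ri)
        = ri W (\<lambda>s' t'. F (t \<otimes> a' \<otimes> t') (a \<otimes> s \<otimes> s') (x \<otimes>\<^bsub>Q\<^esub> x'))" .
    qed
    finally show ?thesis .
  qed
  ultimately show ?thesis by simp
qed

text \<open>$(\widehat\Delta \otimes \mathrm{Id})K = K_{23}K_{13}$: the twist in $\widehat\Delta$ absorbs the two $R$-matrices.\<close>

lemma kq_hat_comul:
  assumes F: "trilin K H H Q W F" and W: "module K W"
  shows "kk W (\<lambda>a x. hw W a (\<lambda>c d. F c d x)) = kk W (\<lambda>a x. kk W (\<lambda>a' x'. F a' a (x \<otimes>\<^bsub>Q\<^esub> x')))"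
proof -
  note [simp] = W trilin_comp[OF F]
  \<comment> \<open>\<open>G\<close> and \<open>J\<close> carry the two halves of the twist with the
    Q-argument as a parameter: the \<open>r2\<close> in \<open>J\<close> will cancel R21^{-1}, and
    the \<open>c2\<close> in \<open>G\<close> will cancel R21 by \<open>R_Si\<close>.\<close>
  define G where "G c d x = c2 W (\<lambda>c d. F c d x) c d" for c d x
  have G: "trilin K H H Q W G" unfolding G_def c2_def by (simp add: trilin_def)
  define J where "J c d x = r2 W (\<lambda>c d. G c d x) c d" for c d x
  note [simp] = trilin_comp[OF G]
  have J: "trilin K H H Q W J" unfolding J_def r2_def by (simp add: trilin_def)
  note [simp] = trilin_comp[OF J]
  have "kk W (\<lambda>a x. hw W a (\<lambda>c d. F c d x)) = kk W (\<lambda>a x. sw W a (\<lambda>c d. J c d x))"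
    by (rule kk_cong, simp, simp, subst hw_eq) (simp_all add: J_def[abs_def] G_def[abs_def])
  also have "\<dots> = kk W (\<lambda>a x. rr W (\<lambda>s t. kk W (\<lambda>a' x'. ri W (\<lambda>s' t'. J (t \<otimes> a' \<otimes> t') (a \<otimes> s \<otimes> s') (x \<otimes>\<^bsub>Q\<^esub> x')))))"
    by (rule kq_comul[OF J W])
  also have "\<dots> = kk W (\<lambda>a x. rr W (\<lambda>s t. kk W (\<lambda>a' x'. G (t \<otimes> a') (a \<otimes> s) (x \<otimes>\<^bsub>Q\<^esub> x'))))"
  proof (rule kk_cong, simp, simp, rule rr_cong(1), simp, simp, rule kk_cong, simp, simp)
    fix a x s t a' x' assume [simp]: "a \<in> carrier H" "x \<in> carrier Q" "s \<in> carrier H" "t \<in> carrier H" "a' \<in> carrier H" "x' \<in> carrier Q"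
    have "ri W (\<lambda>s' t'. J (t \<otimes> a' \<otimes> t') (a \<otimes> s \<otimes> s') (x \<otimes>\<^bsub>Q\<^esub> x'))
       = ri W (\<lambda>s' t'. rr W (\<lambda>s'' t''. G (t \<otimes> a' \<otimes> (t' \<otimes> t'')) (a \<otimes> s \<otimes> (s' \<otimes> s'')) (x \<otimes>\<^bsub>Q\<^esub> x')))"
      unfolding J_def r2_def by (rule rr_cong(2), simp, simp, rule rr_cong(1)) (simp_all add: H.m_assoc)
    also have "\<dots> = G (t \<otimes> a' \<otimes> \<one>) (a \<otimes> s \<otimes> \<one>) (x \<otimes>\<^bsub>Q\<^esub> x')"
      by (rule R_inverse(2)[where F = "\<lambda>u v. G (t \<otimes> a' \<otimes> v) (a \<otimes> s \<otimes> u) (x \<otimes>\<^bsub>Q\<^esub> x')"]) simp_all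
    finally show "ri W (\<lambda>s' t'. J (t \<otimes> a' \<otimes> t') (a \<otimes> s \<otimes> s') (x \<otimes>\<^bsub>Q\<^esub> x')) = G (t \<otimes> a') (a \<otimes> s) (x \<otimes>\<^bsub>Q\<^esub> x')" by simp
  qed
  also have "\<dots> = kk W (\<lambda>a x. kk W (\<lambda>a' x'. rr W (\<lambda>s t. G (t \<otimes> a') (a \<otimes> s) (x \<otimes>\<^bsub>Q\<^esub> x'))))"
    by (rule kk_cong, simp, simp, rule rr_kk_swap) simp_all
  also have "\<dots> = kk W (\<lambda>a x. kk W (\<lambda>a' x'. F a' a (x \<otimes>\<^bsub>Q\<^esub> x')))"
  proof (rule kk_cong, simp, simp, rule kk_cong, simp, simp)
    fix a x a' x' assume [simp]: "a \<in> carrier H" "x \<in> carrier Q" "a' \<in> carrier H" "x' \<in> carrier Q"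
    have "rr W (\<lambda>s t. G (t \<otimes> a') (a \<otimes> s) (x \<otimes>\<^bsub>Q\<^esub> x'))
       = rr W (\<lambda>s t. rr W (\<lambda>s' t'. F (t' \<otimes> t \<otimes> a') (a \<otimes> (s \<otimes> Si s')) (x \<otimes>\<^bsub>Q\<^esub> x')))"
      unfolding G_def c2_def by (rule rr_cong(1), simp, simp, rule rr_cong(1)) (simp_all add: H.m_assoc)
    also have "\<dots> = rr W (\<lambda>s' t'. rr W (\<lambda>s t. F (t' \<otimes> t \<otimes> a') (a \<otimes> (s \<otimes> Si s')) (x \<otimes>\<^bsub>Q\<^esub> x')))"
      by (rule tt_swap) simp_all
    also have "\<dots> = F (\<one> \<otimes> a') (a \<otimes> \<one>) (x \<otimes>\<^bsub>Q\<^esub> x')"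
      by (rule R_Si(1)[where F = "\<lambda>u v. F (v \<otimes> a') (a \<otimes> u) (x \<otimes>\<^bsub>Q\<^esub> x')"]) simp_all
    finally show "rr W (\<lambda>s t. G (t \<otimes> a') (a \<otimes> s) (x \<otimes>\<^bsub>Q\<^esub> x')) = F a' a (x \<otimes>\<^bsub>Q\<^esub> x')" by simp
  qed
  finally show ?thesis .
qed

lemma coact_hom: "coact Q \<in> module_hom K Q (tensor K H Q)" "coact Q \<in> ring_hom Q (tensor K H Q)"
  using comod by (auto simp: comodule_algebra_def algebra_hom_def)

lemma lin_coact [simp]: "f \<in> module_hom K Y Q \<Longrightarrow> (\<lambda>x. coact Q (f x)) \<in> module_hom K Y (tensor K H Q)"
  by (rule module_hom_comp[OF coact_hom(1)])

lemma coact_closed [simp]: "x \<in> carrier Q \<Longrightarrow> coact Q x \<in> carrier (tensor K H Q)"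
  by (rule module_homD(1)[OF coact_hom(1)])

text \<open>The functional \<open>g\<close> is applied to the first leg of (Id \<otimes> \<delta>)K
  = R21 K13 R12. Later \<open>g\<close> is the pairing with an element of the reflective algebra,
  and the right side becomes its coaction pushed forward along \<open>phi\<close>.\<close>

lemma kq_coact:
  assumes g: "g \<in> module_hom K H (ground_algebra K)"
  shows "kk (tensor K H Q) (\<lambda>a x. g a \<odot>\<^bsub>tensor K H Q\<^esub> coact Q x)
    = kk (tensor K H Q) (\<lambda>a x. rr (tensor K H Q) (\<lambda>sj tj. rr (tensor K H Q) (\<lambda>si ti.
        g (tj \<otimes> a \<otimes> si) \<odot>\<^bsub>tensor K H Q\<^esub> pure K H Q (sj \<otimes> ti) x)))"
proof -
  let ?T = "tensor3 K H H Q" and ?p = "pure3 K H H Q" and ?W = "tensor K H Q"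
  define L where "L = tensor_lift ?W (\<lambda>a u. g a \<odot>\<^bsub>?W\<^esub> u)"
  have bL: "bilin K H ?W ?W (\<lambda>a u. g a \<odot>\<^bsub>?W\<^esub> u)"
    using module_homD(1)[OF g] g module_hom_comp[OF g] by simp
  have L: "L \<in> module_hom K ?T ?W" unfolding L_def by (rule TQ.ABC.lift_hom[OF bL]) simp
  have Lp: "L (pure K H ?W a u) = g a \<odot>\<^bsub>?W\<^esub> u" if "a \<in> carrier H" "u \<in> carrier ?W" for a u
    unfolding L_def by (rule TQ.ABC.lift_pure[OF bL]) (use that in simp_all)
  note [simp] = module_hom_comp[OF L] Lp TQ.mult_pure3 module_homD(1)[OF g, simplified] module_hom_comp[OF g]
  have T [simp]: "assoc_algebra K ?T" by (rule TQ.algebra3)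
  have "tensor_map K H ?W id (coact Q) kq = leg21 K H Q R \<otimes>\<^bsub>?T\<^esub> leg13 K H Q kq \<otimes>\<^bsub>?T\<^esub> leg12 K H Q R"
    using K_mat unfolding K_matrix_def Let_def by simp
  moreover have "L (tensor_map K H ?W id (coact Q) kq) = kk ?W (\<lambda>a x. g a \<odot>\<^bsub>?W\<^esub> coact Q x)"
  proof -
    have "L (tensor_map K H ?W id (coact Q) kq) = kk ?W (\<lambda>a x. L (pure K H ?W a (coact Q x)))"
      unfolding tensor_map_def id_def by (rule hom_kk[OF L]) simp_all
    also have "\<dots> = kk ?W (\<lambda>a x. g a \<odot>\<^bsub>?W\<^esub> coact Q x)"
      by (rule kk_cong) simp_all
    finally show ?thesis .
  qed
  moreover have "L (leg21 K H Q R \<otimes>\<^bsub>?T\<^esub> leg13 K H Q kq \<otimes>\<^bsub>?T\<^esub> leg12 K H Q R)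
    = rr ?W (\<lambda>sj tj. kk ?W (\<lambda>a x. rr ?W (\<lambda>si ti. g (tj \<otimes> a \<otimes> si) \<odot>\<^bsub>?W\<^esub> pure K H Q (sj \<otimes> ti) x)))"
  proof -
    have [simp]: "leg13 K H Q kq \<in> carrier ?T" "leg12 K H Q R \<in> carrier ?T"
      unfolding leg12_def leg13_def by simp_all
    have "L (leg21 K H Q R \<otimes>\<^bsub>?T\<^esub> leg13 K H Q kq \<otimes>\<^bsub>?T\<^esub> leg12 K H Q R)
      = rr ?W (\<lambda>sj tj. L (?p tj sj \<one>\<^bsub>Q\<^esub> \<otimes>\<^bsub>?T\<^esub> leg13 K H Q kq \<otimes>\<^bsub>?T\<^esub> leg12 K H Q R))"
      unfolding leg21_def by (rule hom_rr(1)[where g = "\<lambda>z. L (z \<otimes>\<^bsub>?T\<^esub> leg13 K H Q kq \<otimes>\<^bsub>?T\<^esub> leg12 K H Q R)"]) simp_all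
    also have "\<dots> = rr ?W (\<lambda>sj tj. kk ?W (\<lambda>a x. L (?p tj sj \<one>\<^bsub>Q\<^esub> \<otimes>\<^bsub>?T\<^esub> ?p a \<one> x \<otimes>\<^bsub>?T\<^esub> leg12 K H Q R)))"
      unfolding leg13_def by (rule rr_cong(1), simp, simp add: leg13_def[symmetric], rule hom_kk[where g = "\<lambda>z. L (?p _ _ \<one>\<^bsub>Q\<^esub> \<otimes>\<^bsub>?T\<^esub> z \<otimes>\<^bsub>?T\<^esub> leg12 K H Q R)"]) simp_all
    also have "\<dots> = rr ?W (\<lambda>sj tj. kk ?W (\<lambda>a x. L (?p (tj \<otimes> a) sj x \<otimes>\<^bsub>?T\<^esub> leg12 K H Q R)))"
      by (rule rr_cong(1), simp, simp, rule kk_cong) simp_all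
    also have "\<dots> = rr ?W (\<lambda>sj tj. kk ?W (\<lambda>a x. rr ?W (\<lambda>si ti. L (?p (tj \<otimes> a) sj x \<otimes>\<^bsub>?T\<^esub> ?p si ti \<one>\<^bsub>Q\<^esub>))))"
      unfolding leg12_def by (rule rr_cong(1), simp, simp add: leg12_def[symmetric], rule kk_cong, simp, simp add: leg12_def[symmetric],
          rule hom_rr(1)[where g = "\<lambda>z. L (?p _ _ _ \<otimes>\<^bsub>?T\<^esub> z)"]) simp_all
    also have "\<dots> = rr ?W (\<lambda>sj tj. kk ?W (\<lambda>a x. rr ?W (\<lambda>si ti. g (tj \<otimes> a \<otimes> si) \<odot>\<^bsub>?W\<^esub> pure K H Q (sj \<otimes> ti) x)))"
      by (rule rr_cong(1), simp, simp, rule kk_cong, simp, simp, rule rr_cong(1)) simp_all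
    finally show ?thesis .
  qed
  moreover have "\<dots> = kk ?W (\<lambda>a x. rr ?W (\<lambda>sj tj. rr ?W (\<lambda>si ti. g (tj \<otimes> a \<otimes> si) \<odot>\<^bsub>?W\<^esub> pure K H Q (sj \<otimes> ti) x)))"
    by (rule rr_kk_swap) simp_all
  ultimately show ?thesis by simp
qed

lemma kq_counit: "kk Q (\<lambda>a x. \<epsilon> a \<odot>\<^bsub>Q\<^esub> x) = \<one>\<^bsub>Q\<^esub>"
proof -
  define e where "e = kk Q (\<lambda>a x. \<epsilon> a \<odot>\<^bsub>Q\<^esub> x)"
  have b: "bilin K H Q Q (\<lambda>a x. \<epsilon> a \<odot>\<^bsub>Q\<^esub> x)" by simp
  have [simp]: "e \<in> carrier Q" unfolding e_def by simp
  \<comment> \<open>A right inverse is enough: its image \<open>i\<close> under \<epsilon> \<otimes>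
    Id satisfies e i = 1, and with e = e e this gives e = e (e i) = (e e) i = e i = 1.\<close>
  obtain k' where k': "k' \<in> carrier (tensor K H Q)" "kq \<otimes>\<^bsub>tensor K H Q\<^esub> k' = \<one>\<^bsub>tensor K H Q\<^esub>"
    using kq_unit unfolding Units_def by auto
  define i where "i = tensor_lift Q (\<lambda>a x. \<epsilon> a \<odot>\<^bsub>Q\<^esub> x) k'"
  have [simp]: "i \<in> carrier Q" unfolding i_def by (rule module_homD(1)[OF HQ.lift_hom[OF b] k'(1)]) simp
  have "\<one>\<^bsub>Q\<^esub> = tensor_lift Q (\<lambda>a x. \<epsilon> a \<odot>\<^bsub>Q\<^esub> x) \<one>\<^bsub>tensor K H Q\<^esub>"
    unfolding HQ.one_tensor by (subst HQ.lift_pure[OF b]) simp_all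
  also have "\<dots> = kk Q (\<lambda>a x. tensor_lift Q (\<lambda>a' x'. \<epsilon> (a \<otimes> a') \<odot>\<^bsub>Q\<^esub> (x \<otimes>\<^bsub>Q\<^esub> x')) k')"
    unfolding k'(2)[symmetric] by (rule HQ.lift_mult[OF b _ _ k'(1)]) simp_all
  also have "\<dots> = kk Q (\<lambda>a x. tensor_lift Q (\<lambda>a' x'. (\<epsilon> a \<odot>\<^bsub>Q\<^esub> x) \<otimes>\<^bsub>Q\<^esub> (\<epsilon> a' \<odot>\<^bsub>Q\<^esub> x')) k')"
  proof -
    have [simp]: "(\<lambda>x. tensor_lift Q (f x) k') \<in> module_hom K Y Q" 
      if "module K Y" "\<forall>x\<in>carrier Y. bilin K H Q Q (f x)" "\<forall>u\<in>carrier H. \<forall>v\<in>carrier Q. (\<lambda>x. f x u v) \<in> module_hom K Y Q"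
      for Y :: "('k, 'y, 'yy) module_scheme" and f
      by (rule HQ.lift_param[OF _ _ _ _ k'(1)]) (use that in auto)
    show ?thesis
      by (rule kk_cong, simp, simp, rule HQ.lift_cong[OF _ _ _ k'(1)])
         (simp_all add: smult_mult_A module.smult_assoc1[OF assoc_algebraD(3)[OF algebra_Q], symmetric] K.m_comm)
  qed
  also have "\<dots> = kk Q (\<lambda>a x. (\<epsilon> a \<odot>\<^bsub>Q\<^esub> x) \<otimes>\<^bsub>Q\<^esub> i)"
    unfolding i_def by (rule kk_cong[symmetric], simp, simp add: i_def[symmetric], rule HQ.hom_lift[OF _ b _ _ k'(1)]) simp_all
  also have "\<dots> = e \<otimes>\<^bsub>Q\<^esub> i"
    unfolding e_def by (rule hom_kk[symmetric, where g = "\<lambda>z. z \<otimes>\<^bsub>Q\<^esub> i"]) simp_all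
  finally have ei: "e \<otimes>\<^bsub>Q\<^esub> i = \<one>\<^bsub>Q\<^esub>" ..
  \<comment> \<open>\<epsilon> is also the counit of the twisted comultiplication, so
    \<open>e\<close> can be written with that comultiplication inside, and
    \<open>kq_hat_comul\<close> produces the square of \<open>e\<close>.\<close>
  have "e = kk Q (\<lambda>a x. hw Q a (\<lambda>c d. \<epsilon> c \<odot>\<^bsub>Q\<^esub> (\<epsilon> d \<odot>\<^bsub>Q\<^esub> x)))"
    unfolding e_def by (rule kk_cong, simp, simp, rule hat_counit(1)[symmetric]) simp_all
  also have "\<dots> = kk Q (\<lambda>a x. kk Q (\<lambda>a' x'. \<epsilon> a' \<odot>\<^bsub>Q\<^esub> (\<epsilon> a \<odot>\<^bsub>Q\<^esub> (x \<otimes>\<^bsub>Q\<^esub> x'))))"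
    by (rule kq_hat_comul) (simp_all add: trilin_def)
  also have "\<dots> = kk Q (\<lambda>a x. kk Q (\<lambda>a' x'. (\<epsilon> a \<odot>\<^bsub>Q\<^esub> x) \<otimes>\<^bsub>Q\<^esub> (\<epsilon> a' \<odot>\<^bsub>Q\<^esub> x')))"
    by (rule kk_cong, simp, simp, rule kk_cong) (simp_all add: smult_mult_A)
  also have "\<dots> = kk Q (\<lambda>a x. (\<epsilon> a \<odot>\<^bsub>Q\<^esub> x) \<otimes>\<^bsub>Q\<^esub> e)"
    unfolding e_def by (rule kk_cong[symmetric], simp, simp, rule hom_kk) simp_all
  also have "\<dots> = e \<otimes>\<^bsub>Q\<^esub> e"
    by (subst (2) e_def, rule hom_kk[symmetric, where g = "\<lambda>z. z \<otimes>\<^bsub>Q\<^esub> e"]) simp_all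
  finally have "e \<otimes>\<^bsub>Q\<^esub> i = e \<otimes>\<^bsub>Q\<^esub> (e \<otimes>\<^bsub>Q\<^esub> i)" using Q.m_assoc[of e e i] by simp
  then show ?thesis using ei unfolding e_def by simp
qed

end

section \<open>Models of the reflective algebra of the ground field\<close>

lemma finsum_module_hom:
  assumes "finite D" "\<And>d. d \<in> D \<Longrightarrow> f d \<in> module_hom K V W" and V: "module K V" and W: "module K W"
  shows "(\<lambda>v. \<Oplus>\<^bsub>W\<^esub>d\<in>D. f d v) \<in> module_hom K V W"
  using assms(1,2)
proof (induction D)
  case empty
  interpret W: module K W by fact
  show ?case by (auto intro!: module_homI)
next
  case (insert e D)
  interpret V: module K V by fact
  interpret W: module K W by fact
  have e: "f e \<in> module_hom K V W" and D: "\<And>d. d \<in> D \<Longrightarrow> f d \<in> module_hom K V W"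
    and IH: "(\<lambda>v. \<Oplus>\<^bsub>W\<^esub>d\<in>D. f d v) \<in> module_hom K V W" using insert by auto
  have s: "(\<Oplus>\<^bsub>W\<^esub>d\<in>insert e D. f d v) = f e v \<oplus>\<^bsub>W\<^esub> (\<Oplus>\<^bsub>W\<^esub>d\<in>D. f d v)" if "v \<in> carrier V" for v
    using insert.hyps module_homD(1)[OF e that] module_homD(1)[OF D that] by (intro W.finsum_insert) auto
  show ?case
    by (rule module_homI) (simp_all add: s module_homD[OF e] module_homD[OF IH] W.a_ac W.smult_r_distr)
qed

lemma hom_finsum:
  assumes "finite D" and g: "g \<in> module_hom K V W" and V: "module K V" and W: "module K W"
    and "\<And>d. d \<in> D \<Longrightarrow> f d \<in> carrier V"
  shows "g (\<Oplus>\<^bsub>V\<^esub>d\<in>D. f d) = (\<Oplus>\<^bsub>W\<^esub>d\<in>D. g (f d))"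
  using assms(1,5)
proof (induction D)
  case empty
  interpret V: module K V by fact
  interpret W: module K W by fact
  show ?case by (simp add: module_hom_zero[OF g V W])
next
  case (insert e D)
  interpret V: module K V by fact
  interpret W: module K W by fact
  have f: "f e \<in> carrier V" "f \<in> D \<rightarrow> carrier V" using insert by auto
  then have "g (\<Oplus>\<^bsub>V\<^esub>d\<in>insert e D. f d) = g (f e) \<oplus>\<^bsub>W\<^esub> g (\<Oplus>\<^bsub>V\<^esub>d\<in>D. f d)"
    using insert.hyps by (simp add: V.finsum_insert module_homD(2)[OF g] V.finsum_closed)
  also have "\<dots> = (\<Oplus>\<^bsub>W\<^esub>d\<in>insert e D. g (f d))"
    using insert f module_homD(1)[OF g] by (subst W.finsum_insert) (auto intro: module_homD(1)[OF g])
  finally show ?case .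
qed

lemma finsum_module_cong:
  assumes "module K W" "\<And>d. d \<in> D \<Longrightarrow> f d = g d" "\<And>d. d \<in> D \<Longrightarrow> g d \<in> carrier W"
  shows "(\<Oplus>\<^bsub>W\<^esub>d\<in>D. f d) = (\<Oplus>\<^bsub>W\<^esub>d\<in>D. g d)"
proof -
  interpret W: module K W by fact
  show ?thesis using assms(2,3) by (intro W.add.finprod_cong') auto
qed

text \<open>
  A model of $R_H(\Bbbk)$: an algebra \<open>P\<close> in perfect pairing with $\widehat H$. Everything about
  $H \otimes P$ and $H \otimes H \otimes P$ is tested by evaluating the last leg at elements of \<open>H\<close>,
  which turns $K_{\mathrm{ref}}$ into the identity map of \<open>H\<close>.
\<close>

locale ref_model = fd_qt_hopf K H R
  for K :: "('k, 'l) ring_scheme" and H :: "('k, 'h, 'm) hopf_scheme" (structure) and R :: "('h, 'h) tensor" +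
  fixes P :: "('k, 'h, 'p) comod_algebra" and kp :: "('h, 'p) tensor" and ev :: "'h \<Rightarrow> 'p \<Rightarrow> 'k"
    and D :: "'d set" and hb :: "'d \<Rightarrow> 'h" and xb :: "'d \<Rightarrow> 'p"
  assumes algebra_P [simp]: "assoc_algebra K P"
    and ev_bilin: "bilin K H P (ground_algebra K) ev"
    and fin_D: "finite D" and hb: "\<And>d. d \<in> D \<Longrightarrow> hb d \<in> carrier H" and xb: "\<And>d. d \<in> D \<Longrightarrow> xb d \<in> carrier P"
    and ev_expand: "\<And>p. p \<in> carrier P \<Longrightarrow> p = (\<Oplus>\<^bsub>P\<^esub>d\<in>D. ev (hb d) p \<odot>\<^bsub>P\<^esub> xb d)"
    and ev_mult: "\<And>h p q. h \<in> carrier H \<Longrightarrow> p \<in> carrier P \<Longrightarrow> q \<in> carrier P \<Longrightarrow>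
      ev h (p \<otimes>\<^bsub>P\<^esub> q) = hw (ground_algebra K) h (\<lambda>a b. ev a q \<otimes>\<^bsub>K\<^esub> ev b p)"
    and ev_one: "\<And>h. h \<in> carrier H \<Longrightarrow> ev h \<one>\<^bsub>P\<^esub> = \<epsilon> h"
    and coact_P [simp]: "\<And>p. p \<in> carrier P \<Longrightarrow> coact P p \<in> carrier (tensor K H P)"
    and eval_coact: "\<And>h p. h \<in> carrier H \<Longrightarrow> p \<in> carrier P \<Longrightarrow>
      tensor_lift H (\<lambda>a q. ev h q \<odot>\<^bsub>H\<^esub> a) (coact P p)
      = rr H (\<lambda>sj tj. rr H (\<lambda>si ti. ev (tj \<otimes> h \<otimes> si) p \<odot>\<^bsub>H\<^esub> (sj \<otimes> ti)))"
    and kp [simp]: "kp \<in> carrier (tensor K H P)"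
    and eval_kp: "\<And>h. h \<in> carrier H \<Longrightarrow> tensor_lift H (\<lambda>a q. ev h q \<odot>\<^bsub>H\<^esub> a) kp = h"
begin

sublocale P: ring P using assoc_algebraD(2)[OF algebra_P] .
sublocale HP: tensor_algebra K H P by (intro tensor_algebra.intro algebra_H algebra_P)
sublocale TP: tensor_triple_algebra K H H P by (intro tensor_triple_algebra.intro algebra_H algebra_P)

definition E where "E h t = tensor_lift H (\<lambda>a q. ev h q \<odot>\<^bsub>H\<^esub> a) t"
definition E3 where "E3 h t = tensor_lift HH (\<lambda>a u. pure K H H a (E h u)) t"

lemma ev_closed [simp]: "h \<in> carrier H \<Longrightarrow> p \<in> carrier P \<Longrightarrow> ev h p \<in> carrier K"
  using bilinD(1)[OF ev_bilin] by simp

lemma lin_ev [simp]: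
  "f \<in> module_hom K Y H \<Longrightarrow> p \<in> carrier P \<Longrightarrow> (\<lambda>x. ev (f x) p) \<in> module_hom K Y (ground_algebra K)"
  "h \<in> carrier H \<Longrightarrow> g \<in> module_hom K Y P \<Longrightarrow> (\<lambda>x. ev h (g x)) \<in> module_hom K Y (ground_algebra K)"
  using bilin_comp[OF ev_bilin] by auto

lemma bilin_E: "h \<in> carrier H \<Longrightarrow> bilin K H P H (\<lambda>a q. ev h q \<odot>\<^bsub>H\<^esub> a)"
  by simp

lemma E_hom: "h \<in> carrier H \<Longrightarrow> E h \<in> module_hom K (tensor K H P) H"
  unfolding E_def by (rule HP.lift_hom[OF bilin_E]) simp_all

lemma E_closed [simp]: "h \<in> carrier H \<Longrightarrow> t \<in> carrier (tensor K H P) \<Longrightarrow> E h t \<in> carrier H"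
  by (rule module_homD(1)[OF E_hom])

lemma E_pure [simp]:
  "h \<in> carrier H \<Longrightarrow> a \<in> carrier H \<Longrightarrow> q \<in> carrier P \<Longrightarrow> E h (pure K H P a q) = ev h q \<odot>\<^bsub>H\<^esub> a"
  unfolding E_def by (rule HP.lift_pure[OF bilin_E]) simp_all

lemma lin_E1 [simp]: "h \<in> carrier H \<Longrightarrow> f \<in> module_hom K Y (tensor K H P) \<Longrightarrow> (\<lambda>x. E h (f x)) \<in> module_hom K Y H"
  by (rule module_hom_comp[OF E_hom])

lemma lin_E2 [simp]:
  assumes t: "t \<in> carrier (tensor K H P)" and f: "f \<in> module_hom K Y H"
  shows "(\<lambda>x. E (f x) t) \<in> module_hom K Y H"
proof -
  have "(\<lambda>h. E h t) \<in> module_hom K H H"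
    unfolding E_def by (rule HP.lift_param[OF _ bilin_E _ _ t]) simp_all
  from module_hom_comp[OF this f] show ?thesis .
qed

lemma bilin_E3: "h \<in> carrier H \<Longrightarrow> bilin K H (tensor K H P) HH (\<lambda>a u. pure K H H a (E h u))"
  by simp

lemma E3_hom: "h \<in> carrier H \<Longrightarrow> E3 h \<in> module_hom K (tensor3 K H H P) HH"
  unfolding E3_def by (rule TP.ABC.lift_hom[OF bilin_E3]) simp_all

lemma E3_closed [simp]: "h \<in> carrier H \<Longrightarrow> t \<in> carrier (tensor3 K H H P) \<Longrightarrow> E3 h t \<in> carrier HH"
  by (rule module_homD(1)[OF E3_hom])

lemma E3_pure [simp]:
  "h \<in> carrier H \<Longrightarrow> a \<in> carrier H \<Longrightarrow> u \<in> carrier (tensor K H P) \<Longrightarrow> E3 h (pure K H (tensor K H P) a u) = pure K H H a (E h u)"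
  unfolding E3_def by (rule TP.ABC.lift_pure[OF bilin_E3]) simp_all

lemma lin_E31 [simp]: "h \<in> carrier H \<Longrightarrow> f \<in> module_hom K Y (tensor3 K H H P) \<Longrightarrow> (\<lambda>x. E3 h (f x)) \<in> module_hom K Y HH"
  by (rule module_hom_comp[OF E3_hom])

lemma lin_E32 [simp]:
  assumes t: "t \<in> carrier (tensor3 K H H P)" and f: "f \<in> module_hom K Y H"
  shows "(\<lambda>x. E3 (f x) t) \<in> module_hom K Y HH"
proof -
  have "(\<lambda>h. E3 h t) \<in> module_hom K H HH"
    unfolding E3_def by (rule TP.ABC.lift_param[OF _ bilin_E3 _ _ t]) simp_all
  from module_hom_comp[OF this f] show ?thesis .
qed

lemma ev_inj:
  assumes "p \<in> carrier P" "q \<in> carrier P" "\<And>h. h \<in> carrier H \<Longrightarrow> ev h p = ev h q"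
  shows "p = q"
proof -
  have "(\<Oplus>\<^bsub>P\<^esub>d\<in>D. ev (hb d) p \<odot>\<^bsub>P\<^esub> xb d) = (\<Oplus>\<^bsub>P\<^esub>d\<in>D. ev (hb d) q \<odot>\<^bsub>P\<^esub> xb d)"
    by (rule finsum_module_cong[where K = K]) (use assms hb xb in auto)
  then show ?thesis using ev_expand[OF assms(1)] ev_expand[OF assms(2)] by simp
qed

text \<open>A tensor is recovered from its evaluations as the sum over \<open>d\<close> of E (hb d)
  t \<otimes> xb d; on pure tensors this is \<open>ev_expand\<close>.\<close>

lemma E_inj:
  assumes s: "s \<in> carrier (tensor K H P)" and t: "t \<in> carrier (tensor K H P)"
    and e: "\<And>h. h \<in> carrier H \<Longrightarrow> E h s = E h t"
  shows "s = t"
proof -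
  let ?W = "tensor K H P"
  note [simp] = hb xb
  have r: "(\<Oplus>\<^bsub>?W\<^esub>d\<in>D. pure K H P (E (hb d) r) (xb d)) = r" if "r \<in> carrier ?W" for r
  proof (rule HP.hom_eqI[OF finsum_module_hom[OF fin_D] module_hom_id _ _ that])
    fix a p assume [simp]: "a \<in> carrier H" "p \<in> carrier P"
    have "(\<Oplus>\<^bsub>?W\<^esub>d\<in>D. pure K H P (E (hb d) (pure K H P a p)) (xb d)) = (\<Oplus>\<^bsub>?W\<^esub>d\<in>D. pure K H P a (ev (hb d) p \<odot>\<^bsub>P\<^esub> xb d))"
      by (rule finsum_module_cong[where K = K]) auto
    also have "\<dots> = pure K H P a (\<Oplus>\<^bsub>P\<^esub>d\<in>D. ev (hb d) p \<odot>\<^bsub>P\<^esub> xb d)"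
      by (rule hom_finsum[OF fin_D, symmetric, where K = K and g = "\<lambda>z. pure K H P a z"]) simp_all
    also have "\<dots> = pure K H P a p" using ev_expand[of p] by simp
    finally show "(\<Oplus>\<^bsub>?W\<^esub>d\<in>D. pure K H P (E (hb d) (pure K H P a p)) (xb d)) = pure K H P a p" .
  qed simp_all
  have "(\<Oplus>\<^bsub>?W\<^esub>d\<in>D. pure K H P (E (hb d) s) (xb d)) = (\<Oplus>\<^bsub>?W\<^esub>d\<in>D. pure K H P (E (hb d) t) (xb d))"
    by (rule finsum_module_cong[where K = K]) (use s t e in auto)
  then show ?thesis using r[OF s] r[OF t] by simp
qed

lemma E3_inj:
  assumes s: "s \<in> carrier (tensor3 K H H P)" and t: "t \<in> carrier (tensor3 K H H P)"
    and e: "\<And>h. h \<in> carrier H \<Longrightarrow> E3 h s = E3 h t"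
  shows "s = t"
proof -
  let ?W = "tensor3 K H H P"
  note [simp] = hb xb
  \<comment> \<open>\<open>J d\<close> inserts \<open>xb d\<close> as the last leg, so that the sum
    of \<open>J d (E3 (hb d) r)\<close> over \<open>d\<close> reconstructs \<open>r\<close>.\<close>
  define J where "J d = tensor_lift ?W (\<lambda>a b. pure3 K H H P a b (xb d))" for d
  have bJ: "bilin K H H ?W (\<lambda>a b. pure3 K H H P a b (xb d))" if "d \<in> D" for d using that by simp
  have J: "J d \<in> module_hom K HH ?W" if "d \<in> D" for d
    unfolding J_def by (rule HH.lift_hom[OF bJ[OF that]]) simp
  have Jp: "J d (pure K H H a b) = pure3 K H H P a b (xb d)" if "d \<in> D" "a \<in> carrier H" "b \<in> carrier H" for a b d
    unfolding J_def by (rule HH.lift_pure[OF bJ]) (use that in simp_all)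
  note [simp] = module_hom_comp[OF J] module_homD(1)[OF J]
  have r: "(\<Oplus>\<^bsub>?W\<^esub>d\<in>D. J d (E3 (hb d) r)) = r" if "r \<in> carrier ?W" for r
  proof (rule TP.hom_eqI3[OF finsum_module_hom[OF fin_D] module_hom_id _ _ that])
    fix a b p assume [simp]: "a \<in> carrier H" "b \<in> carrier H" "p \<in> carrier P"
    have "(\<Oplus>\<^bsub>?W\<^esub>d\<in>D. J d (E3 (hb d) (pure3 K H H P a b p))) = (\<Oplus>\<^bsub>?W\<^esub>d\<in>D. pure3 K H H P a b (ev (hb d) p \<odot>\<^bsub>P\<^esub> xb d))"
      by (rule finsum_module_cong[where K = K]) (auto simp: Jp module_homD(3)[OF J])
    also have "\<dots> = pure3 K H H P a b (\<Oplus>\<^bsub>P\<^esub>d\<in>D. ev (hb d) p \<odot>\<^bsub>P\<^esub> xb d)"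
      by (rule hom_finsum[OF fin_D, symmetric, where K = K and g = "\<lambda>z. pure3 K H H P a b z"]) simp_all
    also have "\<dots> = pure3 K H H P a b p" using ev_expand[of p] by simp
    finally show "(\<Oplus>\<^bsub>?W\<^esub>d\<in>D. J d (E3 (hb d) (pure3 K H H P a b p))) = pure3 K H H P a b p" .
  qed simp_all
  have "(\<Oplus>\<^bsub>?W\<^esub>d\<in>D. J d (E3 (hb d) s)) = (\<Oplus>\<^bsub>?W\<^esub>d\<in>D. J d (E3 (hb d) t))"
    by (rule finsum_module_cong[where K = K]) (use s t e in auto)
  then show ?thesis using r[OF s] r[OF t] by simp
qed

lemma smult_smult: "module K W \<Longrightarrow> a \<in> carrier K \<Longrightarrow> b \<in> carrier K \<Longrightarrow> w \<in> carrier W \<Longrightarrow>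
    a \<odot>\<^bsub>W\<^esub> (b \<odot>\<^bsub>W\<^esub> w) = (a \<otimes>\<^bsub>K\<^esub> b) \<odot>\<^bsub>W\<^esub> w"
  by (simp add: module.smult_assoc1)

lemma ev_mult_smult:
  assumes [simp]: "h \<in> carrier H" "p \<in> carrier P" "q \<in> carrier P" "module K W" "w \<in> carrier W"
  shows "ev h (p \<otimes>\<^bsub>P\<^esub> q) \<odot>\<^bsub>W\<^esub> w = hw W h (\<lambda>c d. (ev c q \<otimes>\<^bsub>K\<^esub> ev d p) \<odot>\<^bsub>W\<^esub> w)"
  unfolding ev_mult[OF assms(1,2,3)] by (rule hom_hw[where g = "\<lambda>x. x \<odot>\<^bsub>W\<^esub> w"]) simp_all

text \<open>\<open>P\<close> models the opposite of the dual algebra, hence \<open>s\<close> is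
  evaluated at the second factor of the twisted coproduct and \<open>t\<close> at the first, while
  the product in H keeps its order.\<close>

lemma E_mult:
  assumes h [simp]: "h \<in> carrier H" and s: "s \<in> carrier (tensor K H P)" and t: "t \<in> carrier (tensor K H P)"
  shows "E h (s \<otimes>\<^bsub>tensor K H P\<^esub> t) = hw H h (\<lambda>a b. E b s \<otimes> E a t)"
proof -
  have 1: "E h (pure K H P a p \<otimes>\<^bsub>tensor K H P\<^esub> t) = hw H h (\<lambda>c d. E d (pure K H P a p) \<otimes> E c t)"
    if [simp]: "a \<in> carrier H" "p \<in> carrier P" for a p
  proof (rule HP.hom_eqI[where W = H, OF _ _ _ _ t])
    fix b q assume [simp]: "b \<in> carrier H" "q \<in> carrier P"
    have "E h (pure K H P a p \<otimes>\<^bsub>tensor K H P\<^esub> pure K H P b q) = ev h (p \<otimes>\<^bsub>P\<^esub> q) \<odot>\<^bsub>H\<^esub> (a \<otimes> b)"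
      by (simp add: HP.mult_pure)
    also have "\<dots> = hw H h (\<lambda>c d. (ev c q \<otimes>\<^bsub>K\<^esub> ev d p) \<odot>\<^bsub>H\<^esub> (a \<otimes> b))"
      by (rule ev_mult_smult) simp_all
    also have "\<dots> = hw H h (\<lambda>c d. E d (pure K H P a p) \<otimes> E c (pure K H P b q))"
      by (rule hw_cong) (simp_all add: smult_mult_A smult_smult)
    finally show "E h (pure K H P a p \<otimes>\<^bsub>tensor K H P\<^esub> pure K H P b q)
      = hw H h (\<lambda>c d. E d (pure K H P a p) \<otimes> E c (pure K H P b q))" .
  qed simp_all
  show ?thesis
    by (rule HP.hom_eqI[where W = H, OF _ _ _ _ s]) (use t in \<open>simp_all add: 1\<close>)
qed

lemma E3_mult:
  assumes h [simp]: "h \<in> carrier H" and s: "s \<in> carrier (tensor3 K H H P)" and t: "t \<in> carrier (tensor3 K H H P)"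
  shows "E3 h (s \<otimes>\<^bsub>tensor3 K H H P\<^esub> t) = hw HH h (\<lambda>a b. E3 b s \<otimes>\<^bsub>HH\<^esub> E3 a t)"
proof -
  let ?p = "pure3 K H H P"
  have 1: "E3 h (?p a a' p \<otimes>\<^bsub>tensor3 K H H P\<^esub> t) = hw HH h (\<lambda>c d. E3 d (?p a a' p) \<otimes>\<^bsub>HH\<^esub> E3 c t)"
    if [simp]: "a \<in> carrier H" "a' \<in> carrier H" "p \<in> carrier P" for a a' p
  proof (rule TP.hom_eqI3[where W = HH, OF _ _ _ _ t])
    fix b b' q assume [simp]: "b \<in> carrier H" "b' \<in> carrier H" "q \<in> carrier P"
    have "E3 h (?p a a' p \<otimes>\<^bsub>tensor3 K H H P\<^esub> ?p b b' q) = ev h (p \<otimes>\<^bsub>P\<^esub> q) \<odot>\<^bsub>HH\<^esub> pure K H H (a \<otimes> b) (a' \<otimes> b')"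
      by (simp add: TP.mult_pure3)
    also have "\<dots> = hw HH h (\<lambda>c d. (ev c q \<otimes>\<^bsub>K\<^esub> ev d p) \<odot>\<^bsub>HH\<^esub> pure K H H (a \<otimes> b) (a' \<otimes> b'))"
      by (rule ev_mult_smult) simp_all
    also have "\<dots> = hw HH h (\<lambda>c d. E3 d (?p a a' p) \<otimes>\<^bsub>HH\<^esub> E3 c (?p b b' q))"
      by (rule hw_cong) (simp_all add: smult_mult_A smult_smult HH.mult_pure)
    finally show "E3 h (?p a a' p \<otimes>\<^bsub>tensor3 K H H P\<^esub> ?p b b' q)
      = hw HH h (\<lambda>c d. E3 d (?p a a' p) \<otimes>\<^bsub>HH\<^esub> E3 c (?p b b' q))" .
  qed simp_all
  show ?thesis
    by (rule TP.hom_eqI3[where W = HH, OF _ _ _ _ s]) (use t in \<open>simp_all add: 1\<close>)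
qed

lemma E_one: "h \<in> carrier H \<Longrightarrow> E h \<one>\<^bsub>tensor K H P\<^esub> = \<epsilon> h \<odot>\<^bsub>H\<^esub> \<one>"
  by (simp add: HP.one_tensor ev_one)

lemma E_kp [simp]: "h \<in> carrier H \<Longrightarrow> E h kp = h"
  unfolding E_def by (rule eval_kp)

section \<open>The model is a comodule algebra\<close>

lemma E_coact: "h \<in> carrier H \<Longrightarrow> p \<in> carrier P \<Longrightarrow>
    E h (coact P p) = rr H (\<lambda>sj tj. rr H (\<lambda>si ti. ev (tj \<otimes> h \<otimes> si) p \<odot>\<^bsub>H\<^esub> (sj \<otimes> ti)))"
  unfolding E_def by (rule eval_coact)

text \<open>The locale prescribes the evaluations of \<open>coact P\<close>. These are linear in
  \<open>p\<close>, and evaluation is injective by \<open>E_inj\<close>, so linearity of the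
  coaction follows.\<close>

lemma coact_hom: "coact P \<in> module_hom K P (tensor K H P)"
proof (rule module_homI)
  interpret W: module K "tensor K H P" by simp
  interpret mP: module K P by simp
  have d: "(\<lambda>p. rr H (\<lambda>sj tj. rr H (\<lambda>si ti. ev (tj \<otimes> h \<otimes> si) p \<odot>\<^bsub>H\<^esub> (sj \<otimes> ti)))) \<in> module_hom K P H"
    if [simp]: "h \<in> carrier H" for h by simp
  fix p q assume [simp]: "p \<in> carrier P" "q \<in> carrier P"
  show "coact P (p \<oplus>\<^bsub>P\<^esub> q) = coact P p \<oplus>\<^bsub>tensor K H P\<^esub> coact P q"
    by (rule E_inj) (simp_all add: E_coact module_homD(2)[OF E_hom] module_homD(2)[OF d])
next
  interpret mP: module K P by simp
  have d: "(\<lambda>p. rr H (\<lambda>sj tj. rr H (\<lambda>si ti. ev (tj \<otimes> h \<otimes> si) p \<odot>\<^bsub>H\<^esub> (sj \<otimes> ti)))) \<in> module_hom K P H"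
    if [simp]: "h \<in> carrier H" for h by simp
  fix c p assume [simp]: "c \<in> carrier K" "p \<in> carrier P"
  show "coact P (c \<odot>\<^bsub>P\<^esub> p) = c \<odot>\<^bsub>tensor K H P\<^esub> coact P p"
    by (rule E_inj) (simp_all add: E_coact module_homD(3)[OF E_hom] module_homD(3)[OF d])
qed simp

lemma lin_coact [simp]: "f \<in> module_hom K Y P \<Longrightarrow> (\<lambda>x. coact P (f x)) \<in> module_hom K Y (tensor K H P)"
  by (rule module_hom_comp[OF coact_hom])

text \<open>This is \<open>delta_mult\<close> for the form that pairs its first two arguments with
  \<open>q\<close> and \<open>p\<close>; multiplying out the two coactions on the right yields its
  four copies of R.\<close>

lemma coact_mult:
  assumes [simp]: "p \<in> carrier P" "q \<in> carrier P"
  shows "coact P (p \<otimes>\<^bsub>P\<^esub> q) = coact P p \<otimes>\<^bsub>tensor K H P\<^esub> coact P q"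
proof (rule E_inj, simp, simp)
  fix h assume [simp]: "h \<in> carrier H"
  have "E h (coact P (p \<otimes>\<^bsub>P\<^esub> q)) = rr H (\<lambda>sj tj. rr H (\<lambda>si ti. ev (tj \<otimes> h \<otimes> si) (p \<otimes>\<^bsub>P\<^esub> q) \<odot>\<^bsub>H\<^esub> (sj \<otimes> ti)))"
    by (rule E_coact) simp_all
  also have "\<dots> = rr H (\<lambda>sj tj. rr H (\<lambda>si ti. hw H (tj \<otimes> h \<otimes> si) (\<lambda>a b. (ev a q \<otimes>\<^bsub>K\<^esub> ev b p) \<odot>\<^bsub>H\<^esub> (sj \<otimes> ti))))"
    by (rule rr_cong(1), simp, simp, rule rr_cong(1), simp, simp, rule ev_mult_smult) simp_all
  also have "\<dots> = hw H h (\<lambda>a b. rr H (\<lambda>sj tj. rr H (\<lambda>si ti. rr H (\<lambda>sk tk. rr H (\<lambda>sl tl.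
        (ev (tk \<otimes> a \<otimes> sl) q \<otimes>\<^bsub>K\<^esub> ev (tj \<otimes> b \<otimes> si) p) \<odot>\<^bsub>H\<^esub> ((sj \<otimes> ti) \<otimes> (sk \<otimes> tl)))))))"
    by (rule delta_mult[where F = "\<lambda>a b z. (ev a q \<otimes>\<^bsub>K\<^esub> ev b p) \<odot>\<^bsub>H\<^esub> z"]) (simp_all add: trilin_def)
  also have "\<dots> = hw H h (\<lambda>a b. E b (coact P p) \<otimes> E a (coact P q))"
  proof (rule hw_cong, simp, simp, simp)
    fix a b assume [simp]: "a \<in> carrier H" "b \<in> carrier H"
    have "E b (coact P p) \<otimes> E a (coact P q) = rr H (\<lambda>sj tj. rr H (\<lambda>si ti. ev (tj \<otimes> b \<otimes> si) p \<odot>\<^bsub>H\<^esub> (sj \<otimes> ti)) \<otimes> E a (coact P q))"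
      by (subst E_coact[of b p], simp, simp, rule hom_rr(1)) simp_all
    also have "\<dots> = rr H (\<lambda>sj tj. rr H (\<lambda>si ti. (ev (tj \<otimes> b \<otimes> si) p \<odot>\<^bsub>H\<^esub> (sj \<otimes> ti)) \<otimes> E a (coact P q)))"
      by (rule rr_cong(1), simp, simp, rule hom_rr(1)) simp_all
    also have "\<dots> = rr H (\<lambda>sj tj. rr H (\<lambda>si ti. rr H (\<lambda>sk tk. (ev (tj \<otimes> b \<otimes> si) p \<odot>\<^bsub>H\<^esub> (sj \<otimes> ti)) \<otimes> rr H (\<lambda>sl tl. ev (tk \<otimes> a \<otimes> sl) q \<odot>\<^bsub>H\<^esub> (sk \<otimes> tl)))))"
      by (subst E_coact[of a q], simp, simp, rule rr_cong(1), simp, simp, rule rr_cong(1), simp, simp, rule hom_rr(1)) simp_all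
    also have "\<dots> = rr H (\<lambda>sj tj. rr H (\<lambda>si ti. rr H (\<lambda>sk tk. rr H (\<lambda>sl tl. (ev (tj \<otimes> b \<otimes> si) p \<odot>\<^bsub>H\<^esub> (sj \<otimes> ti)) \<otimes> (ev (tk \<otimes> a \<otimes> sl) q \<odot>\<^bsub>H\<^esub> (sk \<otimes> tl))))))"
      by (rule rr_cong(1), simp, simp, rule rr_cong(1), simp, simp, rule rr_cong(1), simp, simp, rule hom_rr(1)) simp_all
    also have "\<dots> = rr H (\<lambda>sj tj. rr H (\<lambda>si ti. rr H (\<lambda>sk tk. rr H (\<lambda>sl tl.
        (ev (tk \<otimes> a \<otimes> sl) q \<otimes>\<^bsub>K\<^esub> ev (tj \<otimes> b \<otimes> si) p) \<odot>\<^bsub>H\<^esub> ((sj \<otimes> ti) \<otimes> (sk \<otimes> tl))))))"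
      by (rule rr_cong(1), simp, simp, rule rr_cong(1), simp, simp, rule rr_cong(1), simp, simp, rule rr_cong(1))
         (simp_all add: smult_mult_A smult_smult)
    finally show "rr H (\<lambda>sj tj. rr H (\<lambda>si ti. rr H (\<lambda>sk tk. rr H (\<lambda>sl tl.
        (ev (tk \<otimes> a \<otimes> sl) q \<otimes>\<^bsub>K\<^esub> ev (tj \<otimes> b \<otimes> si) p) \<odot>\<^bsub>H\<^esub> ((sj \<otimes> ti) \<otimes> (sk \<otimes> tl))))))
      = E b (coact P p) \<otimes> E a (coact P q)" ..
  qed
  also have "\<dots> = E h (coact P p \<otimes>\<^bsub>tensor K H P\<^esub> coact P q)"
    by (rule E_mult[symmetric]) simp_all
  finally show "E h (coact P (p \<otimes>\<^bsub>P\<^esub> q)) = E h (coact P p \<otimes>\<^bsub>tensor K H P\<^esub> coact P q)" .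
qed

lemma coact_one: "coact P \<one>\<^bsub>P\<^esub> = \<one>\<^bsub>tensor K H P\<^esub>"
proof (rule E_inj, simp, simp add: HP.one_tensor)
  fix h assume [simp]: "h \<in> carrier H"
  have "E h (coact P \<one>\<^bsub>P\<^esub>) = rr H (\<lambda>sj tj. rr H (\<lambda>si ti. \<epsilon> (tj \<otimes> h \<otimes> si) \<odot>\<^bsub>H\<^esub> (sj \<otimes> ti)))"
    by (simp add: E_coact, rule rr_cong(1), simp, simp, rule rr_cong(1)) (simp_all add: ev_one)
  also have "\<dots> = rr H (\<lambda>sj tj. rr H (\<lambda>si ti. \<epsilon> si \<odot>\<^bsub>H\<^esub> (\<epsilon> (tj \<otimes> h) \<odot>\<^bsub>H\<^esub> (sj \<otimes> ti))))"
    by (rule rr_cong(1), simp, simp, rule rr_cong(1)) (simp_all add: smult_smult K.m_ac)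
  also have "\<dots> = rr H (\<lambda>sj tj. \<epsilon> (tj \<otimes> h) \<odot>\<^bsub>H\<^esub> (sj \<otimes> \<one>))"
    by (rule rr_cong(1), simp, simp, rule R_counit_left) simp_all
  also have "\<dots> = rr H (\<lambda>sj tj. \<epsilon> tj \<odot>\<^bsub>H\<^esub> (\<epsilon> h \<odot>\<^bsub>H\<^esub> sj))"
    by (rule rr_cong(1)) (simp_all add: smult_smult)
  also have "\<dots> = \<epsilon> h \<odot>\<^bsub>H\<^esub> \<one>" by (rule R_counit_right) simp_all
  finally show "E h (coact P \<one>\<^bsub>P\<^esub>) = E h \<one>\<^bsub>tensor K H P\<^esub>" by (simp add: E_one)
qed

lemma comul_left_hom: "comul_left K H P \<in> module_hom K (tensor K H P) (tensor3 K H H P)"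
  unfolding comul_left_def by (rule HP.lift_hom) simp_all

lemma E3_comul_left:
  assumes [simp]: "h \<in> carrier H" and t: "t \<in> carrier (tensor K H P)"
  shows "E3 h (comul_left K H P t) = \<Delta> (E h t)"
proof (rule HP.hom_eqI[where W = HH, OF _ _ _ _ t])
  show "(\<lambda>t. E3 h (comul_left K H P t)) \<in> module_hom K (tensor K H P) HH"
    by (rule module_hom_comp[OF E3_hom comul_left_hom]) simp
  fix a q assume [simp]: "a \<in> carrier H" "q \<in> carrier P"
  have "E3 h (comul_left K H P (pure K H P a q)) = E3 h (sw (tensor3 K H H P) a (\<lambda>c d. pure3 K H H P c d q))"
    unfolding comul_left_def by (subst HP.lift_pure) simp_all
  also have "\<dots> = sw HH a (\<lambda>c d. E3 h (pure3 K H H P c d q))"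
    by (rule hom_sw[OF E3_hom]) simp_all
  also have "\<dots> = sw HH a (\<lambda>c d. ev h q \<odot>\<^bsub>HH\<^esub> pure K H H c d)"
    by (rule sw_cong) simp_all
  also have "\<dots> = ev h q \<odot>\<^bsub>HH\<^esub> sw HH a (pure K H H)"
    by (rule hom_sw[symmetric, where g = "\<lambda>z. ev h q \<odot>\<^bsub>HH\<^esub> z"]) simp_all
  also have "\<dots> = \<Delta> (E h (pure K H P a q))"
    by (simp add: sw_pure module_homD(3)[OF comul_hom(1)])
  finally show "E3 h (comul_left K H P (pure K H P a q)) = \<Delta> (E h (pure K H P a q))" .
qed simp_all

text \<open>The coaction is dual to the map sending h to R21 (h \<otimes> 1) R12, the sum of tj h si
  \<otimes> sj ti. Evaluating the new last leg at \<open>h\<close> therefore evaluates the old one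
  at tj h si and leaves sj ti behind.\<close>

lemma E3_coact:
  assumes [simp]: "h \<in> carrier H" and t: "t \<in> carrier (tensor K H P)"
  shows "E3 h (tensor_map K H (tensor K H P) id (coact P) t)
    = rr HH (\<lambda>sj tj. rr HH (\<lambda>si ti. pure K H H (E (tj \<otimes> h \<otimes> si) t) (sj \<otimes> ti)))"
proof (rule HP.hom_eqI[where W = HH, OF _ _ _ _ t])
  have "tensor_map K H (tensor K H P) id (coact P) \<in> module_hom K (tensor K H P) (tensor3 K H H P)"
    unfolding tensor_map_def id_def by (rule HP.lift_hom) simp_all
  from module_hom_comp[OF E3_hom this]
  show "(\<lambda>t. E3 h (tensor_map K H (tensor K H P) id (coact P) t)) \<in> module_hom K (tensor K H P) HH" by simp
  fix a q assume [simp]: "a \<in> carrier H" "q \<in> carrier P"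
  have "E3 h (tensor_map K H (tensor K H P) id (coact P) (pure K H P a q)) = pure K H H a (E h (coact P q))"
    unfolding tensor_map_def id_def by (subst HP.lift_pure) simp_all
  also have "\<dots> = rr HH (\<lambda>sj tj. pure K H H a (rr H (\<lambda>si ti. ev (tj \<otimes> h \<otimes> si) q \<odot>\<^bsub>H\<^esub> (sj \<otimes> ti))))"
    by (subst E_coact, simp, simp, rule hom_rr(1)) simp_all
  also have "\<dots> = rr HH (\<lambda>sj tj. rr HH (\<lambda>si ti. pure K H H a (ev (tj \<otimes> h \<otimes> si) q \<odot>\<^bsub>H\<^esub> (sj \<otimes> ti))))"
    by (rule rr_cong(1), simp, simp, rule hom_rr(1)) simp_all
  also have "\<dots> = rr HH (\<lambda>sj tj. rr HH (\<lambda>si ti. pure K H H (E (tj \<otimes> h \<otimes> si) (pure K H P a q)) (sj \<otimes> ti)))"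
    by (rule rr_cong(1), simp, simp del: pure_smult, rule rr_cong(1)) simp_all
  finally show "E3 h (tensor_map K H (tensor K H P) id (coact P) (pure K H P a q))
    = rr HH (\<lambda>sj tj. rr HH (\<lambda>si ti. pure K H H (E (tj \<otimes> h \<otimes> si) (pure K H P a q)) (sj \<otimes> ti)))" .
qed simp_all

lemma tensor_map_coact_closed: "t \<in> carrier (tensor K H P) \<Longrightarrow> tensor_map K H (tensor K H P) id (coact P) t \<in> carrier (tensor3 K H H P)"
  unfolding tensor_map_def id_def by (rule module_homD(1)[OF HP.lift_hom]) simp_all

lemma coact_coassoc:
  assumes [simp]: "p \<in> carrier P"
  shows "comul_left K H P (coact P p) = tensor_map K H (tensor K H P) id (coact P) (coact P p)"
proof (rule E3_inj)
  fix h assume [simp]: "h \<in> carrier H"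
  have "E3 h (comul_left K H P (coact P p)) = \<Delta> (rr H (\<lambda>sj tj. rr H (\<lambda>si ti. ev (tj \<otimes> h \<otimes> si) p \<odot>\<^bsub>H\<^esub> (sj \<otimes> ti))))"
    by (simp add: E3_comul_left E_coact)
  also have "\<dots> = rr HH (\<lambda>sj tj. \<Delta> (rr H (\<lambda>si ti. ev (tj \<otimes> h \<otimes> si) p \<odot>\<^bsub>H\<^esub> (sj \<otimes> ti))))"
    by (rule hom_rr(1)[OF comul_hom(1)]) simp_all
  also have "\<dots> = rr HH (\<lambda>sj tj. rr HH (\<lambda>si ti. \<Delta> (ev (tj \<otimes> h \<otimes> si) p \<odot>\<^bsub>H\<^esub> (sj \<otimes> ti))))"
    by (rule rr_cong(1), simp, simp, rule hom_rr(1)[OF comul_hom(1)]) simp_all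
  also have "\<dots> = rr HH (\<lambda>sj tj. rr HH (\<lambda>si ti. sw HH (sj \<otimes> ti) (\<lambda>x y. ev (tj \<otimes> h \<otimes> si) p \<odot>\<^bsub>HH\<^esub> pure K H H x y)))"
  proof (rule rr_cong(1), simp, simp, rule rr_cong(1), simp, simp)
    fix sj tj si ti assume [simp]: "sj \<in> carrier H" "tj \<in> carrier H" "si \<in> carrier H" "ti \<in> carrier H"
    have "ev (tj \<otimes> h \<otimes> si) p \<odot>\<^bsub>HH\<^esub> sw HH (sj \<otimes> ti) (pure K H H) = sw HH (sj \<otimes> ti) (\<lambda>x y. ev (tj \<otimes> h \<otimes> si) p \<odot>\<^bsub>HH\<^esub> pure K H H x y)"
      by (rule hom_sw[where g = "\<lambda>z. ev (tj \<otimes> h \<otimes> si) p \<odot>\<^bsub>HH\<^esub> z"]) simp_all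
    then show "\<Delta> (ev (tj \<otimes> h \<otimes> si) p \<odot>\<^bsub>H\<^esub> (sj \<otimes> ti)) = sw HH (sj \<otimes> ti) (\<lambda>x y. ev (tj \<otimes> h \<otimes> si) p \<odot>\<^bsub>HH\<^esub> pure K H H x y)"
      by (simp add: module_homD(3)[OF comul_hom(1)] sw_pure)
  qed
  also have "\<dots> = rr HH (\<lambda>sk tk. rr HH (\<lambda>sl tl. rr HH (\<lambda>sj tj. rr HH (\<lambda>si ti. ev (tj \<otimes> (tk \<otimes> h \<otimes> sl) \<otimes> si) p \<odot>\<^bsub>HH\<^esub> pure K H H (sj \<otimes> ti) (sk \<otimes> tl)))))"
    by (rule delta_coassoc[where F = "\<lambda>u x y. ev u p \<odot>\<^bsub>HH\<^esub> pure K H H x y"]) (simp_all add: trilin_def)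
  also have "\<dots> = rr HH (\<lambda>sk tk. rr HH (\<lambda>sl tl. pure K H H (E (tk \<otimes> h \<otimes> sl) (coact P p)) (sk \<otimes> tl)))"
  proof (rule rr_cong(1), simp, simp, rule rr_cong(1), simp, simp)
    fix sk tk sl tl assume [simp]: "sk \<in> carrier H" "tk \<in> carrier H" "sl \<in> carrier H" "tl \<in> carrier H"
    have "pure K H H (E (tk \<otimes> h \<otimes> sl) (coact P p)) (sk \<otimes> tl)
      = rr HH (\<lambda>sj tj. pure K H H (rr H (\<lambda>si ti. ev (tj \<otimes> (tk \<otimes> h \<otimes> sl) \<otimes> si) p \<odot>\<^bsub>H\<^esub> (sj \<otimes> ti))) (sk \<otimes> tl))"
      by (subst E_coact, simp, simp, rule hom_rr(1)[where g = "\<lambda>z. pure K H H z (sk \<otimes> tl)"]) simp_all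
    also have "\<dots> = rr HH (\<lambda>sj tj. rr HH (\<lambda>si ti. pure K H H (ev (tj \<otimes> (tk \<otimes> h \<otimes> sl) \<otimes> si) p \<odot>\<^bsub>H\<^esub> (sj \<otimes> ti)) (sk \<otimes> tl)))"
      by (rule rr_cong(1), simp, simp, rule hom_rr(1)[where g = "\<lambda>z. pure K H H z (sk \<otimes> tl)"]) simp_all
    also have "\<dots> = rr HH (\<lambda>sj tj. rr HH (\<lambda>si ti. ev (tj \<otimes> (tk \<otimes> h \<otimes> sl) \<otimes> si) p \<odot>\<^bsub>HH\<^esub> pure K H H (sj \<otimes> ti) (sk \<otimes> tl)))"
      by (rule rr_cong(1), simp, simp del: pure_smult, rule rr_cong(1)) simp_all
    finally show "rr HH (\<lambda>sj tj. rr HH (\<lambda>si ti. ev (tj \<otimes> (tk \<otimes> h \<otimes> sl) \<otimes> si) p \<odot>\<^bsub>HH\<^esub> pure K H H (sj \<otimes> ti) (sk \<otimes> tl)))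
      = pure K H H (E (tk \<otimes> h \<otimes> sl) (coact P p)) (sk \<otimes> tl)" ..
  qed
  also have "\<dots> = E3 h (tensor_map K H (tensor K H P) id (coact P) (coact P p))"
    by (rule E3_coact[symmetric]) simp_all
  finally show "E3 h (comul_left K H P (coact P p)) = E3 h (tensor_map K H (tensor K H P) id (coact P) (coact P p))" .
qed (simp_all add: tensor_map_coact_closed module_homD(1)[OF comul_left_hom])

lemma coact_counit:
  assumes [simp]: "p \<in> carrier P"
  shows "tensor_lift P (\<lambda>a x. \<epsilon> a \<odot>\<^bsub>P\<^esub> x) (coact P p) = p"
proof (rule ev_inj)
  have b: "bilin K H P P (\<lambda>a x. \<epsilon> a \<odot>\<^bsub>P\<^esub> x)" by simp
  have L: "tensor_lift P (\<lambda>a x. \<epsilon> a \<odot>\<^bsub>P\<^esub> x) \<in> module_hom K (tensor K H P) P"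
    by (rule HP.lift_hom[OF b]) simp
  show "tensor_lift P (\<lambda>a x. \<epsilon> a \<odot>\<^bsub>P\<^esub> x) (coact P p) \<in> carrier P"
    by (rule module_homD(1)[OF L]) simp
  fix h assume [simp]: "h \<in> carrier H"
  let ?k = "ground_algebra K"
  have "ev h (tensor_lift P (\<lambda>a x. \<epsilon> a \<odot>\<^bsub>P\<^esub> x) (coact P p)) = \<epsilon> (E h (coact P p))"
  proof (rule HP.hom_eqI[where W = ?k])
    fix a q assume [simp]: "a \<in> carrier H" "q \<in> carrier P"
    have "tensor_lift P (\<lambda>a x. \<epsilon> a \<odot>\<^bsub>P\<^esub> x) (pure K H P a q) = \<epsilon> a \<odot>\<^bsub>P\<^esub> q"
      by (rule HP.lift_pure[OF b]) simp_all
    then show "ev h (tensor_lift P (\<lambda>a x. \<epsilon> a \<odot>\<^bsub>P\<^esub> x) (pure K H P a q)) = \<epsilon> (E h (pure K H P a q))"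
      using smult_hom[OF lin_ev(2)[OF _ module_hom_id], of h "\<epsilon> a" q] smult_hom[OF counit_hom(1), of "ev h q" a]
      by (simp add: K.m_comm)
  qed (simp_all add: module_hom_comp[OF L])
  also have "\<dots> = rr ?k (\<lambda>sj tj. \<epsilon> (rr H (\<lambda>si ti. ev (tj \<otimes> h \<otimes> si) p \<odot>\<^bsub>H\<^esub> (sj \<otimes> ti))))"
    by (subst E_coact, simp, simp, rule hom_rr(1)[OF counit_hom(1)]) simp_all
  also have "\<dots> = rr ?k (\<lambda>sj tj. rr ?k (\<lambda>si ti. \<epsilon> (ev (tj \<otimes> h \<otimes> si) p \<odot>\<^bsub>H\<^esub> (sj \<otimes> ti))))"
    by (rule rr_cong(1), simp, simp, rule hom_rr(1)[OF counit_hom(1)]) simp_all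
  also have "\<dots> = rr ?k (\<lambda>sj tj. rr ?k (\<lambda>si ti. \<epsilon> ti \<odot>\<^bsub>?k\<^esub> (\<epsilon> sj \<otimes>\<^bsub>K\<^esub> ev (tj \<otimes> h \<otimes> si) p)))"
    by (rule rr_cong(1), simp, simp, rule rr_cong(1))
       (simp_all add: smult_hom[OF counit_hom(1)] K.m_ac)
  also have "\<dots> = rr ?k (\<lambda>sj tj. \<epsilon> sj \<otimes>\<^bsub>K\<^esub> ev (tj \<otimes> h \<otimes> \<one>) p)"
    by (rule rr_cong(1), simp, simp, rule R_counit_right) simp_all
  also have "\<dots> = rr ?k (\<lambda>sj tj. \<epsilon> sj \<odot>\<^bsub>?k\<^esub> ev (tj \<otimes> h \<otimes> \<one>) p)" by simp
  also have "\<dots> = ev (\<one> \<otimes> h \<otimes> \<one>) p"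
    by (rule R_counit_left) simp_all
  finally show "ev h (tensor_lift P (\<lambda>a x. \<epsilon> a \<odot>\<^bsub>P\<^esub> x) (coact P p)) = ev h p" by simp
qed simp

lemma comodule_algebra_P: "comodule_algebra K H P"
proof -
  have "coact P \<in> ring_hom P (tensor K H P)"
    by (rule ring_hom_memI) (simp_all add: coact_mult coact_one module_homD(2)[OF coact_hom])
  then show ?thesis
    unfolding comodule_algebra_def algebra_hom_def using coact_hom coact_coassoc coact_counit by simp
qed

text \<open>As evaluation turns \<open>kp\<close> into the identity of H, applying \<open>g\<close>
  to its first leg produces an element whose evaluation is \<open>g\<close>. Every linear
  endomorphism of H is realised in this way, which is how inverses of \<open>kp\<close> are
  constructed.\<close>

lemma realize:
  assumes g: "g \<in> module_hom K H H"
  shows "tensor_map K H P g id kp \<in> carrier (tensor K H P)" "\<And>h. h \<in> carrier H \<Longrightarrow> E h (tensor_map K H P g id kp) = g h"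
proof -
  note [simp] = module_hom_comp[OF g] g
  have b: "bilin K H P (tensor K H P) (\<lambda>a q. pure K H P (g a) q)"
    using module_homD(1)[OF g] by simp
  note L = HP.lift_hom[OF b, simplified]
  show "tensor_map K H P g id kp \<in> carrier (tensor K H P)"
    unfolding tensor_map_def id_def by (rule module_homD(1)[OF L]) simp
  fix h assume [simp]: "h \<in> carrier H"
  have "E h (tensor_lift (tensor K H P) (\<lambda>a q. pure K H P (g a) q) kp) = g (E h kp)"
    by (rule HP.hom_eqI[where W = H])
       (simp_all add: module_hom_comp[OF E_hom L] HP.lift_pure[OF b] module_homD[OF g])
  then show "E h (tensor_map K H P g id kp) = g h"
    unfolding tensor_map_def id_def by simp
qed

text \<open>\<open>E_mult\<close> turns the two inverse conditions into
  \<open>K_ref_right_inverse\<close> and \<open>K_ref_left_inverse\<close>, so \<open>x\<close>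
  realises a right and \<open>y\<close> a left inverse. Despite their different formulas, y = y (kp
  x) = (y kp) x = x.\<close>

lemma kp_unit: "kp \<in> Units (tensor K H P)"
proof -
  let ?A = "tensor K H P"
  define g where "g a = rr H (\<lambda>s t. ri H (\<lambda>s' t'. s \<otimes> s' \<otimes> Si t' \<otimes> Si a \<otimes> Si t))" for a
  define f where "f b = rr H (\<lambda>s t. ri H (\<lambda>s' t'. S s \<otimes> S b \<otimes> S s' \<otimes> t' \<otimes> t))" for b
  have g: "g \<in> module_hom K H H" and f: "f \<in> module_hom K H H" unfolding g_def f_def by simp_all
  note [simp] = g f module_homD(1)[OF g] module_homD(1)[OF f] module_hom_comp[OF f] module_hom_comp[OF g]
  define x where "x = tensor_map K H P g id kp"
  define y where "y = tensor_map K H P f id kp"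
  have c [simp]: "x \<in> carrier ?A" "y \<in> carrier ?A" unfolding x_def y_def by (rule realize; simp)+
  have e: "E h x = g h" "E h y = f h" if "h \<in> carrier H" for h
    unfolding x_def y_def by (rule realize; simp add: that)+
  note m_assoc = monoid.m_assoc[OF ring.is_monoid[OF assoc_algebraD(2)[OF HP.assoc_algebra_tensor]]]
  have 1: "kp \<otimes>\<^bsub>?A\<^esub> x = \<one>\<^bsub>?A\<^esub>"
  proof (rule E_inj)
    fix h assume [simp]: "h \<in> carrier H"
    have "E h (kp \<otimes>\<^bsub>?A\<^esub> x) = hw H h (\<lambda>a b. E b kp \<otimes> E a x)" by (rule E_mult) simp_all
    also have "\<dots> = hw H h (\<lambda>a b. b \<otimes> g a)" by (rule hw_cong) (simp_all add: e)
    also have "\<dots> = \<epsilon> h \<odot>\<^bsub>H\<^esub> \<one>" unfolding g_def by (rule K_ref_right_inverse) simp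
    finally show "E h (kp \<otimes>\<^bsub>?A\<^esub> x) = E h \<one>\<^bsub>?A\<^esub>" by (simp add: E_one)
  qed simp_all
  have 2: "y \<otimes>\<^bsub>?A\<^esub> kp = \<one>\<^bsub>?A\<^esub>"
  proof (rule E_inj)
    fix h assume [simp]: "h \<in> carrier H"
    have "E h (y \<otimes>\<^bsub>?A\<^esub> kp) = hw H h (\<lambda>a b. E b y \<otimes> E a kp)" by (rule E_mult) simp_all
    also have "\<dots> = hw H h (\<lambda>a b. f b \<otimes> a)" by (rule hw_cong) (simp_all add: e)
    also have "\<dots> = \<epsilon> h \<odot>\<^bsub>H\<^esub> \<one>" unfolding f_def by (rule K_ref_left_inverse) simp
    finally show "E h (y \<otimes>\<^bsub>?A\<^esub> kp) = E h \<one>\<^bsub>?A\<^esub>" by (simp add: E_one)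
  qed simp_all
  have "y = y \<otimes>\<^bsub>?A\<^esub> (kp \<otimes>\<^bsub>?A\<^esub> x)" by (simp add: 1)
  also have "\<dots> = x" by (subst m_assoc[symmetric]) (simp_all add: 2)
  finally show ?thesis unfolding Units_def using 1 2 by auto
qed

lemma kp_commute:
  assumes [simp]: "p \<in> carrier P"
  shows "kp \<otimes>\<^bsub>tensor K H P\<^esub> coact P p = coact P p \<otimes>\<^bsub>tensor K H P\<^esub> kp"
proof (rule E_inj)
  fix h assume [simp]: "h \<in> carrier H"
  have "E h (kp \<otimes>\<^bsub>tensor K H P\<^esub> coact P p) = hw H h (\<lambda>a b. E b kp \<otimes> E a (coact P p))"
    by (rule E_mult) simp_all
  also have "\<dots> = hw H h (\<lambda>a b. rr H (\<lambda>sj tj. rr H (\<lambda>si ti. ev (tj \<otimes> a \<otimes> si) p \<odot>\<^bsub>H\<^esub> (b \<otimes> (sj \<otimes> ti)))))"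
  proof (rule hw_cong, simp, simp, simp)
    fix a b assume [simp]: "a \<in> carrier H" "b \<in> carrier H"
    have "b \<otimes> E a (coact P p) = rr H (\<lambda>sj tj. b \<otimes> rr H (\<lambda>si ti. ev (tj \<otimes> a \<otimes> si) p \<odot>\<^bsub>H\<^esub> (sj \<otimes> ti)))"
      by (subst E_coact, simp, simp, rule hom_rr(1)) simp_all
    also have "\<dots> = rr H (\<lambda>sj tj. rr H (\<lambda>si ti. b \<otimes> (ev (tj \<otimes> a \<otimes> si) p \<odot>\<^bsub>H\<^esub> (sj \<otimes> ti))))"
      by (rule rr_cong(1), simp, simp, rule hom_rr(1)) simp_all
    also have "\<dots> = rr H (\<lambda>sj tj. rr H (\<lambda>si ti. ev (tj \<otimes> a \<otimes> si) p \<odot>\<^bsub>H\<^esub> (b \<otimes> (sj \<otimes> ti))))"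
      by (rule rr_cong(1), simp, simp, rule rr_cong(1)) (simp_all add: smult_mult_A)
    finally show "E b kp \<otimes> E a (coact P p) = rr H (\<lambda>sj tj. rr H (\<lambda>si ti. ev (tj \<otimes> a \<otimes> si) p \<odot>\<^bsub>H\<^esub> (b \<otimes> (sj \<otimes> ti))))" by simp
  qed
  also have "\<dots> = hw H h (\<lambda>a b. rr H (\<lambda>sj tj. rr H (\<lambda>si ti. ev (tj \<otimes> b \<otimes> si) p \<odot>\<^bsub>H\<^esub> (sj \<otimes> ti \<otimes> a))))"
    by (rule K_ref_commute[where F = "\<lambda>x y. ev x p \<odot>\<^bsub>H\<^esub> y"]) simp_all
  also have "\<dots> = hw H h (\<lambda>a b. E b (coact P p) \<otimes> E a kp)"
  proof (rule hw_cong, simp, simp, simp)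
    fix a b assume [simp]: "a \<in> carrier H" "b \<in> carrier H"
    have "E b (coact P p) \<otimes> a = rr H (\<lambda>sj tj. rr H (\<lambda>si ti. ev (tj \<otimes> b \<otimes> si) p \<odot>\<^bsub>H\<^esub> (sj \<otimes> ti)) \<otimes> a)"
      by (subst E_coact, simp, simp, rule hom_rr(1)) simp_all
    also have "\<dots> = rr H (\<lambda>sj tj. rr H (\<lambda>si ti. (ev (tj \<otimes> b \<otimes> si) p \<odot>\<^bsub>H\<^esub> (sj \<otimes> ti)) \<otimes> a))"
      by (rule rr_cong(1), simp, simp, rule hom_rr(1)) simp_all
    also have "\<dots> = rr H (\<lambda>sj tj. rr H (\<lambda>si ti. ev (tj \<otimes> b \<otimes> si) p \<odot>\<^bsub>H\<^esub> (sj \<otimes> ti \<otimes> a)))"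
      by (rule rr_cong(1), simp, simp, rule rr_cong(1)) (simp_all add: smult_mult_A)
    finally show "rr H (\<lambda>sj tj. rr H (\<lambda>si ti. ev (tj \<otimes> b \<otimes> si) p \<odot>\<^bsub>H\<^esub> (sj \<otimes> ti \<otimes> a))) = E b (coact P p) \<otimes> E a kp" by simp
  qed
  also have "\<dots> = E h (coact P p \<otimes>\<^bsub>tensor K H P\<^esub> kp)"
    by (rule E_mult[symmetric]) simp_all
  finally show "E h (kp \<otimes>\<^bsub>tensor K H P\<^esub> coact P p) = E h (coact P p \<otimes>\<^bsub>tensor K H P\<^esub> kp)" .
qed simp_all

definition swp where "swp t = tensor_lift HH (\<lambda>a b. pure K H H b a) t"

lemma swp_closed [simp]: "t \<in> carrier HH \<Longrightarrow> swp t \<in> carrier HH"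
  unfolding swp_def by (rule module_homD(1)[OF HH.lift_hom]) simp_all

lemma legs_closed [simp]:
  "t \<in> carrier HH \<Longrightarrow> leg12 K H P t \<in> carrier (tensor3 K H H P)"
  "t \<in> carrier HH \<Longrightarrow> leg21 K H P t \<in> carrier (tensor3 K H H P)"
  "u \<in> carrier (tensor K H P) \<Longrightarrow> leg13 K H P u \<in> carrier (tensor3 K H H P)"
  "u \<in> carrier (tensor K H P) \<Longrightarrow> leg23 K H P u \<in> carrier (tensor3 K H H P)"
  unfolding leg12_def leg21_def leg13_def leg23_def
  by (rule module_homD(1)[OF HH.lift_hom] module_homD(1)[OF HP.lift_hom]; simp)+

lemma E3_leg21:
  assumes [simp]: "h \<in> carrier H" and t: "t \<in> carrier HH"
  shows "E3 h (leg21 K H P t) = \<epsilon> h \<odot>\<^bsub>HH\<^esub> swp t"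
proof (rule HH.hom_eqI[where W = HH, OF _ _ _ _ t])
  have b: "bilin K H H (tensor3 K H H P) (\<lambda>a b. pure3 K H H P b a \<one>\<^bsub>P\<^esub>)" and b': "bilin K H H HH (\<lambda>a b. pure K H H b a)" by simp_all
  show "(\<lambda>t. E3 h (leg21 K H P t)) \<in> module_hom K HH HH" "(\<lambda>t. \<epsilon> h \<odot>\<^bsub>HH\<^esub> swp t) \<in> module_hom K HH HH"
    unfolding leg21_def swp_def using HH.lift_hom[OF b] HH.lift_hom[OF b'] by simp_all
  fix u v assume [simp]: "u \<in> carrier H" "v \<in> carrier H"
  show "E3 h (leg21 K H P (pure K H H u v)) = \<epsilon> h \<odot>\<^bsub>HH\<^esub> swp (pure K H H u v)"
    unfolding leg21_def swp_def by (simp add: HH.lift_pure[OF b] HH.lift_pure[OF b'] ev_one)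
qed simp

lemma E3_leg12:
  assumes [simp]: "h \<in> carrier H" and t: "t \<in> carrier HH"
  shows "E3 h (leg12 K H P t) = \<epsilon> h \<odot>\<^bsub>HH\<^esub> t"
proof (rule HH.hom_eqI[where W = HH, OF _ _ _ _ t])
  have b: "bilin K H H (tensor3 K H H P) (\<lambda>a b. pure3 K H H P a b \<one>\<^bsub>P\<^esub>)" by simp
  show "(\<lambda>t. E3 h (leg12 K H P t)) \<in> module_hom K HH HH"
    unfolding leg12_def using HH.lift_hom[OF b] by simp
  fix u v assume [simp]: "u \<in> carrier H" "v \<in> carrier H"
  show "E3 h (leg12 K H P (pure K H H u v)) = \<epsilon> h \<odot>\<^bsub>HH\<^esub> pure K H H u v"
    unfolding leg12_def by (simp add: HH.lift_pure[OF b] ev_one)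
qed simp_all

lemma E3_leg13:
  assumes [simp]: "h \<in> carrier H" and t: "t \<in> carrier (tensor K H P)"
  shows "E3 h (leg13 K H P t) = pure K H H (E h t) \<one>" "E3 h (leg23 K H P t) = pure K H H \<one> (E h t)"
proof -
  have b: "bilin K H P (tensor3 K H H P) (\<lambda>a q. pure3 K H H P a \<one> q)"
    "bilin K H P (tensor3 K H H P) (\<lambda>a q. pure3 K H H P \<one> a q)" by simp_all
  have L: "tensor_lift (tensor3 K H H P) (\<lambda>a q. pure3 K H H P a \<one> q) \<in> module_hom K (tensor K H P) (tensor3 K H H P)"
    "tensor_lift (tensor3 K H H P) (\<lambda>a q. pure3 K H H P \<one> a q) \<in> module_hom K (tensor K H P) (tensor3 K H H P)"
    by (rule HP.lift_hom; simp)+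
  show "E3 h (leg13 K H P t) = pure K H H (E h t) \<one>"
    unfolding leg13_def
    by (rule HP.hom_eqI[where W = HH, OF module_hom_comp[OF E3_hom L(1)] _ _ _ t]) (simp_all add: HP.lift_pure[OF b(1)])
  show "E3 h (leg23 K H P t) = pure K H H \<one> (E h t)"
    unfolding leg23_def
    by (rule HP.hom_eqI[where W = HH, OF module_hom_comp[OF E3_hom L(2)] _ _ _ t]) (simp_all add: HP.lift_pure[OF b(2)])
qed

text \<open>The assumption \<open>e\<close> expresses that the last leg of \<open>c\<close> is the
  unit of \<open>P\<close>, so that evaluation contributes only \<epsilon>(h). The counit property
  of the twisted comultiplication then lets \<open>c\<close> act as the constant \<open>C\<close>.
  This handles the copies of R in the K-matrix axioms.\<close>

lemma E3_const:
  assumes c: "c \<in> carrier (tensor3 K H H P)" and C: "C \<in> carrier HH" and e: "\<And>h. h \<in> carrier H \<Longrightarrow> E3 h c = \<epsilon> h \<odot>\<^bsub>HH\<^esub> C"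
    and s: "s \<in> carrier (tensor3 K H H P)" and [simp]: "h \<in> carrier H"
  shows "E3 h (s \<otimes>\<^bsub>tensor3 K H H P\<^esub> c) = E3 h s \<otimes>\<^bsub>HH\<^esub> C"
    "E3 h (c \<otimes>\<^bsub>tensor3 K H H P\<^esub> s) = C \<otimes>\<^bsub>HH\<^esub> E3 h s"
proof -
  note [simp] = c C s
  have "E3 h (s \<otimes>\<^bsub>tensor3 K H H P\<^esub> c) = hw HH h (\<lambda>a b. E3 b s \<otimes>\<^bsub>HH\<^esub> E3 a c)" by (rule E3_mult) simp_all
  also have "\<dots> = hw HH h (\<lambda>a b. \<epsilon> a \<odot>\<^bsub>HH\<^esub> (E3 b s \<otimes>\<^bsub>HH\<^esub> C))" by (rule hw_cong) (simp_all add: e smult_mult_A)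
  also have "\<dots> = E3 h s \<otimes>\<^bsub>HH\<^esub> C" by (rule hat_counit(1)) simp_all
  finally show "E3 h (s \<otimes>\<^bsub>tensor3 K H H P\<^esub> c) = E3 h s \<otimes>\<^bsub>HH\<^esub> C" .
  have "E3 h (c \<otimes>\<^bsub>tensor3 K H H P\<^esub> s) = hw HH h (\<lambda>a b. E3 b c \<otimes>\<^bsub>HH\<^esub> E3 a s)" by (rule E3_mult) simp_all
  also have "\<dots> = hw HH h (\<lambda>a b. \<epsilon> b \<odot>\<^bsub>HH\<^esub> (C \<otimes>\<^bsub>HH\<^esub> E3 a s))" by (rule hw_cong) (simp_all add: e smult_mult_A)
  also have "\<dots> = C \<otimes>\<^bsub>HH\<^esub> E3 h s" by (rule hat_counit(2)) simp_all
  finally show "E3 h (c \<otimes>\<^bsub>tensor3 K H H P\<^esub> s) = C \<otimes>\<^bsub>HH\<^esub> E3 h s" .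
qed

lemma swp_R_inverse: "swp R \<otimes>\<^bsub>HH\<^esub> swp Ri = \<one>\<^bsub>HH\<^esub>"
proof -
  note tp = HH.tensor_product_axioms
  have b: "bilin K H H HH (\<lambda>a b. pure K H H b a)" by simp
  have "swp R \<otimes>\<^bsub>HH\<^esub> swp Ri = rr HH (\<lambda>s t. ri HH (\<lambda>s' t'. pure K H H t s \<otimes>\<^bsub>HH\<^esub> pure K H H t' s'))"
    unfolding swp_def by (rule lift_lift_mult[OF tp _ b tp _ b algebra_HH module_hom_id]) simp_all
  also have "\<dots> = rr HH (\<lambda>s t. ri HH (\<lambda>s' t'. pure K H H (t \<otimes> t') (s \<otimes> s')))"
    by (rule rr_cong(1), simp, simp, rule rr_cong(2)) (simp_all add: HH.mult_pure)
  also have "\<dots> = pure K H H \<one> \<one>"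
    by (rule R_inverse(1)[where F = "\<lambda>a b. pure K H H b a"]) simp_all
  finally show ?thesis by (simp add: HH.one_tensor)
qed

text \<open>Evaluating K23 R21 K13 gives the sum of t a \<otimes> b s over R and the twisted
  coproduct of \<open>h\<close>. \<open>hat_cancel\<close> turns this into \<Delta>(h) R21, and the
  last factor R21^{-1} cancels.\<close>

lemma kp_comul:
  "comul_left K H P kp = leg23 K H P kp \<otimes>\<^bsub>tensor3 K H H P\<^esub> leg21 K H P R \<otimes>\<^bsub>tensor3 K H H P\<^esub> leg13 K H P kp
     \<otimes>\<^bsub>tensor3 K H H P\<^esub> inv\<^bsub>tensor3 K H H P\<^esub> (leg21 K H P R)"
  unfolding leg21_inverse(2)[OF algebra_P]
proof (rule E3_inj)
  let ?T = "tensor3 K H H P"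
  fix h assume [simp]: "h \<in> carrier H"
  note c21 = E3_const[OF legs_closed(2)[OF R_closed] swp_closed[OF R_closed] E3_leg21[OF _ R_closed]]
  note c21i = E3_const[OF legs_closed(2)[OF Ri_closed] swp_closed[OF Ri_closed] E3_leg21[OF _ Ri_closed]]
  have "E3 h (leg23 K H P kp \<otimes>\<^bsub>?T\<^esub> leg21 K H P R \<otimes>\<^bsub>?T\<^esub> leg13 K H P kp)
    = hw HH h (\<lambda>a b. E3 b (leg23 K H P kp \<otimes>\<^bsub>?T\<^esub> leg21 K H P R) \<otimes>\<^bsub>HH\<^esub> E3 a (leg13 K H P kp))"
    by (rule E3_mult) simp_all
  also have "\<dots> = hw HH h (\<lambda>a b. rr HH (\<lambda>s t. pure K H H (t \<otimes> a) (b \<otimes> s)))"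
  proof (rule hw_cong, simp, simp, simp)
    fix a b assume [simp]: "a \<in> carrier H" "b \<in> carrier H"
    have "E3 b (leg23 K H P kp \<otimes>\<^bsub>?T\<^esub> leg21 K H P R) \<otimes>\<^bsub>HH\<^esub> E3 a (leg13 K H P kp)
      = pure K H H \<one> b \<otimes>\<^bsub>HH\<^esub> swp R \<otimes>\<^bsub>HH\<^esub> pure K H H a \<one>"
      by (simp add: c21(1) E3_leg13)
    also have "\<dots> = rr HH (\<lambda>s t. pure K H H \<one> b \<otimes>\<^bsub>HH\<^esub> pure K H H t s \<otimes>\<^bsub>HH\<^esub> pure K H H a \<one>)"
      unfolding swp_def by (rule hom_rr(1)[where g = "\<lambda>z. pure K H H \<one> b \<otimes>\<^bsub>HH\<^esub> z \<otimes>\<^bsub>HH\<^esub> pure K H H a \<one>"]) simp_all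
    also have "\<dots> = rr HH (\<lambda>s t. pure K H H (t \<otimes> a) (b \<otimes> s))"
      by (rule rr_cong(1)) (simp_all add: HH.mult_pure)
    finally show "E3 b (leg23 K H P kp \<otimes>\<^bsub>?T\<^esub> leg21 K H P R) \<otimes>\<^bsub>HH\<^esub> E3 a (leg13 K H P kp)
      = rr HH (\<lambda>s t. pure K H H (t \<otimes> a) (b \<otimes> s))" .
  qed
  also have "\<dots> = sw HH h (\<lambda>a b. rr HH (\<lambda>s t. pure K H H (a \<otimes> t) (b \<otimes> s)))"
    by (rule hat_cancel) simp_all
  also have "\<dots> = sw HH h (\<lambda>a b. rr HH (\<lambda>s t. pure K H H a b \<otimes>\<^bsub>HH\<^esub> pure K H H t s))"
    by (rule sw_cong, simp, simp, simp, rule rr_cong(1)) (simp_all add: HH.mult_pure)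
  also have "\<dots> = sw HH h (\<lambda>a b. pure K H H a b \<otimes>\<^bsub>HH\<^esub> swp R)"
    unfolding swp_def by (rule sw_cong, simp, simp, simp, rule hom_rr(1)[symmetric]) simp_all
  also have "\<dots> = sw HH h (pure K H H) \<otimes>\<^bsub>HH\<^esub> swp R"
    by (rule hom_sw[symmetric, where g = "\<lambda>z. z \<otimes>\<^bsub>HH\<^esub> swp R"]) simp_all
  also have "\<dots> = \<Delta> h \<otimes>\<^bsub>HH\<^esub> swp R" by (simp add: sw_pure)
  finally have "E3 h (leg23 K H P kp \<otimes>\<^bsub>?T\<^esub> leg21 K H P R \<otimes>\<^bsub>?T\<^esub> leg13 K H P kp \<otimes>\<^bsub>?T\<^esub> leg21 K H P Ri)
    = \<Delta> h \<otimes>\<^bsub>HH\<^esub> swp R \<otimes>\<^bsub>HH\<^esub> swp Ri"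
    by (simp add: c21i(1))
  also have "\<dots> = \<Delta> h" by (simp add: monoid.m_assoc[OF monoid_HH] swp_R_inverse)
  finally show "E3 h (comul_left K H P kp)
    = E3 h (leg23 K H P kp \<otimes>\<^bsub>?T\<^esub> leg21 K H P R \<otimes>\<^bsub>?T\<^esub> leg13 K H P kp \<otimes>\<^bsub>?T\<^esub> leg21 K H P Ri)"
    by (simp add: E3_comul_left)
qed (simp_all add: module_homD(1)[OF comul_left_hom])

lemma kp_coact:
  "tensor_map K H (tensor K H P) id (coact P) kp
    = leg21 K H P R \<otimes>\<^bsub>tensor3 K H H P\<^esub> leg13 K H P kp \<otimes>\<^bsub>tensor3 K H H P\<^esub> leg12 K H P R"
proof (rule E3_inj)
  let ?T = "tensor3 K H H P"
  fix h assume [simp]: "h \<in> carrier H"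
  note c21 = E3_const[OF legs_closed(2)[OF R_closed] swp_closed[OF R_closed] E3_leg21[OF _ R_closed]]
  note c12 = E3_const[OF legs_closed(1)[OF R_closed] R_closed E3_leg12[OF _ R_closed]]
  have "E3 h (leg21 K H P R \<otimes>\<^bsub>?T\<^esub> leg13 K H P kp \<otimes>\<^bsub>?T\<^esub> leg12 K H P R) = swp R \<otimes>\<^bsub>HH\<^esub> pure K H H h \<one> \<otimes>\<^bsub>HH\<^esub> R"
    by (simp add: c21(2) c12(1) E3_leg13)
  also have "\<dots> = rr HH (\<lambda>sj tj. pure K H H tj sj \<otimes>\<^bsub>HH\<^esub> pure K H H h \<one> \<otimes>\<^bsub>HH\<^esub> R)"
    unfolding swp_def by (rule hom_rr(1)[where g = "\<lambda>z. z \<otimes>\<^bsub>HH\<^esub> pure K H H h \<one> \<otimes>\<^bsub>HH\<^esub> R"]) simp_all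
  also have "\<dots> = rr HH (\<lambda>sj tj. rr HH (\<lambda>si ti. pure K H H (tj \<otimes> h \<otimes> si) (sj \<otimes> ti)))"
  proof (rule rr_cong(1), simp, simp)
    fix sj tj assume [simp]: "sj \<in> carrier H" "tj \<in> carrier H"
    have "pure K H H tj sj \<otimes>\<^bsub>HH\<^esub> pure K H H h \<one> \<otimes>\<^bsub>HH\<^esub> rr HH (pure K H H)
      = rr HH (\<lambda>si ti. pure K H H tj sj \<otimes>\<^bsub>HH\<^esub> pure K H H h \<one> \<otimes>\<^bsub>HH\<^esub> pure K H H si ti)"
      by (rule hom_rr(1)[where g = "\<lambda>z. pure K H H tj sj \<otimes>\<^bsub>HH\<^esub> pure K H H h \<one> \<otimes>\<^bsub>HH\<^esub> z"]) simp_all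
    also have "\<dots> = rr HH (\<lambda>si ti. pure K H H (tj \<otimes> h \<otimes> si) (sj \<otimes> ti))"
      by (rule rr_cong(1)) (simp_all add: HH.mult_pure)
    finally show "pure K H H tj sj \<otimes>\<^bsub>HH\<^esub> pure K H H h \<one> \<otimes>\<^bsub>HH\<^esub> R
      = rr HH (\<lambda>si ti. pure K H H (tj \<otimes> h \<otimes> si) (sj \<otimes> ti))" unfolding R_eq .
  qed
  also have "\<dots> = rr HH (\<lambda>sj tj. rr HH (\<lambda>si ti. pure K H H (E (tj \<otimes> h \<otimes> si) kp) (sj \<otimes> ti)))"
    by (rule rr_cong(1), simp, simp, rule rr_cong(1)) simp_all
  also have "\<dots> = E3 h (tensor_map K H (tensor K H P) id (coact P) kp)"
    by (rule E3_coact[symmetric]) simp_all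
  finally show "E3 h (tensor_map K H (tensor K H P) id (coact P) kp)
    = E3 h (leg21 K H P R \<otimes>\<^bsub>?T\<^esub> leg13 K H P kp \<otimes>\<^bsub>?T\<^esub> leg12 K H P R)" ..
qed (simp_all add: tensor_map_coact_closed)

lemma QT_object: "(P, kp) \<in> QT_objects K H R"
  unfolding QT_objects_def K_matrix_def Let_def
  using comodule_algebra_P kp_unit kp_comul kp_coact kp_commute by simp

end

section \<open>The unique morphism out of the model\<close>

locale ref_model_target =
  ref_model K H R P kp ev D hb xb + QO: qt_object K H R Q kq
  for K :: "('k, 'l) ring_scheme" and H :: "('k, 'h, 'm) hopf_scheme" (structure) and R :: "('h, 'h) tensor"
    and P :: "('k, 'h, 'p) comod_algebra" and kp :: "('h, 'p) tensor" and ev :: "'h \<Rightarrow> 'p \<Rightarrow> 'k"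
    and D :: "'d set" and hb :: "'d \<Rightarrow> 'h" and xb :: "'d \<Rightarrow> 'p"
    and Q :: "('k, 'h, 'q) comod_algebra" and kq :: "('h, 'q) tensor"
begin

definition phi where "phi p = QO.kk Q (\<lambda>a x. ev a p \<odot>\<^bsub>Q\<^esub> x)"

lemma phi_hom: "phi \<in> module_hom K P Q"
proof -
  have "(\<lambda>p. QO.kk Q (\<lambda>a x. ev a p \<odot>\<^bsub>Q\<^esub> x)) \<in> module_hom K P Q" by simp
  then show ?thesis by (simp add: phi_def[abs_def])
qed

lemma lin_phi [simp]: "f \<in> module_hom K Y P \<Longrightarrow> (\<lambda>x. phi (f x)) \<in> module_hom K Y Q"
  by (rule module_hom_comp[OF phi_hom])

lemma phi_closed [simp]: "p \<in> carrier P \<Longrightarrow> phi p \<in> carrier Q"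
  by (rule module_homD(1)[OF phi_hom])

lemma phi_mult:
  assumes [simp]: "p \<in> carrier P" "q \<in> carrier P"
  shows "phi (p \<otimes>\<^bsub>P\<^esub> q) = phi p \<otimes>\<^bsub>Q\<^esub> phi q"
proof -
  have "phi (p \<otimes>\<^bsub>P\<^esub> q) = QO.kk Q (\<lambda>a x. hw Q a (\<lambda>c d. (ev c q \<otimes>\<^bsub>K\<^esub> ev d p) \<odot>\<^bsub>Q\<^esub> x))"
    unfolding phi_def by (rule QO.kk_cong, simp, simp, rule ev_mult_smult) simp_all
  also have "\<dots> = QO.kk Q (\<lambda>a x. QO.kk Q (\<lambda>a' x'. (ev a' q \<otimes>\<^bsub>K\<^esub> ev a p) \<odot>\<^bsub>Q\<^esub> (x \<otimes>\<^bsub>Q\<^esub> x')))"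
    by (rule QO.kq_hat_comul) (simp_all add: trilin_def)
  also have "\<dots> = QO.kk Q (\<lambda>a x. QO.kk Q (\<lambda>a' x'. (ev a p \<odot>\<^bsub>Q\<^esub> x) \<otimes>\<^bsub>Q\<^esub> (ev a' q \<odot>\<^bsub>Q\<^esub> x')))"
    by (rule QO.kk_cong, simp, simp, rule QO.kk_cong) (simp_all add: smult_mult_A smult_smult)
  also have "\<dots> = QO.kk Q (\<lambda>a x. (ev a p \<odot>\<^bsub>Q\<^esub> x) \<otimes>\<^bsub>Q\<^esub> phi q)"
    unfolding phi_def by (rule QO.kk_cong[symmetric], simp, simp, rule QO.hom_kk) simp_all
  also have "\<dots> = phi p \<otimes>\<^bsub>Q\<^esub> phi q"
    by (subst (2) phi_def, rule QO.hom_kk[symmetric, where g = "\<lambda>z. z \<otimes>\<^bsub>Q\<^esub> phi q"]) simp_all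
  finally show ?thesis .
qed

lemma phi_one: "phi \<one>\<^bsub>P\<^esub> = \<one>\<^bsub>Q\<^esub>"
proof -
  have "phi \<one>\<^bsub>P\<^esub> = QO.kk Q (\<lambda>a x. \<epsilon> a \<odot>\<^bsub>Q\<^esub> x)"
    unfolding phi_def by (rule QO.kk_cong) (simp_all add: ev_one)
  then show ?thesis by (simp add: QO.kq_counit)
qed

text \<open>On a \<otimes> q the definition of \<open>phi\<close> gives the sum of a \<otimes> ev b
  q x over the terms b \<otimes> x of \<open>kq\<close>, and the scalar ev b q can be moved to a.
  The conditions on K-matrix and coaction thus become statements about the known evaluations of
  \<open>kp\<close> and \<open>coact P p\<close>.\<close>

lemma tensor_map_phi:
  assumes t: "t \<in> carrier (tensor K H P)"
  shows "tensor_map K H Q id phi t = QO.kk (tensor K H Q) (\<lambda>b x. pure K H Q (E b t) x)"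
  unfolding tensor_map_def id_def
proof (rule HP.hom_eqI[where W = "tensor K H Q", OF _ _ _ _ t])
  have b: "bilin K H P (tensor K H Q) (\<lambda>a q. pure K H Q a (phi q))" by simp
  show "tensor_lift (tensor K H Q) (\<lambda>a q. pure K H Q a (phi q)) \<in> module_hom K (tensor K H P) (tensor K H Q)"
    by (rule HP.lift_hom[OF b]) simp
  fix a q assume [simp]: "a \<in> carrier H" "q \<in> carrier P"
  have "tensor_lift (tensor K H Q) (\<lambda>a q. pure K H Q a (phi q)) (pure K H P a q) = pure K H Q a (phi q)"
    by (rule HP.lift_pure[OF b]) simp_all
  also have "\<dots> = QO.kk (tensor K H Q) (\<lambda>b x. pure K H Q a (ev b q \<odot>\<^bsub>Q\<^esub> x))"
    unfolding phi_def by (rule QO.hom_kk) simp_all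
  also have "\<dots> = QO.kk (tensor K H Q) (\<lambda>b x. pure K H Q (E b (pure K H P a q)) x)"
    by (rule QO.kk_cong, simp, simp del: pure_smult) simp_all
  finally show "tensor_lift (tensor K H Q) (\<lambda>a q. pure K H Q a (phi q)) (pure K H P a q)
    = QO.kk (tensor K H Q) (\<lambda>b x. pure K H Q (E b (pure K H P a q)) x)" .
qed simp_all

lemma phi_K: "tensor_map K H Q id phi kp = kq"
proof -
  have "tensor_map K H Q id phi kp = QO.kk (tensor K H Q) (\<lambda>b x. pure K H Q (E b kp) x)"
    by (rule tensor_map_phi) simp
  also have "\<dots> = QO.kk (tensor K H Q) (pure K H Q)"
    by (rule QO.kk_cong) simp_all
  also have "\<dots> = kq" by (rule QO.HQ.lift_id) simp
  finally show ?thesis .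
qed

lemma phi_coact:
  assumes [simp]: "p \<in> carrier P"
  shows "tensor_map K H Q id phi (coact P p) = coact Q (phi p)"
proof -
  let ?W = "tensor K H Q"
  have "tensor_map K H Q id phi (coact P p) = QO.kk ?W (\<lambda>b x. pure K H Q (E b (coact P p)) x)"
    by (rule tensor_map_phi) simp
  also have "\<dots> = QO.kk ?W (\<lambda>b x. rr ?W (\<lambda>sj tj. rr ?W (\<lambda>si ti. ev (tj \<otimes> b \<otimes> si) p \<odot>\<^bsub>?W\<^esub> pure K H Q (sj \<otimes> ti) x)))"
  proof (rule QO.kk_cong, simp, simp)
    fix b x assume [simp]: "b \<in> carrier H" "x \<in> carrier Q"
    have "pure K H Q (E b (coact P p)) x = rr ?W (\<lambda>sj tj. pure K H Q (rr H (\<lambda>si ti. ev (tj \<otimes> b \<otimes> si) p \<odot>\<^bsub>H\<^esub> (sj \<otimes> ti))) x)"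
      by (subst E_coact, simp, simp, rule hom_rr(1)[where g = "\<lambda>z. pure K H Q z x"]) simp_all
    also have "\<dots> = rr ?W (\<lambda>sj tj. rr ?W (\<lambda>si ti. pure K H Q (ev (tj \<otimes> b \<otimes> si) p \<odot>\<^bsub>H\<^esub> (sj \<otimes> ti)) x))"
      by (rule rr_cong(1), simp, simp, rule hom_rr(1)[where g = "\<lambda>z. pure K H Q z x"]) simp_all
    also have "\<dots> = rr ?W (\<lambda>sj tj. rr ?W (\<lambda>si ti. ev (tj \<otimes> b \<otimes> si) p \<odot>\<^bsub>?W\<^esub> pure K H Q (sj \<otimes> ti) x))"
      by (rule rr_cong(1), simp, simp del: pure_smult, rule rr_cong(1)) simp_all
    finally show "pure K H Q (E b (coact P p)) x
      = rr ?W (\<lambda>sj tj. rr ?W (\<lambda>si ti. ev (tj \<otimes> b \<otimes> si) p \<odot>\<^bsub>?W\<^esub> pure K H Q (sj \<otimes> ti) x))" .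
  qed
  also have "\<dots> = QO.kk ?W (\<lambda>a x. ev a p \<odot>\<^bsub>?W\<^esub> coact Q x)"
    by (rule QO.kq_coact[symmetric]) simp
  also have "\<dots> = QO.kk ?W (\<lambda>a x. coact Q (ev a p \<odot>\<^bsub>Q\<^esub> x))"
    by (rule QO.kk_cong) (simp_all add: smult_hom[OF QO.coact_hom(1)])
  also have "\<dots> = coact Q (phi p)"
    unfolding phi_def by (rule QO.hom_kk[symmetric, OF QO.coact_hom(1)]) simp_all
  finally show ?thesis .
qed

text \<open>Pair the first leg of (Id \<otimes> f)(kp) = kq with \<open>p\<close>. The right side
  gives \<open>phi p\<close>, the left side \<open>f\<close> applied to the pairing of
  \<open>kp\<close> with \<open>p\<close>; and that pairing is \<open>p\<close> itself, since its
  evaluation at \<open>h\<close> is ev (E h kp) p = ev h p.\<close>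

lemma hom_unique:
  assumes f: "f \<in> module_hom K P Q" and fk: "tensor_map K H Q id f kp = kq" and p [simp]: "p \<in> carrier P"
  shows "f p = phi p"
proof -
  note [simp] = module_hom_comp[OF f] module_homD(1)[OF f]
  have b: "bilin K H P (tensor K H Q) (\<lambda>a q. pure K H Q a (f q))" by simp
  have b1: "bilin K H Q Q (\<lambda>a x. ev a p \<odot>\<^bsub>Q\<^esub> x)" by simp
  have b2: "bilin K H P P (\<lambda>a q. ev a p \<odot>\<^bsub>P\<^esub> q)" by simp
  note L = HP.lift_hom[OF b2 assoc_algebraD(3)[OF algebra_P]]
  have "phi p = tensor_lift Q (\<lambda>a x. ev a p \<odot>\<^bsub>Q\<^esub> x) (tensor_map K H Q id f kp)"
    by (simp add: fk phi_def)
  also have "\<dots> = tensor_lift Q (\<lambda>a q. tensor_lift Q (\<lambda>a x. ev a p \<odot>\<^bsub>Q\<^esub> x) (pure K H Q a (f q))) kp"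
    unfolding tensor_map_def id_def
    by (rule HP.hom_lift[OF QO.HQ.lift_hom[OF b1] b]) simp_all
  also have "\<dots> = tensor_lift Q (\<lambda>a q. f (ev a p \<odot>\<^bsub>P\<^esub> q)) kp"
    by (rule HP.lift_cong) (simp_all add: module_hom_comp[OF QO.HQ.lift_hom[OF b1]] QO.HQ.lift_pure[OF b1] smult_hom[OF f])
  also have "\<dots> = f (tensor_lift P (\<lambda>a q. ev a p \<odot>\<^bsub>P\<^esub> q) kp)"
    by (rule HP.hom_lift[OF f b2, symmetric]) simp_all
  also have "tensor_lift P (\<lambda>a q. ev a p \<odot>\<^bsub>P\<^esub> q) kp = p"
  proof (rule ev_inj)
    show "tensor_lift P (\<lambda>a q. ev a p \<odot>\<^bsub>P\<^esub> q) kp \<in> carrier P" by (rule module_homD(1)[OF L]) simp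
    fix h assume [simp]: "h \<in> carrier H"
    have "ev h (tensor_lift P (\<lambda>a q. ev a p \<odot>\<^bsub>P\<^esub> q) kp) = ev (E h kp) p"
    proof (rule HP.hom_eqI[where W = "ground_algebra K"])
      fix a q assume [simp]: "a \<in> carrier H" "q \<in> carrier P"
      have "tensor_lift P (\<lambda>a q. ev a p \<odot>\<^bsub>P\<^esub> q) (pure K H P a q) = ev a p \<odot>\<^bsub>P\<^esub> q"
        by (rule HP.lift_pure[OF b2]) simp_all
      then show "ev h (tensor_lift P (\<lambda>a q. ev a p \<odot>\<^bsub>P\<^esub> q) (pure K H P a q)) = ev (E h (pure K H P a q)) p"
        using smult_hom[OF lin_ev(2)[OF _ module_hom_id], of h "ev a p" q]
          smult_hom[OF lin_ev(1)[OF module_hom_id], of p "ev h q" a]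
        by (simp add: K.m_comm)
    qed (simp_all add: module_hom_comp[OF L])
    then show "ev h (tensor_lift P (\<lambda>a q. ev a p \<odot>\<^bsub>P\<^esub> q) kp) = ev h p" by simp
  qed simp
  finally show ?thesis ..
qed

lemma tensor_map_cong:
  assumes f: "f \<in> module_hom K P Q" and e: "\<And>p. p \<in> carrier P \<Longrightarrow> f p = g p" and t: "t \<in> carrier (tensor K H P)"
  shows "tensor_map K H Q id f t = tensor_map K H Q id g t"
  unfolding tensor_map_def id_def
  by (rule HP.lift_cong) (simp_all add: module_hom_comp[OF f] module_homD(1)[OF f] f t, simp add: e)

lemma exists_unique_QT_hom: "\<exists>!f. f \<in> QT_hom K H (P, kp) (Q, kq)"
proof -
  interpret mP: module K P by simp
  \<comment> \<open>Morphisms in \<open>QT_hom\<close> are extensional, so \<open>phi\<close> is cut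
    off outside the carrier before it is compared with other morphisms.\<close>
  define f where "f = restrict phi (carrier P)"
  have fe: "f p = phi p" if "p \<in> carrier P" for p using that by (simp add: f_def)
  have f_hom: "f \<in> module_hom K P Q"
    by (rule module_homI) (simp_all add: fe module_homD[OF phi_hom])
  have tm: "tensor_map K H Q id f t = tensor_map K H Q id phi t" if "t \<in> carrier (tensor K H P)" for t
    by (rule tensor_map_cong[OF f_hom fe that])
  show ?thesis
  proof (rule ex1I[of _ f])
    have "f \<in> ring_hom P Q"
      by (rule ring_hom_memI) (simp_all add: fe phi_mult phi_one module_homD[OF phi_hom])
    then show "f \<in> QT_hom K H (P, kp) (Q, kq)"
      unfolding QT_hom_def using f_hom
      by (simp add: algebra_hom_def tm phi_K phi_coact fe) (simp add: f_def)
    fix g assume "g \<in> QT_hom K H (P, kp) (Q, kq)"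
    then have g: "g \<in> module_hom K P Q" "tensor_map K H Q id g kp = kq" "g \<in> extensional (carrier P)"
      by (auto simp: QT_hom_def algebra_hom_def)
    show "g = f"
    proof (rule extensionalityI[OF g(3)])
      show "f \<in> extensional (carrier P)" by (simp add: f_def)
      show "g p = f p" if "p \<in> carrier P" for p using hom_unique[OF g(1,2) that] fe[OF that] by simp
    qed
  qed
qed

end

section \<open>Free products with the ground field\<close>

abbreviation word_mult :: "('x list \<Rightarrow>\<^sub>0 int) \<Rightarrow> ('x list \<Rightarrow>\<^sub>0 int) \<Rightarrow> ('x list \<Rightarrow>\<^sub>0 int)" where
  "word_mult x y \<equiv> frag_extend (\<lambda>u. frag_extend (\<lambda>v. frag_of (u @ v)) y) x"

lemma frag_extend_fun_diff:
  "frag_extend (\<lambda>u. f u - g u) x = frag_extend f x - frag_extend g x"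
proof -
  have k: "Poly_Mapping.keys x \<subseteq> UNIV" by simp
  from k show ?thesis by (induction x rule: frag_induction) (simp_all add: frag_extend_diff)
qed

lemma frag_extend_fun_add:
  "frag_extend (\<lambda>u. f u + g u) x = frag_extend f x + frag_extend g x"
proof -
  have k: "Poly_Mapping.keys x \<subseteq> UNIV" by simp
  from k show ?thesis by (induction x rule: frag_induction) (simp_all add: frag_extend_diff)
qed

lemma word_mult_diff:
  "word_mult (x - y) z = word_mult x z - word_mult y z"
  "word_mult x (y - z) = word_mult x y - word_mult x z"
  by (simp_all add: frag_extend_diff frag_extend_fun_diff)

lemma word_mult_assoc: "word_mult (word_mult x y) z = word_mult x (word_mult y z)"
proof -
  have k: "Poly_Mapping.keys w \<subseteq> UNIV" for w :: "'a list \<Rightarrow>\<^sub>0 int" by simp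
  from k[of x] show ?thesis
  proof (induction x rule: frag_induction)
    case (one u)
    from k[of y] show ?case
    proof (induction y rule: frag_induction)
      case (one v)
      from k[of z] show ?case
        by (induction z rule: frag_induction) (simp_all add: frag_extend_diff)
    qed (simp_all add: frag_extend_diff)
  qed (simp_all add: frag_extend_diff)
qed

lemma free_ring_simps [simp]:
  "carrier (free_ring S) = {x. Poly_Mapping.keys x \<subseteq> lists S}" "x \<otimes>\<^bsub>free_ring S\<^esub> y = word_mult x y"
  "\<one>\<^bsub>free_ring S\<^esub> = frag_of []" "\<zero>\<^bsub>free_ring S\<^esub> = 0" "x \<oplus>\<^bsub>free_ring S\<^esub> y = x + y"
  by (simp_all add: free_ring_def)

lemma ring_free_ring: "ring (free_ring S)"
proof (rule ringI)
  show "abelian_group (free_ring S)"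
  proof (rule abelian_groupI)
    fix x assume "x \<in> carrier (free_ring S)"
    then show "\<exists>y\<in>carrier (free_ring S). y \<oplus>\<^bsub>free_ring S\<^esub> x = \<zero>\<^bsub>free_ring S\<^esub>"
      by (auto intro!: exI[of _ "- x"])
  qed (use keys_add in \<open>fastforce simp: add_ac\<close>)+
  show "monoid (free_ring S)"
  proof (rule monoidI)
    fix x y assume xy: "x \<in> carrier (free_ring S)" "y \<in> carrier (free_ring S)"
    have "Poly_Mapping.keys (word_mult x y) \<subseteq> (\<Union>u\<in>Poly_Mapping.keys x. \<Union>v\<in>Poly_Mapping.keys y. {u @ v})"
      by (rule order_trans[OF keys_frag_extend UN_mono[OF subset_refl order_trans[OF keys_frag_extend]]]) simp
    also have "\<dots> \<subseteq> lists S" using xy by (auto simp: subset_iff in_lists_conv_set)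
    finally show "x \<otimes>\<^bsub>free_ring S\<^esub> y \<in> carrier (free_ring S)" by simp
  next
    fix x show "x \<otimes>\<^bsub>free_ring S\<^esub> \<one>\<^bsub>free_ring S\<^esub> = x"
      by (simp flip: frag_expansion)
    show "\<one>\<^bsub>free_ring S\<^esub> \<otimes>\<^bsub>free_ring S\<^esub> x = x"
      by (simp flip: frag_expansion)
  qed (simp_all add: word_mult_assoc)
qed (simp_all add: frag_extend_add frag_extend_fun_add)

lemma free_ring_minus: "x \<in> carrier (free_ring S) \<Longrightarrow> y \<in> carrier (free_ring S) \<Longrightarrow> x \<ominus>\<^bsub>free_ring S\<^esub> y = x - y"
proof -
  interpret F: ring "free_ring S" by (rule ring_free_ring)
  assume x: "x \<in> carrier (free_ring S)" and y: "y \<in> carrier (free_ring S)"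
  have "\<ominus>\<^bsub>free_ring S\<^esub> y = - y" by (rule F.minus_equality) (use y in simp_all)
  then show ?thesis by (simp add: F.minus_eq)
qed

definition word_eval :: "('b, 'm) ring_scheme \<Rightarrow> ('x \<Rightarrow> 'b) \<Rightarrow> 'x list \<Rightarrow> 'b" where
  "word_eval B g u = foldr (\<lambda>x b. g x \<otimes>\<^bsub>B\<^esub> b) u \<one>\<^bsub>B\<^esub>"

definition free_eval :: "('b, 'm) ring_scheme \<Rightarrow> ('x \<Rightarrow> 'b) \<Rightarrow> ('x list \<Rightarrow>\<^sub>0 int) \<Rightarrow> 'b" where
  "free_eval B g x = (\<Oplus>\<^bsub>B\<^esub>u\<in>Poly_Mapping.keys x. [Poly_Mapping.lookup x u] \<cdot>\<^bsub>B\<^esub> word_eval B g u)"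

context ring begin

lemma word_eval_simps [simp]: "word_eval R g [] = \<one>" "word_eval R g (x # u) = g x \<otimes> word_eval R g u"
  by (simp_all add: word_eval_def)

context
  fixes g :: "'x \<Rightarrow> 'a" and S :: "'x set"
  assumes g: "g \<in> S \<rightarrow> carrier R"
begin

lemma word_eval_closed: "u \<in> lists S \<Longrightarrow> word_eval R g u \<in> carrier R"
  using g by (induction u) auto

lemma word_eval_append: "u \<in> lists S \<Longrightarrow> v \<in> lists S \<Longrightarrow> word_eval R g (u @ v) = word_eval R g u \<otimes> word_eval R g v"
proof (induction u)
  case (Cons x u)
  then show ?case using g word_eval_closed[of u] word_eval_closed[of v] by (auto simp: m_assoc Pi_iff)
qed (simp add: word_eval_closed)

lemma free_eval_of: "u \<in> lists S \<Longrightarrow> free_eval R g (frag_of u) = word_eval R g u"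
  unfolding free_eval_def by (rule finsum_frag_of) (rule word_eval_closed)

lemma free_eval_group_hom: "group_hom (free_Abelian_group (lists S)) (add_monoid R) (free_eval R g)"
  using finsum_frag_hom[of "word_eval R g" "lists S"] word_eval_closed
  by (intro group_hom.intro group_hom_axioms.intro group_free_Abelian_group a_group)
     (simp add: free_eval_def[abs_def] Pi_iff)

text \<open>The universal property of the free ring. Additivity is that of the free abelian group on
  words; multiplicativity holds on words by \<open>word_eval_append\<close> and extends to formal
  sums one argument at a time.\<close>

lemma free_eval_hom: "free_eval R g \<in> ring_hom (free_ring S) R"
proof -
  interpret F: ring "free_ring S" by (rule ring_free_ring)
  interpret h: group_hom "free_Abelian_group (lists S)" "add_monoid R" "free_eval R g"
    by (rule free_eval_group_hom)
  note cl = h.hom_closed[simplified]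
  have add: "free_eval R g (x + y) = free_eval R g x \<oplus> free_eval R g y" if "Poly_Mapping.keys x \<subseteq> lists S" "Poly_Mapping.keys y \<subseteq> lists S" for x y
    using h.hom_mult[of x y] that by simp
  have z: "free_eval R g 0 = \<zero>" using h.hom_one by simp
  have diff: "free_eval R g (x - y) = free_eval R g x \<ominus> free_eval R g y" if "Poly_Mapping.keys x \<subseteq> lists S" "Poly_Mapping.keys y \<subseteq> lists S" for x y
  proof -
    have "Poly_Mapping.keys (x - y) \<subseteq> lists S" using keys_diff[of x y] that by blast
    then have "free_eval R g (x - y) \<oplus> free_eval R g y = free_eval R g x" using add[of "x - y" y] that by simp
    then show ?thesis using cl that \<open>Poly_Mapping.keys (x - y) \<subseteq> lists S\<close>
      by (metis add.m_closed add.inv_solve_right minus_eq)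
  qed
  have wm: "Poly_Mapping.keys (word_mult x y) \<subseteq> lists S" if "Poly_Mapping.keys x \<subseteq> lists S" "Poly_Mapping.keys y \<subseteq> lists S" for x y
    using F.m_closed[of x y] that by simp
  have mult: "free_eval R g (word_mult x y) = free_eval R g x \<otimes> free_eval R g y"
    if x: "Poly_Mapping.keys x \<subseteq> lists S" and y: "Poly_Mapping.keys y \<subseteq> lists S" for x y
  proof (rule free_Abelian_group_induct[OF x], goal_cases)
    case 1 then show ?case using cl y by (simp add: z)
  next
    case (2 a b)
    then show ?case using cl y wm[OF _ y] by (simp only: word_mult_diff diff) (simp add: minus_eq l_distr l_minus)
  next
    case (3 u)
    then have u: "Poly_Mapping.keys (frag_of u) \<subseteq> lists S" "word_eval R g u \<in> carrier R" using word_eval_closed by auto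
    show ?case
    proof (rule free_Abelian_group_induct[OF y], goal_cases)
      case 1 then show ?case using u 3 by (simp add: z free_eval_of)
    next
      case (2 a b)
      then show ?case using cl[of a] cl[of b] cl[OF u(1)] wm[OF u(1), of a] wm[OF u(1), of b]
        by (simp only: word_mult_diff diff) (simp add: minus_eq r_distr r_minus)
    next
      case (3 v)
      then show ?case using \<open>u \<in> lists S\<close> by (simp add: free_eval_of word_eval_append)
    qed
  qed
  show ?thesis
    by (rule ring_hom_memI) (simp_all add: cl add mult free_eval_of)
qed

end
end

text \<open>No algebra axiom for \<open>P\<close> is among the assumptions: all of them are
  transported from \<open>B\<close> along the bijection. Applied to the free product and to the
  reflective algebra, this avoids checking the axioms on iterated cosets.\<close>

locale algebra_iso =
  fixes K :: "('k, 'l) ring_scheme" and B :: "('k, 'b, 'm) module_scheme"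
    and P :: "('k, 'p, 'n) module_scheme" and f :: "'b \<Rightarrow> 'p"
  assumes algebra_B: "assoc_algebra K B"
    and bij: "bij_betw f (carrier B) (carrier P)"
    and mult: "\<And>x y. x \<in> carrier B \<Longrightarrow> y \<in> carrier B \<Longrightarrow> f (x \<otimes>\<^bsub>B\<^esub> y) = f x \<otimes>\<^bsub>P\<^esub> f y"
    and one: "f \<one>\<^bsub>B\<^esub> = \<one>\<^bsub>P\<^esub>"
    and add: "\<And>x y. x \<in> carrier B \<Longrightarrow> y \<in> carrier B \<Longrightarrow> f (x \<oplus>\<^bsub>B\<^esub> y) = f x \<oplus>\<^bsub>P\<^esub> f y"
    and zero: "f \<zero>\<^bsub>B\<^esub> = \<zero>\<^bsub>P\<^esub>"
    and smult: "\<And>c x. c \<in> carrier K \<Longrightarrow> x \<in> carrier B \<Longrightarrow> f (c \<odot>\<^bsub>B\<^esub> x) = c \<odot>\<^bsub>P\<^esub> f x"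
begin

lemma algebra: "assoc_algebra K P"
proof -
  interpret rB: ring B using assoc_algebraD(2)[OF algebra_B] .
  interpret B: module K B using assoc_algebraD(3)[OF algebra_B] .
  have cP: "carrier P = f ` carrier B" using bij by (simp add: bij_betw_def)
  note s = mult[symmetric] add[symmetric] smult[symmetric] one[symmetric] zero[symmetric]
  have P: "abelian_group P"
  proof (rule abelian_groupI)
    fix p assume "p \<in> carrier P"
    then obtain x where "p = f x" "x \<in> carrier B" by (auto simp: cP)
    then show "\<exists>y\<in>carrier P. y \<oplus>\<^bsub>P\<^esub> p = \<zero>\<^bsub>P\<^esub>"
      by (auto simp: cP s rB.l_neg intro!: bexI[of _ "\<ominus>\<^bsub>B\<^esub> x"])
  qed (auto simp: cP s rB.a_ac)
  from P have P': "ring P"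
    by (intro ringI monoidI) (auto simp: cP s rB.m_assoc rB.l_distr rB.r_distr)
  have "cring K" by (rule B.R.is_cring)
  with P have "module K P"
    by (intro moduleI) (auto simp: cP s B.smult_l_distr B.smult_r_distr B.smult_assoc1)
  with P' show ?thesis
    using algebra_B unfolding assoc_algebra_def vectorspace_def by (auto simp: cP s)
qed
end

text \<open>
  When the first factor is the ground field, every word in the free product is identified with a
  single letter of \<open>B\<close>, so the inclusion of \<open>B\<close> is an isomorphism.
\<close>

locale ground_free_product =
  fixes K :: "('k, 'l) ring_scheme" and A :: "('k, 'k, 'm) module_scheme" and B :: "('k, 'b, 'n) module_scheme"
  assumes algebra_B: "assoc_algebra K B"
    and A: "carrier A = carrier K" "\<And>x y. x \<otimes>\<^bsub>A\<^esub> y = x \<otimes>\<^bsub>K\<^esub> y" "\<one>\<^bsub>A\<^esub> = \<one>\<^bsub>K\<^esub>"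
      "\<And>x y. x \<oplus>\<^bsub>A\<^esub> y = x \<oplus>\<^bsub>K\<^esub> y" "\<And>x y. x \<odot>\<^bsub>A\<^esub> y = x \<otimes>\<^bsub>K\<^esub> y"
begin

sublocale B: ring B using assoc_algebraD(2)[OF algebra_B] .
sublocale mB: module K B using assoc_algebraD(3)[OF algebra_B] .
sublocale kf: field K using assoc_algebraD(4)[OF algebra_B] .

abbreviation "letters \<equiv> carrier A <+> carrier B"
abbreviation "F \<equiv> free_ring letters"
abbreviation "rels \<equiv> free_product_relators K A B"
abbreviation "I \<equiv> Idl\<^bsub>F\<^esub> rels"
abbreviation "cls \<equiv> free_product_class K A B"
abbreviation "FP \<equiv> free_product K A B"

text \<open>A scalar letter is read as a multiple of the unit of \<open>B\<close>, as the relators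
  identifying the two images of the scalars demand.\<close>

definition "letter_val = case_sum (\<lambda>c. c \<odot>\<^bsub>B\<^esub> \<one>\<^bsub>B\<^esub>) (\<lambda>b. b)"

abbreviation "val \<equiv> free_eval B letter_val"

definition inB where "inB b = cls (frag_of [Inr b])"

lemma letter_val_simps [simp]: "letter_val (Inl c) = c \<odot>\<^bsub>B\<^esub> \<one>\<^bsub>B\<^esub>" "letter_val (Inr b) = b"
  by (simp_all add: letter_val_def)

lemma letter_val: "letter_val \<in> letters \<rightarrow> carrier B"
  by (auto simp: A)

sublocale F: ring F by (rule ring_free_ring)

lemma letters_iff [simp]: "Inl c \<in> letters \<longleftrightarrow> c \<in> carrier K" "Inr b \<in> letters \<longleftrightarrow> b \<in> carrier B"
  "Inl c \<in> carrier K <+> carrier B \<longleftrightarrow> c \<in> carrier K" "Inr b \<in> carrier K <+> carrier B \<longleftrightarrow> b \<in> carrier B"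
  by (auto simp: A)

lemma smult_one_mult:
  "c \<in> carrier K \<Longrightarrow> b \<in> carrier B \<Longrightarrow> (c \<odot>\<^bsub>B\<^esub> \<one>\<^bsub>B\<^esub>) \<otimes>\<^bsub>B\<^esub> b = c \<odot>\<^bsub>B\<^esub> b"
  using algebra_B by (simp add: assoc_algebra_def)

text \<open>The seven families of relators have only two shapes. Membership in the free ring and
  vanishing under \<open>val\<close> are then checked once per shape.\<close>

lemma relator_words:
  "rels \<subseteq> {frag_of u - frag_of v | u v. u \<in> lists letters \<and> v \<in> lists letters \<and>
        word_eval B letter_val u = word_eval B letter_val v} \<union>
     {frag_of u - frag_of v - frag_of w | u v w. u \<in> lists letters \<and> v \<in> lists letters \<and> w \<in> lists letters \<and>
        word_eval B letter_val u = word_eval B letter_val v \<oplus>\<^bsub>B\<^esub> word_eval B letter_val w}"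
  unfolding free_product_relators_def
  by (intro Un_least; rule subsetI; (elim CollectE exE conjE singletonE); hypsubst;
      (rule UnI1, rule CollectI, (rule exI)+, rule conjI, rule refl |
       rule UnI2, rule CollectI, (rule exI)+, rule conjI, rule refl);
      simp add: A smult_one_mult mB.smult_l_distr mB.smult_assoc1)

lemma frag_in: "u \<in> lists letters \<Longrightarrow> frag_of u \<in> carrier F" by simp

lemma diff_in: "x \<in> carrier F \<Longrightarrow> y \<in> carrier F \<Longrightarrow> x - y \<in> carrier F"
  using F.minus_closed[of x y] by (simp only: free_ring_minus)

lemma rels_carrier: "rels \<subseteq> carrier F"
  by (rule subset_trans[OF relator_words], intro Un_least; rule subsetI; (elim CollectE exE conjE); hypsubst;
      intro diff_in frag_in; assumption)

sublocale I: ideal I F by (rule F.genideal_ideal[OF rels_carrier])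

lemma cls_eq: "cls x = I +>\<^bsub>F\<^esub> x"
  by (simp add: free_product_class_def Let_def)

lemma cls_eqI:
  assumes "x \<in> carrier F" "y \<in> carrier F" "x - y \<in> rels"
  shows "cls x = cls y"
proof -
  have "x - y \<in> I" using F.genideal_self[OF rels_carrier] assms(3) by blast
  then show ?thesis
    using F.quotient_eq_iff_same_a_r_cos[OF I.ideal_axioms assms(1,2)] by (simp add: cls_eq free_ring_minus[OF assms(1,2)])
qed

lemma val_hom: "val \<in> ring_hom F B"
  by (rule B.free_eval_hom[OF letter_val])

lemma val_word: "u \<in> lists letters \<Longrightarrow> val (frag_of u) = word_eval B letter_val u"
  by (rule B.free_eval_of[OF letter_val])

sublocale val: ring_hom_ring F B val
  by (intro ring_hom_ringI2 val_hom F.ring_axioms B.ring_axioms)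

lemma val_diff: "x \<in> carrier F \<Longrightarrow> y \<in> carrier F \<Longrightarrow> val (x - y) = val x \<ominus>\<^bsub>B\<^esub> val y"
  by (simp only: free_ring_minus[symmetric] F.minus_eq val.hom_add val.hom_a_inv F.a_inv_closed B.minus_eq)

lemma Inr_in: "b \<in> carrier B \<Longrightarrow> [Inr b] \<in> lists letters"
  by simp

lemma val_rels:
  assumes "r \<in> rels" shows "val r = \<zero>\<^bsub>B\<^esub>"
proof -
  have s: "a \<oplus>\<^bsub>B\<^esub> b \<ominus>\<^bsub>B\<^esub> a \<ominus>\<^bsub>B\<^esub> b = \<zero>\<^bsub>B\<^esub>" if "a \<in> carrier B" "b \<in> carrier B" for a b
  proof -
    have "a \<oplus>\<^bsub>B\<^esub> b \<ominus>\<^bsub>B\<^esub> a = b" using that by (simp add: B.a_comm[of a b] B.minus_eq B.a_assoc B.r_neg)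
    then show ?thesis using that by (simp add: B.minus_eq B.r_neg)
  qed
  have d: "a \<ominus>\<^bsub>B\<^esub> a = \<zero>\<^bsub>B\<^esub>" if "a \<in> carrier B" for a
    using that by (simp add: B.minus_eq B.r_neg)
  note w = val_diff diff_in frag_in val_word s d B.word_eval_closed[OF letter_val]
  from subsetD[OF relator_words assms] show ?thesis
    by (elim UnE CollectE exE conjE; simp only: w)
qed

lemma val_I:
  assumes "x \<in> I" shows "val x = \<zero>\<^bsub>B\<^esub>"
proof -
  have "rels \<subseteq> a_kernel F B val"
    unfolding a_kernel_def' using rels_carrier val_rels by blast
  from F.genideal_minimal[OF val.kernel_is_ideal this] assms show ?thesis
    unfolding a_kernel_def' by blast
qed

lemma cls_hom: "cls \<in> ring_hom F (F Quot I)"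
  using I.rcos_ring_hom by (simp add: cls_eq[abs_def])

lemma inB_simps:
  assumes "b \<in> carrier B" "b' \<in> carrier B"
  shows "inB (b \<oplus>\<^bsub>B\<^esub> b') = inB b \<oplus>\<^bsub>F Quot I\<^esub> inB b'"
    and "inB (b \<otimes>\<^bsub>B\<^esub> b') = inB b \<otimes>\<^bsub>F Quot I\<^esub> inB b'"
proof -
  note c = frag_in[OF Inr_in]
  have "inB (b \<oplus>\<^bsub>B\<^esub> b') = cls (frag_of [Inr b] + frag_of [Inr b'])"
    unfolding inB_def
    by (rule cls_eqI)
       (use assms F.a_closed[OF c c] in \<open>auto simp: free_product_relators_def diff_diff_eq\<close>)
  also have "\<dots> = inB b \<oplus>\<^bsub>F Quot I\<^esub> inB b'"
    using ring_hom_add[OF cls_hom c c] assms by (simp add: inB_def)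
  finally show "inB (b \<oplus>\<^bsub>B\<^esub> b') = inB b \<oplus>\<^bsub>F Quot I\<^esub> inB b'" .
  have "inB (b \<otimes>\<^bsub>B\<^esub> b') = cls (frag_of [Inr b, Inr b'])"
    unfolding inB_def by (rule cls_eqI) (use assms in \<open>auto simp: free_product_relators_def\<close>)
  also have "\<dots> = inB b \<otimes>\<^bsub>F Quot I\<^esub> inB b'"
    using ring_hom_mult[OF cls_hom c c] assms by (simp add: inB_def)
  finally show "inB (b \<otimes>\<^bsub>B\<^esub> b') = inB b \<otimes>\<^bsub>F Quot I\<^esub> inB b'" .
qed

lemma inB_one: "inB \<one>\<^bsub>B\<^esub> = cls (frag_of [])"
  unfolding inB_def by (rule cls_eqI) (auto simp: free_product_relators_def)

lemma cls_Inl: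
  assumes "c \<in> carrier K" shows "cls (frag_of [Inl c]) = inB (c \<odot>\<^bsub>B\<^esub> \<one>\<^bsub>B\<^esub>)"
proof -
  have "frag_of [Inl (c \<odot>\<^bsub>A\<^esub> \<one>\<^bsub>A\<^esub>)] - frag_of [Inr (c \<odot>\<^bsub>B\<^esub> \<one>\<^bsub>B\<^esub>)] \<in> rels"
    using assms unfolding free_product_relators_def by blast
  then show ?thesis unfolding inB_def
    by (intro cls_eqI) (use assms in \<open>auto simp: A\<close>)
qed

sublocale Q: ring "F Quot I" by (rule I.quotient_is_ring)

lemma inB_closed: "b \<in> carrier B \<Longrightarrow> inB b \<in> carrier (F Quot I)"
  using ring_hom_closed[OF cls_hom frag_in[OF Inr_in]] by (simp add: inB_def)

lemma inB_zero: "inB \<zero>\<^bsub>B\<^esub> = \<zero>\<^bsub>F Quot I\<^esub>"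
proof -
  have "inB \<zero>\<^bsub>B\<^esub> \<oplus>\<^bsub>F Quot I\<^esub> inB \<zero>\<^bsub>B\<^esub> = inB \<zero>\<^bsub>B\<^esub>"
    using inB_simps(1)[of "\<zero>\<^bsub>B\<^esub>" "\<zero>\<^bsub>B\<^esub>"] by simp
  then show ?thesis using inB_closed by simp
qed

lemma cls_word:
  assumes "u \<in> lists letters" shows "cls (frag_of u) = inB (word_eval B letter_val u)"
  using assms
proof (induction u)
  case Nil
  then show ?case by (simp add: inB_one)
next
  case (Cons x u)
  have x: "letter_val x \<in> carrier B" "cls (frag_of [x]) = inB (letter_val x)"
    using Cons.hyps(1) by (auto simp: A cls_Inl inB_def)
  have "cls (frag_of (x # u)) = cls (frag_of [x]) \<otimes>\<^bsub>F Quot I\<^esub> cls (frag_of u)"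
    using ring_hom_mult[OF cls_hom, of "frag_of [x]" "frag_of u"] Cons.hyps by simp
  then show ?case
    using Cons x B.word_eval_closed[OF letter_val, of u] by (simp add: inB_simps)
qed

text \<open>Words are reduced to one letter by \<open>cls_word\<close>, and additivity passes from
  words to formal sums. It gives the surjectivity of \<open>inB\<close>.\<close>

lemma cls_val: "x \<in> carrier F \<Longrightarrow> cls x = inB (val x)"
proof -
  assume x: "x \<in> carrier F"
  have k: "Poly_Mapping.keys x \<subseteq> lists letters" using x by simp
  show ?thesis
  proof (rule free_Abelian_group_induct[OF k], goal_cases)
    case 1
    have "cls 0 = \<zero>\<^bsub>F Quot I\<^esub>"
      using ring_hom_zero[OF cls_hom F.ring_axioms Q.ring_axioms] by simp
    then show ?case using val.hom_zero inB_zero by simp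
  next
    case (2 a b)
    have ab: "a \<in> carrier F" "b \<in> carrier F" using 2 by simp_all
    then have d: "a - b \<in> carrier F" using F.minus_closed[OF ab] free_ring_minus[OF ab] by simp
    have "cls a = cls (a - b) \<oplus>\<^bsub>F Quot I\<^esub> cls b" using ring_hom_add[OF cls_hom d ab(2)] by simp
    moreover have "inB (val a) = inB (val (a - b)) \<oplus>\<^bsub>F Quot I\<^esub> inB (val b)"
      using val.hom_add[OF d ab(2)] val.hom_closed[OF d] val.hom_closed[OF ab(2)] inB_simps(1) by simp
    ultimately show ?case using 2
      inB_closed[OF val.hom_closed[OF d]] inB_closed[OF val.hom_closed[OF ab(2)]] ring_hom_closed[OF cls_hom d]
      by (simp del: free_ring_simps)
  next
    case (3 u)
    then show ?case by (simp add: cls_word val_word)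
  qed
qed

text \<open>\<open>val\<close> vanishes on the ideal and sends the letter of \<open>b\<close> back
  to \<open>b\<close>, so it provides a left inverse of \<open>inB\<close>.\<close>

lemma inB_inj: "inj_on inB (carrier B)"
proof (rule inj_onI)
  fix b b' assume b: "b \<in> carrier B" "b' \<in> carrier B" and e: "inB b = inB b'"
  note c = frag_in[OF Inr_in[OF b(1)]] frag_in[OF Inr_in[OF b(2)]]
  have "frag_of [Inr b] - frag_of [Inr b'] \<in> I"
    using F.quotient_eq_iff_same_a_r_cos[OF I.ideal_axioms c] e
    by (simp only: inB_def cls_eq free_ring_minus[OF c])
  then have "val (frag_of [Inr b]) \<ominus>\<^bsub>B\<^esub> val (frag_of [Inr b']) = \<zero>\<^bsub>B\<^esub>"
    using val_I val_diff[OF c] by simp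
  then show "b = b'" using b by (simp add: val_word B.r_right_minus_eq)
qed

lemma FP_simps: "carrier FP = carrier (F Quot I)" "x \<otimes>\<^bsub>FP\<^esub> y = x \<otimes>\<^bsub>F Quot I\<^esub> y" "\<one>\<^bsub>FP\<^esub> = \<one>\<^bsub>F Quot I\<^esub>"
  "x \<oplus>\<^bsub>FP\<^esub> y = x \<oplus>\<^bsub>F Quot I\<^esub> y" "\<zero>\<^bsub>FP\<^esub> = \<zero>\<^bsub>F Quot I\<^esub>"
  "c \<odot>\<^bsub>FP\<^esub> x = cls (frag_of [Inl (c \<odot>\<^bsub>A\<^esub> \<one>\<^bsub>A\<^esub>)]) \<otimes>\<^bsub>F Quot I\<^esub> x"
  by (simp_all add: free_product_def Let_def ring.defs module.defs)

lemma iso_inB: "algebra_iso K B FP inB"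
proof
  show "assoc_algebra K B" by (rule algebra_B)
  have "carrier (F Quot I) = cls ` carrier F"
    by (auto simp: FactRing_def A_RCOSETS_def' cls_eq)
  also have "\<dots> \<subseteq> inB ` carrier B" using val.hom_closed by (auto simp: cls_val simp del: free_ring_simps)
  finally show "bij_betw inB (carrier B) (carrier FP)"
    using inB_inj inB_closed by (auto simp: bij_betw_def FP_simps)
  show "inB \<one>\<^bsub>B\<^esub> = \<one>\<^bsub>FP\<^esub>" using ring_hom_one[OF cls_hom] by (simp add: inB_one FP_simps)
  show "inB \<zero>\<^bsub>B\<^esub> = \<zero>\<^bsub>FP\<^esub>" by (simp add: inB_zero FP_simps)
  show "inB (c \<odot>\<^bsub>B\<^esub> b) = c \<odot>\<^bsub>FP\<^esub> inB b" if "c \<in> carrier K" "b \<in> carrier B" for c b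
  proof -
    have "c \<odot>\<^bsub>FP\<^esub> inB b = inB ((c \<odot>\<^bsub>B\<^esub> \<one>\<^bsub>B\<^esub>) \<otimes>\<^bsub>B\<^esub> b)"
      using that by (simp add: FP_simps A cls_Inl inB_simps)
    also have "(c \<odot>\<^bsub>B\<^esub> \<one>\<^bsub>B\<^esub>) \<otimes>\<^bsub>B\<^esub> b = c \<odot>\<^bsub>B\<^esub> b" using algebra_B that by (simp add: assoc_algebra_def)
    finally show ?thesis by simp
  qed
qed (simp_all add: FP_simps inB_simps)

end

section \<open>The reflective algebra of the ground field\<close>

text \<open>\<open>D\<close> is in bijection with a basis, which is finite in finite dimension.
  Expanding \<open>x\<close> in this basis and applying the functional with index \<open>e\<close>
  picks out the coefficient of \<open>v e\<close>.\<close>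

lemma dual_basis_expand:
  assumes V: "vectorspace K V" and fd: "vectorspace.fin_dim K V" and db: "dual_basis K V D v \<xi>"
  shows "finite D"
    and "x \<in> carrier V \<Longrightarrow> x = (\<Oplus>\<^bsub>V\<^esub>d\<in>D. \<xi> d x \<odot>\<^bsub>V\<^esub> v d)"
proof -
  interpret V: vectorspace K V by fact
  have inj: "inj_on v D" and b: "V.basis (v ` D)" and xi: "\<xi> \<in> D \<rightarrow> dual_space K V"
    and pair: "\<And>d e. d \<in> D \<Longrightarrow> e \<in> D \<Longrightarrow> \<xi> d (v e) = (if d = e then \<one>\<^bsub>K\<^esub> else \<zero>\<^bsub>K\<^esub>)"
    using db by (auto simp: dual_basis_def)
  have vc: "v ` D \<subseteq> carrier V" "\<not> V.lin_dep (v ` D)" "V.span (v ` D) = carrier V"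
    using b by (auto simp: V.basis_def)
  have "finite (v ` D)" by (rule V.fin_dim_li_fin[OF fd vc(2,1)])
  then show fin: "finite D" using finite_imageD[OF _ inj] by blast
  have xh: "\<xi> d \<in> module_hom K V (ground_algebra K)" if "d \<in> D" for d
    using xi that by (auto simp: dual_space_def)
  assume x: "x \<in> carrier V"
  then obtain a where a: "a \<in> v ` D \<rightarrow> carrier K" and "x = V.lincomb a (v ` D)"
    using V.finite_span[OF \<open>finite (v ` D)\<close> vc(1)] vc(3) by auto
  have vd: "v d \<in> carrier V" "a (v d) \<in> carrier K" if "d \<in> D" for d
    using vc(1) a that by auto
  have "x = (\<Oplus>\<^bsub>V\<^esub>d\<in>D. a (v d) \<odot>\<^bsub>V\<^esub> v d)"
    unfolding \<open>x = _\<close> V.lincomb_def using vd by (subst V.M.finsum_reindex[OF _ inj]) auto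
  then have e: "\<xi> e x = a (v e)" if "e \<in> D" for e
  proof -
    have mK: "module K (ground_algebra K)" by (rule module_ground[OF V.field_axioms])
    have "\<xi> e x = (\<Oplus>\<^bsub>ground_algebra K\<^esub>d\<in>D. \<xi> e (a (v d) \<odot>\<^bsub>V\<^esub> v d))"
      unfolding \<open>x = (\<Oplus>\<^bsub>V\<^esub>d\<in>D. a (v d) \<odot>\<^bsub>V\<^esub> v d)\<close>
      by (rule hom_finsum[OF fin xh[OF that] V.module_axioms mK]) (simp add: vd)
    also have "\<dots> = (\<Oplus>\<^bsub>ground_algebra K\<^esub>d\<in>D. if e = d then a (v d) else \<zero>\<^bsub>K\<^esub>)"
      by (rule finsum_module_cong[OF mK])
         (use that vd in \<open>simp_all add: module_homD(3)[OF xh] pair ground_algebra_def\<close>)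
    also have "\<dots> = (\<Oplus>\<^bsub>K\<^esub>d\<in>D. if e = d then a (v d) else \<zero>\<^bsub>K\<^esub>)" by (simp add: finsum_ground)
    also have "\<dots> = a (v e)"
      using that vd fin by (intro V.R.add.finprod_singleton) auto
    finally show ?thesis .
  qed
  show "x = (\<Oplus>\<^bsub>V\<^esub>d\<in>D. \<xi> d x \<odot>\<^bsub>V\<^esub> v d)"
    unfolding \<open>x = (\<Oplus>\<^bsub>V\<^esub>d\<in>D. a (v d) \<odot>\<^bsub>V\<^esub> v d)\<close>[symmetric]
    by (subst \<open>x = (\<Oplus>\<^bsub>V\<^esub>d\<in>D. a (v d) \<odot>\<^bsub>V\<^esub> v d)\<close>, rule finsum_module_cong[where K = K])
       (simp_all add: e vd V.module_axioms)
qed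

section \<open>The opposite dual algebra of the twisted coalgebra\<close>

context fd_qt_hopf begin

abbreviation "B \<equiv> hat_dual_op K H R"
abbreviation "GK \<equiv> ground_algebra K"

text \<open>The opposite multiplication lets the second factor take the first leg of the twisted
  coproduct. The product is recorded twice: pointwise for calculations, and as a restricted function
  for closure.\<close>

lemma B_simps:
  "carrier B = dual_space K H"
  "h \<in> carrier H \<Longrightarrow> (\<xi> \<otimes>\<^bsub>B\<^esub> \<zeta>) h = hw GK h (\<lambda>a b. \<zeta> a \<otimes>\<^bsub>K\<^esub> \<xi> b)"
  "\<one>\<^bsub>B\<^esub> = restrict \<epsilon> (carrier H)" "\<zero>\<^bsub>B\<^esub> = (\<lambda>h\<in>carrier H. \<zero>\<^bsub>K\<^esub>)"
  "\<xi> \<oplus>\<^bsub>B\<^esub> \<zeta> = (\<lambda>h\<in>carrier H. \<xi> h \<oplus>\<^bsub>K\<^esub> \<zeta> h)" "c \<odot>\<^bsub>B\<^esub> \<xi> = (\<lambda>h\<in>carrier H. c \<otimes>\<^bsub>K\<^esub> \<xi> h)"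
  "\<xi> \<otimes>\<^bsub>B\<^esub> \<zeta> = (\<lambda>h\<in>carrier H. hw GK h (\<lambda>a b. \<zeta> a \<otimes>\<^bsub>K\<^esub> \<xi> b))"
  by (simp_all add: op_algebra_def hat_dual_def tensor_lift_ground restrict_def)

lemma dual_hom [simp]: "\<xi> \<in> carrier B \<Longrightarrow> \<xi> \<in> module_hom K H GK"
  by (simp add: B_simps dual_space_def)

lemma lin_dual: "\<xi> \<in> carrier B \<Longrightarrow> f \<in> module_hom K Y H \<Longrightarrow> (\<lambda>x. \<xi> (f x)) \<in> module_hom K Y GK"
  by (rule module_hom_comp[OF dual_hom])

lemma dual_closed [simp]: "\<xi> \<in> carrier B \<Longrightarrow> h \<in> carrier H \<Longrightarrow> \<xi> h \<in> carrier K"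
  using module_homD(1)[OF dual_hom] by simp

lemma dual_eqI:
  "\<xi> \<in> carrier B \<Longrightarrow> \<zeta> \<in> carrier B \<Longrightarrow> (\<And>h. h \<in> carrier H \<Longrightarrow> \<xi> h = \<zeta> h) \<Longrightarrow> \<xi> = \<zeta>"
  by (rule extensionalityI[of _ "carrier H"]) (auto simp: B_simps dual_space_def)

lemma restrict_dual: "f \<in> module_hom K H GK \<Longrightarrow> restrict f (carrier H) \<in> carrier B"
  using module_homD(1)[of f K H GK] by (auto simp: B_simps dual_space_def intro!: module_homI simp: module_homD)

lemma lin_ground_mult [simp]:
  "c \<in> carrier K \<Longrightarrow> f \<in> module_hom K Y GK \<Longrightarrow> (\<lambda>x. f x \<otimes>\<^bsub>K\<^esub> c) \<in> module_hom K Y GK"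
  using lin_smult1[of f Y GK c] by simp

lemma hw_ground_closed [simp]: "bilin K H H GK F \<Longrightarrow> h \<in> carrier H \<Longrightarrow> hw GK h F \<in> carrier K"
  using hw_closed[of GK F h] by simp

lemma B_closed:
  "\<xi> \<in> carrier B \<Longrightarrow> \<zeta> \<in> carrier B \<Longrightarrow> \<xi> \<otimes>\<^bsub>B\<^esub> \<zeta> \<in> carrier B" "\<one>\<^bsub>B\<^esub> \<in> carrier B" "\<zero>\<^bsub>B\<^esub> \<in> carrier B"
  "\<xi> \<in> carrier B \<Longrightarrow> \<zeta> \<in> carrier B \<Longrightarrow> \<xi> \<oplus>\<^bsub>B\<^esub> \<zeta> \<in> carrier B"
  "c \<in> carrier K \<Longrightarrow> \<xi> \<in> carrier B \<Longrightarrow> c \<odot>\<^bsub>B\<^esub> \<xi> \<in> carrier B"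
proof -
  show "\<xi> \<in> carrier B \<Longrightarrow> \<zeta> \<in> carrier B \<Longrightarrow> \<xi> \<otimes>\<^bsub>B\<^esub> \<zeta> \<in> carrier B"
    unfolding B_simps(7) by (rule restrict_dual) simp
  show "\<one>\<^bsub>B\<^esub> \<in> carrier B" unfolding B_simps(3) by (rule restrict_dual[OF counit_hom(1)])
  show "\<zero>\<^bsub>B\<^esub> \<in> carrier B" unfolding B_simps(4) by (rule restrict_dual) (auto intro!: module_homI)
  show "\<xi> \<oplus>\<^bsub>B\<^esub> \<zeta> \<in> carrier B" if "\<xi> \<in> carrier B" "\<zeta> \<in> carrier B"
    unfolding B_simps(5)
    by (rule restrict_dual, rule module_homI)
       (use that in \<open>simp_all add: module_homD[OF dual_hom] K.add.m_ac K.r_distr\<close>)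
  show "c \<odot>\<^bsub>B\<^esub> \<xi> \<in> carrier B" if "c \<in> carrier K" "\<xi> \<in> carrier B"
    unfolding B_simps(6) by (rule restrict_dual) (use that in simp)
qed

lemma B_eval:
  "h \<in> carrier H \<Longrightarrow> \<one>\<^bsub>B\<^esub> h = \<epsilon> h" "h \<in> carrier H \<Longrightarrow> \<zero>\<^bsub>B\<^esub> h = \<zero>\<^bsub>K\<^esub>"
  "h \<in> carrier H \<Longrightarrow> (\<xi> \<oplus>\<^bsub>B\<^esub> \<zeta>) h = \<xi> h \<oplus>\<^bsub>K\<^esub> \<zeta> h" "h \<in> carrier H \<Longrightarrow> (c \<odot>\<^bsub>B\<^esub> \<xi>) h = c \<otimes>\<^bsub>K\<^esub> \<xi> h"
  by (simp_all add: B_simps)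

text \<open>Associativity is dual to \<open>hat_coassoc\<close>; facts \<open>1\<close> and
  \<open>2\<close> only move a scalar factor under a sum.\<close>

lemma B_mult_assoc:
  assumes [simp]: "\<xi> \<in> carrier B" "\<eta> \<in> carrier B" "\<zeta> \<in> carrier B"
  shows "\<xi> \<otimes>\<^bsub>B\<^esub> \<eta> \<otimes>\<^bsub>B\<^esub> \<zeta> = \<xi> \<otimes>\<^bsub>B\<^esub> (\<eta> \<otimes>\<^bsub>B\<^esub> \<zeta>)"
proof (rule dual_eqI)
  fix h assume [simp]: "h \<in> carrier H"
  have 1: "\<zeta> a \<otimes>\<^bsub>K\<^esub> hw GK b (\<lambda>c d. \<eta> c \<otimes>\<^bsub>K\<^esub> \<xi> d) = hw GK b (\<lambda>c d. \<zeta> a \<otimes>\<^bsub>K\<^esub> \<eta> c \<otimes>\<^bsub>K\<^esub> \<xi> d)"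
    if [simp]: "a \<in> carrier H" "b \<in> carrier H" for a b
  proof -
    have "\<zeta> a \<otimes>\<^bsub>K\<^esub> hw GK b (\<lambda>c d. \<eta> c \<otimes>\<^bsub>K\<^esub> \<xi> d) = hw GK b (\<lambda>c d. \<zeta> a \<otimes>\<^bsub>K\<^esub> (\<eta> c \<otimes>\<^bsub>K\<^esub> \<xi> d))"
      by (rule hom_hw[where g = "\<lambda>z. \<zeta> a \<otimes>\<^bsub>K\<^esub> z"]) simp_all
    also have "\<dots> = hw GK b (\<lambda>c d. \<zeta> a \<otimes>\<^bsub>K\<^esub> \<eta> c \<otimes>\<^bsub>K\<^esub> \<xi> d)"
      by (rule hw_cong) (simp_all add: K.m_assoc)
    finally show ?thesis .
  qed
  have 2: "hw GK a (\<lambda>c d. \<zeta> c \<otimes>\<^bsub>K\<^esub> \<eta> d) \<otimes>\<^bsub>K\<^esub> \<xi> b = hw GK a (\<lambda>c d. \<zeta> c \<otimes>\<^bsub>K\<^esub> \<eta> d \<otimes>\<^bsub>K\<^esub> \<xi> b)"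
    if [simp]: "a \<in> carrier H" "b \<in> carrier H" for a b
    by (rule hom_hw[where g = "\<lambda>z. z \<otimes>\<^bsub>K\<^esub> \<xi> b"]) simp_all
  have "(\<xi> \<otimes>\<^bsub>B\<^esub> \<eta> \<otimes>\<^bsub>B\<^esub> \<zeta>) h = hw GK h (\<lambda>a b. \<zeta> a \<otimes>\<^bsub>K\<^esub> (\<xi> \<otimes>\<^bsub>B\<^esub> \<eta>) b)"
    by (simp add: B_simps(2))
  also have "\<dots> = hw GK h (\<lambda>a b. hw GK b (\<lambda>c d. \<zeta> a \<otimes>\<^bsub>K\<^esub> \<eta> c \<otimes>\<^bsub>K\<^esub> \<xi> d))"
    by (rule hw_cong) (simp_all add: B_closed B_simps(2) 1)
  also have "\<dots> = hw GK h (\<lambda>a b. hw GK a (\<lambda>c d. \<zeta> c \<otimes>\<^bsub>K\<^esub> \<eta> d \<otimes>\<^bsub>K\<^esub> \<xi> b))"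
    by (rule hat_coassoc[symmetric]) (simp_all add: trilin_def)
  also have "\<dots> = hw GK h (\<lambda>a b. (\<eta> \<otimes>\<^bsub>B\<^esub> \<zeta>) a \<otimes>\<^bsub>K\<^esub> \<xi> b)"
    by (rule hw_cong[symmetric]) (simp_all add: B_closed B_simps(2) 2)
  also have "\<dots> = (\<xi> \<otimes>\<^bsub>B\<^esub> (\<eta> \<otimes>\<^bsub>B\<^esub> \<zeta>)) h"
    by (simp add: B_simps(2))
  finally show "(\<xi> \<otimes>\<^bsub>B\<^esub> \<eta> \<otimes>\<^bsub>B\<^esub> \<zeta>) h = (\<xi> \<otimes>\<^bsub>B\<^esub> (\<eta> \<otimes>\<^bsub>B\<^esub> \<zeta>)) h" .
qed (simp_all add: B_closed)

lemma B_mult_bilin: "bilin K B B B (\<lambda>\<xi> \<zeta>. \<xi> \<otimes>\<^bsub>B\<^esub> \<zeta>)"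
  unfolding bilin_def
proof (intro conjI ballI; rule module_homI)
  fix \<xi> \<zeta> \<zeta>' assume [simp]: "\<xi> \<in> carrier B" "\<zeta> \<in> carrier B" "\<zeta>' \<in> carrier B"
  show "\<xi> \<otimes>\<^bsub>B\<^esub> (\<zeta> \<oplus>\<^bsub>B\<^esub> \<zeta>') = \<xi> \<otimes>\<^bsub>B\<^esub> \<zeta> \<oplus>\<^bsub>B\<^esub> \<xi> \<otimes>\<^bsub>B\<^esub> \<zeta>'"
  proof (rule dual_eqI)
    fix h assume [simp]: "h \<in> carrier H"
    have "(\<xi> \<otimes>\<^bsub>B\<^esub> (\<zeta> \<oplus>\<^bsub>B\<^esub> \<zeta>')) h = hw GK h (\<lambda>a b. \<zeta> a \<otimes>\<^bsub>K\<^esub> \<xi> b \<oplus>\<^bsub>GK\<^esub> \<zeta>' a \<otimes>\<^bsub>K\<^esub> \<xi> b)"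
      unfolding B_simps(2)[OF \<open>h \<in> _\<close>]
      by (rule hw_cong) (simp_all add: B_closed B_eval K.l_distr)
    also have "\<dots> = (\<xi> \<otimes>\<^bsub>B\<^esub> \<zeta> \<oplus>\<^bsub>B\<^esub> \<xi> \<otimes>\<^bsub>B\<^esub> \<zeta>') h"
      by (subst HH.lift_add) (simp_all add: B_eval B_simps(2))
    finally show "(\<xi> \<otimes>\<^bsub>B\<^esub> (\<zeta> \<oplus>\<^bsub>B\<^esub> \<zeta>')) h = (\<xi> \<otimes>\<^bsub>B\<^esub> \<zeta> \<oplus>\<^bsub>B\<^esub> \<xi> \<otimes>\<^bsub>B\<^esub> \<zeta>') h" .
  qed (simp_all add: B_closed)
  show "(\<zeta> \<oplus>\<^bsub>B\<^esub> \<zeta>') \<otimes>\<^bsub>B\<^esub> \<xi> = \<zeta> \<otimes>\<^bsub>B\<^esub> \<xi> \<oplus>\<^bsub>B\<^esub> \<zeta>' \<otimes>\<^bsub>B\<^esub> \<xi>"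
  proof (rule dual_eqI)
    fix h assume [simp]: "h \<in> carrier H"
    have "((\<zeta> \<oplus>\<^bsub>B\<^esub> \<zeta>') \<otimes>\<^bsub>B\<^esub> \<xi>) h = hw GK h (\<lambda>a b. \<xi> a \<otimes>\<^bsub>K\<^esub> \<zeta> b \<oplus>\<^bsub>GK\<^esub> \<xi> a \<otimes>\<^bsub>K\<^esub> \<zeta>' b)"
      unfolding B_simps(2)[OF \<open>h \<in> _\<close>]
      by (rule hw_cong) (simp_all add: B_closed B_eval K.r_distr)
    also have "\<dots> = (\<zeta> \<otimes>\<^bsub>B\<^esub> \<xi> \<oplus>\<^bsub>B\<^esub> \<zeta>' \<otimes>\<^bsub>B\<^esub> \<xi>) h"
      by (subst HH.lift_add) (simp_all add: B_eval B_simps(2))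
    finally show "((\<zeta> \<oplus>\<^bsub>B\<^esub> \<zeta>') \<otimes>\<^bsub>B\<^esub> \<xi>) h = (\<zeta> \<otimes>\<^bsub>B\<^esub> \<xi> \<oplus>\<^bsub>B\<^esub> \<zeta>' \<otimes>\<^bsub>B\<^esub> \<xi>) h" .
  qed (simp_all add: B_closed)
next
  fix \<xi> \<zeta> c assume [simp]: "\<xi> \<in> carrier B" "\<zeta> \<in> carrier B" "c \<in> carrier K"
  have m: "hw GK h (\<lambda>a b. c \<odot>\<^bsub>GK\<^esub> (\<zeta> a \<otimes>\<^bsub>K\<^esub> \<xi> b)) = c \<otimes>\<^bsub>K\<^esub> hw GK h (\<lambda>a b. \<zeta> a \<otimes>\<^bsub>K\<^esub> \<xi> b)"
    if "\<xi> \<in> carrier B" "\<zeta> \<in> carrier B" "h \<in> carrier H" for \<xi> \<zeta> h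
    by (subst HH.lift_smult) (simp_all add: that)
  show "\<xi> \<otimes>\<^bsub>B\<^esub> (c \<odot>\<^bsub>B\<^esub> \<zeta>) = c \<odot>\<^bsub>B\<^esub> (\<xi> \<otimes>\<^bsub>B\<^esub> \<zeta>)"
  proof (rule dual_eqI)
    fix h assume [simp]: "h \<in> carrier H"
    have "(\<xi> \<otimes>\<^bsub>B\<^esub> (c \<odot>\<^bsub>B\<^esub> \<zeta>)) h = hw GK h (\<lambda>a b. c \<odot>\<^bsub>GK\<^esub> (\<zeta> a \<otimes>\<^bsub>K\<^esub> \<xi> b))"
      unfolding B_simps(2)[OF \<open>h \<in> _\<close>]
      by (rule hw_cong) (simp_all add: B_closed B_eval K.m_assoc)
    then show "(\<xi> \<otimes>\<^bsub>B\<^esub> (c \<odot>\<^bsub>B\<^esub> \<zeta>)) h = (c \<odot>\<^bsub>B\<^esub> (\<xi> \<otimes>\<^bsub>B\<^esub> \<zeta>)) h"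
      by (simp only: m B_eval B_simps(2) \<open>\<xi> \<in> _\<close> \<open>\<zeta> \<in> _\<close> \<open>h \<in> _\<close>)
  qed (simp_all add: B_closed)
  show "(c \<odot>\<^bsub>B\<^esub> \<zeta>) \<otimes>\<^bsub>B\<^esub> \<xi> = c \<odot>\<^bsub>B\<^esub> (\<zeta> \<otimes>\<^bsub>B\<^esub> \<xi>)"
  proof (rule dual_eqI)
    fix h assume [simp]: "h \<in> carrier H"
    have "((c \<odot>\<^bsub>B\<^esub> \<zeta>) \<otimes>\<^bsub>B\<^esub> \<xi>) h = hw GK h (\<lambda>a b. c \<odot>\<^bsub>GK\<^esub> (\<xi> a \<otimes>\<^bsub>K\<^esub> \<zeta> b))"
      unfolding B_simps(2)[OF \<open>h \<in> _\<close>]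
      by (rule hw_cong) (simp_all add: B_closed B_eval K.m_lcomm)
    then show "((c \<odot>\<^bsub>B\<^esub> \<zeta>) \<otimes>\<^bsub>B\<^esub> \<xi>) h = (c \<odot>\<^bsub>B\<^esub> (\<zeta> \<otimes>\<^bsub>B\<^esub> \<xi>)) h"
      by (simp only: m B_eval B_simps(2) \<open>\<xi> \<in> _\<close> \<open>\<zeta> \<in> _\<close> \<open>h \<in> _\<close>)
  qed (simp_all add: B_closed)
qed (simp_all add: B_closed)

lemma algebra_B: "assoc_algebra K B"
proof -
  have g: "abelian_group B"
  proof (rule abelian_groupI)
    fix \<xi> assume x: "\<xi> \<in> carrier B"
    have m: "(\<ominus>\<^bsub>K\<^esub> \<one>\<^bsub>K\<^esub>) \<odot>\<^bsub>B\<^esub> \<xi> \<in> carrier B" by (rule B_closed) (use x in simp_all)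
    then have "(\<ominus>\<^bsub>K\<^esub> \<one>\<^bsub>K\<^esub>) \<odot>\<^bsub>B\<^esub> \<xi> \<oplus>\<^bsub>B\<^esub> \<xi> = \<zero>\<^bsub>B\<^esub>"
      by (intro dual_eqI) (use x in \<open>simp_all add: B_closed B_eval K.l_minus K.l_neg\<close>)
    with m show "\<exists>\<zeta>\<in>carrier B. \<zeta> \<oplus>\<^bsub>B\<^esub> \<xi> = \<zero>\<^bsub>B\<^esub>" by blast
  qed ((rule B_closed; assumption) | (rule dual_eqI; simp add: B_closed B_eval K.add.m_ac))+
  have m: "module K B"
    by (rule moduleI[OF K.is_cring g])
       ((rule B_closed; assumption) |
        (rule dual_eqI; simp add: B_closed B_eval K.l_distr K.r_distr K.m_assoc))+
  have u: "\<one>\<^bsub>B\<^esub> \<otimes>\<^bsub>B\<^esub> \<xi> = \<xi>" "\<xi> \<otimes>\<^bsub>B\<^esub> \<one>\<^bsub>B\<^esub> = \<xi>" if [simp]: "\<xi> \<in> carrier B" for \<xi>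
  proof -
    have "(\<one>\<^bsub>B\<^esub> \<otimes>\<^bsub>B\<^esub> \<xi>) h = \<xi> h" "(\<xi> \<otimes>\<^bsub>B\<^esub> \<one>\<^bsub>B\<^esub>) h = \<xi> h" if [simp]: "h \<in> carrier H" for h
    proof -
      have "(\<one>\<^bsub>B\<^esub> \<otimes>\<^bsub>B\<^esub> \<xi>) h = hw GK h (\<lambda>a b. \<epsilon> b \<odot>\<^bsub>GK\<^esub> \<xi> a)"
        unfolding B_simps(2)[OF \<open>h \<in> _\<close>] by (rule hw_cong) (simp_all add: B_closed B_eval K.m_comm)
      then show "(\<one>\<^bsub>B\<^esub> \<otimes>\<^bsub>B\<^esub> \<xi>) h = \<xi> h" using hat_counit(2)[OF dual_hom] by simp
      have "(\<xi> \<otimes>\<^bsub>B\<^esub> \<one>\<^bsub>B\<^esub>) h = hw GK h (\<lambda>a b. \<epsilon> a \<odot>\<^bsub>GK\<^esub> \<xi> b)"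
        unfolding B_simps(2)[OF \<open>h \<in> _\<close>] by (rule hw_cong) (simp_all add: B_closed B_eval)
      then show "(\<xi> \<otimes>\<^bsub>B\<^esub> \<one>\<^bsub>B\<^esub>) h = \<xi> h" using hat_counit(1)[OF dual_hom] by simp
    qed
    then show "\<one>\<^bsub>B\<^esub> \<otimes>\<^bsub>B\<^esub> \<xi> = \<xi>" "\<xi> \<otimes>\<^bsub>B\<^esub> \<one>\<^bsub>B\<^esub> = \<xi>" by (auto intro!: dual_eqI simp: B_closed)
  qed
  have "ring B"
    by (intro ringI[OF g] monoidI) (simp_all add: B_closed B_mult_assoc u bilinD[OF B_mult_bilin])
  then show ?thesis
    using m field_K bilinD[OF B_mult_bilin] by (simp add: assoc_algebra_def vectorspace_def)
qed

abbreviation "TA \<equiv> trivial_comodule_algebra K H"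

lemma TA_simps: "carrier TA = carrier K" "x \<otimes>\<^bsub>TA\<^esub> y = x \<otimes>\<^bsub>K\<^esub> y" "\<one>\<^bsub>TA\<^esub> = \<one>\<^bsub>K\<^esub>"
  "x \<oplus>\<^bsub>TA\<^esub> y = x \<oplus>\<^bsub>K\<^esub> y" "x \<odot>\<^bsub>TA\<^esub> y = x \<otimes>\<^bsub>K\<^esub> y" "coact TA c = pure K H GK \<one> c"
  by (simp_all add: trivial_comodule_algebra_def ground_algebra_def module.defs comod_algebra.defs)

sublocale FPk: ground_free_product K TA B
  by unfold_locales (simp_all add: TA_simps algebra_B)

sublocale iB: algebra_iso K B FPk.FP FPk.inB by (rule FPk.iso_inB)

lemma inB_hom: "FPk.inB \<in> module_hom K B FPk.FP"
  by (rule module_homI) (use iB.bij in \<open>auto simp: iB.add iB.smult bij_betw_def\<close>)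

lemma hat_act_one: "h \<in> carrier H \<Longrightarrow> hat_act H \<one> h = h"
proof -
  assume [simp]: "h \<in> carrier H"
  have "\<Delta> \<one> = pure K H H \<one> \<one>"
    using ring_hom_one[OF comul_hom(2)] by (simp add: HH.one_tensor)
  then have "hat_act H \<one> h = \<one> \<otimes> h \<otimes> Si \<one>"
    unfolding hat_act_def by (simp add: HH.lift_pure)
  then show ?thesis by simp
qed

lemma hat_act_bilin: "bilin K H H H (hat_act H)"
  by (simp add: hat_act_def)

lemma hat_dual_act_hom:
  assumes [simp]: "\<xi> \<in> carrier B" shows "hat_dual_act H \<xi> \<in> module_hom K H B"
proof -
  note [simp] = bilinD[OF hat_act_bilin] 
  have h: "(\<lambda>h. \<xi> (hat_act H l h)) \<in> module_hom K H GK" if "l \<in> carrier H" for l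
    by (rule lin_dual) (use hat_act_bilin that in \<open>simp_all add: bilin_def\<close>)
  have c: "hat_dual_act H \<xi> l \<in> carrier B" if "l \<in> carrier H" for l
    unfolding hat_dual_act_def by (rule restrict_dual[OF h[OF that]])
  show ?thesis
  proof (rule module_homI[OF c])
    fix l l' assume "l \<in> carrier H" "l' \<in> carrier H"
    then show "hat_dual_act H \<xi> (l \<oplus> l') = hat_dual_act H \<xi> l \<oplus>\<^bsub>B\<^esub> hat_dual_act H \<xi> l'"
      by (intro dual_eqI) (simp_all add: c B_closed B_eval, simp add: hat_dual_act_def module_homD[OF dual_hom])
  next
    fix k l assume "k \<in> carrier K" "l \<in> carrier H"
    then show "hat_dual_act H \<xi> (k \<odot>\<^bsub>H\<^esub> l) = k \<odot>\<^bsub>B\<^esub> hat_dual_act H \<xi> l"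
      by (intro dual_eqI) (simp_all add: c B_closed B_eval, simp add: hat_dual_act_def module_homD[OF dual_hom])
  qed simp
qed

lemma hat_dual_act_one: "\<xi> \<in> carrier B \<Longrightarrow> hat_dual_act H \<xi> \<one> = \<xi>"
  by (rule dual_eqI) (simp_all add: module_homD(1)[OF hat_dual_act_hom], simp add: hat_dual_act_def hat_act_one)

section \<open>Collapse of the reflective quotient over the ground field\<close>

abbreviation "PR \<equiv> reflective_algebra K H R TA"
abbreviation "J \<equiv> Idl\<^bsub>FPk.FP\<^esub> (reflective_relators K H R TA)"

lemma algebra_FP: "assoc_algebra K FPk.FP" by (rule iB.algebra)

sublocale FPr: ring FPk.FP using assoc_algebraD(2)[OF algebra_FP] .

text \<open>Scalars are central and $1_H$ acts trivially, so the reflective relations already hold in the free product.\<close>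

lemma reflective_relators_trivial: "reflective_relators K H R TA \<subseteq> {\<zero>\<^bsub>FPk.FP\<^esub>}"
proof -
  interpret mB: module K B using assoc_algebraD(3)[OF algebra_B] .
  interpret rB: ring B using assoc_algebraD(2)[OF algebra_B] .
  note [simp] = algebra_FP
  have r: "(FPk.inB \<xi> \<otimes>\<^bsub>FPk.FP\<^esub> FPk.cls (frag_of [Inl a])) \<ominus>\<^bsub>FPk.FP\<^esub>
      tensor_lift FPk.FP (\<lambda>l a0. FPk.cls (frag_of [Inl a0]) \<otimes>\<^bsub>FPk.FP\<^esub> FPk.inB (hat_dual_act H \<xi> l)) (coact TA a) = \<zero>\<^bsub>FPk.FP\<^esub>"
    if [simp]: "\<xi> \<in> carrier B" "a \<in> carrier K" for \<xi> a
  proof -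
    let ?f = "\<lambda>l c. FPk.cls (frag_of [Inl c]) \<otimes>\<^bsub>FPk.FP\<^esub> FPk.inB (hat_dual_act H \<xi> l)"
    have c: "hat_dual_act H \<xi> l \<in> carrier B" if "l \<in> carrier H" for l
      using module_homD(1)[OF hat_dual_act_hom] that by simp
    have f: "FPk.inB (c \<odot>\<^bsub>B\<^esub> hat_dual_act H \<xi> l) = ?f l c" if "l \<in> carrier H" "c \<in> carrier K" for l c
      using that by (simp add: FPk.cls_Inl iB.mult[symmetric] c FPk.smult_one_mult)
    have b: "bilin K H GK FPk.FP (\<lambda>l c. FPk.inB (c \<odot>\<^bsub>B\<^esub> hat_dual_act H \<xi> l))"
      unfolding bilin_def
      by (intro conjI ballI; rule module_hom_comp[OF inB_hom])
         (simp_all add: c assoc_algebraD(3)[OF algebra_B] hat_dual_act_hom)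
    have p: "tensor_product K H GK" by (rule tensor_product.intro) simp_all
    have bf: "bilin K H GK FPk.FP ?f"
      by (rule bilin_cong[OF b]) (simp_all add: f del: bilin_iff)
    have "tensor_lift FPk.FP ?f (coact TA a) = ?f \<one> a"
      unfolding TA_simps(6)
      by (rule tensor_product.lift_pure[OF p bf]) (simp_all add: assoc_algebraD(3)[OF algebra_FP])
    also have "\<dots> = FPk.inB (a \<odot>\<^bsub>B\<^esub> \<xi>)" using f[of \<one> a] by (simp add: hat_dual_act_one)
    also have "a \<odot>\<^bsub>B\<^esub> \<xi> = \<xi> \<otimes>\<^bsub>B\<^esub> (a \<odot>\<^bsub>B\<^esub> \<one>\<^bsub>B\<^esub>)"
      using algebra_B by (simp add: assoc_algebra_def)
    also have "FPk.inB \<dots> = FPk.inB \<xi> \<otimes>\<^bsub>FPk.FP\<^esub> FPk.cls (frag_of [Inl a])"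
      by (simp add: FPk.cls_Inl iB.mult)
    moreover have "FPk.inB (a \<odot>\<^bsub>B\<^esub> \<xi>) \<in> carrier FPk.FP"
      using module_homD(1)[OF inB_hom] by simp
    ultimately show ?thesis by (simp add: FPr.minus_eq FPr.r_neg \<open>a \<odot>\<^bsub>B\<^esub> \<xi> = _\<close>)
  qed
  show ?thesis
    unfolding reflective_relators_def Let_def FPk.inB_def[symmetric] TA_simps(1) using r by auto
qed

lemma J_eq: "J = {\<zero>\<^bsub>FPk.FP\<^esub>}"
proof
  show "J \<subseteq> {\<zero>\<^bsub>FPk.FP\<^esub>}"
    by (rule FPr.genideal_minimal[OF FPr.zeroideal reflective_relators_trivial])
  have "ideal J FPk.FP"
    by (rule FPr.genideal_ideal) (use reflective_relators_trivial in auto)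
  then show "{\<zero>\<^bsub>FPk.FP\<^esub>} \<subseteq> J"
    using additive_subgroup.zero_closed[OF ideal.axioms(1)] by blast
qed

lemma zero_coset: "x \<in> carrier FPk.FP \<Longrightarrow> {\<zero>\<^bsub>FPk.FP\<^esub>} +>\<^bsub>FPk.FP\<^esub> x = {x}"
  by (simp add: a_r_coset_def')

lemma reflective_class_eq: "x \<in> carrier FPk.FP \<Longrightarrow> reflective_class K H R TA x = {x}"
  by (simp add: reflective_class_def Let_def J_eq zero_coset)

abbreviation "iota \<equiv> reflective_incl K H R TA"

lemma iota_eq: "\<xi> \<in> carrier B \<Longrightarrow> iota \<xi> = {FPk.inB \<xi>}"
  using module_homD(1)[OF inB_hom] by (simp add: reflective_incl_def FPk.inB_def[symmetric] reflective_class_eq)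

text \<open>The quotient is by the zero ideal, so cosets are singletons and x \<mapsto> {x}
  identifies the free product with the reflective algebra. Scalars act through the class of c times
  the unit, which gives back the scalar action of the free product.\<close>

lemma PR_simps:
  "carrier PR = (\<lambda>x. {x}) ` carrier FPk.FP"
  "x \<in> carrier FPk.FP \<Longrightarrow> y \<in> carrier FPk.FP \<Longrightarrow> {x} \<otimes>\<^bsub>PR\<^esub> {y} = {x \<otimes>\<^bsub>FPk.FP\<^esub> y}"
  "\<one>\<^bsub>PR\<^esub> = {\<one>\<^bsub>FPk.FP\<^esub>}" "\<zero>\<^bsub>PR\<^esub> = {\<zero>\<^bsub>FPk.FP\<^esub>}"
  "{x} \<oplus>\<^bsub>PR\<^esub> {y} = {x \<oplus>\<^bsub>FPk.FP\<^esub> y}"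
  "c \<in> carrier K \<Longrightarrow> x \<in> carrier FPk.FP \<Longrightarrow> c \<odot>\<^bsub>PR\<^esub> {x} = {c \<odot>\<^bsub>FPk.FP\<^esub> x}"
proof -
  note d = reflective_algebra_def Let_def J_eq ring.defs module.defs FactRing_def
  show "carrier PR = (\<lambda>x. {x}) ` carrier FPk.FP" by (auto simp: d A_RCOSETS_def' zero_coset)
  have m: "{x} \<otimes>\<^bsub>FPk.FP Quot {\<zero>\<^bsub>FPk.FP\<^esub>}\<^esub> {y} = {x \<otimes>\<^bsub>FPk.FP\<^esub> y}"
    if "x \<in> carrier FPk.FP" "y \<in> carrier FPk.FP" for x y
    using that by (simp add: FactRing_def rcoset_mult_def zero_coset)
  then show "x \<in> carrier FPk.FP \<Longrightarrow> y \<in> carrier FPk.FP \<Longrightarrow> {x} \<otimes>\<^bsub>PR\<^esub> {y} = {x \<otimes>\<^bsub>FPk.FP\<^esub> y}"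
    by (simp add: reflective_algebra_def Let_def J_eq ring.defs module.defs)
  show "\<one>\<^bsub>PR\<^esub> = {\<one>\<^bsub>FPk.FP\<^esub>}" "\<zero>\<^bsub>PR\<^esub> = {\<zero>\<^bsub>FPk.FP\<^esub>}" by (simp_all add: d zero_coset)
  show "{x} \<oplus>\<^bsub>PR\<^esub> {y} = {x \<oplus>\<^bsub>FPk.FP\<^esub> y}" by (simp add: d set_add_def set_mult_def)
  show "c \<odot>\<^bsub>PR\<^esub> {x} = {c \<odot>\<^bsub>FPk.FP\<^esub> x}" if "c \<in> carrier K" "x \<in> carrier FPk.FP"
  proof -
    interpret mF: module K FPk.FP using assoc_algebraD(3)[OF algebra_FP] .
    have "c \<odot>\<^bsub>PR\<^esub> {x} = {c \<odot>\<^bsub>FPk.FP\<^esub> \<one>\<^bsub>FPk.FP\<^esub>} \<otimes>\<^bsub>FPk.FP Quot {\<zero>\<^bsub>FPk.FP\<^esub>}\<^esub> {x}"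
      using that by (simp add: reflective_algebra_def Let_def J_eq ring.defs module.defs reflective_class_eq)
    also have "\<dots> = {c \<odot>\<^bsub>FPk.FP\<^esub> x}"
      using that algebra_FP by (simp add: m assoc_algebra_def)
    finally show ?thesis .
  qed
qed

lemma iso_iota: "algebra_iso K B PR iota"
proof
  have c: "FPk.inB \<xi> \<in> carrier FPk.FP" if "\<xi> \<in> carrier B" for \<xi>
    using module_homD(1)[OF inB_hom that] .
  have "iota ` carrier B = (\<lambda>x. {x}) ` FPk.inB ` carrier B" by (force simp: iota_eq)
  then show "bij_betw iota (carrier B) (carrier PR)"
    using iB.bij by (auto simp: bij_betw_def PR_simps(1) inj_on_def iota_eq)
qed (simp_all add: algebra_B iota_eq B_closed PR_simps iB.mult iB.add iB.one iB.zero iB.smult module_homD(1)[OF inB_hom])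

end

section \<open>The coaction and K-matrix of the reflective algebra as a model\<close>

locale reflective_data = fd_qt_hopf K H R
  for K :: "('k, 'l) ring_scheme" and H :: "('k, 'h, 'm) hopf_scheme" (structure) and R :: "('h, 'h) tensor" +
  fixes D :: "'d set" and hb :: "'d \<Rightarrow> 'h" and xb :: "'d \<Rightarrow> 'h \<Rightarrow> 'k"
  assumes dual_basis: "dual_basis K H D hb xb"
begin

lemma fin_D: "finite D" and expand: "x \<in> carrier H \<Longrightarrow> x = (\<Oplus>\<^bsub>H\<^esub>d\<in>D. xb d x \<odot>\<^bsub>H\<^esub> hb d)"
  using dual_basis_expand[OF assoc_algebraD(1)[OF algebra_H] fin_dim dual_basis] by blast+

lemma hb [simp]: "d \<in> D \<Longrightarrow> hb d \<in> carrier H" and xb [simp]: "d \<in> D \<Longrightarrow> xb d \<in> carrier B"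
  using dual_basis vectorspace.basis_def[OF assoc_algebraD(1)[OF algebra_H]]
  unfolding B_simps(1) by (auto simp: dual_basis_def)

lemma lin_finsum [simp]:
  "module K Y \<Longrightarrow> module K W \<Longrightarrow> (\<And>d. d \<in> D \<Longrightarrow> (\<lambda>x. f x d) \<in> module_hom K Y W) \<Longrightarrow>
    (\<lambda>x. \<Oplus>\<^bsub>W\<^esub>d\<in>D. f x d) \<in> module_hom K Y W"
  by (rule finsum_module_hom[OF fin_D])

lemma module_B [simp]: "module K B" using assoc_algebraD(3)[OF algebra_B] .

lemma expand_hom:
  assumes g: "g \<in> module_hom K H W" and W: "module K W" and x: "x \<in> carrier H"
  shows "(\<Oplus>\<^bsub>W\<^esub>d\<in>D. xb d x \<odot>\<^bsub>W\<^esub> g (hb d)) = g x"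
proof -
  have "g (\<Oplus>\<^bsub>H\<^esub>d\<in>D. xb d x \<odot>\<^bsub>H\<^esub> hb d) = (\<Oplus>\<^bsub>W\<^esub>d\<in>D. g (xb d x \<odot>\<^bsub>H\<^esub> hb d))"
    by (rule hom_finsum[OF fin_D g _ W]) (use x in simp_all)
  also have "\<dots> = (\<Oplus>\<^bsub>W\<^esub>d\<in>D. xb d x \<odot>\<^bsub>W\<^esub> g (hb d))"
    by (rule finsum_module_cong[OF W]) (use x W in \<open>simp_all add: module_homD[OF g]\<close>)
  finally show ?thesis using expand[OF x] by simp
qed

lemma finsum_module_closed [simp]: "module K W \<Longrightarrow> (\<And>d. d \<in> D \<Longrightarrow> f d \<in> carrier W) \<Longrightarrow> (\<Oplus>\<^bsub>W\<^esub>d\<in>D. f d) \<in> carrier W"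
  by (rule abelian_monoid.finsum_closed) (auto simp: module_def abelian_group_def)

lemma eval_hom [simp]: "h \<in> carrier H \<Longrightarrow> (\<lambda>\<zeta>. \<zeta> h) \<in> module_hom K B GK"
  by (rule module_homI) (simp_all add: B_eval)

text \<open>The dual basis expands functionals as well: evaluated at \<open>h\<close>, the claim is
  the basis expansion of \<open>h\<close> under \<xi>.\<close>

lemma B_expand:
  assumes [simp]: "\<xi> \<in> carrier B" shows "\<xi> = (\<Oplus>\<^bsub>B\<^esub>d\<in>D. \<xi> (hb d) \<odot>\<^bsub>B\<^esub> xb d)"
proof (rule dual_eqI)
  show "(\<Oplus>\<^bsub>B\<^esub>d\<in>D. \<xi> (hb d) \<odot>\<^bsub>B\<^esub> xb d) \<in> carrier B" by simp
  fix h assume [simp]: "h \<in> carrier H"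
  have "(\<Oplus>\<^bsub>B\<^esub>d\<in>D. \<xi> (hb d) \<odot>\<^bsub>B\<^esub> xb d) h = (\<Oplus>\<^bsub>GK\<^esub>d\<in>D. (\<xi> (hb d) \<odot>\<^bsub>B\<^esub> xb d) h)"
    by (rule hom_finsum[OF fin_D, where g = "\<lambda>\<zeta>. \<zeta> h" and K = K]) (simp_all add: B_closed)
  also have "\<dots> = (\<Oplus>\<^bsub>GK\<^esub>d\<in>D. xb d h \<odot>\<^bsub>GK\<^esub> \<xi> (hb d))"
    by (rule finsum_module_cong[OF module_K]) (simp_all add: B_eval K.m_comm)
  also have "\<dots> = \<xi> h" by (rule expand_hom) simp_all
  finally show "\<xi> h = (\<Oplus>\<^bsub>B\<^esub>d\<in>D. \<xi> (hb d) \<odot>\<^bsub>B\<^esub> xb d) h" by simp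
qed simp

abbreviation "HB \<equiv> tensor K H B"

lemma lin_dual_comp [simp]:
  "\<xi> \<in> carrier B \<Longrightarrow> a \<in> carrier H \<Longrightarrow> b \<in> carrier H \<Longrightarrow> (\<lambda>x. \<xi> (x \<otimes> a \<otimes> b)) \<in> module_hom K H GK"
  "\<xi> \<in> carrier B \<Longrightarrow> a \<in> carrier H \<Longrightarrow> b \<in> carrier H \<Longrightarrow> (\<lambda>x. \<xi> (a \<otimes> x \<otimes> b)) \<in> module_hom K H GK"
  "\<xi> \<in> carrier B \<Longrightarrow> a \<in> carrier H \<Longrightarrow> b \<in> carrier H \<Longrightarrow> (\<lambda>x. \<xi> (a \<otimes> b \<otimes> x)) \<in> module_hom K H GK"
  by (rule lin_dual; simp)+

abbreviation "delta \<equiv> delta_ref K H R D hb xb"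

lemma delta_eq:
  "delta \<xi> = rr HB (\<lambda>sj tj. rr HB (\<lambda>si ti. \<Oplus>\<^bsub>HB\<^esub>d\<in>D. \<xi> (tj \<otimes> hb d \<otimes> si) \<odot>\<^bsub>HB\<^esub> pure K H B (sj \<otimes> ti) (xb d)))"
  by (simp add: delta_ref_def Let_def)

lemma delta_closed [simp]: "\<xi> \<in> carrier B \<Longrightarrow> delta \<xi> \<in> carrier HB"
  unfolding delta_eq by simp

text \<open>Evaluation at \<open>h\<close> turns the sum over the dual basis into the expansion of
  \<open>h\<close>, so the basis disappears from the coaction and only the two copies of R
  remain.\<close>

lemma eval_delta:
  assumes [simp]: "\<xi> \<in> carrier B" "h \<in> carrier H"
  shows "tensor_lift H (\<lambda>a \<zeta>. \<zeta> h \<odot>\<^bsub>H\<^esub> a) (delta \<xi>)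
    = rr H (\<lambda>sj tj. rr H (\<lambda>si ti. \<xi> (tj \<otimes> h \<otimes> si) \<odot>\<^bsub>H\<^esub> (sj \<otimes> ti)))"
proof -
  interpret tB: tensor_product K H B by (rule tensor_product.intro) simp_all
  let ?g = "tensor_lift H (\<lambda>a \<zeta>. \<zeta> h \<odot>\<^bsub>H\<^esub> a)"
  have b: "bilin K H B H (\<lambda>a \<zeta>. \<zeta> h \<odot>\<^bsub>H\<^esub> a)" by simp
  have g: "?g \<in> module_hom K HB H" by (rule tB.lift_hom[OF b module_H])
  have inner: "?g (\<Oplus>\<^bsub>HB\<^esub>d\<in>D. \<xi> (tj \<otimes> hb d \<otimes> si) \<odot>\<^bsub>HB\<^esub> pure K H B (sj \<otimes> ti) (xb d)) = \<xi> (tj \<otimes> h \<otimes> si) \<odot>\<^bsub>H\<^esub> (sj \<otimes> ti)"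
    if [simp]: "sj \<in> carrier H" "tj \<in> carrier H" "si \<in> carrier H" "ti \<in> carrier H" for sj tj si ti
  proof -
    have "?g (\<Oplus>\<^bsub>HB\<^esub>d\<in>D. \<xi> (tj \<otimes> hb d \<otimes> si) \<odot>\<^bsub>HB\<^esub> pure K H B (sj \<otimes> ti) (xb d))
        = (\<Oplus>\<^bsub>H\<^esub>d\<in>D. ?g (\<xi> (tj \<otimes> hb d \<otimes> si) \<odot>\<^bsub>HB\<^esub> pure K H B (sj \<otimes> ti) (xb d)))"
      by (rule hom_finsum[OF fin_D g]) simp_all
    also have "\<dots> = (\<Oplus>\<^bsub>H\<^esub>d\<in>D. xb d h \<odot>\<^bsub>H\<^esub> (\<xi> (tj \<otimes> hb d \<otimes> si) \<odot>\<^bsub>H\<^esub> (sj \<otimes> ti)))"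
      by (rule finsum_module_cong[OF module_H])
         (simp_all add: module_homD(3)[OF g] tB.lift_pure[OF b module_H] mH.smult_assoc1[symmetric] K.m_comm)
    also have "\<dots> = \<xi> (tj \<otimes> h \<otimes> si) \<odot>\<^bsub>H\<^esub> (sj \<otimes> ti)"
      by (rule expand_hom[where g = "\<lambda>x. \<xi> (tj \<otimes> x \<otimes> si) \<odot>\<^bsub>H\<^esub> (sj \<otimes> ti)"]) simp_all
    finally show ?thesis .
  qed
  have "?g (delta \<xi>) = rr H (\<lambda>sj tj. ?g (rr HB (\<lambda>si ti. \<Oplus>\<^bsub>HB\<^esub>d\<in>D. \<xi> (tj \<otimes> hb d \<otimes> si) \<odot>\<^bsub>HB\<^esub> pure K H B (sj \<otimes> ti) (xb d))))"
    unfolding delta_eq by (rule hom_rr[OF g]) simp_all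
  also have "\<dots> = rr H (\<lambda>sj tj. rr H (\<lambda>si ti. ?g (\<Oplus>\<^bsub>HB\<^esub>d\<in>D. \<xi> (tj \<otimes> hb d \<otimes> si) \<odot>\<^bsub>HB\<^esub> pure K H B (sj \<otimes> ti) (xb d))))"
    by (rule rr_cong, simp, simp add: module_hom_comp[OF g], rule hom_rr[OF g]) simp_all
  also have "\<dots> = rr H (\<lambda>sj tj. rr H (\<lambda>si ti. \<xi> (tj \<otimes> h \<otimes> si) \<odot>\<^bsub>H\<^esub> (sj \<otimes> ti)))"
    by (rule rr_cong, simp, simp add: module_hom_comp[OF g], rule rr_cong) (simp_all add: module_hom_comp[OF g] inner)
  finally show ?thesis .
qed

abbreviation "RC \<equiv> reflective_comodule_algebra K H R D hb xb"
abbreviation "j \<equiv> inv_into (carrier B) iota"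

lemma RC_simps: "carrier RC = carrier PR" "x \<otimes>\<^bsub>RC\<^esub> y = x \<otimes>\<^bsub>PR\<^esub> y" "\<one>\<^bsub>RC\<^esub> = \<one>\<^bsub>PR\<^esub>"
  "x \<oplus>\<^bsub>RC\<^esub> y = x \<oplus>\<^bsub>PR\<^esub> y" "\<zero>\<^bsub>RC\<^esub> = \<zero>\<^bsub>PR\<^esub>" "c \<odot>\<^bsub>RC\<^esub> x = c \<odot>\<^bsub>PR\<^esub> x"
  "coact RC t = tensor_map K H PR id iota (delta (j t))"
  by (simp_all add: reflective_comodule_algebra_def Let_def module.defs comod_algebra.defs)

text \<open>\<open>RC\<close> is \<open>PR\<close> with the field \<open>coact\<close> added. The
  coaction and the K-matrix are defined over \<open>PR\<close>, while the axioms speak about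
  \<open>RC\<close>; the tensor construction reads only the common fields.\<close>

lemma tensor_RC: "pure K H PR = pure K H RC" "tensor K H PR = tensor K H RC"
proof -
  have r: "tensor_relators K H PR = tensor_relators K H RC" by (simp add: tensor_relators_def RC_simps)
  then have n: "tensor_null K H PR = tensor_null K H RC" by (simp add: tensor_null_def RC_simps)
  then show p: "pure K H PR = pure K H RC" by (intro ext) (simp add: pure_def RC_simps)
  from n have "tensor_additive K H PR = tensor_additive K H RC" by (simp add: tensor_additive_def RC_simps)
  with p show "tensor K H PR = tensor K H RC" by (simp add: tensor_def RC_simps)
qed

lemma iso_RC: "algebra_iso K B RC iota"
  using iso_iota by (simp add: algebra_iso_def RC_simps)

sublocale iR: algebra_iso K B RC iota by (rule iso_RC)

lemma algebra_RC [simp]: "assoc_algebra K RC" by (rule iR.algebra)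

lemma iota_hom: "iota \<in> module_hom K B RC"
  by (rule module_homI) (use iR.bij in \<open>auto simp: iR.add iR.smult bij_betw_def\<close>)

lemma iota_closed [simp]: "\<xi> \<in> carrier B \<Longrightarrow> iota \<xi> \<in> carrier RC"
  by (rule module_homD(1)[OF iota_hom])

lemma j_closed [simp]: "p \<in> carrier RC \<Longrightarrow> j p \<in> carrier B"
  using iR.bij by (metis bij_betw_def inv_into_into)

lemma iota_j [simp]: "p \<in> carrier RC \<Longrightarrow> iota (j p) = p"
  using iR.bij by (metis bij_betw_inv_into_right)

lemma j_iota [simp]: "\<xi> \<in> carrier B \<Longrightarrow> j (iota \<xi>) = \<xi>"
  using iR.bij by (metis bij_betw_inv_into_left)

lemma j_eqI: "\<xi> \<in> carrier B \<Longrightarrow> p = iota \<xi> \<Longrightarrow> j p = \<xi>"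
  by simp

lemma j_hom: "j \<in> module_hom K RC B"
proof (rule module_homI)
  show "j (p \<oplus>\<^bsub>RC\<^esub> q) = j p \<oplus>\<^bsub>B\<^esub> j q" if "p \<in> carrier RC" "q \<in> carrier RC" for p q
    by (rule j_eqI) (use that in \<open>simp_all add: B_closed iR.add\<close>)
  show "j (c \<odot>\<^bsub>RC\<^esub> p) = c \<odot>\<^bsub>B\<^esub> j p" if "c \<in> carrier K" "p \<in> carrier RC" for c p
    by (rule j_eqI) (use that in \<open>simp_all add: B_closed iR.smult\<close>)
qed simp

lemma j_mult: "p \<in> carrier RC \<Longrightarrow> q \<in> carrier RC \<Longrightarrow> j (p \<otimes>\<^bsub>RC\<^esub> q) = j p \<otimes>\<^bsub>B\<^esub> j q"
  by (rule j_eqI) (simp_all add: B_closed iR.mult)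

abbreviation "kref \<equiv> K_ref K H R D hb xb"

lemma eval_bilin: "h \<in> carrier H \<Longrightarrow> (\<lambda>p. j p h) \<in> module_hom K RC GK"
  by (rule module_hom_comp[OF eval_hom j_hom])

lemma module_RC [simp]: "module K RC" by (rule assoc_algebraD(3)[OF algebra_RC])

lemma tensor_map_closed: "t \<in> carrier HB \<Longrightarrow> tensor_map K H RC id iota t \<in> carrier (tensor K H RC)"
proof -
  interpret tB: tensor_product K H B by (rule tensor_product.intro) simp_all
  have b: "bilin K H B (tensor K H RC) (\<lambda>x y. pure K H RC x (iota y))" by (simp add: iota_hom)
  show "t \<in> carrier HB \<Longrightarrow> tensor_map K H RC id iota t \<in> carrier (tensor K H RC)"
    unfolding tensor_map_def id_def by (rule module_homD(1)[OF tB.lift_hom[OF b]]) simp_all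
qed

lemma eval_tensor_map:
  assumes [simp]: "h \<in> carrier H" and t: "t \<in> carrier HB"
  shows "tensor_lift H (\<lambda>a q. j q h \<odot>\<^bsub>H\<^esub> a) (tensor_map K H RC id iota t) = tensor_lift H (\<lambda>a \<zeta>. \<zeta> h \<odot>\<^bsub>H\<^esub> a) t"
proof -
  interpret tB: tensor_product K H B by (rule tensor_product.intro) simp_all
  interpret tR: tensor_product K H RC by (rule tensor_product.intro) simp_all
  have b: "bilin K H B (tensor K H RC) (\<lambda>x y. pure K H RC x (iota y))" by (simp add: iota_hom)
  have e: "bilin K H RC H (\<lambda>a q. j q h \<odot>\<^bsub>H\<^esub> a)" by (simp add: eval_bilin)
  note g = tR.lift_hom[OF e module_H]
  have "tensor_lift H (\<lambda>a q. j q h \<odot>\<^bsub>H\<^esub> a) (tensor_map K H RC id iota t)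
      = tensor_lift H (\<lambda>x y. tensor_lift H (\<lambda>a q. j q h \<odot>\<^bsub>H\<^esub> a) (pure K H RC x (iota y))) t"
    unfolding tensor_map_def id_def by (rule tB.hom_lift[OF g b _ module_H t]) simp
  also have "\<dots> = tensor_lift H (\<lambda>a \<zeta>. \<zeta> h \<odot>\<^bsub>H\<^esub> a) t"
    by (rule tB.lift_cong[OF bilin_post[OF g b] module_H _ t]) (simp add: tR.lift_pure[OF e module_H])
  finally show ?thesis .
qed

lemma kref_eq: "kref = (\<Oplus>\<^bsub>tensor K H RC\<^esub>d\<in>D. pure K H RC (hb d) (iota (xb d)))"
  by (simp add: K_ref_def Let_def tensor_RC)

lemma eval_kref:
  assumes [simp]: "h \<in> carrier H"
  shows "tensor_lift H (\<lambda>a q. j q h \<odot>\<^bsub>H\<^esub> a) kref = h"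
proof -
  interpret tR: tensor_product K H RC by (rule tensor_product.intro) simp_all
  have e: "bilin K H RC H (\<lambda>a q. j q h \<odot>\<^bsub>H\<^esub> a)" by (simp add: eval_bilin)
  note g = tR.lift_hom[OF e module_H]
  have "tensor_lift H (\<lambda>a q. j q h \<odot>\<^bsub>H\<^esub> a) kref
      = (\<Oplus>\<^bsub>H\<^esub>d\<in>D. tensor_lift H (\<lambda>a q. j q h \<odot>\<^bsub>H\<^esub> a) (pure K H RC (hb d) (iota (xb d))))"
    unfolding kref_eq by (rule hom_finsum[OF fin_D g]) simp_all
  also have "\<dots> = (\<Oplus>\<^bsub>H\<^esub>d\<in>D. xb d h \<odot>\<^bsub>H\<^esub> hb d)"
    by (rule finsum_module_cong[OF module_H]) (simp_all add: tR.lift_pure[OF e module_H])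
  also have "\<dots> = h" by (rule expand[symmetric]) simp
  finally show ?thesis .
qed

lemma iota_expand:
  assumes [simp]: "p \<in> carrier RC"
  shows "p = (\<Oplus>\<^bsub>RC\<^esub>d\<in>D. j p (hb d) \<odot>\<^bsub>RC\<^esub> iota (xb d))"
proof -
  have "p = iota (\<Oplus>\<^bsub>B\<^esub>d\<in>D. j p (hb d) \<odot>\<^bsub>B\<^esub> xb d)" using B_expand[of "j p"] by simp
  also have "\<dots> = (\<Oplus>\<^bsub>RC\<^esub>d\<in>D. iota (j p (hb d) \<odot>\<^bsub>B\<^esub> xb d))"
    by (rule hom_finsum[OF fin_D iota_hom]) (simp_all add: B_closed)
  also have "\<dots> = (\<Oplus>\<^bsub>RC\<^esub>d\<in>D. j p (hb d) \<odot>\<^bsub>RC\<^esub> iota (xb d))"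
    by (rule finsum_module_cong[OF module_RC]) (simp_all add: iR.smult)
  finally show ?thesis .
qed

text \<open>The pairing pulls \<open>p\<close> back along the canonical map to a functional and
  evaluates it at \<open>h\<close>. Its perfectness is the dual basis expansion, and the
  multiplication rule is the definition of the product in the opposite dual.\<close>

lemma ref_model_RC: "ref_model K H R RC kref (\<lambda>h p. j p h) D hb (\<lambda>d. iota (xb d))"
proof
  show "bilin K H RC GK (\<lambda>h p. j p h)" by (simp add: eval_bilin)
  show "j (p \<otimes>\<^bsub>RC\<^esub> q) h = hw GK h (\<lambda>a b. j q a \<otimes>\<^bsub>K\<^esub> j p b)"
    if "h \<in> carrier H" "p \<in> carrier RC" "q \<in> carrier RC" for h p q
    using that by (simp add: j_mult B_simps(2))
  show "j \<one>\<^bsub>RC\<^esub> h = \<epsilon> h" if "h \<in> carrier H" for h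
    using j_eqI[OF B_closed(2) iR.one[symmetric]] that by (simp add: B_eval)
  have c: "coact RC p = tensor_map K H RC id iota (delta (j p))" for p
    by (simp add: RC_simps(7) tensor_map_def tensor_RC)
  show "coact RC p \<in> carrier (tensor K H RC)" if "p \<in> carrier RC" for p
    using that by (simp add: c tensor_map_closed)
  show "tensor_lift H (\<lambda>a q. j q h \<odot>\<^bsub>H\<^esub> a) (coact RC p)
      = rr H (\<lambda>sj tj. rr H (\<lambda>si ti. j p (tj \<otimes> h \<otimes> si) \<odot>\<^bsub>H\<^esub> (sj \<otimes> ti)))"
    if "h \<in> carrier H" "p \<in> carrier RC" for h p
    using that by (simp add: c eval_tensor_map eval_delta)
  show "kref \<in> carrier (tensor K H RC)" unfolding kref_eq by simp
qed (simp_all add: fin_D eval_kref iota_expand[symmetric])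

theorem initial:
  shows "(RC, kref) \<in> QT_objects K H R"
    and "(Q, \<kappa>) \<in> QT_objects K H R \<Longrightarrow> \<exists>!\<phi>. \<phi> \<in> QT_hom K H (RC, kref) (Q, \<kappa>)"
proof -
  interpret m: ref_model K H R RC kref "\<lambda>h p. j p h" D hb "\<lambda>d. iota (xb d)" by (rule ref_model_RC)
  show "(RC, kref) \<in> QT_objects K H R" by (rule m.QT_object)
  assume "(Q, \<kappa>) \<in> QT_objects K H R"
  then have "qt_object K H R Q \<kappa>"
    by (intro qt_object.intro fd_qt_hopf_axioms qt_object_axioms.intro) (simp_all add: QT_objects_def)
  then interpret t: ref_model_target K H R RC kref "\<lambda>h p. j p h" D hb "\<lambda>d. iota (xb d)" Q \<kappa>
    by (intro ref_model_target.intro ref_model_RC)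
  show "\<exists>!\<phi>. \<phi> \<in> QT_hom K H (RC, kref) (Q, \<kappa>)" by (rule t.exists_unique_QT_hom)
qed

end

theorem theoremD:
  fixes K :: "('k, 'l) ring_scheme"
    and H :: "('k, 'h, 'm) hopf_scheme"
    and R :: "('h, 'h) tensor"
    and D :: "'d set" and hb :: "'d \<Rightarrow> 'h" and \<xi>b :: "'d \<Rightarrow> 'h \<Rightarrow> 'k"
  assumes "algebraically_closed K"
    and "quasitriangular_hopf_algebra K H R"
    and "vectorspace.fin_dim K H"
    and "dual_basis K H D hb \<xi>b"
  defines "Rk \<equiv> (reflective_comodule_algebra K H R D hb \<xi>b, K_ref K H R D hb \<xi>b)"
  shows "Rk \<in> QT_objects K H R \<and>
    (\<forall>Q\<kappa> \<in> (QT_objects K H R :: (('k, 'h, 'q) comod_algebra \<times> ('h, 'q) tensor) set).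
       \<exists>!\<phi>. \<phi> \<in> QT_hom K H Rk Q\<kappa>)"
proof -
  interpret reflective_data K H R D hb \<xi>b
    by unfold_locales (use assms in \<open>simp_all add: quasitriangular_hopf_algebra_def\<close>)
  show ?thesis
    unfolding Rk_def using initial(1) initial(2)[of "fst Q\<kappa>" "snd Q\<kappa>" for Q\<kappa>] unfolding prod.collapse by blast
qed

end
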